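(* Let $k\ge 1$ and $l\ge -1$ be integers, and let $K\subset\mathbb R^2$ be a simple polygon with diameter $h_K$ admitting a virtual triangulation $\mathcal T_K$ as in assumption (A2) (stated in the context). There exist constants $c,C>0$, depending only on $k$, $l$ and the regularity parameters of $\mathcal T_K$, such that for all $v\in V_{k,l}(K)$ $$c\,h_K\|\boldsymbol\chi(v)\|_{l^2}\le\|v\|_{0,K}\le C\,h_K\|\boldsymbol\chi(v)\|_{l^2}.$$
   Context: A simple polygon is an open simply connected set in $\mathbb R^2$ with non-self-intersecting polygonal boundary; $h_K$ is the diameter of $K$. Assumption (A2): there is a (conforming) triangulation $\mathcal T_K$ of $K$, called a virtual triangulation, which is shape regular (for each triangle the ratio of its diameter to the radius of its inscribed circle is at most $\kappa$), quasi-uniform ($\max_{\tau\in\mathcal T_K}h_\tau\le\sigma\min_{\tau\in\mathcal T_K}h_\tau$, where $h_\tau$ is the diameter of $\tau$), with mesh size proportional to $h_K$ ($h_K\le c_0h_\tau$ for all $\tau\in\mathcal T_K$), and such that each edge of $K$ is a side of a triangle in $\mathcal T_K$ (vertices may be added in the interior of $K$ but not on $\partial K$). The constants $\kappa,\sigma,c_0$ are called the regularity parameters of $\mathcal T_K$. $\mathbb P_m(D)$ denotes polynomials of degree $\le m$ on $D$, with $\mathbb P_{-1}(D)=\{0\}$. $\mathbb B_k(\partial K)=\{v\in C^0(\partial K): v|_e\in\mathbb P_k(e)\text{ for all edges }e\subset\partial K\}$, and $$V_{k,l}(K)=\{v\in H^1(K): v|_{\partial K}\in\mathbb B_k(\partial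 K),\ \Delta v\in\mathbb P_l(K)\}.$$ Scaled monomials: $\mathbb M_m(D)=\{((\boldsymbol x-\boldsymbol x_c)/h_D)^{\boldsymbol s}: |\boldsymbol s|\le m\}$ (empty for $m=-1$), where $h_D$ is the diameter of $D$; for $D=K$, $\boldsymbol x_c$ is the average of the coordinates of the vertices of $K$, and for $D=e$ an edge (one-dimensional monomials in the coordinate along $e$), $\boldsymbol x_c$ is the midpoint. Degrees of freedom: $\boldsymbol\chi(v)$ is the vector consisting of (i) the values of $v$ at the vertices of $K$; (ii) the edge moments $|e|^{-1}(m,v)_e$ for all $m\in\mathbb M_{k-2}(e)$ and all edges $e\subset\partial K$; (iii) the interior moments $|K|^{-1}(m,v)_K$ for all $m\in\mathbb M_l(K)$. $\|\cdot\|_{l^2}$ is the Euclidean norm and $\|\cdot\|_{0,K}$ the $L^2(K)$ norm. *)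

theory Defs
  imports "HOL-Analysis.Analysis"
begin

section \<open>Polygons and virtual triangulations\<close>

text \<open>A polygon is an open set \<open>K\<close> together with the cyclic list \<open>ps\<close> of its vertices.  The list is
  data: a vertex at which the two adjacent edges are collinear (a hanging node) is admitted.\<close>

definition vtx :: "(real^2) list \<Rightarrow> nat \<Rightarrow> real^2"
  where "vtx ps i = ps ! (i mod length ps)"

definition polygon_edge :: "(real^2) list \<Rightarrow> nat \<Rightarrow> (real^2) set"
  where "polygon_edge ps i = closed_segment (vtx ps i) (vtx ps (Suc i))"

text \<open>Two different edges meet exactly in the endpoints which they share, so the closed polygonal
  curve through \<open>ps\<close> does not intersect itself.\<close>

definition simple_polygon :: "(real^2) set \<Rightarrow> (real^2) list \<Rightarrow> bool"
  where "simple_polygon K ps \<longleftrightarrow>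
    open K \<and> bounded K \<and> simply_connected K \<and>
    3 \<le> length ps \<and> distinct ps \<and>
    (\<forall>i<length ps. \<forall>j<length ps. i \<noteq> j \<longrightarrow>
       polygon_edge ps i \<inter> polygon_edge ps j =
       {vtx ps i, vtx ps (Suc i)} \<inter> {vtx ps j, vtx ps (Suc j)}) \<and>
    frontier K = (\<Union>i<length ps. polygon_edge ps i)"

text \<open>The inscribed circle of a triangle lies in the triangle and touches each of its sides.\<close>

definition inscribed_circle :: "(real^2) set \<Rightarrow> real^2 \<Rightarrow> real \<Rightarrow> bool"
  where "inscribed_circle \<tau> x r \<longleftrightarrow>
    cball x r \<subseteq> \<tau> \<and> (\<forall>s. s edge_of \<tau> \<longrightarrow> cball x r \<inter> s \<noteq> {})"

text \<open>Triangles are closed.  The library's \<^const>\<open>triangulation\<close> is conforming, so when each edge of \<open>K\<close>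
  is a side of a triangle, no vertex of a triangle lies in the relative interior of an edge of \<open>K\<close>.\<close>

definition virtual_triangulation ::
    "real \<Rightarrow> real \<Rightarrow> real \<Rightarrow> (real^2) set \<Rightarrow> (real^2) list \<Rightarrow> (real^2) set set \<Rightarrow> bool"
  where "virtual_triangulation \<kappa> \<sigma> c\<^sub>0 K ps \<T> \<longleftrightarrow>
    triangulation \<T> \<and> (\<forall>\<tau>\<in>\<T>. 2 simplex \<tau>) \<and> \<Union>\<T> = closure K \<and>
    (\<forall>i<length ps. \<exists>\<tau>\<in>\<T>. polygon_edge ps i edge_of \<tau>) \<and>
    (\<forall>\<tau>\<in>\<T>. \<exists>x r. inscribed_circle \<tau> x r \<and> diameter \<tau> / r \<le> \<kappa>) \<and>
    Max (diameter ` \<T>) \<le> \<sigma> * Min (diameter ` \<T>) \<and>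
    (\<forall>\<tau>\<in>\<T>. diameter K \<le> c\<^sub>0 * diameter \<tau>)"


section \<open>Polynomials\<close>

definition multi_indices :: "int \<Rightarrow> (nat \<times> nat) set"
  where "multi_indices m = {(a, b). int a + int b \<le> m}"

text \<open>Functions that agree on \<open>D\<close> with a polynomial of total degree at most \<open>m\<close>; for \<open>m = -1\<close> the index
  set is empty and only functions vanishing on \<open>D\<close> remain.\<close>

definition polys :: "int \<Rightarrow> (real^2) set \<Rightarrow> (real^2 \<Rightarrow> real) set"
  where "polys m D = {f. \<exists>coef :: nat \<Rightarrow> nat \<Rightarrow> real.
    \<forall>x\<in>D. f x = (\<Sum>(a, b)\<in>multi_indices m. coef a b * (x $ 1) ^ a * (x $ 2) ^ b)}"


section \<open>Sobolev space, trace and Laplacian\<close>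

definition partial :: "2 \<Rightarrow> (real^2 \<Rightarrow> real) \<Rightarrow> real^2 \<Rightarrow> real"
  where "partial i f x = frechet_derivative f (at x) (axis i 1)"

text \<open>All iterated partial derivatives exist and are differentiable, hence continuous.\<close>

definition smooth :: "(real^2 \<Rightarrow> real) \<Rightarrow> bool"
  where "smooth f \<longleftrightarrow> (\<forall>is x. (foldr partial is f) differentiable (at x))"

definition test_functions :: "(real^2) set \<Rightarrow> (real^2 \<Rightarrow> real) set"
  where "test_functions K =
    {\<phi>. smooth \<phi> \<and> compact (closure {x. \<phi> x \<noteq> 0}) \<and> closure {x. \<phi> x \<noteq> 0} \<subseteq> K}"

definition L2 :: "'a::euclidean_space set \<Rightarrow> ('a \<Rightarrow> real) set"
  where "L2 D = {f. f \<in> borel_measurable (lebesgue_on D) \<and>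
    integrable (lebesgue_on D) (\<lambda>x. (f x)\<^sup>2)}"

definition L2_norm :: "'a::euclidean_space set \<Rightarrow> ('a \<Rightarrow> real) \<Rightarrow> real"
  where "L2_norm D f = sqrt (\<integral>x. (f x)\<^sup>2 \<partial>lebesgue_on D)"

definition weak_gradient :: "(real^2) set \<Rightarrow> (real^2 \<Rightarrow> real) \<Rightarrow> (2 \<Rightarrow> real^2 \<Rightarrow> real) \<Rightarrow> bool"
  where "weak_gradient K v w \<longleftrightarrow> (\<forall>i. \<forall>\<phi>\<in>test_functions K.
    (\<integral>x. v x * partial i \<phi> x \<partial>lebesgue_on K) = - (\<integral>x. w i x * \<phi> x \<partial>lebesgue_on K))"

definition H1 :: "(real^2) set \<Rightarrow> (real^2 \<Rightarrow> real) set"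
  where "H1 K = {v \<in> L2 K. \<exists>w. (\<forall>i. w i \<in> L2 K) \<and> weak_gradient K v w}"

definition weak_laplacian :: "(real^2) set \<Rightarrow> (real^2 \<Rightarrow> real) \<Rightarrow> (real^2 \<Rightarrow> real) \<Rightarrow> bool"
  where "weak_laplacian K v p \<longleftrightarrow> (\<forall>\<phi>\<in>test_functions K.
    (\<integral>x. v x * (\<Sum>i\<in>UNIV. partial i (partial i \<phi>) x) \<partial>lebesgue_on K) =
    (\<integral>x. p x * \<phi> x \<partial>lebesgue_on K))"

text \<open>Integration with respect to arc length over an edge with endpoints \<open>a\<close> and \<open>b\<close>.\<close>

definition edge_integral :: "real^2 \<Rightarrow> real^2 \<Rightarrow> (real^2 \<Rightarrow> real) \<Rightarrow> real"
  where "edge_integral a b f = dist a b * (\<integral>t. f (linepath a b t) \<partial>lebesgue_on {0..1})"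

definition boundary_integral :: "(real^2) list \<Rightarrow> (real^2 \<Rightarrow> real) \<Rightarrow> real"
  where "boundary_integral ps f = (\<Sum>i<length ps. edge_integral (vtx ps i) (vtx ps (Suc i)) f)"

text \<open>The trace operator from \<open>H1\<close> of \<open>K\<close> to \<open>L2\<close> of its boundary is the continuous extension of the
  restriction of smooth functions, which are dense in \<open>H1\<close> of a polygon: \<open>g\<close> is the trace of \<open>v\<close> if some
  smooth functions converge to \<open>v\<close> in \<open>H1\<close> and their restrictions converge to \<open>g\<close> in \<open>L2\<close> of the boundary.
  Only the values of \<open>g\<close> on the boundary matter.\<close>

definition has_trace ::
    "(real^2) set \<Rightarrow> (real^2) list \<Rightarrow> (real^2 \<Rightarrow> real) \<Rightarrow> (real^2 \<Rightarrow> real) \<Rightarrow> bool"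
  where "has_trace K ps v g \<longleftrightarrow>
    v \<in> L2 K \<and>
    (\<forall>i<length ps. (\<lambda>t. g (linepath (vtx ps i) (vtx ps (Suc i)) t)) \<in> L2 {0..1}) \<and>
    (\<exists>w \<phi>. (\<forall>i. w i \<in> L2 K) \<and> weak_gradient K v w \<and> (\<forall>n :: nat. smooth (\<phi> n)) \<and>
      (\<lambda>n. L2_norm K (\<lambda>x. \<phi> n x - v x)) \<longlonglongrightarrow> 0 \<and>
      (\<forall>i. (\<lambda>n. L2_norm K (\<lambda>x. partial i (\<phi> n) x - w i x)) \<longlonglongrightarrow> 0) \<and>
      (\<lambda>n. boundary_integral ps (\<lambda>x. (\<phi> n x - g x)\<^sup>2)) \<longlonglongrightarrow> 0)"

text \<open>The continuous representative of the trace, for those \<open>v\<close> whose trace has one.  Its values on the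
  boundary are unique, since the trace is unique almost everywhere.\<close>

definition boundary_trace :: "(real^2) set \<Rightarrow> (real^2) list \<Rightarrow> (real^2 \<Rightarrow> real) \<Rightarrow> real^2 \<Rightarrow> real"
  where "boundary_trace K ps v = (SOME g. continuous_on (frontier K) g \<and> has_trace K ps v g)"


section \<open>The virtual element space\<close>

definition boundary_space :: "int \<Rightarrow> (real^2) set \<Rightarrow> (real^2) list \<Rightarrow> (real^2 \<Rightarrow> real) set"
  where "boundary_space k K ps =
    {g. continuous_on (frontier K) g \<and> (\<forall>i<length ps. g \<in> polys k (polygon_edge ps i))}"

definition vem_space :: "int \<Rightarrow> int \<Rightarrow> (real^2) set \<Rightarrow> (real^2) list \<Rightarrow> (real^2 \<Rightarrow> real) set"
  where "vem_space k l K ps =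
    {v \<in> H1 K. (\<exists>g\<in>boundary_space k K ps. has_trace K ps v g) \<and>
               (\<exists>p\<in>polys l K. weak_laplacian K v p)}"


section \<open>Degrees of freedom\<close>

definition vertex_average :: "(real^2) list \<Rightarrow> real^2"
  where "vertex_average ps = (1 / real (length ps)) *\<^sub>R sum_list ps"

definition scaled_monomial ::
    "(real^2) set \<Rightarrow> (real^2) list \<Rightarrow> nat \<times> nat \<Rightarrow> real^2 \<Rightarrow> real"
  where "scaled_monomial K ps s x =
    (((x - vertex_average ps) $ 1) / diameter K) ^ fst s *
    (((x - vertex_average ps) $ 2) / diameter K) ^ snd s"

text \<open>The coordinate along the edge is arc length in the direction from \<open>a\<close> to \<open>b\<close>; the opposite
  orientation only changes signs of moments.\<close>

definition scaled_edge_monomial :: "real^2 \<Rightarrow> real^2 \<Rightarrow> nat \<Rightarrow> real^2 \<Rightarrow> real"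
  where "scaled_edge_monomial a b j x =
    (((x - midpoint a b) \<bullet> sgn (b - a)) / diameter (closed_segment a b)) ^ j"

datatype dof_index =
    Vertex nat
  | Edge_Moment nat nat
  | Interior_Moment "nat \<times> nat"

definition dof_indices :: "int \<Rightarrow> int \<Rightarrow> (real^2) list \<Rightarrow> dof_index set"
  where "dof_indices k l ps =
    Vertex ` {..<length ps} \<union>
    {Edge_Moment i j |i j. i < length ps \<and> int j \<le> k - 2} \<union>
    Interior_Moment ` multi_indices l"

fun dof :: "(real^2) set \<Rightarrow> (real^2) list \<Rightarrow> (real^2 \<Rightarrow> real) \<Rightarrow> dof_index \<Rightarrow> real"
  where
    "dof K ps v (Vertex i) = boundary_trace K ps v (vtx ps i)"
  | "dof K ps v (Edge_Moment i j) =
       (let a = vtx ps i; b = vtx ps (Suc i) in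
        edge_integral a b (\<lambda>x. scaled_edge_monomial a b j x * boundary_trace K ps v x) / dist a b)"
  | "dof K ps v (Interior_Moment s) =
       (\<integral>x. scaled_monomial K ps s x * v x \<partial>lebesgue_on K) / measure lebesgue K"

definition dof_norm :: "int \<Rightarrow> int \<Rightarrow> (real^2) set \<Rightarrow> (real^2) list \<Rightarrow> (real^2 \<Rightarrow> real) \<Rightarrow> real"
  where "dof_norm k l K ps v = L2_set (dof K ps v) (dof_indices k l ps)"

lemma finite_multi_indices: "finite (multi_indices m)"
proof (rule finite_subset)
  show "multi_indices m \<subseteq> {..nat m} \<times> {..nat m}"
    by (auto simp: multi_indices_def)
qed simp

lemma finite_dof_indices: "finite (dof_indices k l ps)"
proof -
  have "{Edge_Moment i j |i j. i < length ps \<and> int j \<le> k - 2}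
      \<subseteq> case_prod Edge_Moment ` ({..<length ps} \<times> {..nat k})"
    by auto
  then have "finite {Edge_Moment i j |i j. i < length ps \<and> int j \<le> k - 2}"
    by (rule finite_subset) simp
  then show ?thesis
    by (simp add: dof_indices_def finite_multi_indices)
qed

end

theory Submission
  imports Defs
begin

text \<open>
  Why the two norms are equivalent. Every triangle of the triangulation contains a disc of radius \<open>\<theta> h\<close>, where \<open>h\<close> is the
  diameter of \<open>K\<close> and \<open>\<theta>\<close> depends only on \<open>c\<^sub>0\<close> and \<open>\<kappa>\<close>. Consequently \<open>K\<close> contains such a disc, the number of edges is bounded
  in terms of \<open>\<theta>\<close>, and every edge is a side of a triangle in \<open>K\<close> whose shape and size are controlled. A function \<open>v\<close> of the space
  is described by two polynomials, its Laplacian \<open>p\<close> and its trace \<open>g\<close> on the edges; on polynomials of bounded degree all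
  norms are equivalent by compactness, with constants that survive scaling.

  The lower inequality bounds \<open>p\<close> and \<open>g\<close> by \<open>v\<close>. Testing the equation with \<open>p\<close> times a bump supported in the disc moves both
  derivatives to the test function and yields \<open>h\<^sup>3 \<bar>p\<bar> \<le> C \<parallel>v\<parallel>\<close> (\<open>h\<^sup>3\<close> is the correct scaling in the plane, \<open>source_bound\<close>). For an edge
  the test function is a bubble on the adjacent triangle which contains \<open>g\<close> as a factor and vanishes to second order on the
  other two sides: Green's identity (\<open>trace_Green_identity\<close>) expresses a weighted integral of \<open>g\<^sup>2\<close> over the edge by \<open>v\<close> and \<open>p\<close>,
  and hence \<open>h \<bar>g\<bar> \<le> C \<parallel>v\<parallel>\<close> (\<open>edge_bound\<close>). The interior moments are bounded by the Cauchy-Schwarz inequality.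

  The upper inequality is a comparison argument in energy form. Let \<open>D\<close> be the norm of the degrees of freedom. On an edge they
  determine \<open>g\<close>, so \<open>\<bar>g\<bar> \<le> G\<close> with \<open>G\<close> a multiple of \<open>D\<close> (\<open>dof_bounds_trace\<close>), and the interior moments are exactly what \<open>p\<close> sees of
  \<open>v\<close>: the integral of \<open>p v\<close> is at most \<open>\<bar>p\<bar> D \<bar>K\<bar>\<close> (\<open>source_pairing_le\<close>). Let \<open>T v\<close> be a smooth version of the part of \<open>v\<close> whose
  modulus exceeds \<open>G\<close>, saturated at a high level to keep it bounded. It has vanishing trace, so it may be used to test the equation, and with \<open>E\<close> the energy norm of
  \<open>T v\<close> one finds that \<open>E\<^sup>2\<close> is at most minus the integral of \<open>p T v\<close>, while the Poincare inequality gives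
  \<open>\<parallel>T v\<parallel> \<le> 2 h E\<close> (\<open>threshold_energy\<close>). Since \<open>v - T v\<close> is of size \<open>G\<close>, the bound on \<open>p\<close> by \<open>v\<close> turns this into a quadratic
  inequality for \<open>E\<close>, whence \<open>\<parallel>v\<parallel> \<le> C h (D + G)\<close> (\<open>solution_bound\<close>). Thresholding at the level of the boundary values takes the
  place of an extension of \<open>g\<close> into \<open>K\<close>, whose construction would have to be uniform over all polygons.

  The analytic difficulty is that \<open>v\<close> has weak derivatives only, and that admissible test functions vanish near the boundary.
  On a single triangle, truncated barycentric coordinates make a bubble admissible (\<open>weak_divergence_on_triangle\<close>). For
  functions with vanishing trace a cutoff of width \<open>\<epsilon>\<close> along the boundary is used: its derivative is of size \<open>1 / \<epsilon>\<close>, and the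
  integral of the square of a function over the collar where it acts is of order \<open>\<epsilon>\<^sup>2\<close>, up to the boundary values
  (\<open>boundary_cutoff_energy\<close>, \<open>vanishing_trace_test\<close>).
\<close>

section \<open>Smooth functions and test functions\<close>

lemma smooth_differentiable: "smooth f \<Longrightarrow> f differentiable (at x)"
  unfolding smooth_def by (metis foldr.simps(1) id_apply)

lemma smooth_partial:
  assumes "smooth f"
  shows "smooth (partial i f)"
  unfolding smooth_def
proof (intro allI)
  fix "is" x
  have "foldr partial (is @ [i]) f differentiable (at x)"
    using assms unfolding smooth_def by blast
  then show "foldr partial is (partial i f) differentiable (at x)"
    by simp
qed

text \<open>Smoothness is the greatest property that implies differentiability and passes to partial derivatives.\<close>

lemma smooth_coinduct:
  assumes "f \<in> S" and "\<And>f x. f \<in> S \<Longrightarrow> f differentiable (at x)" and "\<And>f i. f \<in> S \<Longrightarrow> partial i f \<in> S"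
  shows "smooth f"
proof -
  have "foldr partial is f \<in> S" for "is"
    by (induction "is") (auto simp: assms)
  then show ?thesis
    unfolding smooth_def using assms(2) by blast
qed

lemma partial_eq:
  assumes "(f has_derivative f') (at x)"
  shows "partial i f x = f' (axis i 1)"
  using frechet_derivative_at[OF assms] by (simp add: partial_def)

lemma has_derivative_partial:
  assumes "f differentiable (at x)"
  shows "(f has_derivative (\<lambda>v. \<Sum>i\<in>UNIV. v $ i * partial i f x)) (at x)"
proof -
  obtain f' where f': "(f has_derivative f') (at x)"
    using assms by (auto simp: differentiable_def)
  interpret bounded_linear f' using f' by (rule has_derivative_bounded_linear)
  have "f' v = (\<Sum>i\<in>UNIV. v $ i * partial i f x)" for v
  proof -
    have "f' v = f' (\<Sum>i\<in>UNIV. v $ i *\<^sub>R axis i 1)"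
      by (metis basis_expansion scalar_mult_eq_scaleR)
    also have "\<dots> = (\<Sum>i\<in>UNIV. v $ i * f' (axis i 1))"
      by (simp add: sum scale)
    finally show ?thesis by (simp add: partial_eq[OF f'])
  qed
  then have "f' = (\<lambda>v. \<Sum>i\<in>UNIV. v $ i * partial i f x)" by blast
  then show ?thesis using f' by simp
qed

lemma partial_add:
  assumes "f differentiable (at x)" "g differentiable (at x)"
  shows "partial i (\<lambda>x. f x + g x) x = partial i f x + partial i g x"
  using partial_eq[OF has_derivative_add[OF has_derivative_partial[OF assms(1)] has_derivative_partial[OF assms(2)]], of i]
  by (simp add: axis_def if_distrib[of "\<lambda>c. c * _"] cong: if_cong)

lemma partial_mult:
  assumes "f differentiable (at x)" "g differentiable (at x)"
  shows "partial i (\<lambda>x. f x * g x) x = f x * partial i g x + partial i f x * g x"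
  using partial_eq[OF has_derivative_mult[OF has_derivative_partial[OF assms(1)] has_derivative_partial[OF assms(2)]], of i]
  by (simp add: axis_def if_distrib[of "\<lambda>c. c * _"] cong: if_cong)

lemma partial_affine: "partial i (\<lambda>x. u \<bullet> x + c) x = u $ i"
proof -
  have "((\<lambda>x. u \<bullet> x + c) has_derivative (\<lambda>v. u \<bullet> v)) (at x)"
    by (auto intro!: derivative_eq_intros)
  from partial_eq[OF this, of i] show ?thesis
    by (simp add: inner_axis)
qed

lemma partial_const: "partial i (\<lambda>x. c) x = 0"
  using partial_affine[of i 0 c x] by simp

lemma has_derivative_compose_real:
  assumes "(h has_real_derivative h') (at (f x))" and "f differentiable (at x)"
  shows "((\<lambda>x. h (f x)) has_derivative (\<lambda>v. h' * (\<Sum>i\<in>UNIV. v $ i * partial i f x))) (at x)"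
  using has_derivative_compose[OF has_derivative_partial[OF assms(2)], of h "(*) h'"] assms(1)
  by (simp add: has_field_derivative_def)

lemma partial_compose:
  assumes "(h has_real_derivative h') (at (f x))" and "f differentiable (at x)"
  shows "partial i (\<lambda>x. h (f x)) x = h' * partial i f x"
  using partial_eq[OF has_derivative_compose_real[of h h' f x, OF assms], of i]
  by (simp add: axis_def if_distrib[of "\<lambda>c. c * _"] cong: if_cong)

definition smooth_real :: "(real \<Rightarrow> real) \<Rightarrow> bool"
  where "smooth_real h \<longleftrightarrow> (\<exists>H. H 0 = h \<and> (\<forall>n x. (H n has_real_derivative H (Suc n) x) (at x)))"

text \<open>The family is stable under partial derivatives by the sum, product and chain rules, so
  coinduction makes all its members smooth at once.\<close>

inductive_set smooth_closure :: "(real^2 \<Rightarrow> real) set" where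
  smooth: "smooth f \<Longrightarrow> f \<in> smooth_closure"
| add: "f \<in> smooth_closure \<Longrightarrow> g \<in> smooth_closure \<Longrightarrow> (\<lambda>x. f x + g x) \<in> smooth_closure"
| mult: "f \<in> smooth_closure \<Longrightarrow> g \<in> smooth_closure \<Longrightarrow> (\<lambda>x. f x * g x) \<in> smooth_closure"
| comp: "smooth_real h \<Longrightarrow> f \<in> smooth_closure \<Longrightarrow> (\<lambda>x. h (f x)) \<in> smooth_closure"

lemma smooth_closure_partial:
  "f \<in> smooth_closure \<Longrightarrow> (\<forall>x. f differentiable (at x)) \<and> (\<forall>i. partial i f \<in> smooth_closure)"
proof (induction rule: smooth_closure.induct)
  case (smooth f)
  then show ?case
    by (auto simp: smooth_differentiable smooth_partial intro: smooth_closure.smooth)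
next
  case (add f g)
  then have "partial i (\<lambda>x. f x + g x) = (\<lambda>x. partial i f x + partial i g x)" for i
    by (auto simp: partial_add)
  with add show ?case by (auto intro: smooth_closure.add)
next
  case (mult f g)
  then have "partial i (\<lambda>x. f x * g x) = (\<lambda>x. f x * partial i g x + partial i f x * g x)" for i
    by (auto simp: partial_mult)
  with mult show ?case by (auto intro!: smooth_closure.add smooth_closure.mult)
next
  case (comp h f)
  obtain H where H: "H 0 = h" "\<And>n x. (H n has_real_derivative H (Suc n) x) (at x)"
    using comp(1) unfolding smooth_real_def by blast
  have "smooth_real (H 1)"
    unfolding smooth_real_def by (rule exI[of _ "\<lambda>n. H (Suc n)"]) (use H in simp)
  moreover have h: "(h has_real_derivative H 1 s) (at s)" for s
    using H(2)[of 0] H(1) by simp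
  then have "partial i (\<lambda>x. h (f x)) = (\<lambda>x. H 1 (f x) * partial i f x)" for i
    by (intro ext partial_compose) (use comp in auto)
  moreover have "(\<lambda>x. h (f x)) differentiable (at x)" for x
    using has_derivative_compose_real[of h _ f x, OF h] comp.IH unfolding differentiable_def by blast
  moreover have "(\<lambda>x. H 1 (f x) * partial i f x) \<in> smooth_closure" for i
    using smooth_closure.mult[OF smooth_closure.comp[OF \<open>smooth_real (H 1)\<close> comp(2)]] comp.IH by blast
  ultimately show ?case by simp
qed

lemma smooth_closure_smooth: "f \<in> smooth_closure \<Longrightarrow> smooth f"
  by (rule smooth_coinduct[of f smooth_closure]) (blast dest: smooth_closure_partial)+

lemma smooth_add: "smooth f \<Longrightarrow> smooth g \<Longrightarrow> smooth (\<lambda>x. f x + g x)"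
  by (rule smooth_closure_smooth, rule smooth_closure.add; erule smooth_closure.smooth)

lemma smooth_mult: "smooth f \<Longrightarrow> smooth g \<Longrightarrow> smooth (\<lambda>x. f x * g x)"
  by (rule smooth_closure_smooth, rule smooth_closure.mult; erule smooth_closure.smooth)

lemma smooth_compose: "smooth_real h \<Longrightarrow> smooth f \<Longrightarrow> smooth (\<lambda>x. h (f x))"
  by (rule smooth_closure_smooth, erule smooth_closure.comp, erule smooth_closure.smooth)

lemma smooth_affine: "smooth (\<lambda>x. u \<bullet> x + c)"
proof (rule smooth_coinduct[of _ "{f. \<exists>u c. f = (\<lambda>x. u \<bullet> x + c)}"])
  fix f :: "real^2 \<Rightarrow> real" and i
  assume "f \<in> {f. \<exists>u c. f = (\<lambda>x. u \<bullet> x + c)}"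
  then obtain u c where "f = (\<lambda>x. u \<bullet> x + c)" by blast
  then have "partial i f = (\<lambda>x. 0 \<bullet> x + u $ i)"
    by (auto simp: partial_affine)
  then show "partial i f \<in> {f. \<exists>u c. f = (\<lambda>x. u \<bullet> x + c)}" by blast
qed auto

lemma smooth_const: "smooth (\<lambda>x. c)"
  using smooth_affine[of 0 c] by simp

lemma smooth_component: "smooth (\<lambda>x. x $ i)"
  using smooth_affine[of "axis i 1" 0] by (simp add: inner_axis')

lemma smooth_cmult: "smooth f \<Longrightarrow> smooth (\<lambda>x. c * f x)"
  by (rule smooth_mult[OF smooth_const])

lemma smooth_diff: "smooth f \<Longrightarrow> smooth g \<Longrightarrow> smooth (\<lambda>x. f x - g x)"
  using smooth_add[of f "\<lambda>x. (-1) * g x"] smooth_cmult[of g "-1"] by simp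

lemma smooth_power: "smooth f \<Longrightarrow> smooth (\<lambda>x. f x ^ n)"
  by (induction n) (auto intro: smooth_const smooth_mult)

lemma smooth_sum: "(\<And>s. s \<in> I \<Longrightarrow> smooth (f s)) \<Longrightarrow> smooth (\<lambda>x. \<Sum>s\<in>I. f s x)"
  by (induction I rule: infinite_finite_induct) (auto intro: smooth_const smooth_add)

lemma smooth_prod: "(\<And>s. s \<in> I \<Longrightarrow> smooth (f s)) \<Longrightarrow> smooth (\<lambda>x. \<Prod>s\<in>I. f s x)"
  by (induction I rule: infinite_finite_induct) (auto intro: smooth_const smooth_mult)

lemma partial_cmult: "smooth f \<Longrightarrow> partial i (\<lambda>x. c * f x) x = c * partial i f x"
  by (subst partial_mult) (auto simp: smooth_differentiable partial_const)

lemma partial_sum: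
  assumes "\<And>s. s \<in> I \<Longrightarrow> smooth (f s)"
  shows "partial i (\<lambda>x. \<Sum>s\<in>I. f s x) x = (\<Sum>s\<in>I. partial i (f s) x)"
  using assms
proof (induction I rule: infinite_finite_induct)
  case (insert s I)
  then have "smooth (\<lambda>x. \<Sum>s\<in>I. f s x)" by (auto intro: smooth_sum)
  with insert show ?case
    by (simp add: partial_add smooth_differentiable)
qed (simp_all add: partial_const)

lemma smooth_continuous_on: "smooth f \<Longrightarrow> continuous_on S f"
  by (meson continuous_at_imp_continuous_on differentiable_imp_continuous_within smooth_differentiable)

lemma partial_cong_open:
  assumes "open S" "x \<in> S" "\<And>y. y \<in> S \<Longrightarrow> f y = g y" and "g differentiable (at x)"
  shows "f differentiable (at x)" and "partial i f x = partial i g x"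
proof -
  have "(f has_derivative (\<lambda>v. \<Sum>i\<in>UNIV. v $ i * partial i g x)) (at x)"
    by (rule has_derivative_transform_within_open[OF has_derivative_partial[OF assms(4)] assms(1,2)])
      (simp add: assms(3))
  then show "f differentiable (at x)" and "partial i f x = partial i g x"
    by (auto simp: differentiable_def partial_eq axis_def if_distrib[of "\<lambda>c. c * _"] cong: if_cong)
qed

lemma partial_zero_open:
  assumes "open S" "x \<in> S" "\<And>y. y \<in> S \<Longrightarrow> f y = 0"
  shows "partial i f x = 0"
  using partial_cong_open(2)[OF assms(1,2), of f "\<lambda>x. 0" i] assms(3) by (simp add: partial_const)

lemma partial_test_functions:
  assumes "\<phi> \<in> test_functions K"
  shows "partial i \<phi> \<in> test_functions K"
proof -
  have \<phi>: "smooth \<phi>" "compact (closure {x. \<phi> x \<noteq> 0})" "closure {x. \<phi> x \<noteq> 0} \<subseteq> K"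
    using assms by (auto simp: test_functions_def)
  have "{x. partial i \<phi> x \<noteq> 0} \<subseteq> closure {x. \<phi> x \<noteq> 0}"
  proof
    fix x assume x: "x \<in> {x. partial i \<phi> x \<noteq> 0}"
    show "x \<in> closure {x. \<phi> x \<noteq> 0}"
    proof (rule ccontr)
      assume "x \<notin> closure {x. \<phi> x \<noteq> 0}"
      moreover have "\<phi> y = 0" if "y \<in> - closure {x. \<phi> x \<noteq> 0}" for y
        using that closure_subset[of "{x. \<phi> x \<noteq> 0}"] by blast
      moreover have "open (- closure {x. \<phi> x \<noteq> 0})" by (intro open_Compl closed_closure)
      ultimately have "partial i \<phi> x = 0"
        using partial_zero_open[of "- closure {x. \<phi> x \<noteq> 0}" x \<phi> i] by blast
      then show False using x by simp
    qed
  qed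
  then have sub: "closure {x. partial i \<phi> x \<noteq> 0} \<subseteq> closure {x. \<phi> x \<noteq> 0}"
    by (simp add: closure_minimal)
  then have "compact (closure {x. partial i \<phi> x \<noteq> 0})"
    using \<phi>(2) by (metis bounded_subset closed_closure compact_eq_bounded_closed)
  then show ?thesis
    using \<phi> sub by (auto simp: test_functions_def smooth_partial)
qed

text \<open>The way all test functions below arise: cut off a smooth function outside \<open>K\<close>, across which it vanishes anyway.\<close>

lemma smooth_restrict_test_function:
  assumes K: "open K" "bounded K" and "smooth F" and U: "open U" "frontier K \<subseteq> U" "\<And>x. x \<in> U \<Longrightarrow> F x = 0"
  shows "(\<lambda>x. if x \<in> K then F x else 0) \<in> test_functions K"
    and "x \<in> K \<Longrightarrow> partial i (\<lambda>x. if x \<in> K then F x else 0) x = partial i F x"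
proof -
  define S where "S = {(\<lambda>x. if x \<in> K then F x else 0) | F. smooth F \<and> (\<forall>x\<in>U. F x = 0)}"
  have loc: "(\<lambda>x. if x \<in> K then F x else 0) differentiable (at x) \<and>
      partial i (\<lambda>x. if x \<in> K then F x else 0) x = (if x \<in> K then partial i F x else 0)"
    if F: "smooth F" "\<forall>x\<in>U. F x = 0" for F x i
  proof (cases "x \<in> K")
    case True
    show ?thesis
      using partial_cong_open[OF K(1) True, of "\<lambda>x. if x \<in> K then F x else 0" F] F True
      by (simp add: smooth_differentiable)
  next
    case False
    have "x \<in> U \<union> - closure K"
      using False U(2) K(1) by (auto simp: frontier_def interior_open)
    moreover have "(if y \<in> K then F y else 0) = 0" if "y \<in> U \<union> - closure K" for y
      using that F(2) closure_subset[of K] by auto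
    moreover have "open (U \<union> - closure K)" using U(1) by auto
    ultimately show ?thesis
      using partial_cong_open[of "U \<union> - closure K" x "\<lambda>x. if x \<in> K then F x else 0" "\<lambda>x. 0"] False
      by (simp add: partial_const)
  qed
  have "smooth (\<lambda>x. if x \<in> K then F x else 0)"
  proof (rule smooth_coinduct[of _ S])
    show "(\<lambda>x. if x \<in> K then F x else 0) \<in> S" using assms by (auto simp: S_def)
    fix f assume "f \<in> S"
    then obtain F where F: "smooth F" "\<forall>x\<in>U. F x = 0" and f: "f = (\<lambda>x. if x \<in> K then F x else 0)"
      by (auto simp: S_def)
    show "f differentiable (at x)" for x using loc[OF F] f by simp
    have "partial i F x = 0" if "x \<in> U" for x i
      by (rule partial_zero_open[OF U(1) that]) (use F in auto)
    moreover have "partial i f = (\<lambda>x. if x \<in> K then partial i F x else 0)" for i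
      using loc[OF F] f by auto
    ultimately show "partial i f \<in> S" for i
      using F by (auto simp: S_def smooth_partial)
  qed
  moreover have sub: "closure {x. (if x \<in> K then F x else 0) \<noteq> 0} \<subseteq> closure K - U"
  proof (rule closure_minimal)
    show "closed (closure K - U)" using U(1) by (simp add: closed_Diff)
    show "{x. (if x \<in> K then F x else 0) \<noteq> 0} \<subseteq> closure K - U"
      using U(3) closure_subset[of K] by auto
  qed
  moreover have "closure K - U \<subseteq> K"
    using U(2) K(1) by (auto simp: frontier_def interior_open)
  moreover have "bounded (closure {x. (if x \<in> K then F x else 0) \<noteq> 0})"
    using sub K(2) bounded_closure bounded_subset by (meson Diff_subset order_trans)
  ultimately show "(\<lambda>x. if x \<in> K then F x else 0) \<in> test_functions K"
    by (auto simp: test_functions_def compact_eq_bounded_closed)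
  show "partial i (\<lambda>x. if x \<in> K then F x else 0) x = partial i F x" if "x \<in> K"
    using loc[of F x i] assms that by auto
qed

section \<open>Cutoff functions of one variable\<close>

text \<open>Differentiation multiplies by the square of \<open>1 / s\<close> and changes the polynomial, so the whole family is smooth at once.\<close>

definition flat_poly :: "real poly \<Rightarrow> real \<Rightarrow> real"
  where "flat_poly p s = (if s \<le> 0 then 0 else poly p (1 / s) * exp (- (1 / s)))"

text \<open>The classical smooth function which is not analytic at zero.\<close>

abbreviation exp_flat :: "real \<Rightarrow> real"
  where "exp_flat \<equiv> flat_poly 1"

lemma flat_poly_tendsto_0: "(flat_poly p \<longlongrightarrow> 0) (at 0)"
proof -
  have "((\<lambda>x. poly p x * exp (- x)) \<longlongrightarrow> 0) at_top"
  proof -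
    have "((\<lambda>x. \<Sum>i\<le>degree p. coeff p i * (x ^ i / exp x)) \<longlongrightarrow> (\<Sum>i\<le>degree p. coeff p i * 0)) at_top"
      by (intro tendsto_intros tendsto_power_div_exp_0)
    then show ?thesis
      by (simp add: poly_altdef sum_distrib_right sum_divide_distrib exp_minus field_simps)
  qed
  then have "((\<lambda>s. poly p (1 / s) * exp (- (1 / s))) \<longlongrightarrow> 0) (at_right 0)"
    using filterlim_compose[OF _ filterlim_inverse_at_top_right] by (fastforce simp: inverse_eq_divide)
  then have "(flat_poly p \<longlongrightarrow> 0) (at_right 0)"
    by (rule Lim_transform_eventually)
      (auto simp: flat_poly_def eventually_at_filter intro!: always_eventually)
  moreover have "(flat_poly p \<longlongrightarrow> 0) (at_left 0)"
    by (rule Lim_transform_eventually[OF tendsto_const])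
      (auto simp: flat_poly_def eventually_at_filter intro!: always_eventually)
  ultimately show ?thesis
    by (simp add: filterlim_split_at)
qed

lemma has_real_derivative_flat_poly:
  "(flat_poly p has_real_derivative flat_poly ([:0, 0, 1:] * (p - pderiv p)) s) (at s)"
proof -
  consider "s < 0" | "s > 0" | "s = 0" by linarith
  then show ?thesis
  proof cases
    case 1
    have "((\<lambda>_. 0) has_real_derivative 0) (at s)" by simp
    then have "(flat_poly p has_real_derivative 0) (at s)"
      by (rule has_field_derivative_transform_within_open[of _ _ _ "{..<0}"]) (use 1 in \<open>auto simp: flat_poly_def\<close>)
    then show ?thesis using 1 by (simp add: flat_poly_def)
  next
    case 2
    have "((\<lambda>s. poly p (1 / s) * exp (- (1 / s))) has_real_derivative
        poly ([:0, 0, 1:] * (p - pderiv p)) (1 / s) * exp (- (1 / s))) (at s)"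
      using 2 by (auto intro!: derivative_eq_intros poly_DERIV[THEN DERIV_chain2] simp: field_simps power2_eq_square)
    then have "(flat_poly p has_real_derivative poly ([:0, 0, 1:] * (p - pderiv p)) (1 / s) * exp (- (1 / s))) (at s)"
      by (rule has_field_derivative_transform_within_open[of _ _ _ "{0<..}"]) (use 2 in \<open>auto simp: flat_poly_def\<close>)
    then show ?thesis using 2 by (simp add: flat_poly_def)
  next
    case 3
    have "((\<lambda>h. flat_poly p h / h) \<longlongrightarrow> 0) (at 0)"
    proof (rule Lim_transform_eventually[OF flat_poly_tendsto_0[of "[:0, 1:] * p"]])
      show "\<forall>\<^sub>F h in at 0. flat_poly ([:0, 1:] * p) h = flat_poly p h / h"
        by (auto simp: flat_poly_def)
    qed
    then show ?thesis using 3 by (simp add: DERIV_def flat_poly_def)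
  qed
qed

lemma smooth_real_flat_poly: "smooth_real (flat_poly p)"
proof -
  define P where "P n = ((\<lambda>p. [:0, 0, 1:] * (p - pderiv p)) ^^ n) p" for n
  show ?thesis
    unfolding smooth_real_def
    by (rule exI[of _ "\<lambda>n. flat_poly (P n)"]) (auto simp: P_def simp del: mult_pCons_left intro: has_real_derivative_flat_poly)
qed

lemma smooth_real_tanh: "smooth_real tanh"
proof -
  define P :: "nat \<Rightarrow> real poly" where "P n = ((\<lambda>p. pderiv p * [:1, 0, -1:]) ^^ n) [:0, 1:]" for n
  have "((\<lambda>x. poly p (tanh x)) has_real_derivative poly (pderiv p * [:1, 0, -1:]) (tanh x)) (at x)" for p x
    by (auto intro!: derivative_eq_intros poly_DERIV[THEN DERIV_chain2] simp: algebra_simps power2_eq_square)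
  then show ?thesis
    unfolding smooth_real_def
    by (intro exI[of _ "\<lambda>n x. poly (P n) (tanh x)"]) (auto simp: P_def simp del: mult_pCons_right)
qed

definition exp_flat_deriv :: "real \<Rightarrow> real"
  where "exp_flat_deriv s = (if s \<le> 0 then 0 else exp (- (1 / s)) / s\<^sup>2)"

lemma exp_flat_deriv_eq: "exp_flat_deriv = flat_poly [:0, 0, 1:]"
  by (auto simp: fun_eq_iff flat_poly_def exp_flat_deriv_def power2_eq_square field_simps)

lemma has_real_derivative_exp_flat [derivative_intros]:
  "(exp_flat has_real_derivative exp_flat_deriv s) (at s)"
  using has_real_derivative_flat_poly[of 1 s] by (simp add: exp_flat_deriv_eq)

lemma continuous_on_exp_flat: "continuous_on S exp_flat" "continuous_on S exp_flat_deriv"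
  unfolding exp_flat_deriv_eq
  by (meson DERIV_continuous_on has_real_derivative_flat_poly has_field_derivative_at_within)+

lemma exp_flat_bounds: "0 \<le> exp_flat s" "exp_flat s \<le> 1"
  by (auto simp: flat_poly_def)

lemma exp_flat_mono: "s \<le> t \<Longrightarrow> exp_flat s \<le> exp_flat t"
  by (auto simp: flat_poly_def frac_le)

lemma exp_flat_deriv_bounds: "0 \<le> exp_flat_deriv s" "exp_flat_deriv s \<le> 2"
proof -
  show "0 \<le> exp_flat_deriv s" by (simp add: exp_flat_deriv_def)
  show "exp_flat_deriv s \<le> 2"
  proof (cases "s \<le> 0")
    case False
    define x where "x = 1 / s"
    have x: "x > 0" using False by (simp add: x_def)
    have "x\<^sup>2 \<le> 2 * exp x" using exp_lower_Taylor_quadratic[of x] x by (simp add: field_simps)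
    then have "x\<^sup>2 * exp (- x) \<le> 2" by (simp add: exp_minus field_simps)
    then show ?thesis using False by (simp add: exp_flat_deriv_def x_def power_divide)
  qed (simp add: exp_flat_deriv_def)
qed

text \<open>Because \<^term>\<open>exp_flat\<close> passes the value one half before 2, the inner argument becomes
  negative there and the outer function is exactly zero: a plateau on both sides without any integration.\<close>

definition smooth_step :: "real \<Rightarrow> real"
  where "smooth_step s = exp_flat (1/2 - exp_flat (4 - 2 * s)) / exp_flat (1/2)"

definition smooth_step_deriv :: "real \<Rightarrow> real"
  where "smooth_step_deriv s =
    exp_flat_deriv (1/2 - exp_flat (4 - 2 * s)) * (2 * exp_flat_deriv (4 - 2 * s)) / exp_flat (1/2)"

lemma exp_flat_half_pos: "exp_flat (1/2) > 0"
  by (simp add: flat_poly_def)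

lemma has_real_derivative_smooth_step: "(smooth_step has_real_derivative smooth_step_deriv s) (at s)"
  unfolding smooth_step_def[abs_def] smooth_step_deriv_def
  using exp_flat_half_pos by (auto intro!: derivative_eq_intros DERIV_chain2[OF has_real_derivative_exp_flat])

lemma exp_flat_ge_half: "s \<ge> 2 \<Longrightarrow> exp_flat s \<ge> 1/2"
proof -
  assume "s \<ge> 2"
  have "1/2 \<le> exp (- (1/2::real))" using exp_ge_add_one_self[of "-(1/2)"] by simp
  also have "\<dots> \<le> exp (- (1 / s))" using \<open>s \<ge> 2\<close> by (simp add: field_simps)
  finally show ?thesis using \<open>s \<ge> 2\<close> by (simp add: flat_poly_def)
qed

lemma smooth_step_bounds: "0 \<le> smooth_step s" "smooth_step s \<le> 1"
  using exp_flat_mono[of "1/2 - exp_flat (4 - 2 * s)" "1/2"] exp_flat_bounds exp_flat_half_pos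
  by (auto simp: smooth_step_def)

lemma smooth_step_0: "s \<le> 1 \<Longrightarrow> smooth_step s = 0" and smooth_step_deriv_0: "s \<le> 1 \<Longrightarrow> smooth_step_deriv s = 0"
  using exp_flat_ge_half[of "4 - 2 * s"]
  by (simp_all add: smooth_step_def smooth_step_deriv_def flat_poly_def[of 1 "1/2 - _"] exp_flat_deriv_def[of "1/2 - _"])

lemma smooth_step_1: "2 \<le> s \<Longrightarrow> smooth_step s = 1" and smooth_step_deriv_1: "2 \<le> s \<Longrightarrow> smooth_step_deriv s = 0"
  using exp_flat_half_pos
  by (simp_all add: smooth_step_def smooth_step_deriv_def flat_poly_def[of 1 "4 - _"] exp_flat_deriv_def[of "4 - _"])

definition step_slope :: real
  where "step_slope = 8 / exp_flat (1/2)"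

lemma step_slope_pos: "step_slope > 0"
  using exp_flat_half_pos by (simp add: step_slope_def)

lemma smooth_step_deriv_bound: "\<bar>smooth_step_deriv s\<bar> \<le> step_slope"
proof -
  have "\<bar>exp_flat_deriv (1/2 - exp_flat (4 - 2 * s)) * (2 * exp_flat_deriv (4 - 2 * s))\<bar> \<le> 2 * (2 * 2)"
    unfolding abs_mult using exp_flat_deriv_bounds by (intro mult_mono) auto
  then show ?thesis
    using exp_flat_half_pos by (simp add: smooth_step_deriv_def step_slope_def divide_right_mono)
qed

lemma smooth_smooth_step:
  assumes "smooth f"
  shows "smooth (\<lambda>x. smooth_step (f x))"
proof -
  have "smooth (\<lambda>x. exp_flat (4 - 2 * f x))"
    by (intro smooth_compose[OF smooth_real_flat_poly] smooth_diff smooth_cmult smooth_const assms)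
  then have "smooth (\<lambda>x. exp_flat (1/2 - exp_flat (4 - 2 * f x)))"
    by (rule smooth_compose[OF smooth_real_flat_poly smooth_diff[OF smooth_const]])
  from smooth_cmult[OF this, of "1 / exp_flat (1/2)"] show ?thesis
    by (simp add: smooth_step_def)
qed

lemma partial_smooth_step:
  "smooth f \<Longrightarrow> partial i (\<lambda>x. smooth_step (f x)) x = smooth_step_deriv (f x) * partial i f x"
  by (rule partial_compose[OF has_real_derivative_smooth_step smooth_differentiable])

section \<open>Square integrable functions\<close>

lemma L2_mult_integrable:
  assumes "f \<in> L2 D" "g \<in> L2 D"
  shows "integrable (lebesgue_on D) (\<lambda>x. f x * g x)"
proof (rule Bochner_Integration.integrable_bound)
  show "integrable (lebesgue_on D) (\<lambda>x. (f x)\<^sup>2 + (g x)\<^sup>2)"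
    using assms by (auto simp: L2_def)
  show "(\<lambda>x. f x * g x) \<in> borel_measurable (lebesgue_on D)"
    using assms by (auto simp: L2_def)
  have "\<bar>a * b\<bar> \<le> a\<^sup>2 + b\<^sup>2" for a b :: real
  proof -
    have "2 * (\<bar>a\<bar> * \<bar>b\<bar>) \<le> a\<^sup>2 + b\<^sup>2" using sum_squares_bound[of "\<bar>a\<bar>" "\<bar>b\<bar>"] by (simp add: mult.assoc)
    moreover have "0 \<le> \<bar>a\<bar> * \<bar>b\<bar>" by simp
    ultimately show ?thesis unfolding abs_mult by linarith
  qed
  then show "AE x in lebesgue_on D. norm (f x * g x) \<le> norm ((f x)\<^sup>2 + (g x)\<^sup>2)"
    by (auto intro!: AE_I2)
qed

lemma L2_cmult: "f \<in> L2 D \<Longrightarrow> (\<lambda>x. c * f x) \<in> L2 D"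
  by (auto simp: L2_def power_mult_distrib)

lemma L2_zero: "(\<lambda>x. 0) \<in> L2 D"
  by (auto simp: L2_def)

lemma L2_add:
  assumes "f \<in> L2 D" "g \<in> L2 D"
  shows "(\<lambda>x. f x + g x) \<in> L2 D"
proof -
  have "integrable (lebesgue_on D) (\<lambda>x. (f x)\<^sup>2 + 2 * (f x * g x) + (g x)\<^sup>2)"
    using assms L2_mult_integrable[OF assms] by (auto simp: L2_def)
  then show ?thesis
    using assms by (auto simp: L2_def power2_sum algebra_simps)
qed

lemma L2_diff: "f \<in> L2 D \<Longrightarrow> g \<in> L2 D \<Longrightarrow> (\<lambda>x. f x - g x) \<in> L2 D"
  using L2_add[of f D "\<lambda>x. (-1) * g x"] L2_cmult[of g D "-1"] by simp



lemma L2_bound: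
  assumes "f \<in> L2 D" "g \<in> borel_measurable (lebesgue_on D)" "\<And>x. x \<in> D \<Longrightarrow> \<bar>g x\<bar> \<le> B * \<bar>f x\<bar>"
  shows "g \<in> L2 D"
proof -
  have "(\<lambda>x. B * f x) \<in> L2 D" using assms(1) by (rule L2_cmult)
  then have i: "integrable (lebesgue_on D) (\<lambda>x. (B * f x)\<^sup>2)" by (auto simp: L2_def)
  have "(g x)\<^sup>2 \<le> (B * f x)\<^sup>2" if "x \<in> D" for x
  proof -
    have "\<bar>g x\<bar> \<le> \<bar>B * f x\<bar>"
      using order_trans[OF assms(3)[OF that] mult_right_mono[OF abs_ge_self abs_ge_zero]] by (simp add: abs_mult)
    then show ?thesis by (simp add: abs_le_square_iff)
  qed
  then have "integrable (lebesgue_on D) (\<lambda>x. (g x)\<^sup>2)"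
    by (intro Bochner_Integration.integrable_bound[OF i] AE_I2) (use assms(2) in auto)
  then show ?thesis using assms(2) by (auto simp: L2_def)
qed

lemma L2_mult_bounded:
  assumes "f \<in> L2 D" "b \<in> borel_measurable (lebesgue_on D)" "\<And>x. x \<in> D \<Longrightarrow> \<bar>b x\<bar> \<le> B"
  shows "(\<lambda>x. b x * f x) \<in> L2 D"
  by (rule L2_bound[OF assms(1)]) (use assms in \<open>auto simp: L2_def abs_mult intro!: mult_right_mono\<close>)

lemma L2_integrable:
  assumes "f \<in> L2 D" "D \<in> lmeasurable"
  shows "integrable (lebesgue_on D) f"
proof -
  interpret finite_measure "lebesgue_on D" by (rule finite_measure_lebesgue_on[OF assms(2)])
  have "(\<lambda>x. 1) \<in> L2 D" by (auto simp: L2_def)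
  from L2_mult_integrable[OF this assms(1)] show ?thesis by simp
qed

lemma L2_norm_nonneg: "L2_norm D f \<ge> 0"
  by (simp add: L2_norm_def)

lemma L2_norm_power2: "(L2_norm D f)\<^sup>2 = (\<integral>x. (f x)\<^sup>2 \<partial>lebesgue_on D)"
  by (simp add: L2_norm_def)

lemma L2_norm_mono:
  assumes "f \<in> L2 D" "g \<in> L2 D" "\<And>x. x \<in> D \<Longrightarrow> \<bar>f x\<bar> \<le> \<bar>g x\<bar>"
  shows "L2_norm D f \<le> L2_norm D g"
  unfolding L2_norm_def
proof (rule real_sqrt_le_mono, rule integral_mono)
  show "integrable (lebesgue_on D) (\<lambda>x. (f x)\<^sup>2)" "integrable (lebesgue_on D) (\<lambda>x. (g x)\<^sup>2)"
    using assms by (auto simp: L2_def)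
  show "(f x)\<^sup>2 \<le> (g x)\<^sup>2" if "x \<in> space (lebesgue_on D)" for x
    using assms(3)[of x] that by (simp add: abs_le_square_iff)
qed

lemma L2_norm_cmult: "L2_norm D (\<lambda>x. c * f x) = \<bar>c\<bar> * L2_norm D f"
  by (simp add: L2_norm_def power_mult_distrib real_sqrt_mult)

lemma L2_Cauchy_Schwarz:
  assumes "f \<in> L2 D" "g \<in> L2 D"
  shows "\<bar>\<integral>x. f x * g x \<partial>lebesgue_on D\<bar> \<le> L2_norm D f * L2_norm D g"
proof -
  define a b c where "a = (\<integral>x. (f x)\<^sup>2 \<partial>lebesgue_on D)" and "b = (\<integral>x. f x * g x \<partial>lebesgue_on D)"
    and "c = (\<integral>x. (g x)\<^sup>2 \<partial>lebesgue_on D)"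
  have int: "integrable (lebesgue_on D) (\<lambda>x. (f x)\<^sup>2)" "integrable (lebesgue_on D) (\<lambda>x. f x * g x)"
    "integrable (lebesgue_on D) (\<lambda>x. (g x)\<^sup>2)"
    using assms L2_mult_integrable[OF assms] by (auto simp: L2_def)
  have quad: "0 \<le> s\<^sup>2 * a + 2 * s * t * b + t\<^sup>2 * c" for s t
  proof -
    have "0 \<le> (\<integral>x. (s * f x + t * g x)\<^sup>2 \<partial>lebesgue_on D)" by simp
    also have "\<dots> = (\<integral>x. s\<^sup>2 * (f x)\<^sup>2 + (2 * s * t) * (f x * g x) + t\<^sup>2 * (g x)\<^sup>2 \<partial>lebesgue_on D)"
      by (rule Bochner_Integration.integral_cong) (auto simp: power2_eq_square algebra_simps)
    also have "\<dots> = s\<^sup>2 * a + 2 * s * t * b + t\<^sup>2 * c"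
      using int by (simp add: a_def b_def c_def)
    finally show ?thesis .
  qed
  have "b\<^sup>2 \<le> a * c"
  proof (cases "c = 0")
    case True
    have "b = 0"
    proof (rule ccontr)
      assume "b \<noteq> 0"
      then show False using quad[of 1 "- (a + 1) / (2 * b)"] True by (simp add: field_simps)
    qed
    then show ?thesis using True by simp
  next
    case False
    then have "c > 0" by (simp add: c_def order_less_le)
    have "0 \<le> c * (a * c - b\<^sup>2)"
      using quad[of c "- b"] by (simp add: power2_eq_square algebra_simps)
    then show ?thesis using \<open>c > 0\<close> by (simp add: zero_le_mult_iff)
  qed
  then have "sqrt (b\<^sup>2) \<le> sqrt (a * c)" by (rule real_sqrt_le_mono)
  then show ?thesis
    by (simp add: a_def b_def c_def L2_norm_def real_sqrt_mult)
qed

lemma L2_norm_triangle: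
  assumes "f \<in> L2 D" "g \<in> L2 D"
  shows "L2_norm D (\<lambda>x. f x + g x) \<le> L2_norm D f + L2_norm D g"
proof (rule power2_le_imp_le)
  have "(\<integral>x. (f x + g x)\<^sup>2 \<partial>lebesgue_on D) = (\<integral>x. (f x)\<^sup>2 + 2 * (f x * g x) + (g x)\<^sup>2 \<partial>lebesgue_on D)"
    by (rule Bochner_Integration.integral_cong) (auto simp: power2_eq_square algebra_simps)
  also have "\<dots> = (L2_norm D f)\<^sup>2 + 2 * (\<integral>x. f x * g x \<partial>lebesgue_on D) + (L2_norm D g)\<^sup>2"
    unfolding L2_norm_power2 using assms L2_mult_integrable[OF assms] by (auto simp: L2_def)
  finally show "(L2_norm D (\<lambda>x. f x + g x))\<^sup>2 \<le> (L2_norm D f + L2_norm D g)\<^sup>2"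
    using L2_Cauchy_Schwarz[OF assms] by (simp add: L2_norm_power2[of D "\<lambda>x. f x + g x"] power2_sum)
qed (simp add: L2_norm_nonneg)

lemma L2_bounded_function:
  assumes "D \<in> lmeasurable" "f \<in> borel_measurable (lebesgue_on D)" "\<And>x. x \<in> D \<Longrightarrow> \<bar>f x\<bar> \<le> B"
  shows "f \<in> L2 D" and "B \<ge> 0 \<Longrightarrow> L2_norm D f \<le> B * sqrt (measure lebesgue D)"
proof -
  interpret finite_measure "lebesgue_on D" by (rule finite_measure_lebesgue_on[OF assms(1)])
  have one: "(\<lambda>x. 1) \<in> L2 D" by (auto simp: L2_def)
  show f: "f \<in> L2 D"
    by (rule L2_bound[OF one assms(2)]) (use assms(3) in simp)
  assume "B \<ge> 0"
  then have "L2_norm D f \<le> L2_norm D (\<lambda>x. B * 1)"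
    by (intro L2_norm_mono f L2_cmult one) (use assms(3) in auto)
  also have "\<dots> = B * sqrt (measure lebesgue D)"
    unfolding L2_norm_cmult using \<open>B \<ge> 0\<close> assms(1)
    by (simp add: L2_norm_def measure_restrict_space fmeasurableD)
  finally show "L2_norm D f \<le> B * sqrt (measure lebesgue D)" .
qed

lemma L2_continuous:
  assumes "D \<in> lmeasurable" "bounded D" "continuous_on UNIV f"
  shows "f \<in> L2 D"
proof -
  have "compact (f ` closure D)"
    using assms(2,3) by (intro compact_continuous_image) (auto intro: continuous_on_subset)
  then obtain B where B: "\<And>x. x \<in> closure D \<Longrightarrow> \<bar>f x\<bar> \<le> B"
    by (metis bounded_iff compact_imp_bounded imageI real_norm_def)
  show ?thesis
  proof (rule L2_bounded_function(1)[OF assms(1)])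
    show "f \<in> borel_measurable (lebesgue_on D)"
      using assms(1,3) by (intro continuous_imp_measurable_on_sets_lebesgue) (auto intro: continuous_on_subset)
    show "\<bar>f x\<bar> \<le> B" if "x \<in> D" for x using B that closure_subset by blast
  qed
qed

lemma lebesgue_on_integral_subset:
  fixes f :: "'a::euclidean_space \<Rightarrow> real"
  assumes "E \<in> sets lebesgue" "D \<in> sets lebesgue" "E \<subseteq> D"
  shows "(\<integral>x. f x \<partial>lebesgue_on E) = (\<integral>x. indicator E x * f x \<partial>lebesgue_on D)"
    and "integrable (lebesgue_on E) f \<longleftrightarrow> integrable (lebesgue_on D) (\<lambda>x. indicator E x * f x)"
proof -
  have eq: "(\<lambda>x. indicator D x *\<^sub>R (indicator E x * f x)) = (\<lambda>x. indicator E x *\<^sub>R f x)"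
    using assms(3) by (auto simp: indicator_def fun_eq_iff)
  show "(\<integral>x. f x \<partial>lebesgue_on E) = (\<integral>x. indicator E x * f x \<partial>lebesgue_on D)"
    using assms eq by (simp add: integral_restrict_space)
  show "integrable (lebesgue_on E) f \<longleftrightarrow> integrable (lebesgue_on D) (\<lambda>x. indicator E x * f x)"
    using assms eq by (simp add: integrable_restrict_space)
qed

lemma L2_subset:
  assumes "E \<in> sets lebesgue" "D \<in> sets lebesgue" "E \<subseteq> D" "f \<in> L2 D"
  shows "f \<in> L2 E" and "L2_norm E f \<le> L2_norm D f"
proof -
  have f: "f \<in> borel_measurable (lebesgue_on D)" "integrable (lebesgue_on D) (\<lambda>x. (f x)\<^sup>2)"
    using assms(4) by (auto simp: L2_def)
  have i: "integrable (lebesgue_on D) (\<lambda>x. indicator E x * (f x)\<^sup>2)"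
  proof (rule Bochner_Integration.integrable_bound[OF f(2)])
    have "indicator E \<in> borel_measurable (lebesgue_on D)"
      using assms(1) by (simp add: borel_measurable_indicator_iff sets_restrict_space_iff assms(2) Int_commute
          measurable_restrict_space1)
    then show "(\<lambda>x. indicator E x * (f x)\<^sup>2) \<in> borel_measurable (lebesgue_on D)"
      using f(1) by measurable
  qed (auto simp: indicator_def)
  show "f \<in> L2 E"
    using i lebesgue_on_integral_subset(2)[OF assms(1-3)] measurable_restrict_mono[OF f(1) assms(3)]
    by (auto simp: L2_def)
  show "L2_norm E f \<le> L2_norm D f"
    unfolding L2_norm_def lebesgue_on_integral_subset(1)[OF assms(1-3)]
    by (intro real_sqrt_le_mono integral_mono i f) (auto simp: indicator_def)
qed

definition L2_tendsto :: "'a::euclidean_space set \<Rightarrow> (nat \<Rightarrow> 'a \<Rightarrow> real) \<Rightarrow> ('a \<Rightarrow> real) \<Rightarrow> bool"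
  where "L2_tendsto D u f \<longleftrightarrow> f \<in> L2 D \<and> (\<forall>n. u n \<in> L2 D) \<and> (\<lambda>n. L2_norm D (\<lambda>x. u n x - f x)) \<longlonglongrightarrow> 0"

lemma L2_tendsto_bound:
  assumes "L2_tendsto D u f" "g \<in> L2 D" "\<And>n. w n \<in> L2 D"
    and "\<And>n x. x \<in> D \<Longrightarrow> \<bar>w n x - g x\<bar> \<le> B * \<bar>u n x - f x\<bar>"
  shows "L2_tendsto D w g"
proof -
  have "(\<lambda>n. L2_norm D (\<lambda>x. w n x - g x)) \<longlonglongrightarrow> 0"
  proof (rule tendsto_sandwich[OF _ _ tendsto_const])
    have "L2_norm D (\<lambda>x. w n x - g x) \<le> \<bar>B\<bar> * L2_norm D (\<lambda>x. u n x - f x)" for n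
      unfolding L2_norm_cmult[symmetric]
    proof (rule L2_norm_mono)
      show "(\<lambda>x. w n x - g x) \<in> L2 D" "(\<lambda>x. B * (u n x - f x)) \<in> L2 D"
        using assms by (auto simp: L2_tendsto_def intro!: L2_diff L2_cmult)
      show "\<bar>w n x - g x\<bar> \<le> \<bar>B * (u n x - f x)\<bar>" if "x \<in> D" for x
        using order_trans[OF assms(4)[OF that, of n] mult_right_mono[OF abs_ge_self abs_ge_zero]] by (simp add: abs_mult)
    qed
    then show "\<forall>\<^sub>F n in sequentially. L2_norm D (\<lambda>x. w n x - g x) \<le> \<bar>B\<bar> * L2_norm D (\<lambda>x. u n x - f x)" by simp
    show "(\<lambda>n. \<bar>B\<bar> * L2_norm D (\<lambda>x. u n x - f x)) \<longlonglongrightarrow> 0"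
      using assms(1) tendsto_mult_right_zero by (auto simp: L2_tendsto_def)
  qed (simp add: L2_norm_nonneg)
  then show ?thesis using assms by (auto simp: L2_tendsto_def)
qed

lemma L2_tendsto_add:
  assumes "L2_tendsto D u f" "L2_tendsto D w g"
  shows "L2_tendsto D (\<lambda>n x. u n x + w n x) (\<lambda>x. f x + g x)"
proof -
  have in_L2: "f \<in> L2 D" "\<And>n. u n \<in> L2 D" "g \<in> L2 D" "\<And>n. w n \<in> L2 D"
    using assms by (auto simp: L2_tendsto_def)
  have "(\<lambda>n. L2_norm D (\<lambda>x. (u n x + w n x) - (f x + g x))) \<longlonglongrightarrow> 0"
  proof (rule tendsto_sandwich[OF _ _ tendsto_const])
    have "L2_norm D (\<lambda>x. (u n x + w n x) - (f x + g x)) \<le> L2_norm D (\<lambda>x. u n x - f x) + L2_norm D (\<lambda>x. w n x - g x)" for n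
      using L2_norm_triangle[of "\<lambda>x. u n x - f x" D "\<lambda>x. w n x - g x"] in_L2 by (simp add: L2_diff algebra_simps)
    then show "\<forall>\<^sub>F n in sequentially. L2_norm D (\<lambda>x. (u n x + w n x) - (f x + g x))
        \<le> L2_norm D (\<lambda>x. u n x - f x) + L2_norm D (\<lambda>x. w n x - g x)" by simp
    show "(\<lambda>n. L2_norm D (\<lambda>x. u n x - f x) + L2_norm D (\<lambda>x. w n x - g x)) \<longlonglongrightarrow> 0"
      using assms tendsto_add[of _ "0::real" _ _ 0] by (auto simp: L2_tendsto_def)
  qed (simp add: L2_norm_nonneg)
  then show ?thesis using in_L2 by (auto simp: L2_tendsto_def intro: L2_add)
qed

lemma L2_tendsto_const: "f \<in> L2 D \<Longrightarrow> L2_tendsto D (\<lambda>n. f) f"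
  by (simp add: L2_tendsto_def L2_norm_def)

lemma L2_tendsto_mult_fixed:
  assumes "L2_tendsto D u f" "b \<in> borel_measurable (lebesgue_on D)" "\<And>x. x \<in> D \<Longrightarrow> \<bar>b x\<bar> \<le> B"
  shows "L2_tendsto D (\<lambda>n x. b x * u n x) (\<lambda>x. b x * f x)"
proof (rule L2_tendsto_bound[OF assms(1)])
  show "(\<lambda>x. b x * f x) \<in> L2 D" "(\<lambda>x. b x * u n x) \<in> L2 D" for n
    using assms by (auto simp: L2_tendsto_def intro: L2_mult_bounded)
  show "\<bar>b x * u n x - b x * f x\<bar> \<le> B * \<bar>u n x - f x\<bar>" if "x \<in> D" for n x
    using mult_right_mono[OF assms(3)[OF that], of "\<bar>u n x - f x\<bar>"]
    by (simp add: abs_mult[symmetric] algebra_simps)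
qed

text \<open>Dominated convergence for a bounded factor.\<close>

lemma L2_tendsto_mult_pointwise:
  assumes "f \<in> L2 D" and "\<And>n. b n \<in> borel_measurable (lebesgue_on D)" "b' \<in> borel_measurable (lebesgue_on D)"
    and "\<And>n x. x \<in> D \<Longrightarrow> \<bar>b n x\<bar> \<le> B" "\<And>x. x \<in> D \<Longrightarrow> \<bar>b' x\<bar> \<le> B"
    and "AE x in lebesgue_on D. (\<lambda>n. b n x) \<longlonglongrightarrow> b' x"
  shows "L2_tendsto D (\<lambda>n x. b n x * f x) (\<lambda>x. b' x * f x)"
proof -
  have f: "integrable (lebesgue_on D) (\<lambda>x. (f x)\<^sup>2)" "f \<in> borel_measurable (lebesgue_on D)"
    using assms(1) by (auto simp: L2_def)
  have "(\<lambda>n. \<integral>x. (b n x * f x - b' x * f x)\<^sup>2 \<partial>lebesgue_on D) \<longlonglongrightarrow> (\<integral>x. 0 \<partial>lebesgue_on D)"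
  proof (rule integral_dominated_convergence[where w = "\<lambda>x. 4 * B\<^sup>2 * (f x)\<^sup>2"])
    show "AE x in lebesgue_on D. (\<lambda>n. (b n x * f x - b' x * f x)\<^sup>2) \<longlonglongrightarrow> 0"
      using assms(6)
    proof eventually_elim
      case (elim x)
      then have "(\<lambda>n. (b n x * f x - b' x * f x)\<^sup>2) \<longlonglongrightarrow> (b' x * f x - b' x * f x)\<^sup>2"
        by (intro tendsto_intros)
      then show ?case by simp
    qed
    show "AE x in lebesgue_on D. norm ((b n x * f x - b' x * f x)\<^sup>2) \<le> 4 * B\<^sup>2 * (f x)\<^sup>2" for n
    proof (rule AE_I2)
      fix x assume "x \<in> space (lebesgue_on D)"
      then have x: "x \<in> D" by simp
      have "\<bar>b n x - b' x\<bar> \<le> 2 * B" using assms(4)[OF x, of n] assms(5)[OF x] by linarith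
      then have "\<bar>b n x - b' x\<bar>\<^sup>2 \<le> (2 * B)\<^sup>2" by (intro power_mono) auto
      then have "(b n x - b' x)\<^sup>2 * (f x)\<^sup>2 \<le> 4 * B\<^sup>2 * (f x)\<^sup>2"
        by (intro mult_right_mono) (auto simp: power_mult_distrib)
      then show "norm ((b n x * f x - b' x * f x)\<^sup>2) \<le> 4 * B\<^sup>2 * (f x)\<^sup>2"
        by (simp add: power_mult_distrib[symmetric] left_diff_distrib)
    qed
  qed (use f assms in auto)
  then have "(\<lambda>n. sqrt (\<integral>x. (b n x * f x - b' x * f x)\<^sup>2 \<partial>lebesgue_on D)) \<longlonglongrightarrow> sqrt 0"
    by (intro tendsto_real_sqrt) simp
  then show ?thesis
    using assms by (auto simp: L2_tendsto_def L2_norm_def intro!: L2_mult_bounded)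
qed

lemma L2_tendsto_mult:
  assumes "L2_tendsto D u f" and "\<And>n. b n \<in> borel_measurable (lebesgue_on D)" "b' \<in> borel_measurable (lebesgue_on D)"
    and "\<And>n x. x \<in> D \<Longrightarrow> \<bar>b n x\<bar> \<le> B" "\<And>x. x \<in> D \<Longrightarrow> \<bar>b' x\<bar> \<le> B"
    and "AE x in lebesgue_on D. (\<lambda>n. b n x) \<longlonglongrightarrow> b' x"
  shows "L2_tendsto D (\<lambda>n x. b n x * u n x) (\<lambda>x. b' x * f x)"
proof -
  have in_L2: "f \<in> L2 D" "\<And>n. u n \<in> L2 D" using assms(1) by (auto simp: L2_tendsto_def)
  have "L2_tendsto D (\<lambda>n x. b n x * (u n x - f x)) (\<lambda>x. 0)"
  proof (rule L2_tendsto_bound[OF assms(1) L2_zero])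
    show "(\<lambda>x. b n x * (u n x - f x)) \<in> L2 D" for n
      using assms in_L2 by (auto intro!: L2_mult_bounded L2_diff)
    show "\<bar>b n x * (u n x - f x) - 0\<bar> \<le> B * \<bar>u n x - f x\<bar>" if "x \<in> D" for n x
      using mult_right_mono[OF assms(4)[OF that], of "\<bar>u n x - f x\<bar>" n] by (simp add: abs_mult)
  qed
  from L2_tendsto_add[OF this L2_tendsto_mult_pointwise[OF in_L2(1) assms(2-6)]]
  show ?thesis by (simp add: algebra_simps)
qed

lemma L2_tendsto_integral_mult:
  assumes "L2_tendsto D u f" "L2_tendsto D w g"
  shows "(\<lambda>n. \<integral>x. u n x * w n x \<partial>lebesgue_on D) \<longlonglongrightarrow> (\<integral>x. f x * g x \<partial>lebesgue_on D)"
proof -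
  have in_L2: "f \<in> L2 D" "\<And>n. u n \<in> L2 D" "g \<in> L2 D" "\<And>n. w n \<in> L2 D"
    and lim: "(\<lambda>n. L2_norm D (\<lambda>x. u n x - f x)) \<longlonglongrightarrow> 0" "(\<lambda>n. L2_norm D (\<lambda>x. w n x - g x)) \<longlonglongrightarrow> 0"
    using assms by (auto simp: L2_tendsto_def)
  let ?du = "\<lambda>n x. u n x - f x" and ?dw = "\<lambda>n x. w n x - g x"
  have eq: "(\<integral>x. u n x * w n x \<partial>lebesgue_on D) - (\<integral>x. f x * g x \<partial>lebesgue_on D) =
      (\<integral>x. ?du n x * ?dw n x \<partial>lebesgue_on D) + (\<integral>x. ?du n x * g x \<partial>lebesgue_on D) + (\<integral>x. f x * ?dw n x \<partial>lebesgue_on D)" for n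
  proof -
    have "(\<integral>x. u n x * w n x \<partial>lebesgue_on D) =
        (\<integral>x. (?du n x * ?dw n x + ?du n x * g x + f x * ?dw n x) + f x * g x \<partial>lebesgue_on D)"
      by (rule Bochner_Integration.integral_cong) (auto simp: algebra_simps)
    also have "\<dots> = (\<integral>x. ?du n x * ?dw n x \<partial>lebesgue_on D) + (\<integral>x. ?du n x * g x \<partial>lebesgue_on D)
        + (\<integral>x. f x * ?dw n x \<partial>lebesgue_on D) + (\<integral>x. f x * g x \<partial>lebesgue_on D)"
      using in_L2 by (subst Bochner_Integration.integral_add | auto intro!: L2_mult_integrable L2_diff Bochner_Integration.integrable_add)+
    finally show ?thesis by simp
  qed
  have "(\<lambda>n. (\<integral>x. u n x * w n x \<partial>lebesgue_on D) - (\<integral>x. f x * g x \<partial>lebesgue_on D)) \<longlonglongrightarrow> 0"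
  proof (rule Lim_null_comparison)
    have "\<bar>(\<integral>x. u n x * w n x \<partial>lebesgue_on D) - (\<integral>x. f x * g x \<partial>lebesgue_on D)\<bar>
        \<le> L2_norm D (?du n) * L2_norm D (?dw n) + L2_norm D (?du n) * L2_norm D g + L2_norm D f * L2_norm D (?dw n)" for n
    proof -
      have "\<bar>\<integral>x. ?du n x * ?dw n x \<partial>lebesgue_on D\<bar> \<le> L2_norm D (?du n) * L2_norm D (?dw n)"
        "\<bar>\<integral>x. ?du n x * g x \<partial>lebesgue_on D\<bar> \<le> L2_norm D (?du n) * L2_norm D g"
        "\<bar>\<integral>x. f x * ?dw n x \<partial>lebesgue_on D\<bar> \<le> L2_norm D f * L2_norm D (?dw n)"
        using in_L2 by (auto intro!: L2_Cauchy_Schwarz L2_diff)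
      then show ?thesis unfolding eq by linarith
    qed
    then show "\<forall>\<^sub>F n in sequentially. norm ((\<integral>x. u n x * w n x \<partial>lebesgue_on D) - (\<integral>x. f x * g x \<partial>lebesgue_on D))
        \<le> L2_norm D (?du n) * L2_norm D (?dw n) + L2_norm D (?du n) * L2_norm D g + L2_norm D f * L2_norm D (?dw n)"
      by simp
    have "(\<lambda>n. L2_norm D (?du n) * L2_norm D (?dw n) + L2_norm D (?du n) * L2_norm D g + L2_norm D f * L2_norm D (?dw n))
        \<longlonglongrightarrow> 0 * 0 + 0 * L2_norm D g + L2_norm D f * 0"
      by (intro tendsto_intros lim)
    then show "(\<lambda>n. L2_norm D (?du n) * L2_norm D (?dw n) + L2_norm D (?du n) * L2_norm D g + L2_norm D f * L2_norm D (?dw n))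
        \<longlonglongrightarrow> 0" by simp
  qed
  then show ?thesis by (simp add: LIM_zero_iff)
qed

lemma L2_tendsto_AE_subsequence:
  assumes "L2_tendsto D u f"
  shows "\<exists>r. strict_mono r \<and> (AE x in lebesgue_on D. (\<lambda>n. u (r n) x) \<longlonglongrightarrow> f x)"
proof -
  have in_L2: "(\<lambda>x. u n x - f x) \<in> L2 D" for n
    using assms by (auto simp: L2_tendsto_def intro: L2_diff)
  have "(\<lambda>n. (L2_norm D (\<lambda>x. u n x - f x))\<^sup>2) \<longlonglongrightarrow> 0\<^sup>2"
    using assms by (intro tendsto_power) (auto simp: L2_tendsto_def)
  then have "(\<lambda>n. \<integral>x. norm ((u n x - f x)\<^sup>2) \<partial>lebesgue_on D) \<longlonglongrightarrow> 0"
    by (simp add: L2_norm_power2)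
  then obtain r where r: "strict_mono r" "AE x in lebesgue_on D. (\<lambda>n. (u (r n) x - f x)\<^sup>2) \<longlonglongrightarrow> 0"
    using tendsto_L1_AE_subseq[of "lebesgue_on D" "\<lambda>n x. (u n x - f x)\<^sup>2"] in_L2 by (auto simp: L2_def)
  from r(2) have "AE x in lebesgue_on D. (\<lambda>n. u (r n) x) \<longlonglongrightarrow> f x"
  proof eventually_elim
    case (elim x)
    then have "(\<lambda>n. u (r n) x - f x) \<longlonglongrightarrow> 0"
      using tendsto_real_sqrt[of "\<lambda>n. (u (r n) x - f x)\<^sup>2" 0] by (simp add: tendsto_rabs_zero_iff)
    then show ?case by (simp add: LIM_zero_iff)
  qed
  with r(1) show ?thesis by blast
qed

lemma L2_tendsto_subsequence: "L2_tendsto D u f \<Longrightarrow> strict_mono r \<Longrightarrow> L2_tendsto D (\<lambda>n. u (r n)) f"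
  using LIMSEQ_subseq_LIMSEQ[of "\<lambda>n. L2_norm D (\<lambda>x. u n x - f x)" 0 r]
  by (auto simp: L2_tendsto_def o_def)

section \<open>Integration over triangles\<close>

definition det2 :: "real^2 \<Rightarrow> real^2 \<Rightarrow> real"
  where "det2 u w = u $ 1 * w $ 2 - u $ 2 * w $ 1"

definition chart :: "real^2 \<Rightarrow> real^2 \<Rightarrow> real^2 \<Rightarrow> real \<times> real \<Rightarrow> real^2"
  where "chart a u w p = a + fst p *\<^sub>R u + snd p *\<^sub>R w"

definition coord_grad1 :: "real^2 \<Rightarrow> real^2 \<Rightarrow> real^2"
  where "coord_grad1 u w = (1 / det2 u w) *\<^sub>R vector [w $ 2, - w $ 1]"

definition coord_grad2 :: "real^2 \<Rightarrow> real^2 \<Rightarrow> real^2"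
  where "coord_grad2 u w = (1 / det2 u w) *\<^sub>R vector [- u $ 2, u $ 1]"

lemma inner_2: "x \<bullet> y = x $ 1 * y $ 1 + x $ 2 * (y::real^2) $ 2"
  by (simp add: inner_vec_def sum_2)

lemma coord_grad_inner:
  "coord_grad1 u w \<bullet> x = det2 x w / det2 u w" "coord_grad2 u w \<bullet> x = det2 u x / det2 u w"
  by (simp_all add: coord_grad1_def coord_grad2_def inner_2 det2_def[of x w] det2_def[of u x] diff_divide_distrib mult.commute)

lemma coord_grad_dual:
  assumes "det2 u w \<noteq> 0"
  shows "coord_grad1 u w \<bullet> u = 1" "coord_grad1 u w \<bullet> w = 0" "coord_grad2 u w \<bullet> u = 0" "coord_grad2 u w \<bullet> w = 1"
  using assms by (simp_all add: coord_grad_inner det2_def[of w w] det2_def[of u u])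

lemma coord_expansion:
  assumes "det2 u w \<noteq> 0"
  shows "x = (coord_grad1 u w \<bullet> x) *\<^sub>R u + (coord_grad2 u w \<bullet> x) *\<^sub>R w"
proof -
  have "det2 u w * x $ i = det2 x w * u $ i + det2 u x * w $ i" for i
    using exhaust_2[of i] by (auto simp: det2_def algebra_simps)
  then have "x $ i = (coord_grad1 u w \<bullet> x) * u $ i + (coord_grad2 u w \<bullet> x) * w $ i" for i
    using assms by (simp add: coord_grad_inner field_simps)
  then show ?thesis
    by (simp add: vec_eq_iff)
qed

lemma chart_coords:
  assumes "det2 u w \<noteq> 0"
  shows "coord_grad1 u w \<bullet> (chart a u w (s, t) - a) = s" "coord_grad2 u w \<bullet> (chart a u w (s, t) - a) = t"
    and "chart a u w (coord_grad1 u w \<bullet> (x - a), coord_grad2 u w \<bullet> (x - a)) = x"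
  using coord_grad_dual[OF assms] coord_expansion[OF assms, of "x - a"]
  by (simp_all add: chart_def inner_add_right add.assoc)

lemma continuous_on_chart: "continuous_on S (chart a u w)"
  unfolding chart_def[abs_def] by (intro continuous_intros)

lemma chart_measurable [measurable]: "chart a u w \<in> borel_measurable borel"
  by (intro borel_measurable_continuous_onI continuous_on_chart)

lemma chart_axes: "chart 0 (axis 1 1) (axis 2 1) p $ 1 = fst p" "chart 0 (axis 1 1) (axis 2 1) p $ 2 = snd p"
  by (simp_all add: chart_def axis_def)

lemma lborel_chart_axes: "distr lborel borel (chart 0 (axis 1 1) (axis 2 1)) = lborel"
proof (rule lborel_eqI[symmetric])
  fix l r :: "real^2" assume lr: "\<And>b. b \<in> Basis \<Longrightarrow> l \<bullet> b \<le> r \<bullet> b"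
  have le: "l $ 1 \<le> r $ 1" "l $ 2 \<le> r $ 2"
    using lr[of "axis 1 1"] lr[of "axis 2 1"] by (auto simp: inner_axis axis_in_Basis_iff)
  have "chart 0 (axis 1 1) (axis 2 1) -` box l r = {p. l $ 1 < fst p \<and> fst p < r $ 1 \<and> l $ 2 < snd p \<and> snd p < r $ 2}"
    by (auto simp: mem_box_cart forall_2 chart_axes)
  also have "\<dots> = box (l $ 1, l $ 2) (r $ 1, r $ 2)"
    by (auto simp: box_def Basis_prod_def)
  finally have "chart 0 (axis 1 1) (axis 2 1) -` box l r = box (l $ 1, l $ 2) (r $ 1, r $ 2)" .
  moreover have "emeasure lborel (box (l $ 1, l $ 2) (r $ 1, r $ 2)) = (r $ 1 - l $ 1) * (r $ 2 - l $ 2)"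
    using le by (subst emeasure_lborel_box) (auto simp: Basis_prod_def prod.union_disjoint sum.union_disjoint)
  moreover have "(\<Prod>b\<in>Basis. (r - l) \<bullet> b) = (r $ 1 - l $ 1) * (r $ 2 - l $ 2)"
    by (simp add: Basis_vec_def UNION_singleton_eq_range prod.reindex inj_on_def axis_eq_axis inner_axis UNIV_2)
  ultimately show "emeasure (distr lborel borel (chart 0 (axis 1 1) (axis 2 1))) (box l r) = (\<Prod>b\<in>Basis. (r - l) \<bullet> b)"
    by (simp add: emeasure_distr)
qed simp

lemma lborel_chart:
  assumes "det2 u w \<noteq> 0"
  shows "density (distr lborel borel (chart a u w)) (\<lambda>_. ennreal \<bar>det2 u w\<bar>) = lborel"
proof (rule lborel_eqI[symmetric])
  define L where "L x = x $ 1 *\<^sub>R u + x $ 2 *\<^sub>R w" for x :: "real^2"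
  have lin: "linear L"
    by (auto simp: L_def linear_iff algebra_simps)
  have det: "det (matrix L) = det2 u w"
    by (simp add: det_2 matrix_def L_def axis_def det2_def)
  have surj: "L ` (L -` A) = A" for A
  proof -
    have "x \<in> range L" for x
    proof
      show "x = L (vector [coord_grad1 u w \<bullet> x, coord_grad2 u w \<bullet> x])"
        using coord_expansion[OF assms, of x] by (simp add: L_def)
    qed simp
    then show ?thesis by (auto simp: image_vimage_eq)
  qed
  have L_meas [measurable]: "L \<in> borel_measurable borel"
    by (intro borel_measurable_continuous_onI linear_continuous_on lin[unfolded linear_conv_bounded_linear])
  fix l r :: "real^2" assume lr: "\<And>b. b \<in> Basis \<Longrightarrow> l \<bullet> b \<le> r \<bullet> b"
  define A where "A = (+) a -` box l r"
  have A': "A = box (l - a) (r - a)"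
    by (auto simp: A_def mem_box inner_diff_left inner_add_left less_diff_eq diff_less_eq add.commute)
  have A: "A \<in> sets borel" "emeasure lborel A = emeasure lborel (box l r)"
  proof -
    show "A \<in> sets borel" by (simp add: A')
    show "emeasure lborel A = emeasure lborel (box l r)"
      using emeasure_distr[of "(+) a" lborel borel "box l r"] by (simp add: lborel_distr_plus A_def)
  qed

  have fin: "L -` A \<in> lmeasurable"
  proof -
    obtain g where g: "linear g" "\<And>x. g (L x) = x"
      using linear_injective_isomorphism[OF lin] det_nz_iff_inj[OF lin] det assms by auto
    have "L (g z) = z" for z
    proof -
      have "z \<in> L ` (L -` {z})" unfolding surj by simp
      then show ?thesis using g(2) by auto
    qed
    then have "L -` A = g ` A"
      by (intro equalityI subsetI) (use g(2) in \<open>auto intro: image_eqI[of _ g "L _"]\<close>)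
    then show ?thesis
      using measurable_linear_image[OF g(1), of A] by (simp add: A')
  qed
  have "chart a u w -` box l r = chart 0 (axis 1 1) (axis 2 1) -` (L -` A)"
    by (auto simp: chart_def[of a] L_def A_def add.assoc chart_axes)
  moreover have LA: "L -` A \<in> sets borel" using measurable_sets[OF L_meas A(1)] by simp
  ultimately have "emeasure lborel (chart a u w -` box l r) = emeasure lborel (L -` A)"
    using emeasure_distr[of "chart 0 (axis 1 1) (axis 2 1)" lborel borel "L -` A"] by (simp add: lborel_chart_axes)
  moreover have "ennreal \<bar>det2 u w\<bar> * emeasure lborel (L -` A) = emeasure lborel A"
  proof -
    have "measure lebesgue A = \<bar>det2 u w\<bar> * measure lebesgue (L -` A)"
      using measure_linear_image[OF lin fin] unfolding surj det .
    moreover have "emeasure lborel A = ennreal (measure lebesgue A)"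
      using A(1) emeasure_eq_measure2[of A lebesgue] A' by simp
    moreover have "emeasure lborel (L -` A) = ennreal (measure lebesgue (L -` A))"
      using LA fin emeasure_eq_measure2[of "L -` A" lebesgue] by simp
    ultimately show ?thesis
      by (simp add: ennreal_mult')
  qed
  ultimately show "emeasure (density (distr lborel borel (chart a u w)) (\<lambda>_. ennreal \<bar>det2 u w\<bar>)) (box l r) =
      (\<Prod>b\<in>Basis. (r - l) \<bullet> b)"
    using lr A(2) by (simp add: emeasure_density_const emeasure_distr)
qed simp

lemma integral_chart:
  fixes f :: "real^2 \<Rightarrow> real"
  assumes "det2 u w \<noteq> 0" and f: "f \<in> borel_measurable borel"
  shows "integrable lborel f \<longleftrightarrow> integrable lborel (\<lambda>p. f (chart a u w p))"
    and "(\<integral>x. f x \<partial>lborel) = \<bar>det2 u w\<bar> * (\<integral>p. f (chart a u w p) \<partial>lborel)"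
proof -
  have "integrable lborel f \<longleftrightarrow> integrable (density (distr lborel borel (chart a u w)) (\<lambda>_. ennreal \<bar>det2 u w\<bar>)) f"
    by (simp add: lborel_chart[OF assms(1)])
  also have "\<dots> \<longleftrightarrow> integrable lborel (\<lambda>p. \<bar>det2 u w\<bar> * f (chart a u w p))"
    using f by (subst integrable_density) (auto simp: integrable_distr_eq)
  also have "\<dots> \<longleftrightarrow> integrable lborel (\<lambda>p. f (chart a u w p))"
    using assms(1) by (simp add: integrable_mult_left_iff)
  finally show "integrable lborel f \<longleftrightarrow> integrable lborel (\<lambda>p. f (chart a u w p))" .
  have "(\<integral>x. f x \<partial>lborel) = (\<integral>x. f x \<partial>(density (distr lborel borel (chart a u w)) (\<lambda>_. ennreal \<bar>det2 u w\<bar>)))"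
    by (simp add: lborel_chart[OF assms(1)])
  also have "\<dots> = (\<integral>p. \<bar>det2 u w\<bar> * f (chart a u w p) \<partial>lborel)"
    using f by (subst integral_density) (auto simp: integral_distr)
  finally show "(\<integral>x. f x \<partial>lborel) = \<bar>det2 u w\<bar> * (\<integral>p. f (chart a u w p) \<partial>lborel)" by simp
qed

definition chart_region :: "real^2 \<Rightarrow> real^2 \<Rightarrow> real^2 \<Rightarrow> (real \<Rightarrow> real) \<Rightarrow> (real^2) set"
  where "chart_region a u w h = chart a u w ` {(s, t). 0 \<le> s \<and> s \<le> 1 \<and> 0 \<le> t \<and> t \<le> h s}"

lemma mem_chart_region:
  assumes "det2 u w \<noteq> 0"
  shows "x \<in> chart_region a u w h \<longleftrightarrow> (let s = coord_grad1 u w \<bullet> (x - a); t = coord_grad2 u w \<bullet> (x - a) in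
    0 \<le> s \<and> s \<le> 1 \<and> 0 \<le> t \<and> t \<le> h s)"
  unfolding chart_region_def Let_def
proof
  assume "x \<in> chart a u w ` {(s, t). 0 \<le> s \<and> s \<le> 1 \<and> 0 \<le> t \<and> t \<le> h s}"
  then show "0 \<le> coord_grad1 u w \<bullet> (x - a) \<and> coord_grad1 u w \<bullet> (x - a) \<le> 1 \<and>
      0 \<le> coord_grad2 u w \<bullet> (x - a) \<and> coord_grad2 u w \<bullet> (x - a) \<le> h (coord_grad1 u w \<bullet> (x - a))"
    using chart_coords(1,2)[OF assms] by auto
next
  assume "0 \<le> coord_grad1 u w \<bullet> (x - a) \<and> coord_grad1 u w \<bullet> (x - a) \<le> 1 \<and>
      0 \<le> coord_grad2 u w \<bullet> (x - a) \<and> coord_grad2 u w \<bullet> (x - a) \<le> h (coord_grad1 u w \<bullet> (x - a))"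
  then show "x \<in> chart a u w ` {(s, t). 0 \<le> s \<and> s \<le> 1 \<and> 0 \<le> t \<and> t \<le> h s}"
    using chart_coords(3)[OF assms, of a x] by (metis (mono_tags, lifting) case_prodI image_eqI mem_Collect_eq)
qed

lemma compact_chart_region:
  assumes "continuous_on {0..1} h"
  shows "compact (chart_region a u w h)"
proof -
  obtain B where B: "\<And>s. s \<in> {0..1} \<Longrightarrow> \<bar>h s\<bar> \<le> B"
    using compact_imp_bounded[OF compact_continuous_image[OF assms compact_Icc]]
    unfolding bounded_iff by (metis imageI real_norm_def)
  have hB: "h s \<le> B" if "0 \<le> s" "s \<le> 1" for s
    using B[of s] that by auto
  have "{(s, t). 0 \<le> s \<and> s \<le> 1 \<and> 0 \<le> t \<and> t \<le> h s} = ({0..1} \<times> {0..B}) \<inter> (\<lambda>p. snd p - h (fst p)) -` {..0}"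
    by (auto intro: order_trans[OF _ hB])
  also have "compact \<dots>"
  proof -
    have "continuous_on ({0..1} \<times> {0..B}) (\<lambda>p. snd p - h (fst p))"
      by (intro continuous_on_diff continuous_on_snd continuous_on_id continuous_on_compose2[OF assms continuous_on_fst])
        auto
    then have "closed (({0..1} \<times> {0..B}) \<inter> (\<lambda>p. snd p - h (fst p)) -` {..0})"
      by (intro continuous_closed_preimage closed_Times closed_atMost) auto
    moreover have "bounded (({0..1} \<times> {0..B}) \<inter> (\<lambda>p. snd p - h (fst p)) -` {..0})"
      by (rule bounded_subset[OF bounded_Times[OF bounded_closed_interval bounded_closed_interval]]) auto
    ultimately show ?thesis by (simp add: compact_eq_bounded_closed)
  qed
  finally show ?thesis
    unfolding chart_region_def by (intro compact_continuous_image continuous_on_chart)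
qed

lemma lmeasurable_chart_region: "continuous_on {0..1} h \<Longrightarrow> chart_region a u w h \<in> lmeasurable"
  by (intro lmeasurable_compact compact_chart_region)

lemma lebesgue_on_borel:
  fixes f :: "'a::euclidean_space \<Rightarrow> real"
  assumes "R \<in> sets borel" "f \<in> borel_measurable borel"
  shows "(\<integral>x. f x \<partial>lebesgue_on R) = (\<integral>x. indicator R x * f x \<partial>lborel)"
    and "integrable (lebesgue_on R) f \<longleftrightarrow> integrable lborel (\<lambda>x. indicator R x * f x)"
proof -
  have [measurable]: "(\<lambda>x. indicator R x * f x) \<in> borel_measurable borel"
    using assms by measurable
  show "(\<integral>x. f x \<partial>lebesgue_on R) = (\<integral>x. indicator R x * f x \<partial>lborel)"
    using assms by (simp add: integral_restrict_space integral_completion)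
  show "integrable (lebesgue_on R) f \<longleftrightarrow> integrable lborel (\<lambda>x. indicator R x * f x)"
    using assms by (simp add: integrable_restrict_space integrable_completion)
qed

lemma integral_chart_region:
  fixes f :: "real^2 \<Rightarrow> real"
  assumes det: "det2 u w \<noteq> 0" and h: "continuous_on {0..1} h" and f: "continuous_on UNIV f"
  shows "integrable lborel (\<lambda>s. indicator {0..1} s * (\<integral>t. f (chart a u w (s, t)) * indicator {0..h s} t \<partial>lborel))" (is ?int)
    and "(\<integral>x. f x \<partial>lebesgue_on (chart_region a u w h)) =
      \<bar>det2 u w\<bar> * (\<integral>s. indicator {0..1} s * (\<integral>t. f (chart a u w (s, t)) * indicator {0..h s} t \<partial>lborel) \<partial>lborel)" (is ?eq)
proof -
  let ?R = "chart_region a u w h"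
  have R: "?R \<in> sets borel" using compact_chart_region[OF h] by (simp add: borel_compact)
  have fm [measurable]: "f \<in> borel_measurable borel" using f by (rule borel_measurable_continuous_onI)
  have g [measurable]: "(\<lambda>x. indicator ?R x * f x) \<in> borel_measurable borel" using R by measurable
  have "integrable (lebesgue_on ?R) f"
    by (intro L2_integrable L2_continuous lmeasurable_chart_region compact_imp_bounded compact_chart_region h f)
  then have i: "integrable lborel (\<lambda>x. indicator ?R x * f x)"
    using lebesgue_on_borel(2)[OF R fm] by simp
  then have i2: "integrable (lborel \<Otimes>\<^sub>M lborel) (\<lambda>p. indicator ?R (chart a u w p) * f (chart a u w p))"
    unfolding lborel_prod using integral_chart(1)[OF det g, of a] by simp
  have ind: "indicator ?R (chart a u w (s, t)) * f (chart a u w (s, t)) =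
      indicator {0..1} s * (f (chart a u w (s, t)) * indicator {0..h s} t)" for s t
    using mem_chart_region[OF det, of "chart a u w (s, t)" a h] by (auto simp: chart_coords[OF det] Let_def indicator_def)
  show ?int
    using lborel_pair.integrable_fst'[OF i2] by (simp add: ind)
  have "(\<integral>x. f x \<partial>lebesgue_on ?R) = \<bar>det2 u w\<bar> * (\<integral>p. indicator ?R (chart a u w p) * f (chart a u w p) \<partial>lborel)"
    using lebesgue_on_borel(1)[OF R fm] integral_chart(2)[OF det g, of a] by simp
  also have "(\<integral>p. indicator ?R (chart a u w p) * f (chart a u w p) \<partial>lborel) =
      (\<integral>s. \<integral>t. indicator ?R (chart a u w (s, t)) * f (chart a u w (s, t)) \<partial>lborel \<partial>lborel)"
    using lborel_pair.integral_fst'[OF i2] by (simp add: lborel_prod)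
  finally show ?eq by (simp add: ind)
qed

definition dir_deriv :: "real^2 \<Rightarrow> (real^2 \<Rightarrow> real) \<Rightarrow> real^2 \<Rightarrow> real"
  where "dir_deriv w f x = w $ 1 * partial 1 f x + w $ 2 * partial 2 f x"

lemma smooth_dir_deriv: "smooth f \<Longrightarrow> smooth (dir_deriv w f)"
  unfolding dir_deriv_def[abs_def] by (intro smooth_add smooth_cmult smooth_partial)

lemma chart_has_real_derivative:
  assumes "smooth f"
  shows "((\<lambda>t. f (chart a u w (s, t))) has_real_derivative dir_deriv w f (chart a u w (s, t))) (at t)"
proof -
  have "((\<lambda>t. chart a u w (s, t)) has_derivative (\<lambda>h. h *\<^sub>R w)) (at t)"
    unfolding chart_def by (auto intro!: derivative_eq_intros)
  from has_derivative_compose[OF this has_derivative_partial[OF smooth_differentiable[OF assms]]]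
  have "((\<lambda>t. f (chart a u w (s, t))) has_derivative
      (\<lambda>h. \<Sum>i\<in>UNIV. (h *\<^sub>R w) $ i * partial i f (chart a u w (s, t)))) (at t)" .
  moreover have "(\<lambda>h. \<Sum>i\<in>UNIV. (h *\<^sub>R w) $ i * partial i f (chart a u w (s, t))) = (*) (dir_deriv w f (chart a u w (s, t)))"
    by (simp add: fun_eq_iff dir_deriv_def sum_2 algebra_simps)
  ultimately show ?thesis
    by (simp add: has_field_derivative_def)
qed

lemma continuous_chart_snd:
  assumes "continuous_on UNIV f"
  shows "continuous_on S (\<lambda>t. f (chart a u w (s, t)))"
  by (rule continuous_on_compose2[OF assms continuous_on_compose2[OF continuous_on_chart]])
    (auto intro!: continuous_intros)

lemma integrable_indicator_Icc:
  fixes f :: "real \<Rightarrow> real"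
  assumes "continuous_on {a..b} f"
  shows "integrable lborel (\<lambda>t. f t * indicator {a..b} t)"
  using borel_integrable_atLeastAtMost'[OF assms] by (simp add: set_integrable_def mult.commute)

text \<open>The derivative of the square along a segment, multiplied by \<open>t - 2 \<epsilon>\<close> and integrated: the weight is
  negative, so the contribution of the far end has the good sign and is dropped.\<close>

lemma square_integral_near_end:
  fixes z z' :: "real \<Rightarrow> real"
  assumes z: "\<And>t. (z has_real_derivative z' t) (at t)" and z': "continuous_on UNIV z'"
    and \<delta>: "0 \<le> \<delta>" "\<delta> \<le> \<epsilon>"
  shows "(\<integral>t. (z t)\<^sup>2 * indicator {0..\<delta>} t \<partial>lborel)
    \<le> 4 * \<epsilon> * (z 0)\<^sup>2 + 16 * \<epsilon>\<^sup>2 * (\<integral>t. (z' t)\<^sup>2 * indicator {0..\<delta>} t \<partial>lborel)"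
proof -
  have zc: "continuous_on UNIV z"
    using z by (meson DERIV_continuous_on has_field_derivative_at_within)
  define G' where "G' t = (z t)\<^sup>2 + 2 * (t - 2 * \<epsilon>) * z t * z' t" for t
  have G'c: "continuous_on UNIV G'"
    unfolding G'_def by (intro continuous_intros zc z')
  have G: "((\<lambda>t. (t - 2 * \<epsilon>) * (z t)\<^sup>2) has_real_derivative G' t) (at t)" for t
    unfolding G'_def by (auto intro!: derivative_eq_intros z simp: algebra_simps)
  have FTC: "(\<integral>t. G' t * indicator {0..\<delta>} t \<partial>lborel) = (\<delta> - 2 * \<epsilon>) * (z \<delta>)\<^sup>2 - (0 - 2 * \<epsilon>) * (z 0)\<^sup>2"
    by (rule integral_FTC_Icc_real[OF \<delta>(1)]) (use G G'c in \<open>auto simp: continuous_on_eq_continuous_at\<close>)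
  also have "\<dots> \<le> 2 * \<epsilon> * (z 0)\<^sup>2"
    using \<delta> by (simp add: mult_nonpos_nonneg)
  finally have 1: "(\<integral>t. G' t * indicator {0..\<delta>} t \<partial>lborel) \<le> 2 * \<epsilon> * (z 0)\<^sup>2" .
  have iz: "integrable lborel (\<lambda>t. (z t)\<^sup>2 * indicator {0..\<delta>} t)"
    "integrable lborel (\<lambda>t. (z' t)\<^sup>2 * indicator {0..\<delta>} t)"
    "integrable lborel (\<lambda>t. G' t * indicator {0..\<delta>} t)"
    by (intro integrable_indicator_Icc continuous_intros; rule continuous_on_subset[OF _ subset_UNIV]; intro zc z' G'c)+
  have "(\<integral>t. 1/2 * ((z t)\<^sup>2 * indicator {0..\<delta>} t) - 8 * \<epsilon>\<^sup>2 * ((z' t)\<^sup>2 * indicator {0..\<delta>} t) \<partial>lborel)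
      \<le> (\<integral>t. G' t * indicator {0..\<delta>} t \<partial>lborel)"
  proof (rule integral_mono)
    fix t
    show "1/2 * ((z t)\<^sup>2 * indicator {0..\<delta>} t) - 8 * \<epsilon>\<^sup>2 * ((z' t)\<^sup>2 * indicator {0..\<delta>} t) \<le> G' t * indicator {0..\<delta>} t"
    proof (cases "t \<in> {0..\<delta>}")
      case True
      define c where "c = 2 * \<epsilon> - t"
      have "c\<^sup>2 \<le> (2 * \<epsilon>)\<^sup>2"
        unfolding c_def using True \<delta> by (intro power_mono) auto
      then have "c\<^sup>2 * (z' t)\<^sup>2 \<le> (4 * \<epsilon>\<^sup>2) * (z' t)\<^sup>2"
        by (intro mult_right_mono) (auto simp: power_mult_distrib)
      moreover have "(z t - 2 * c * z' t)\<^sup>2 = (z t)\<^sup>2 - 4 * (c * z t * z' t) + 4 * (c\<^sup>2 * (z' t)\<^sup>2)"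
        by (simp add: power2_eq_square algebra_simps)
      moreover have "0 \<le> (z t - 2 * c * z' t)\<^sup>2" by simp
      moreover have "G' t = (z t)\<^sup>2 - 2 * (c * z t * z' t)"
        by (simp add: G'_def c_def algebra_simps)
      ultimately show ?thesis using True by simp
    qed simp
  qed (use iz in auto)
  then have "1/2 * (\<integral>t. (z t)\<^sup>2 * indicator {0..\<delta>} t \<partial>lborel) - 8 * \<epsilon>\<^sup>2 * (\<integral>t. (z' t)\<^sup>2 * indicator {0..\<delta>} t \<partial>lborel)
      \<le> 2 * \<epsilon> * (z 0)\<^sup>2"
    using 1 iz by simp
  then show ?thesis by (simp add: algebra_simps)
qed

lemma integral_chart_region_dir_deriv:
  assumes det: "det2 u w \<noteq> 0" and h: "continuous_on {0..1} h" "\<And>s. s \<in> {0..1} \<Longrightarrow> 0 \<le> h s" and f: "smooth f"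
  shows "(\<integral>x. dir_deriv w f x \<partial>lebesgue_on (chart_region a u w h)) =
    \<bar>det2 u w\<bar> * (\<integral>s. indicator {0..1} s * (f (chart a u w (s, h s)) - f (chart a u w (s, 0))) \<partial>lborel)"
proof -
  have c: "continuous_on UNIV (dir_deriv w f)"
    by (intro smooth_continuous_on smooth_dir_deriv f)
  have "indicator {0..1} s * (\<integral>t. dir_deriv w f (chart a u w (s, t)) * indicator {0..h s} t \<partial>lborel) =
      indicator {0..1} s * (f (chart a u w (s, h s)) - f (chart a u w (s, 0)))" for s
  proof (cases "s \<in> {0..1}")
    case True
    have "(\<integral>t. dir_deriv w f (chart a u w (s, t)) * indicator {0..h s} t \<partial>lborel) =
        f (chart a u w (s, h s)) - f (chart a u w (s, 0))"
      by (rule integral_FTC_Icc_real[OF h(2)[OF True]])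
        (use chart_has_real_derivative[OF f] continuous_chart_snd[OF c, of UNIV] in \<open>auto simp: continuous_on_eq_continuous_at\<close>)
    then show ?thesis by simp
  qed simp
  then show ?thesis
    by (simp only: integral_chart_region(2)[OF det h(1) c])
qed

text \<open>The inequality for one variable on each of the segments that leave the side in direction \<open>w\<close>, integrated over the side. The
  derivative may be needed further inside than the function, hence two regions.\<close>

lemma chart_region_layer_estimate:
  assumes det: "det2 u w \<noteq> 0" and h: "continuous_on {0..1} h" "\<And>s. s \<in> {0..1} \<Longrightarrow> 0 \<le> h s" "\<And>s. s \<in> {0..1} \<Longrightarrow> h s \<le> \<epsilon>"
    and h2: "continuous_on {0..1} h2" "\<And>s. s \<in> {0..1} \<Longrightarrow> h s \<le> h2 s"
    and z: "smooth z"
  shows "(\<integral>x. (z x)\<^sup>2 \<partial>lebesgue_on (chart_region a u w h)) \<le>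
    4 * \<epsilon> * \<bar>det2 u w\<bar> * (\<integral>s. indicator {0..1} s * (z (chart a u w (s, 0)))\<^sup>2 \<partial>lborel)
    + 16 * \<epsilon>\<^sup>2 * (\<integral>x. (dir_deriv w z x)\<^sup>2 \<partial>lebesgue_on (chart_region a u w h2))"
proof -
  have zc: "continuous_on UNIV (\<lambda>x. (z x)\<^sup>2)" "continuous_on UNIV (\<lambda>x. (dir_deriv w z x)\<^sup>2)"
    by (intro continuous_intros smooth_continuous_on smooth_dir_deriv z)+
  define Z where "Z s = (\<integral>t. (z (chart a u w (s, t)))\<^sup>2 * indicator {0..h s} t \<partial>lborel)" for s
  define D where "D s = (\<integral>t. (dir_deriv w z (chart a u w (s, t)))\<^sup>2 * indicator {0..h2 s} t \<partial>lborel)" for s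
  have intZ: "integrable lborel (\<lambda>s. indicator {0..1} s * Z s)"
    and eqZ: "(\<integral>x. (z x)\<^sup>2 \<partial>lebesgue_on (chart_region a u w h)) = \<bar>det2 u w\<bar> * (\<integral>s. indicator {0..1} s * Z s \<partial>lborel)"
    using integral_chart_region[OF det h(1) zc(1), of a] by (simp_all add: Z_def)
  have intD: "integrable lborel (\<lambda>s. indicator {0..1} s * D s)"
    and eqD: "(\<integral>x. (dir_deriv w z x)\<^sup>2 \<partial>lebesgue_on (chart_region a u w h2)) = \<bar>det2 u w\<bar> * (\<integral>s. indicator {0..1} s * D s \<partial>lborel)"
    using integral_chart_region[OF det h2(1) zc(2), of a] by (simp_all add: D_def)
  have int0: "integrable lborel (\<lambda>s. indicator {0..1} s * (z (chart a u w (s, 0)))\<^sup>2)"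
  proof -
    have "continuous_on {0..1} (\<lambda>s. (z (chart a u w (s, 0)))\<^sup>2)"
      by (rule continuous_on_compose2[OF zc(1) continuous_on_compose2[OF continuous_on_chart]])
        (auto intro!: continuous_intros)
    from integrable_indicator_Icc[OF this] show ?thesis by (simp add: mult.commute)
  qed
  have "(\<integral>s. indicator {0..1} s * Z s \<partial>lborel) \<le>
      (\<integral>s. 4 * \<epsilon> * (indicator {0..1} s * (z (chart a u w (s, 0)))\<^sup>2) + 16 * \<epsilon>\<^sup>2 * (indicator {0..1} s * D s) \<partial>lborel)"
  proof (rule integral_mono)
    fix s
    show "indicator {0..1} s * Z s \<le>
        4 * \<epsilon> * (indicator {0..1} s * (z (chart a u w (s, 0)))\<^sup>2) + 16 * \<epsilon>\<^sup>2 * (indicator {0..1} s * D s)"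
    proof (cases "s \<in> {0..1}")
      case True
      have dc: "continuous_on S (\<lambda>t. dir_deriv w z (chart a u w (s, t)))" for S
        by (intro continuous_chart_snd smooth_continuous_on smooth_dir_deriv z)
      have "Z s \<le> 4 * \<epsilon> * (z (chart a u w (s, 0)))\<^sup>2 +
          16 * \<epsilon>\<^sup>2 * (\<integral>t. (dir_deriv w z (chart a u w (s, t)))\<^sup>2 * indicator {0..h s} t \<partial>lborel)"
        unfolding Z_def
        by (rule square_integral_near_end[of "\<lambda>t. z (chart a u w (s, t))" "\<lambda>t. dir_deriv w z (chart a u w (s, t))"])
          (use True h dc chart_has_real_derivative[OF z] in auto)
      also have "(\<integral>t. (dir_deriv w z (chart a u w (s, t)))\<^sup>2 * indicator {0..h s} t \<partial>lborel) \<le> D s"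
        unfolding D_def
        by (intro integral_mono integrable_indicator_Icc continuous_intros dc)
          (use h2(2)[OF True] in \<open>auto simp: indicator_def\<close>)
      finally show ?thesis using True by (simp add: mult_left_mono)
    qed simp
  qed (use intZ intD int0 in auto)
  also have "\<dots> = 4 * \<epsilon> * (\<integral>s. indicator {0..1} s * (z (chart a u w (s, 0)))\<^sup>2 \<partial>lborel)
      + 16 * \<epsilon>\<^sup>2 * (\<integral>s. indicator {0..1} s * D s \<partial>lborel)"
    using int0 intD by simp
  finally show ?thesis
    unfolding eqZ eqD using mult_left_mono[of _ _ "\<bar>det2 u w\<bar>"] by (fastforce simp: algebra_simps)
qed

definition triangle :: "real^2 \<Rightarrow> real^2 \<Rightarrow> real^2 \<Rightarrow> (real^2) set"
  where "triangle a u w = chart_region a u w (\<lambda>s. 1 - s)"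

lemma triangle_eq: "triangle a u w = chart a u w ` {(s, t). 0 \<le> s \<and> 0 \<le> t \<and> s + t \<le> 1}"
  unfolding triangle_def chart_region_def by (rule arg_cong[where f = "image _"]) auto

lemma triangle_commute: "triangle a u w = triangle a w u"
proof -
  have "triangle a u w \<subseteq> triangle a w u" for u w
  proof
    fix x assume "x \<in> triangle a u w"
    then obtain s t where "x = chart a u w (s, t)" "0 \<le> s" "0 \<le> t" "s + t \<le> 1"
      unfolding triangle_eq by auto
    then show "x \<in> triangle a w u"
      unfolding triangle_eq by (intro image_eqI[of _ _ "(t, s)"]) (auto simp: chart_def)
  qed
  then show ?thesis by blast
qed

lemma compact_triangle: "compact (triangle a u w)"
  unfolding triangle_def by (intro compact_chart_region continuous_intros)

lemma lmeasurable_triangle: "triangle a u w \<in> lmeasurable"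
  by (intro lmeasurable_compact compact_triangle)

lemma integrable_smooth:
  assumes "D \<in> lmeasurable" "bounded D" "smooth f"
  shows "integrable (lebesgue_on D) f"
  by (intro L2_integrable L2_continuous smooth_continuous_on assms)

abbreviation laplacian :: "(real^2 \<Rightarrow> real) \<Rightarrow> real^2 \<Rightarrow> real"
  where "laplacian f x \<equiv> \<Sum>i\<in>UNIV. partial i (partial i f) x"

text \<open>Because the gradient of \<open>\<psi>\<close> vanishes on two sides, the boundary term lives on a single side, the one along \<open>u\<close>. The outer normal
  there is a multiple of minus the gradient of the second coordinate.\<close>

lemma triangle_Green:
  assumes det: "det2 u w \<noteq> 0" and sm: "smooth \<phi>" "smooth \<psi>"
    and zero: "\<And>t i. t \<in> {0..1} \<Longrightarrow> partial i \<psi> (chart a u w (1 - t, t)) = 0"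
      "\<And>t i. t \<in> {0..1} \<Longrightarrow> partial i \<psi> (chart a u w (0, t)) = 0"
  shows "(\<integral>x. \<phi> x * laplacian \<psi> x + (\<Sum>i\<in>UNIV. partial i \<phi> x * partial i \<psi> x) \<partial>lebesgue_on (triangle a u w)) =
    - \<bar>det2 u w\<bar> * (\<integral>s. indicator {0..1} s * (\<phi> (chart a u w (s, 0)) * dir_deriv (coord_grad2 u w) \<psi> (chart a u w (s, 0))) \<partial>lborel)"
proof -
  let ?T = "triangle a u w"
  define f1 where "f1 x = \<phi> x * dir_deriv (coord_grad1 u w) \<psi> x" for x
  define f2 where "f2 x = \<phi> x * dir_deriv (coord_grad2 u w) \<psi> x" for x
  have f: "smooth f1" "smooth f2"
    unfolding f1_def[abs_def] f2_def[abs_def] by (intro smooth_mult smooth_dir_deriv sm)+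
  have chart_swap: "chart a w u (t, s) = chart a u w (s, t)" for s t
    by (simp add: chart_def)
  have T: "chart_region a w u (\<lambda>s. 1 - s) = ?T" "chart_region a u w (\<lambda>s. 1 - s) = ?T"
    using triangle_commute by (auto simp: triangle_def)
  have det': "det2 w u \<noteq> 0" using det by (simp add: det2_def mult.commute)
  have "(\<integral>x. dir_deriv u f1 x \<partial>lebesgue_on ?T) =
      \<bar>det2 w u\<bar> * (\<integral>t. indicator {0..1} t * (f1 (chart a u w (1 - t, t)) - f1 (chart a u w (0, t))) \<partial>lborel)"
    using integral_chart_region_dir_deriv[OF det' _ _ f(1), of "\<lambda>s. 1 - s" a]
    by (simp add: T chart_swap continuous_intros)
  also have "(\<lambda>t. indicator {0..1} t * (f1 (chart a u w (1 - t, t)) - f1 (chart a u w (0, t)))) = (\<lambda>t. 0)"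
    using zero by (auto simp: fun_eq_iff f1_def dir_deriv_def indicator_def)
  finally have I1: "(\<integral>x. dir_deriv u f1 x \<partial>lebesgue_on ?T) = 0" by simp
  have "(\<integral>x. dir_deriv w f2 x \<partial>lebesgue_on ?T) =
      \<bar>det2 u w\<bar> * (\<integral>s. indicator {0..1} s * (f2 (chart a u w (s, 1 - s)) - f2 (chart a u w (s, 0))) \<partial>lborel)"
    using integral_chart_region_dir_deriv[OF det _ _ f(2), of "\<lambda>s. 1 - s" a]
    by (simp add: T continuous_intros)
  also have "(\<lambda>s. indicator {0..1} s * (f2 (chart a u w (s, 1 - s)) - f2 (chart a u w (s, 0)))) =
      (\<lambda>s. - (indicator {0..1} s * f2 (chart a u w (s, 0))))"
  proof
    fix s
    show "indicator {0..1} s * (f2 (chart a u w (s, 1 - s)) - f2 (chart a u w (s, 0))) =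
        - (indicator {0..1} s * f2 (chart a u w (s, 0)))"
      using zero(1)[of "1 - s"] by (cases "s \<in> {0..1}") (auto simp: f2_def dir_deriv_def)
  qed
  finally have I2: "(\<integral>x. dir_deriv w f2 x \<partial>lebesgue_on ?T) =
      - \<bar>det2 u w\<bar> * (\<integral>s. indicator {0..1} s * f2 (chart a u w (s, 0)) \<partial>lborel)" by simp
  have expand: "\<phi> x * laplacian \<psi> x + (\<Sum>i\<in>UNIV. partial i \<phi> x * partial i \<psi> x) = dir_deriv u f1 x + dir_deriv w f2 x" for x
  proof -
    have dd: "partial i (dir_deriv v \<psi>) x = v $ 1 * partial i (partial 1 \<psi>) x + v $ 2 * partial i (partial 2 \<psi>) x" for i v
      unfolding dir_deriv_def[abs_def]
      by (subst partial_add) (auto simp: partial_cmult smooth_cmult smooth_partial sm smooth_differentiable)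
    have p: "partial i (\<lambda>x. \<phi> x * dir_deriv v \<psi> x) x =
        \<phi> x * partial i (dir_deriv v \<psi>) x + partial i \<phi> x * dir_deriv v \<psi> x" for i v
      by (intro partial_mult smooth_differentiable sm smooth_dir_deriv)
    have dual: "u $ 1 * coord_grad1 u w $ 1 + w $ 1 * coord_grad2 u w $ 1 = 1"
      "u $ 1 * coord_grad1 u w $ 2 + w $ 1 * coord_grad2 u w $ 2 = 0"
      "u $ 2 * coord_grad1 u w $ 1 + w $ 2 * coord_grad2 u w $ 1 = 0"
      "u $ 2 * coord_grad1 u w $ 2 + w $ 2 * coord_grad2 u w $ 2 = 1"
    proof -
      have "axis j 1 $ i = (coord_grad1 u w $ j) * u $ i + (coord_grad2 u w $ j) * w $ i" for i j :: 2
        using arg_cong[OF coord_expansion[OF det, of "axis j 1"], of "\<lambda>x. x $ i"] by (simp add: inner_axis)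
      from this[of 1 1] this[of 1 2] this[of 2 1] this[of 2 2] show
        "u $ 1 * coord_grad1 u w $ 1 + w $ 1 * coord_grad2 u w $ 1 = 1"
        "u $ 1 * coord_grad1 u w $ 2 + w $ 1 * coord_grad2 u w $ 2 = 0"
        "u $ 2 * coord_grad1 u w $ 1 + w $ 2 * coord_grad2 u w $ 1 = 0"
        "u $ 2 * coord_grad1 u w $ 2 + w $ 2 * coord_grad2 u w $ 2 = 1"
        by (simp_all add: axis_def mult.commute)
    qed
    have "dir_deriv u f1 x + dir_deriv w f2 x =
        (u $ 1 * coord_grad1 u w $ 1 + w $ 1 * coord_grad2 u w $ 1) * (\<phi> x * partial 1 (partial 1 \<psi>) x + partial 1 \<phi> x * partial 1 \<psi> x) +
        (u $ 1 * coord_grad1 u w $ 2 + w $ 1 * coord_grad2 u w $ 2) * (\<phi> x * partial 1 (partial 2 \<psi>) x + partial 1 \<phi> x * partial 2 \<psi> x) +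
        (u $ 2 * coord_grad1 u w $ 1 + w $ 2 * coord_grad2 u w $ 1) * (\<phi> x * partial 2 (partial 1 \<psi>) x + partial 2 \<phi> x * partial 1 \<psi> x) +
        (u $ 2 * coord_grad1 u w $ 2 + w $ 2 * coord_grad2 u w $ 2) * (\<phi> x * partial 2 (partial 2 \<psi>) x + partial 2 \<phi> x * partial 2 \<psi> x)"
      unfolding dir_deriv_def[of u] dir_deriv_def[of w] f1_def[abs_def] f2_def[abs_def] p dd
      by (simp add: dir_deriv_def algebra_simps)
    then show ?thesis unfolding dual by (simp add: sum_2 algebra_simps)
  qed
  have "integrable (lebesgue_on ?T) (dir_deriv u f1)" "integrable (lebesgue_on ?T) (dir_deriv w f2)"
    by (intro integrable_smooth lmeasurable_triangle compact_imp_bounded compact_triangle smooth_dir_deriv f)+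
  then show ?thesis
    unfolding expand using I1 I2 by (simp add: f2_def)
qed

lemma test_function_zero_outside:
  assumes "\<phi> \<in> test_functions K" "x \<notin> K"
  shows "\<phi> x = 0"
proof (rule ccontr)
  assume "\<phi> x \<noteq> 0"
  then have "x \<in> closure {x. \<phi> x \<noteq> 0}" using closure_subset[of "{x. \<phi> x \<noteq> 0}"] by blast
  then show False using assms unfolding test_functions_def by blast
qed

lemma integral_partial_test_function:
  assumes "bounded K" "\<phi> \<in> test_functions K" "K \<in> sets lebesgue"
  shows "(\<integral>x. partial i \<phi> x \<partial>lebesgue_on K) = 0"
proof -
  have \<phi>: "smooth \<phi>" using assms(2) by (simp add: test_functions_def)
  have supp: "\<phi> x = 0" if "x \<notin> K" for x
    using test_function_zero_outside[OF assms(2) that] .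
  have suppd: "partial i \<phi> x = 0" if "x \<notin> K" for x
    using test_function_zero_outside[OF partial_test_functions[OF assms(2)] that] .
  obtain R where R: "R > 0" "\<And>x. x \<in> K \<Longrightarrow> norm x < R"
    using assms(1) by (metis bounded_pos_less)
  have comp: "\<bar>x $ j\<bar> < R" if "x \<in> K" for x j
    using component_le_norm_cart[of x j] R(2)[OF that] by linarith
  define j :: 2 where "j = (if i = 1 then 2 else 1)"
  have j: "j \<noteq> i" "k = i \<or> k = j" for k
    using exhaust_2[of i] exhaust_2[of k] by (auto simp: j_def)
  define u w a where "u = (4 * R) *\<^sub>R axis j (1::real)" and "w = (4 * R) *\<^sub>R axis i (1::real)"
    and "a = (- R) *\<^sub>R (axis i 1 + axis j (1::real)) "
  have ch: "chart a u w (s, t) $ i = - R + 4 * R * t" "chart a u w (s, t) $ j = - R + 4 * R * s" for s t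
    using j(1) by (auto simp: chart_def u_def w_def a_def axis_def)
  have det: "det2 u w \<noteq> 0"
  proof -
    have "i = 1 \<and> j = 2 \<or> i = 2 \<and> j = 1" using j(1) exhaust_2[of i] exhaust_2[of j] by auto
    then show ?thesis using R(1) by (auto simp: det2_def u_def w_def axis_def)
  qed
  let ?T = "triangle a u w"
  have sub: "K \<subseteq> ?T"
  proof
    fix x assume x: "x \<in> K"
    define s t where "s = (x $ j + R) / (4 * R)" and "t = (x $ i + R) / (4 * R)"
    have "chart a u w (s, t) $ i = x $ i" "chart a u w (s, t) $ j = x $ j"
      using R(1) by (simp_all add: ch s_def t_def)
    then have "x $ k = chart a u w (s, t) $ k" for k
      using j(2)[of k] by auto
    then have eq: "x = chart a u w (s, t)"
      by (simp add: vec_eq_iff)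
    have "0 \<le> s" "0 \<le> t" "s + t \<le> 1"
      using comp[OF x, of i] comp[OF x, of j] R(1) by (auto simp: s_def t_def add_divide_distrib[symmetric] field_simps)
    then show "x \<in> ?T" unfolding triangle_eq eq by blast
  qed
  have out: "chart a u w (s, 1 - s) \<notin> K" "chart a u w (s, 0) \<notin> K" for s
  proof -
    show "chart a u w (s, 1 - s) \<notin> K"
    proof
      assume "chart a u w (s, 1 - s) \<in> K"
      from comp[OF this, of i] comp[OF this, of j] show False
        unfolding ch by (simp add: algebra_simps abs_less_iff)
    qed
    show "chart a u w (s, 0) \<notin> K"
      using comp[of "chart a u w (s, 0)" i] R(1) unfolding ch by auto
  qed
  have "(\<integral>x. dir_deriv w \<phi> x \<partial>lebesgue_on ?T) = 0"
    unfolding triangle_def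
    using integral_chart_region_dir_deriv[OF det _ _ \<phi>, of "\<lambda>s. 1 - s" a] supp out
    by (simp add: continuous_intros)
  moreover have "dir_deriv w \<phi> = (\<lambda>x. 4 * R * partial i \<phi> x)"
    using j(1) exhaust_2[of i] by (auto simp: fun_eq_iff dir_deriv_def w_def axis_def)
  ultimately have "(\<integral>x. partial i \<phi> x \<partial>lebesgue_on ?T) = 0"
    using R(1) by simp
  moreover have "(\<integral>x. partial i \<phi> x \<partial>lebesgue_on K) = (\<integral>x. indicator K x * partial i \<phi> x \<partial>lebesgue_on ?T)"
    by (rule lebesgue_on_integral_subset(1)[OF assms(3) _ sub]) (simp add: fmeasurableD lmeasurable_triangle)
  moreover have "(\<lambda>x. indicator K x * partial i \<phi> x) = partial i \<phi>"
  proof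
    show "indicator K x * partial i \<phi> x = partial i \<phi> x" for x
      using suppd[of x] by (cases "x \<in> K") auto
  qed
  ultimately show ?thesis by simp
qed

section \<open>Weak equations tested on triangles\<close>

text \<open>Two vector fields are tested below: the gradient of the solution and the field that proves the Poincare inequality.\<close>

definition has_weak_divergence :: "(real^2) set \<Rightarrow> (2 \<Rightarrow> real^2 \<Rightarrow> real) \<Rightarrow> (real^2 \<Rightarrow> real) \<Rightarrow> bool"
  where "has_weak_divergence K w p \<longleftrightarrow> (\<forall>i. w i \<in> L2 K) \<and> p \<in> L2 K \<and>
    (\<forall>\<zeta>\<in>test_functions K. (\<Sum>i\<in>UNIV. \<integral>x. w i x * partial i \<zeta> x \<partial>lebesgue_on K) = - (\<integral>x. p x * \<zeta> x \<partial>lebesgue_on K))"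

lemma test_function_smooth: "\<zeta> \<in> test_functions K \<Longrightarrow> smooth \<zeta>"
  by (simp add: test_functions_def)

lemma weak_laplacian_has_weak_divergence:
  assumes K: "K \<in> lmeasurable" "bounded K" and v: "v \<in> L2 K" and w: "\<And>i. w i \<in> L2 K" and p: "p \<in> L2 K"
    and grad: "weak_gradient K v w" and lap: "weak_laplacian K v p"
  shows "has_weak_divergence K w p"
  unfolding has_weak_divergence_def
proof (intro conjI allI ballI w p)
  fix \<zeta> assume \<zeta>: "\<zeta> \<in> test_functions K"
  have L2: "partial i (partial i \<zeta>) \<in> L2 K" for i
    by (intro L2_continuous K smooth_continuous_on smooth_partial test_function_smooth[OF \<zeta>])
  have "(\<Sum>i\<in>UNIV. \<integral>x. w i x * partial i \<zeta> x \<partial>lebesgue_on K) =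
      (\<Sum>i\<in>UNIV. - (\<integral>x. v x * partial i (partial i \<zeta>) x \<partial>lebesgue_on K))"
    using grad partial_test_functions[OF \<zeta>] unfolding weak_gradient_def by (intro sum.cong) auto
  also have "\<dots> = - (\<integral>x. v x * laplacian \<zeta> x \<partial>lebesgue_on K)"
    using L2_mult_integrable[OF v L2] by (simp add: sum_2 distrib_left)
  also have "\<dots> = - (\<integral>x. p x * \<zeta> x \<partial>lebesgue_on K)"
    using lap \<zeta> by (simp add: weak_laplacian_def)
  finally show "(\<Sum>i\<in>UNIV. \<integral>x. w i x * partial i \<zeta> x \<partial>lebesgue_on K) = - (\<integral>x. p x * \<zeta> x \<partial>lebesgue_on K)" .
qed

text \<open>The three barycentric coordinates of the triangle with corner \<open>a\<close> and sides \<open>u\<close>, \<open>w\<close>: the first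
  vanishes on the side opposite to \<open>a\<close>, the second on the side along \<open>w\<close> and the third on the side along \<open>u\<close>.\<close>

definition bary1 :: "real^2 \<Rightarrow> real^2 \<Rightarrow> real^2 \<Rightarrow> real^2 \<Rightarrow> real"
  where "bary1 a u w x = coord_grad1 u w \<bullet> (x - a)"

definition bary2 :: "real^2 \<Rightarrow> real^2 \<Rightarrow> real^2 \<Rightarrow> real^2 \<Rightarrow> real"
  where "bary2 a u w x = coord_grad2 u w \<bullet> (x - a)"

definition bary0 :: "real^2 \<Rightarrow> real^2 \<Rightarrow> real^2 \<Rightarrow> real^2 \<Rightarrow> real"
  where "bary0 a u w x = 1 - bary1 a u w x - bary2 a u w x"

lemma bary_affine:
  "bary1 a u w = (\<lambda>x. coord_grad1 u w \<bullet> x + (- (coord_grad1 u w \<bullet> a)))"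
  "bary2 a u w = (\<lambda>x. coord_grad2 u w \<bullet> x + (- (coord_grad2 u w \<bullet> a)))"
  "bary0 a u w = (\<lambda>x. (- coord_grad1 u w - coord_grad2 u w) \<bullet> x + (1 + (coord_grad1 u w + coord_grad2 u w) \<bullet> a))"
  by (auto simp: fun_eq_iff bary0_def bary1_def bary2_def inner_diff_right inner_diff_left inner_add_left)

lemma smooth_bary: "smooth (bary1 a u w)" "smooth (bary2 a u w)" "smooth (bary0 a u w)"
  unfolding bary_affine by (rule smooth_affine)+

lemma partial_bary:
  "partial i (bary1 a u w) x = coord_grad1 u w $ i" "partial i (bary2 a u w) x = coord_grad2 u w $ i"
  "partial i (bary0 a u w) x = - coord_grad1 u w $ i - coord_grad2 u w $ i"
  unfolding bary_affine partial_affine by simp_all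

lemma bary_chart:
  assumes "det2 u w \<noteq> 0"
  shows "bary1 a u w (chart a u w (s, t)) = s" "bary2 a u w (chart a u w (s, t)) = t"
    "bary0 a u w (chart a u w (s, t)) = 1 - s - t"
  by (simp_all add: bary0_def bary1_def bary2_def chart_coords[OF assms])

definition open_triangle :: "real^2 \<Rightarrow> real^2 \<Rightarrow> real^2 \<Rightarrow> (real^2) set"
  where "open_triangle a u w = {x. bary0 a u w x > 0 \<and> bary1 a u w x > 0 \<and> bary2 a u w x > 0}"

lemma mem_triangle:
  assumes "det2 u w \<noteq> 0"
  shows "x \<in> triangle a u w \<longleftrightarrow> bary0 a u w x \<ge> 0 \<and> bary1 a u w x \<ge> 0 \<and> bary2 a u w x \<ge> 0"
  using mem_chart_region[OF assms, of x a "\<lambda>s. 1 - s"]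
  by (auto simp: triangle_def bary0_def bary1_def bary2_def Let_def)

lemma continuous_bary: "continuous_on S (bary0 a u w)" "continuous_on S (bary1 a u w)" "continuous_on S (bary2 a u w)"
  by (intro smooth_continuous_on smooth_bary)+

lemma open_open_triangle: "open (open_triangle a u w)"
  unfolding open_triangle_def by (intro open_Collect_conj open_Collect_less continuous_bary continuous_on_const)

lemma open_triangle_subset: "det2 u w \<noteq> 0 \<Longrightarrow> open_triangle a u w \<subseteq> triangle a u w"
  by (auto simp: mem_triangle open_triangle_def)

lemma negligible_triangle_boundary:
  assumes "det2 u w \<noteq> 0"
  shows "negligible (triangle a u w - open_triangle a u w)"
proof -
  have ne: "coord_grad1 u w \<noteq> 0" "coord_grad2 u w \<noteq> 0" "coord_grad1 u w + coord_grad2 u w \<noteq> 0"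
    using coord_grad_dual[OF assms] inner_add_left[of "coord_grad1 u w" "coord_grad2 u w" u] by auto
  have "triangle a u w - open_triangle a u w \<subseteq>
      {x. coord_grad1 u w \<bullet> x = coord_grad1 u w \<bullet> a} \<union> {x. coord_grad2 u w \<bullet> x = coord_grad2 u w \<bullet> a}
      \<union> {x. (coord_grad1 u w + coord_grad2 u w) \<bullet> x = 1 + (coord_grad1 u w + coord_grad2 u w) \<bullet> a}"
    using assms by (auto simp: mem_triangle open_triangle_def bary0_def bary1_def bary2_def inner_diff_right inner_add_left)
  then show ?thesis
    using ne by (intro negligible_subset[OF _ \<open>_ \<subseteq> _\<close>] negligible_Un negligible_hyperplane) auto
qed

lemma integral_open_triangle:
  fixes f :: "real^2 \<Rightarrow> real"
  assumes "det2 u w \<noteq> 0" and f [measurable]: "f \<in> borel_measurable borel"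
  shows "(\<integral>x. f x \<partial>lebesgue_on (open_triangle a u w)) = (\<integral>x. f x \<partial>lebesgue_on (triangle a u w))"
proof -
  let ?O = "open_triangle a u w" and ?T = "triangle a u w"
  have [measurable]: "?O \<in> sets borel" "?T \<in> sets borel"
    using open_open_triangle compact_triangle by (auto simp: borel_compact)
  have "AE x in lebesgue. x \<notin> ?T - ?O"
    using negligible_triangle_boundary[OF assms(1)] by (intro AE_not_in) (simp add: negligible_iff_null_sets)
  then have "AE x in lebesgue. indicator ?O x *\<^sub>R f x = indicator ?T x *\<^sub>R f x"
    using open_triangle_subset[OF assms(1), of a] by (auto elim!: eventually_mono simp: indicator_def)
  then have "(\<integral>x. indicator ?O x *\<^sub>R f x \<partial>lebesgue) = (\<integral>x. indicator ?T x *\<^sub>R f x \<partial>lebesgue)"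
    by (intro integral_cong_AE) (auto intro: measurable_completion)
  then show ?thesis
    by (simp add: integral_restrict_space)
qed

text \<open>Truncation of a barycentric coordinate near zero. Its derivative stays bounded as \<open>\<epsilon>\<close> tends to 0 although
  the derivative of the step itself is of size \<open>1 / \<epsilon>\<close>: that one acts only where the coordinate is of size \<open>\<epsilon>\<close>.\<close>

definition trunc :: "real \<Rightarrow> real \<Rightarrow> real"
  where "trunc \<epsilon> s = s * smooth_step (s / \<epsilon>)"

definition trunc_deriv :: "real \<Rightarrow> real \<Rightarrow> real"
  where "trunc_deriv \<epsilon> s = smooth_step (s / \<epsilon>) + s / \<epsilon> * smooth_step_deriv (s / \<epsilon>)"

lemma has_real_derivative_trunc: "(trunc \<epsilon> has_real_derivative trunc_deriv \<epsilon> s) (at s)"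
proof -
  have "((\<lambda>s. smooth_step (s / \<epsilon>)) has_real_derivative smooth_step_deriv (s / \<epsilon>) * (1 / \<epsilon>)) (at s)"
    by (rule DERIV_chain2[OF has_real_derivative_smooth_step DERIV_cdivide[OF DERIV_ident]])
  then show ?thesis
    unfolding trunc_def[abs_def] trunc_deriv_def by (auto intro!: derivative_eq_intros)
qed

lemma trunc_bounds: "\<bar>trunc \<epsilon> s\<bar> \<le> \<bar>s\<bar>" "\<bar>trunc_deriv \<epsilon> s\<bar> \<le> 1 + 2 * step_slope"
proof -
  show "\<bar>trunc \<epsilon> s\<bar> \<le> \<bar>s\<bar>"
    using smooth_step_bounds[of "s / \<epsilon>"] by (simp add: trunc_def abs_mult mult_left_le)
  have "\<bar>r * smooth_step_deriv r\<bar> \<le> 2 * step_slope" for r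
  proof (cases "1 \<le> r \<and> r \<le> 2")
    case True
    then show ?thesis
      using smooth_step_deriv_bound[of r] by (auto simp: abs_mult intro!: mult_mono)
  next
    case False
    then show ?thesis
      using smooth_step_deriv_0[of r] smooth_step_deriv_1[of r] step_slope_pos by auto
  qed
  from this[of "s / \<epsilon>"] show "\<bar>trunc_deriv \<epsilon> s\<bar> \<le> 1 + 2 * step_slope"
    using smooth_step_bounds[of "s / \<epsilon>"] unfolding trunc_deriv_def by linarith
qed

lemma trunc_limits:
  assumes "\<And>n. \<epsilon> n > 0" "\<epsilon> \<longlonglongrightarrow> 0"
  shows "(\<lambda>n. trunc (\<epsilon> n) s) \<longlonglongrightarrow> (if s > 0 then s else 0)"
    and "(\<lambda>n. trunc_deriv (\<epsilon> n) s) \<longlonglongrightarrow> (if s > 0 then 1 else 0)"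
proof -
  have "\<forall>\<^sub>F n in sequentially. trunc (\<epsilon> n) s = (if s > 0 then s else 0) \<and> trunc_deriv (\<epsilon> n) s = (if s > 0 then 1 else 0)"
  proof (cases "s > 0")
    case True
    then have "\<forall>\<^sub>F n in sequentially. \<epsilon> n < s / 2"
      using assms(2) by (intro order_tendstoD) auto
    then show ?thesis
    proof eventually_elim
      case (elim n)
      then have "s / \<epsilon> n \<ge> 2" using assms(1)[of n] by (simp add: field_simps)
      then show ?case using True by (simp add: trunc_def trunc_deriv_def smooth_step_1 smooth_step_deriv_1)
    qed
  next
    case False
    then have "s / \<epsilon> n \<le> 1" for n
      using assms(1)[of n] by (simp add: divide_le_eq)
    then show ?thesis using False by (auto simp: trunc_def trunc_deriv_def smooth_step_0 smooth_step_deriv_0)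
  qed
  then show "(\<lambda>n. trunc (\<epsilon> n) s) \<longlonglongrightarrow> (if s > 0 then s else 0)"
    and "(\<lambda>n. trunc_deriv (\<epsilon> n) s) \<longlonglongrightarrow> (if s > 0 then 1 else 0)"
    by (intro tendsto_eventually; elim eventually_mono; blast)+
qed

lemma partial_bary_product:
  assumes "smooth R" and g: "\<And>s. (g has_real_derivative g' s) (at s)"
  shows "partial i (\<lambda>x. R x * (g (bary0 a u w x) * g (bary1 a u w x) * g (bary2 a u w x))) x =
    R x * (g' (bary0 a u w x) * (- coord_grad1 u w $ i - coord_grad2 u w $ i) * g (bary1 a u w x) * g (bary2 a u w x)
      + g (bary0 a u w x) * (g' (bary1 a u w x) * coord_grad1 u w $ i) * g (bary2 a u w x)
      + g (bary0 a u w x) * g (bary1 a u w x) * (g' (bary2 a u w x) * coord_grad2 u w $ i))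
    + partial i R x * (g (bary0 a u w x) * g (bary1 a u w x) * g (bary2 a u w x))"
proof -
  have d: "(\<lambda>x. g (bary0 a u w x)) differentiable (at x)" "(\<lambda>x. g (bary1 a u w x)) differentiable (at x)"
    "(\<lambda>x. g (bary2 a u w x)) differentiable (at x)"
    using has_derivative_compose_real[OF g smooth_differentiable[OF smooth_bary(1)]]
      has_derivative_compose_real[OF g smooth_differentiable[OF smooth_bary(2)]]
      has_derivative_compose_real[OF g smooth_differentiable[OF smooth_bary(3)]]
    unfolding differentiable_def by blast+
  show ?thesis
    by (simp add: partial_mult d differentiable_mult smooth_differentiable[OF assms(1)] partial_compose[OF g]
        smooth_differentiable smooth_bary partial_bary algebra_simps)
qed

lemma smooth_trunc:
  assumes "smooth f"
  shows "smooth (\<lambda>x. trunc \<epsilon> (f x))"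
  using smooth_mult[OF assms smooth_smooth_step[OF smooth_cmult[OF assms, of "1 / \<epsilon>"]]] by (simp add: trunc_def)

definition uniformly_bounded :: "(real^2) set \<Rightarrow> (nat \<Rightarrow> real^2 \<Rightarrow> real) \<Rightarrow> bool"
  where "uniformly_bounded K b \<longleftrightarrow> (\<exists>B. \<forall>n. \<forall>x\<in>K. \<bar>b n x\<bar> \<le> B)"

lemma uniformly_bounded_add:
  assumes "uniformly_bounded K b" "uniformly_bounded K c"
  shows "uniformly_bounded K (\<lambda>n x. b n x + c n x)"
proof -
  obtain B C where "\<forall>n. \<forall>x\<in>K. \<bar>b n x\<bar> \<le> B" "\<forall>n. \<forall>x\<in>K. \<bar>c n x\<bar> \<le> C"
    using assms unfolding uniformly_bounded_def by blast
  then have "\<bar>b n x + c n x\<bar> \<le> B + C" if "x \<in> K" for n x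
    using that by (intro order_trans[OF abs_triangle_ineq] add_mono) auto
  then show ?thesis unfolding uniformly_bounded_def by blast
qed

lemma uniformly_bounded_mult:
  assumes "uniformly_bounded K b" "uniformly_bounded K c"
  shows "uniformly_bounded K (\<lambda>n x. b n x * c n x)"
proof -
  obtain B C where BC: "\<forall>n. \<forall>x\<in>K. \<bar>b n x\<bar> \<le> B" "\<forall>n. \<forall>x\<in>K. \<bar>c n x\<bar> \<le> C"
    using assms unfolding uniformly_bounded_def by blast
  have "\<bar>b n x * c n x\<bar> \<le> B * C" if "x \<in> K" for n x
  proof -
    have "\<bar>b n x\<bar> \<le> B" "\<bar>c n x\<bar> \<le> C" using BC that by auto
    then show ?thesis unfolding abs_mult by (intro mult_mono) auto
  qed
  then show ?thesis unfolding uniformly_bounded_def by blast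
qed

lemma uniformly_bounded_fixed:
  assumes "bounded K" "continuous_on UNIV f"
  shows "uniformly_bounded K (\<lambda>n. f)"
proof -
  have "bounded (f ` closure K)"
    using assms by (intro compact_imp_bounded compact_continuous_image) (auto intro: continuous_on_subset)
  then obtain B where "\<forall>y\<in>f ` closure K. norm y \<le> B" unfolding bounded_iff by blast
  then have "\<forall>x\<in>K. \<bar>f x\<bar> \<le> B" using closure_subset[of K] by auto
  then show ?thesis unfolding uniformly_bounded_def by blast
qed

lemma uniformly_bounded_le:
  assumes "uniformly_bounded K c" "\<And>n x. x \<in> K \<Longrightarrow> \<bar>b n x\<bar> \<le> \<bar>c n x\<bar>"
  shows "uniformly_bounded K b"
proof -
  obtain B where B: "\<forall>n. \<forall>x\<in>K. \<bar>c n x\<bar> \<le> B" using assms(1) unfolding uniformly_bounded_def by blast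
  have "\<bar>b n x\<bar> \<le> B" if "x \<in> K" for n x
    using assms(2)[OF that, of n] B that by (meson order_trans)
  then show ?thesis unfolding uniformly_bounded_def by blast
qed

lemma integral_mult_pointwise_limit:
  assumes K: "K \<in> lmeasurable" and f: "f \<in> L2 K" and b: "\<And>n. continuous_on UNIV (b n)" "uniformly_bounded K b"
    and lim: "\<And>x. x \<in> K \<Longrightarrow> (\<lambda>n. b n x) \<longlonglongrightarrow> b' x"
  shows "(\<lambda>n. \<integral>x. f x * b n x \<partial>lebesgue_on K) \<longlonglongrightarrow> (\<integral>x. f x * b' x \<partial>lebesgue_on K)"
proof -
  obtain B where B: "\<And>n x. x \<in> K \<Longrightarrow> \<bar>b n x\<bar> \<le> B"
    using b(2) unfolding uniformly_bounded_def by blast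
  have bm: "b n \<in> borel_measurable (lebesgue_on K)" for n
    using K b(1) by (intro continuous_imp_measurable_on_sets_lebesgue) (auto intro: continuous_on_subset)
  have b'm: "b' \<in> borel_measurable (lebesgue_on K)"
    by (rule borel_measurable_LIMSEQ_real[OF _ bm]) (use lim in auto)
  have fm: "f \<in> borel_measurable (lebesgue_on K)" using f by (simp add: L2_def)
  show ?thesis
  proof (rule integral_dominated_convergence[where w = "\<lambda>x. B * \<bar>f x\<bar>"])
    show "integrable (lebesgue_on K) (\<lambda>x. B * \<bar>f x\<bar>)"
      using L2_integrable[OF f K] by auto
    show "AE x in lebesgue_on K. (\<lambda>n. f x * b n x) \<longlonglongrightarrow> f x * b' x"
      by (rule AE_I2) (use lim in \<open>auto intro: tendsto_mult_left\<close>)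
    show "AE x in lebesgue_on K. norm (f x * b n x) \<le> B * \<bar>f x\<bar>" for n
      by (rule AE_I2) (use mult_right_mono[OF B abs_ge_zero] in \<open>simp add: abs_mult mult.commute\<close>)
  qed (use fm bm b'm in auto)
qed

text \<open>A smooth function which vanishes on the boundary of a triangle may be used to test the equation: truncated barycentric
  coordinates turn it into a test function, and the truncation is removed by dominated convergence.\<close>

lemma weak_divergence_on_triangle:
  assumes K: "open K" "bounded K" and div: "has_weak_divergence K w p"
    and det: "det2 u v \<noteq> 0" and sub: "open_triangle a u v \<subseteq> K" and R: "smooth R"
    and \<psi>: "\<psi> = (\<lambda>x. R x * (bary0 a u v x * bary1 a u v x * bary2 a u v x))"
  shows "(\<Sum>i\<in>UNIV. \<integral>x. w i x * partial i \<psi> x \<partial>lebesgue_on (open_triangle a u v)) =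
    - (\<integral>x. p x * \<psi> x \<partial>lebesgue_on (open_triangle a u v))"
proof -
  let ?O = "open_triangle a u v"
  have Km: "K \<in> lmeasurable" using K by (rule lmeasurable_open[OF _, rotated])
  have w: "w i \<in> L2 K" and p: "p \<in> L2 K" for i using div by (auto simp: has_weak_divergence_def)
  define \<epsilon> where "\<epsilon> n = 1 / real (Suc n)" for n
  have \<epsilon>: "\<epsilon> n > 0" "\<epsilon> \<longlonglongrightarrow> 0" for n
    unfolding \<epsilon>_def[abs_def] using LIMSEQ_Suc[OF lim_1_over_n] by auto
  define F where "F n x = R x * (trunc (\<epsilon> n) (bary0 a u v x) * trunc (\<epsilon> n) (bary1 a u v x) * trunc (\<epsilon> n) (bary2 a u v x))" for n x
  have Fs: "smooth (F n)" for n
    unfolding F_def[abs_def] by (intro smooth_mult R smooth_trunc smooth_bary)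
  have pF: "partial i (F n) x =
    R x * (trunc_deriv (\<epsilon> n) (bary0 a u v x) * (- coord_grad1 u v $ i - coord_grad2 u v $ i) * trunc (\<epsilon> n) (bary1 a u v x) * trunc (\<epsilon> n) (bary2 a u v x)
      + trunc (\<epsilon> n) (bary0 a u v x) * (trunc_deriv (\<epsilon> n) (bary1 a u v x) * coord_grad1 u v $ i) * trunc (\<epsilon> n) (bary2 a u v x)
      + trunc (\<epsilon> n) (bary0 a u v x) * trunc (\<epsilon> n) (bary1 a u v x) * (trunc_deriv (\<epsilon> n) (bary2 a u v x) * coord_grad2 u v $ i))
    + partial i R x * (trunc (\<epsilon> n) (bary0 a u v x) * trunc (\<epsilon> n) (bary1 a u v x) * trunc (\<epsilon> n) (bary2 a u v x))" for i n x
    unfolding F_def[abs_def] by (rule partial_bary_product[OF R has_real_derivative_trunc])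
  have p\<psi>: "partial i \<psi> x =
    R x * (1 * (- coord_grad1 u v $ i - coord_grad2 u v $ i) * bary1 a u v x * bary2 a u v x
      + bary0 a u v x * (1 * coord_grad1 u v $ i) * bary2 a u v x
      + bary0 a u v x * bary1 a u v x * (1 * coord_grad2 u v $ i))
    + partial i R x * (bary0 a u v x * bary1 a u v x * bary2 a u v x)" for i x
    unfolding \<psi> by (rule partial_bary_product[OF R DERIV_ident])
  define U where "U n = {x. bary0 a u v x < \<epsilon> n} \<union> {x. bary1 a u v x < \<epsilon> n} \<union> {x. bary2 a u v x < \<epsilon> n}" for n
  have U: "open (U n)" "frontier K \<subseteq> U n" "\<And>x. x \<in> U n \<Longrightarrow> F n x = 0" for n
  proof -
    show "open (U n)"
      unfolding U_def by (intro open_Un open_Collect_less continuous_bary continuous_on_const)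
    show "frontier K \<subseteq> U n"
    proof
      fix x assume "x \<in> frontier K"
      then have "x \<notin> ?O" using sub K(1) by (auto simp: frontier_def interior_open)
      then show "x \<in> U n" using \<epsilon>(1)[of n] by (auto simp: U_def open_triangle_def)
    qed
    have "trunc (\<epsilon> n) s = 0" if "s < \<epsilon> n" for s
      using that \<epsilon>(1)[of n] by (simp add: trunc_def smooth_step_0)
    then show "F n x = 0" if "x \<in> U n" for x
      using that by (auto simp: U_def F_def)
  qed
  have eq: "(\<Sum>i\<in>UNIV. \<integral>x. w i x * partial i (F n) x \<partial>lebesgue_on K) = - (\<integral>x. p x * F n x \<partial>lebesgue_on K)" for n
  proof -
    let ?\<zeta> = "\<lambda>x. if x \<in> K then F n x else 0"
    have "(\<Sum>i\<in>UNIV. \<integral>x. w i x * partial i ?\<zeta> x \<partial>lebesgue_on K) = - (\<integral>x. p x * ?\<zeta> x \<partial>lebesgue_on K)"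
      using div smooth_restrict_test_function(1)[OF K Fs U] unfolding has_weak_divergence_def by blast
    moreover have "(\<integral>x. w i x * partial i ?\<zeta> x \<partial>lebesgue_on K) = (\<integral>x. w i x * partial i (F n) x \<partial>lebesgue_on K)" for i
      by (rule Bochner_Integration.integral_cong) (simp_all add: smooth_restrict_test_function(2)[OF K Fs U])
    moreover have "(\<integral>x. p x * ?\<zeta> x \<partial>lebesgue_on K) = (\<integral>x. p x * F n x \<partial>lebesgue_on K)"
      by (rule Bochner_Integration.integral_cong) simp_all
    ultimately show ?thesis by simp
  qed
  have tb: "uniformly_bounded K (\<lambda>n x. trunc (\<epsilon> n) (f x))" "uniformly_bounded K (\<lambda>n x. trunc_deriv (\<epsilon> n) (f x))"
    if "continuous_on UNIV f" for f
  proof -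
    show "uniformly_bounded K (\<lambda>n x. trunc (\<epsilon> n) (f x))"
      by (rule uniformly_bounded_le[OF uniformly_bounded_fixed[OF K(2) that]]) (rule trunc_bounds)
    show "uniformly_bounded K (\<lambda>n x. trunc_deriv (\<epsilon> n) (f x))"
      unfolding uniformly_bounded_def using trunc_bounds(2) by blast
  qed
  note bdd = uniformly_bounded_add uniformly_bounded_mult tb continuous_bary uniformly_bounded_fixed[OF K(2)]
    continuous_on_const smooth_continuous_on R smooth_partial
  have "(\<lambda>n. \<integral>x. w i x * partial i (F n) x \<partial>lebesgue_on K) \<longlonglongrightarrow> (\<integral>x. w i x * (indicator ?O x * partial i \<psi> x) \<partial>lebesgue_on K)" for i
  proof (rule integral_mult_pointwise_limit[OF Km w])
    show "continuous_on UNIV (partial i (F n))" for n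
      by (intro smooth_continuous_on smooth_partial Fs)
    show "uniformly_bounded K (\<lambda>n. partial i (F n))"
      unfolding pF[abs_def] by (intro bdd)
    fix x
    have "(\<lambda>n. partial i (F n) x) \<longlonglongrightarrow>
      R x * ((if bary0 a u v x > 0 then 1 else 0) * (- coord_grad1 u v $ i - coord_grad2 u v $ i) * (if bary1 a u v x > 0 then bary1 a u v x else 0) * (if bary2 a u v x > 0 then bary2 a u v x else 0)
      + (if bary0 a u v x > 0 then bary0 a u v x else 0) * ((if bary1 a u v x > 0 then 1 else 0) * coord_grad1 u v $ i) * (if bary2 a u v x > 0 then bary2 a u v x else 0)
      + (if bary0 a u v x > 0 then bary0 a u v x else 0) * (if bary1 a u v x > 0 then bary1 a u v x else 0) * ((if bary2 a u v x > 0 then 1 else 0) * coord_grad2 u v $ i))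
      + partial i R x * ((if bary0 a u v x > 0 then bary0 a u v x else 0) * (if bary1 a u v x > 0 then bary1 a u v x else 0) * (if bary2 a u v x > 0 then bary2 a u v x else 0))"
      (is "_ \<longlonglongrightarrow> ?l")
      unfolding pF by (intro tendsto_intros trunc_limits[OF \<epsilon>])
    moreover have "?l = indicator ?O x * partial i \<psi> x"
      unfolding p\<psi> by (simp add: indicator_def open_triangle_def)
    ultimately show "(\<lambda>n. partial i (F n) x) \<longlonglongrightarrow> indicator ?O x * partial i \<psi> x" by simp
  qed
  then have "(\<lambda>n. \<Sum>i\<in>UNIV. \<integral>x. w i x * partial i (F n) x \<partial>lebesgue_on K) \<longlonglongrightarrow>
      (\<Sum>i\<in>UNIV. \<integral>x. w i x * (indicator ?O x * partial i \<psi> x) \<partial>lebesgue_on K)"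
    by (intro tendsto_sum)
  moreover have "(\<lambda>n. \<integral>x. p x * F n x \<partial>lebesgue_on K) \<longlonglongrightarrow> (\<integral>x. p x * (indicator ?O x * \<psi> x) \<partial>lebesgue_on K)"
  proof (rule integral_mult_pointwise_limit[OF Km p])
    show "continuous_on UNIV (F n)" for n by (intro smooth_continuous_on Fs)
    show "uniformly_bounded K F"
      unfolding F_def[abs_def] by (intro bdd)
    fix x
    have "(\<lambda>n. F n x) \<longlonglongrightarrow>
      R x * ((if bary0 a u v x > 0 then bary0 a u v x else 0) * (if bary1 a u v x > 0 then bary1 a u v x else 0) * (if bary2 a u v x > 0 then bary2 a u v x else 0))"
      (is "_ \<longlonglongrightarrow> ?l")
      unfolding F_def by (intro tendsto_intros trunc_limits[OF \<epsilon>])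
    moreover have "?l = indicator ?O x * \<psi> x"
      unfolding \<psi> by (simp add: indicator_def open_triangle_def)
    ultimately show "(\<lambda>n. F n x) \<longlonglongrightarrow> indicator ?O x * \<psi> x" by simp
  qed
  then have "(\<lambda>n. \<Sum>i\<in>UNIV. \<integral>x. w i x * partial i (F n) x \<partial>lebesgue_on K) \<longlonglongrightarrow>
      - (\<integral>x. p x * (indicator ?O x * \<psi> x) \<partial>lebesgue_on K)"
    unfolding eq by (rule tendsto_minus)
  ultimately have "(\<Sum>i\<in>UNIV. \<integral>x. w i x * (indicator ?O x * partial i \<psi> x) \<partial>lebesgue_on K) =
      - (\<integral>x. p x * (indicator ?O x * \<psi> x) \<partial>lebesgue_on K)"
    by (rule LIMSEQ_unique)
  moreover have "(\<integral>x. f x * (indicator ?O x * g x) \<partial>lebesgue_on K) = (\<integral>x. f x * g x \<partial>lebesgue_on ?O)" for f g :: "real^2 \<Rightarrow> real"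
    using lebesgue_on_integral_subset(1)[OF _ fmeasurableD[OF Km] sub, of "\<lambda>x. f x * g x"] open_open_triangle[of a u v]
    by (simp add: mult.left_commute)
  ultimately show ?thesis by simp
qed

section \<open>Green's identity with traces\<close>

lemma L2_tendsto_subset:
  assumes "L2_tendsto D u f" "E \<in> sets lebesgue" "D \<in> sets lebesgue" "E \<subseteq> D"
  shows "L2_tendsto E u f"
proof -
  have in_L2: "f \<in> L2 D" "\<And>n. u n \<in> L2 D" using assms(1) by (auto simp: L2_tendsto_def)
  have "(\<lambda>n. L2_norm E (\<lambda>x. u n x - f x)) \<longlonglongrightarrow> 0"
  proof (rule tendsto_sandwich[OF _ _ tendsto_const])
    show "\<forall>\<^sub>F n in sequentially. L2_norm E (\<lambda>x. u n x - f x) \<le> L2_norm D (\<lambda>x. u n x - f x)"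
      using in_L2 by (intro always_eventually allI L2_subset(2) assms L2_diff)
    show "(\<lambda>n. L2_norm D (\<lambda>x. u n x - f x)) \<longlonglongrightarrow> 0" using assms(1) by (simp add: L2_tendsto_def)
  qed (simp add: L2_norm_nonneg)
  then show ?thesis
    using in_L2 L2_subset(1)[OF assms(2-4)] by (auto simp: L2_tendsto_def)
qed

lemma L2_continuous_unit: "continuous_on UNIV (f :: real \<Rightarrow> real) \<Longrightarrow> f \<in> L2 {0..1}"
  by (intro L2_continuous) auto

lemma linepath_chart: "linepath a b t = chart a (b - a) w (t, 0)"
  by (simp add: linepath_def chart_def algebra_simps)

lemma smooth_linepath_continuous: "smooth f \<Longrightarrow> continuous_on UNIV (\<lambda>t. f (linepath a b t))"
  by (rule continuous_on_compose2[OF smooth_continuous_on[of f UNIV]]) (auto intro: continuous_intros)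

lemma boundary_L2_tendsto_edge:
  assumes lim: "(\<lambda>n. boundary_integral ps (\<lambda>x. (\<phi> n x - g x)\<^sup>2)) \<longlonglongrightarrow> 0" and sm: "\<And>n. smooth (\<phi> n)"
    and i: "i < length ps" "vtx ps i \<noteq> vtx ps (Suc i)"
    and g: "(\<lambda>t. g (linepath (vtx ps i) (vtx ps (Suc i)) t)) \<in> L2 {0..1}"
  shows "L2_tendsto {0..1} (\<lambda>n t. \<phi> n (linepath (vtx ps i) (vtx ps (Suc i)) t)) (\<lambda>t. g (linepath (vtx ps i) (vtx ps (Suc i)) t))"
proof -
  let ?l = "linepath (vtx ps i) (vtx ps (Suc i))" and ?d = "dist (vtx ps i) (vtx ps (Suc i))"
  have d: "?d > 0" using i(2) by simp
  have le: "?d * (L2_norm {0..1} (\<lambda>t. \<phi> n (?l t) - g (?l t)))\<^sup>2 \<le> boundary_integral ps (\<lambda>x. (\<phi> n x - g x)\<^sup>2)" for n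
  proof -
    have "?d * (L2_norm {0..1} (\<lambda>t. \<phi> n (?l t) - g (?l t)))\<^sup>2 = edge_integral (vtx ps i) (vtx ps (Suc i)) (\<lambda>x. (\<phi> n x - g x)\<^sup>2)"
      by (simp add: edge_integral_def L2_norm_power2)
    also have "\<dots> \<le> boundary_integral ps (\<lambda>x. (\<phi> n x - g x)\<^sup>2)"
      unfolding boundary_integral_def using i(1)
      by (intro member_le_sum) (auto simp: edge_integral_def)
    finally show ?thesis .
  qed
  have "(\<lambda>n. (L2_norm {0..1} (\<lambda>t. \<phi> n (?l t) - g (?l t)))\<^sup>2) \<longlonglongrightarrow> 0"
  proof (rule tendsto_sandwich[OF _ _ tendsto_const])
    show "(\<lambda>n. boundary_integral ps (\<lambda>x. (\<phi> n x - g x)\<^sup>2) / ?d) \<longlonglongrightarrow> 0"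
      using tendsto_divide[OF lim tendsto_const, of ?d] d by simp
    show "\<forall>\<^sub>F n in sequentially. (L2_norm {0..1} (\<lambda>t. \<phi> n (?l t) - g (?l t)))\<^sup>2 \<le> boundary_integral ps (\<lambda>x. (\<phi> n x - g x)\<^sup>2) / ?d"
      using le d by (simp add: pos_le_divide_eq mult.commute)
  qed simp
  then have "(\<lambda>n. sqrt ((L2_norm {0..1} (\<lambda>t. \<phi> n (?l t) - g (?l t)))\<^sup>2)) \<longlonglongrightarrow> sqrt 0"
    by (rule tendsto_real_sqrt)
  then show ?thesis
    using g by (simp add: L2_tendsto_def L2_norm_nonneg L2_continuous_unit smooth_linepath_continuous sm)
qed

lemma smooth_poly: "smooth f \<Longrightarrow> smooth (\<lambda>x. poly q (f x))"
  unfolding poly_altdef by (intro smooth_sum smooth_cmult smooth_power)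

definition edge_factor :: "real^2 \<Rightarrow> real^2 \<Rightarrow> real^2 \<Rightarrow> real poly \<Rightarrow> real^2 \<Rightarrow> real"
  where "edge_factor a u w q x = bary0 a u w x * bary1 a u w x * poly q (bary1 a u w x)"

text \<open>It vanishes to second order on two sides of the triangle and to first order on the side along \<open>u\<close>, where
  its normal derivative is a weight times \<open>q\<close>.\<close>

definition edge_bubble :: "real^2 \<Rightarrow> real^2 \<Rightarrow> real^2 \<Rightarrow> real poly \<Rightarrow> real^2 \<Rightarrow> real"
  where "edge_bubble a u w q = (\<lambda>x. edge_factor a u w q x * (bary0 a u w x * bary1 a u w x * bary2 a u w x))"

lemma smooth_edge_factor: "smooth (edge_factor a u w q)"
  unfolding edge_factor_def[abs_def] by (intro smooth_mult smooth_poly smooth_bary)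

lemma smooth_edge_bubble: "smooth (edge_bubble a u w q)"
  unfolding edge_bubble_def by (intro smooth_mult smooth_edge_factor smooth_bary)

lemma partial_edge_bubble:
  "partial i (edge_bubble a u w q) x =
    edge_factor a u w q x * ((- coord_grad1 u w $ i - coord_grad2 u w $ i) * bary1 a u w x * bary2 a u w x
      + bary0 a u w x * coord_grad1 u w $ i * bary2 a u w x + bary0 a u w x * bary1 a u w x * coord_grad2 u w $ i)
    + partial i (edge_factor a u w q) x * (bary0 a u w x * bary1 a u w x * bary2 a u w x)"
  unfolding edge_bubble_def
  using partial_bary_product[OF smooth_edge_factor DERIV_ident, of i a u w q a u w x] by simp

text \<open>The smooth functions that define the trace satisfy the classical identity on the triangle. In the limit their gradient
  becomes the weak gradient, and the bubble, admissible as a test function on the triangle, replaces that by the source.\<close>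

lemma trace_Green_identity:
  assumes K: "open K" "bounded K" and v: "v \<in> L2 K" and p: "p \<in> L2 K"
    and tr: "has_trace K ps v g" and lap: "weak_laplacian K v p"
    and i: "i < length ps" "vtx ps i \<noteq> vtx ps (Suc i)"
    and au: "a = vtx ps i" "u = vtx ps (Suc i) - vtx ps i"
    and det: "det2 u w \<noteq> 0" and sub: "open_triangle a u w \<subseteq> K"
  shows "\<bar>det2 u w\<bar> * (coord_grad2 u w \<bullet> coord_grad2 u w) *
      (\<integral>s. g (linepath (vtx ps i) (vtx ps (Suc i)) s) * ((s * (1 - s))\<^sup>2 * poly q s) \<partial>lebesgue_on {0..1})
    = (\<integral>x. p x * edge_bubble a u w q x \<partial>lebesgue_on (open_triangle a u w))
      - (\<integral>x. v x * laplacian (edge_bubble a u w q) x \<partial>lebesgue_on (open_triangle a u w))"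
proof -
  let ?O = "open_triangle a u w" and ?T = "triangle a u w" and ?\<psi> = "edge_bubble a u w q"
    and ?l = "linepath (vtx ps i) (vtx ps (Suc i))"
  have Km: "K \<in> lmeasurable" using K by (rule lmeasurable_open[OF _, rotated])
  have O: "?O \<in> lmeasurable" "bounded ?O"
    using open_open_triangle sub K(2) bounded_subset lmeasurable_open by blast+
  obtain y \<phi> where y: "\<And>i. y i \<in> L2 K" "weak_gradient K v y" and sm: "\<And>n. smooth (\<phi> n)"
    and lim: "(\<lambda>n. L2_norm K (\<lambda>x. \<phi> n x - v x)) \<longlonglongrightarrow> 0"
      "\<And>i. (\<lambda>n. L2_norm K (\<lambda>x. partial i (\<phi> n) x - y i x)) \<longlonglongrightarrow> 0"
      "(\<lambda>n. boundary_integral ps (\<lambda>x. (\<phi> n x - g x)\<^sup>2)) \<longlonglongrightarrow> 0"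
    using tr unfolding has_trace_def by blast
  have L2K: "f \<in> L2 K" if "smooth f" for f by (intro L2_continuous Km K smooth_continuous_on that)
  have L2O: "f \<in> L2 ?O" if "smooth f" for f by (intro L2_continuous O smooth_continuous_on that)
  have tO: "L2_tendsto ?O \<phi> v" "L2_tendsto ?O (\<lambda>n. partial j (\<phi> n)) (y j)" for j
    by (rule L2_tendsto_subset[OF _ fmeasurableD[OF O(1)] fmeasurableD[OF Km] sub],
        simp add: L2_tendsto_def v y L2K sm smooth_partial lim)+
  have div: "has_weak_divergence K y p"
    by (rule weak_laplacian_has_weak_divergence[OF Km K(2) v y(1) p y(2) lap])
  have lap_sm: "smooth (laplacian ?\<psi>)"
    by (intro smooth_sum smooth_partial smooth_edge_bubble)
  have green: "(\<integral>x. \<phi> n x * laplacian ?\<psi> x \<partial>lebesgue_on ?O) + (\<Sum>j\<in>UNIV. \<integral>x. partial j (\<phi> n) x * partial j ?\<psi> x \<partial>lebesgue_on ?O)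
      = - \<bar>det2 u w\<bar> * (coord_grad2 u w \<bullet> coord_grad2 u w) * (\<integral>s. \<phi> n (?l s) * ((s * (1 - s))\<^sup>2 * poly q s) \<partial>lebesgue_on {0..1})" for n
  proof -
    have l: "?l s = chart a u w (s, 0)" for s
      by (simp add: linepath_chart[of _ _ _ w] au)
    have side: "partial j ?\<psi> (chart a u w (s, 0)) = (s * (1 - s))\<^sup>2 * poly q s * coord_grad2 u w $ j" for j s
      by (simp add: partial_edge_bubble bary_chart[OF det] edge_factor_def power2_eq_square)
    have "(\<integral>x. \<phi> n x * laplacian ?\<psi> x + (\<Sum>j\<in>UNIV. partial j (\<phi> n) x * partial j ?\<psi> x) \<partial>lebesgue_on ?T) =
        - \<bar>det2 u w\<bar> * (\<integral>s. indicator {0..1} s * (\<phi> n (chart a u w (s, 0)) * dir_deriv (coord_grad2 u w) ?\<psi> (chart a u w (s, 0))) \<partial>lborel)"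
      by (rule triangle_Green[OF det sm smooth_edge_bubble])
        (simp_all add: partial_edge_bubble bary_chart[OF det] edge_factor_def)
    also have "(\<lambda>s. indicator {0..1} s * (\<phi> n (chart a u w (s, 0)) * dir_deriv (coord_grad2 u w) ?\<psi> (chart a u w (s, 0)))) =
        (\<lambda>s. (coord_grad2 u w \<bullet> coord_grad2 u w) * (indicator {0..1} s * (\<phi> n (?l s) * ((s * (1 - s))\<^sup>2 * poly q s))))"
      by (simp add: fun_eq_iff dir_deriv_def side inner_2 l algebra_simps)
    also have "(\<integral>s. (coord_grad2 u w \<bullet> coord_grad2 u w) * (indicator {0..1} s * (\<phi> n (?l s) * ((s * (1 - s))\<^sup>2 * poly q s))) \<partial>lborel)
        = (coord_grad2 u w \<bullet> coord_grad2 u w) * (\<integral>s. \<phi> n (?l s) * ((s * (1 - s))\<^sup>2 * poly q s) \<partial>lebesgue_on {0..1})"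
    proof -
      have "continuous_on UNIV (\<lambda>s. \<phi> n (?l s) * ((s * (1 - s))\<^sup>2 * poly q s))"
        by (intro continuous_intros smooth_linepath_continuous sm)
      then show ?thesis
        using lebesgue_on_borel(1)[of "{0..1}" "\<lambda>s. \<phi> n (?l s) * ((s * (1 - s))\<^sup>2 * poly q s)"]
        by (simp add: borel_measurable_continuous_onI)
    qed
    finally have 1: "(\<integral>x. \<phi> n x * laplacian ?\<psi> x + (\<Sum>j\<in>UNIV. partial j (\<phi> n) x * partial j ?\<psi> x) \<partial>lebesgue_on ?T) =
      - \<bar>det2 u w\<bar> * (coord_grad2 u w \<bullet> coord_grad2 u w) * (\<integral>s. \<phi> n (?l s) * ((s * (1 - s))\<^sup>2 * poly q s) \<partial>lebesgue_on {0..1})"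
      by simp
    have "smooth (\<lambda>x. \<phi> n x * laplacian ?\<psi> x + (\<Sum>j\<in>UNIV. partial j (\<phi> n) x * partial j ?\<psi> x))"
      by (intro smooth_add smooth_mult lap_sm sm smooth_sum smooth_partial smooth_edge_bubble)
    then have "(\<integral>x. \<phi> n x * laplacian ?\<psi> x + (\<Sum>j\<in>UNIV. partial j (\<phi> n) x * partial j ?\<psi> x) \<partial>lebesgue_on ?T) =
        (\<integral>x. \<phi> n x * laplacian ?\<psi> x + (\<Sum>j\<in>UNIV. partial j (\<phi> n) x * partial j ?\<psi> x) \<partial>lebesgue_on ?O)"
      by (intro integral_open_triangle[OF det, symmetric] borel_measurable_continuous_onI smooth_continuous_on)
    also have "\<dots> = (\<integral>x. \<phi> n x * laplacian ?\<psi> x \<partial>lebesgue_on ?O) + (\<integral>x. (\<Sum>j\<in>UNIV. partial j (\<phi> n) x * partial j ?\<psi> x) \<partial>lebesgue_on ?O)"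
      by (intro Bochner_Integration.integral_add integrable_smooth O smooth_mult lap_sm sm smooth_sum smooth_partial smooth_edge_bubble)
    also have "(\<integral>x. (\<Sum>j\<in>UNIV. partial j (\<phi> n) x * partial j ?\<psi> x) \<partial>lebesgue_on ?O) = (\<Sum>j\<in>UNIV. \<integral>x. partial j (\<phi> n) x * partial j ?\<psi> x \<partial>lebesgue_on ?O)"
      by (intro Bochner_Integration.integral_sum integrable_smooth O smooth_mult sm smooth_partial smooth_edge_bubble)
    finally show ?thesis using 1 by simp
  qed
  have "(\<lambda>n. (\<integral>x. \<phi> n x * laplacian ?\<psi> x \<partial>lebesgue_on ?O) + (\<Sum>j\<in>UNIV. \<integral>x. partial j (\<phi> n) x * partial j ?\<psi> x \<partial>lebesgue_on ?O))
      \<longlonglongrightarrow> (\<integral>x. v x * laplacian ?\<psi> x \<partial>lebesgue_on ?O) + (\<Sum>j\<in>UNIV. \<integral>x. y j x * partial j ?\<psi> x \<partial>lebesgue_on ?O)"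
    by (intro tendsto_add tendsto_sum L2_tendsto_integral_mult tO L2_tendsto_const L2O lap_sm smooth_partial smooth_edge_bubble)
  moreover have "(\<lambda>n. - \<bar>det2 u w\<bar> * (coord_grad2 u w \<bullet> coord_grad2 u w) * (\<integral>s. \<phi> n (?l s) * ((s * (1 - s))\<^sup>2 * poly q s) \<partial>lebesgue_on {0..1}))
      \<longlonglongrightarrow> - \<bar>det2 u w\<bar> * (coord_grad2 u w \<bullet> coord_grad2 u w) * (\<integral>s. g (?l s) * ((s * (1 - s))\<^sup>2 * poly q s) \<partial>lebesgue_on {0..1})"
  proof (intro tendsto_mult tendsto_const L2_tendsto_integral_mult L2_tendsto_const)
    show "L2_tendsto {0..1} (\<lambda>n s. \<phi> n (?l s)) (\<lambda>s. g (?l s))"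
      using tr i(1) by (intro boundary_L2_tendsto_edge lim sm i) (simp add: has_trace_def)
    show "(\<lambda>s. (s * (1 - s))\<^sup>2 * poly q s) \<in> L2 {0..1}"
      by (intro L2_continuous_unit continuous_intros)
  qed
  ultimately have "(\<integral>x. v x * laplacian ?\<psi> x \<partial>lebesgue_on ?O) + (\<Sum>j\<in>UNIV. \<integral>x. y j x * partial j ?\<psi> x \<partial>lebesgue_on ?O) =
    - \<bar>det2 u w\<bar> * (coord_grad2 u w \<bullet> coord_grad2 u w) * (\<integral>s. g (?l s) * ((s * (1 - s))\<^sup>2 * poly q s) \<partial>lebesgue_on {0..1})"
    unfolding green by (rule LIMSEQ_unique)
  moreover have "(\<Sum>j\<in>UNIV. \<integral>x. y j x * partial j ?\<psi> x \<partial>lebesgue_on ?O) = - (\<integral>x. p x * ?\<psi> x \<partial>lebesgue_on ?O)"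
    by (rule weak_divergence_on_triangle[OF K div det sub smooth_edge_factor edge_bubble_def])
  ultimately show ?thesis by simp
qed

text \<open>The right-hand side of Green's identity does not mention the trace, so two traces have the same weighted moments
  against all polynomials; by Weierstrass approximation they agree.\<close>

lemma continuous_trace_unique:
  assumes K: "open K" "bounded K" and v: "v \<in> L2 K" and p: "p \<in> L2 K"
    and tr: "has_trace K ps v g" "has_trace K ps v g'" and lap: "weak_laplacian K v p"
    and i: "i < length ps" "vtx ps i \<noteq> vtx ps (Suc i)"
    and cont: "continuous_on (polygon_edge ps i) g" "continuous_on (polygon_edge ps i) g'"
    and det: "det2 (vtx ps (Suc i) - vtx ps i) w \<noteq> 0" and sub: "open_triangle (vtx ps i) (vtx ps (Suc i) - vtx ps i) w \<subseteq> K"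
    and x: "x \<in> polygon_edge ps i"
  shows "g x = g' x"
proof -
  let ?l = "linepath (vtx ps i) (vtx ps (Suc i))" and ?u = "vtx ps (Suc i) - vtx ps i"
  define d where "d s = g (?l s) - g' (?l s)" for s
  define W where "W s = (s * (1 - s))\<^sup>2" for s :: real
  have lc: "continuous_on {0..1} (\<lambda>s. g (?l s))" "continuous_on {0..1} (\<lambda>s. g' (?l s))"
    using cont by (auto intro!: continuous_on_compose2[of "polygon_edge ps i" _ "{0..1}" ?l] continuous_intros
        simp: polygon_edge_def linepath_image_01[symmetric])
  have dc: "continuous_on {0..1} d" unfolding d_def[abs_def] by (intro continuous_intros lc)
  have int: "f integrable_on {0..1}" "(\<integral>s. f s \<partial>lebesgue_on {0..1}) = integral {0..1} f"
    if "continuous_on {0..1} f" for f :: "real \<Rightarrow> real"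
    using that by (auto simp: integrable_continuous_real lebesgue_integral_eq_integral
        absolutely_integrable_continuous_real absolutely_integrable_imp_integrable)
  have ne: "coord_grad2 ?u w \<bullet> coord_grad2 ?u w \<noteq> 0"
    using coord_grad_dual(4)[OF det] by auto
  have mom: "integral {0..1} (\<lambda>s. W s * d s * poly q s) = 0" for q
  proof -
    have "(\<integral>s. g (?l s) * (W s * poly q s) \<partial>lebesgue_on {0..1}) = (\<integral>s. g' (?l s) * (W s * poly q s) \<partial>lebesgue_on {0..1})"
    proof -
      have "\<bar>det2 ?u w\<bar> * (coord_grad2 ?u w \<bullet> coord_grad2 ?u w) * (\<integral>s. g (?l s) * (W s * poly q s) \<partial>lebesgue_on {0..1})
          = \<bar>det2 ?u w\<bar> * (coord_grad2 ?u w \<bullet> coord_grad2 ?u w) * (\<integral>s. g' (?l s) * (W s * poly q s) \<partial>lebesgue_on {0..1})"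
        unfolding W_def trace_Green_identity[OF K v p tr(1) lap i refl refl det sub, of q]
          trace_Green_identity[OF K v p tr(2) lap i refl refl det sub, of q] ..
      moreover have "\<bar>det2 ?u w\<bar> * (coord_grad2 ?u w \<bullet> coord_grad2 ?u w) \<noteq> 0" using ne det by simp
      ultimately show ?thesis using mult_left_cancel by blast
    qed
    moreover have c: "continuous_on {0..1} (\<lambda>s. g (?l s) * (W s * poly q s))" "continuous_on {0..1} (\<lambda>s. g' (?l s) * (W s * poly q s))"
      unfolding W_def by (intro continuous_intros lc)+
    ultimately have "integral {0..1} (\<lambda>s. g (?l s) * (W s * poly q s)) - integral {0..1} (\<lambda>s. g' (?l s) * (W s * poly q s)) = 0"
      using int(2) by simp
    then show ?thesis
      using Henstock_Kurzweil_Integration.integral_diff[OF int(1)[OF c(1)] int(1)[OF c(2)]] by (simp add: d_def algebra_simps)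
  qed
  define f where "f s = W s * d s" for s
  have fc: "continuous_on {0..1} f" unfolding f_def[abs_def] W_def by (intro continuous_intros dc)
  obtain B where B: "\<And>s. s \<in> {0..1} \<Longrightarrow> \<bar>f s\<bar> \<le> B" "B > 0"
  proof -
    obtain B where "B > 0" "\<forall>y\<in>f ` {0..1}. norm y \<le> B"
      using compact_imp_bounded[OF compact_continuous_image[OF fc compact_Icc]] unfolding bounded_pos by blast
    then show ?thesis by (intro that[of B]) auto
  qed
  have small: "integral {0..1} (\<lambda>s. f s * d s) \<le> B * e" if e: "e > 0" for e
  proof -
    obtain P where P: "real_polynomial_function P" "\<And>s. s \<in> {0..1} \<Longrightarrow> \<bar>d s - P s\<bar> < e"
      using Stone_Weierstrass_real_polynomial_function[OF compact_Icc dc e] by blast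
    obtain q where q: "P = poly q"
    proof -
      obtain a n where "P = (\<lambda>x. \<Sum>i\<le>n. a i * x ^ i)"
        using P(1) by (auto simp: real_polynomial_function_iff_sum)
      then have "P = poly (\<Sum>i\<le>n. monom (a i) i)"
        by (auto simp: fun_eq_iff poly_sum poly_monom)
      then show ?thesis using that by blast
    qed
    have "integral {0..1} (\<lambda>s. f s * d s) = integral {0..1} (\<lambda>s. f s * d s) - integral {0..1} (\<lambda>s. W s * d s * poly q s)"
      by (simp add: mom)
    also have "\<dots> = integral {0..1} (\<lambda>s. f s * (d s - poly q s))"
      by (subst Henstock_Kurzweil_Integration.integral_diff[symmetric])
        (auto simp: f_def W_def algebra_simps intro!: integrable_continuous_real continuous_intros dc)
    also have "\<dots> \<le> integral {0..1} (\<lambda>s::real. B * e)"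
    proof (rule Henstock_Kurzweil_Integration.integral_le)
      show "(\<lambda>s. f s * (d s - poly q s)) integrable_on {0..1}"
        by (intro integrable_continuous_real continuous_intros fc dc)
      show "f s * (d s - poly q s) \<le> B * e" if "s \<in> {0..1}" for s
      proof -
        have "\<bar>f s * (d s - poly q s)\<bar> \<le> B * e"
          unfolding abs_mult using B(1)[OF that] P(2)[OF that] B(2) by (intro mult_mono) (auto simp: q)
        then show ?thesis by linarith
      qed
    qed auto
    finally show ?thesis by simp
  qed
  have "integral {0..1} (\<lambda>s. f s * d s) \<le> 0"
  proof (rule field_le_epsilon)
    fix e :: real assume "e > 0"
    then show "integral {0..1} (\<lambda>s. f s * d s) \<le> 0 + e"
      using small[of "e / B"] B(2) by simp
  qed
  moreover have fd: "f s * d s \<ge> 0" for s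
    by (simp add: f_def W_def mult.assoc power2_eq_square[symmetric])
  ultimately have "integral (cbox 0 1) (\<lambda>s. f s * d s) = 0"
    using integral_nonneg[OF int(1)[OF continuous_on_mult[OF fc dc]]] by (simp add: order_antisym)
  then have "\<forall>s\<in>cbox 0 1. f s * d s = 0"
    using integral_cbox_eq_0_iff[of 0 1 "\<lambda>s. f s * d s"] fd continuous_on_mult[OF fc dc] by (simp add: box_real)
  then have zero: "d s = 0" if "0 < s" "s < 1" for s
  proof -
    have "f s * d s = 0" using \<open>\<forall>s\<in>cbox 0 1. f s * d s = 0\<close> that by (simp add: box_real)
    moreover have "W s > 0" using that by (simp add: W_def)
    ultimately show ?thesis by (simp add: f_def)
  qed
  have "d s = 0" if "s \<in> {0..1}" for s
  proof (rule continuous_constant_on_closure[of "{0<..<1}" d 0 s])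
    show "continuous_on (closure {0<..<1}) d" using dc by simp
  qed (use zero that in auto)
  moreover obtain s where "s \<in> {0..1}" "x = ?l s"
    using x by (auto simp: polygon_edge_def linepath_image_01[symmetric])
  ultimately show ?thesis by (auto simp: d_def)
qed

section \<open>Norm equivalence on polynomial spaces\<close>

lemma compact_PiE_UNIV:
  fixes S :: "'i \<Rightarrow> real set"
  assumes "\<And>i. compact (S i)"
  shows "compact (PiE UNIV S)"
proof -
  have "compactin (product_topology (\<lambda>i. euclidean) UNIV) (PiE UNIV S)"
    using assms by (simp add: compactin_PiE compactin_euclidean_iff)
  then show ?thesis
    by (simp add: euclidean_product_topology[symmetric] compactin_euclidean_iff[symmetric])
qed

text \<open>The minimum of the form over the compact set of coefficients with unit sum is positive; homogeneity does the rest. The form is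
  a function on all families, so coordinates outside \<open>I\<close> are frozen at zero to obtain compactness.\<close>

lemma quadratic_form_coercive:
  fixes Q :: "('i \<Rightarrow> real) \<Rightarrow> real"
  assumes I: "finite I" and cont: "continuous_on UNIV Q" and hom: "\<And>r d. Q (\<lambda>i. r * d i) = r\<^sup>2 * Q d"
    and dep: "\<And>d d'. (\<And>i. i \<in> I \<Longrightarrow> d i = d' i) \<Longrightarrow> Q d = Q d'"
    and pos: "\<And>d i. i \<in> I \<Longrightarrow> d i \<noteq> 0 \<Longrightarrow> Q d > 0"
  shows "\<exists>c>0. \<forall>d. c * (\<Sum>i\<in>I. \<bar>d i\<bar>)\<^sup>2 \<le> Q d"
proof (cases "I = {}")
  case True
  have "Q d = 0" for d
    using dep[of d "\<lambda>i. 0 * d i"] hom[of 0 d] True by simp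
  then show ?thesis using True by (intro exI[of _ 1]) simp
next
  case False
  define S where "S = PiE UNIV (\<lambda>i. if i \<in> I then {-1..1} else {0::real}) \<inter> {d. (\<Sum>i\<in>I. \<bar>d i\<bar>) = 1}"
  have "continuous_on UNIV (\<lambda>d::'i \<Rightarrow> real. \<Sum>i\<in>I. \<bar>d i\<bar>)"
    by (intro continuous_intros continuous_on_product_coordinates)
  then have "closed {d::'i \<Rightarrow> real. (\<Sum>i\<in>I. \<bar>d i\<bar>) = 1}"
    by (intro closed_Collect_eq continuous_on_const)
  then have S: "compact S"
    unfolding S_def by (intro compact_Int_closed compact_PiE_UNIV) auto
  define nrm where "nrm d = (\<lambda>i. if i \<in> I then d i / (\<Sum>i\<in>I. \<bar>d i\<bar>) else 0)" for d :: "'i \<Rightarrow> real"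
  have nrm: "nrm d \<in> S" if "(\<Sum>i\<in>I. \<bar>d i\<bar>) > 0" for d
  proof -
    have "\<bar>d i\<bar> \<le> (\<Sum>i\<in>I. \<bar>d i\<bar>)" if "i \<in> I" for i
      using I that by (intro member_le_sum) auto
    then have "- (\<Sum>i\<in>I. \<bar>d i\<bar>) \<le> d i \<and> d i \<le> (\<Sum>i\<in>I. \<bar>d i\<bar>)" if "i \<in> I" for i
      using that by (meson abs_le_D1 abs_le_D2 minus_le_iff)
    moreover have "(\<Sum>i\<in>I. \<bar>nrm d i\<bar>) = (\<Sum>i\<in>I. \<bar>d i\<bar> / (\<Sum>i\<in>I. \<bar>d i\<bar>))"
      using that by (intro sum.cong) (auto simp: nrm_def)
    ultimately show ?thesis
      using that by (auto simp: S_def nrm_def PiE_def sum_divide_distrib[symmetric] divide_le_eq le_divide_eq)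
  qed
  have "nrm (\<lambda>_. 1) \<in> S"
    using False I by (intro nrm) (simp add: card_gt_0_iff)
  then have "S \<noteq> {}" by blast
  then obtain d0 where d0: "d0 \<in> S" "\<And>d. d \<in> S \<Longrightarrow> Q d0 \<le> Q d"
    using continuous_attains_inf[OF S _ continuous_on_subset[OF cont]] by blast
  have "\<exists>i\<in>I. d0 i \<noteq> 0"
  proof (rule ccontr)
    assume "\<not> (\<exists>i\<in>I. d0 i \<noteq> 0)"
    then have "(\<Sum>i\<in>I. \<bar>d0 i\<bar>) = 0" by (intro sum.neutral) auto
    then show False using d0(1) by (simp add: S_def)
  qed
  then have c: "Q d0 > 0" using pos by blast
  have "Q d0 * (\<Sum>i\<in>I. \<bar>d i\<bar>)\<^sup>2 \<le> Q d" for d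
  proof -
    let ?s = "\<Sum>i\<in>I. \<bar>d i\<bar>"
    have "?s \<ge> 0" by (intro sum_nonneg) auto
    then consider "?s = 0" | "?s > 0" by linarith
    then show ?thesis
    proof cases
      case 1
      then have "\<forall>i\<in>I. d i = 0" using I by (simp add: sum_nonneg_eq_0_iff)
      then have "Q d = Q (\<lambda>i. 0 * d i)" by (intro dep) auto
      then show ?thesis using hom[of 0 d] 1 by simp
    next
      case 2
      have "Q d = Q (\<lambda>i. ?s * nrm d i)"
        using 2 by (intro dep) (auto simp: nrm_def)
      also have "\<dots> = ?s\<^sup>2 * Q (nrm d)" by (rule hom)
      finally show ?thesis
        using mult_right_mono[OF d0(2)[OF nrm[OF 2]], of "?s\<^sup>2"] by (simp add: mult.commute)
    qed
  qed
  then show ?thesis using c by blast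
qed

lemma sum_square_expand:
  fixes f :: "'i \<Rightarrow> real"
  shows "(\<Sum>i\<in>I. d i * f i)\<^sup>2 = (\<Sum>i\<in>I. \<Sum>j\<in>I. d i * d j * (f i * f j))"
  by (simp add: power2_eq_square sum_product mult_ac)

lemma functionals_coercive:
  fixes A :: "'r \<Rightarrow> 'i \<Rightarrow> real"
  assumes I: "finite I" and R: "finite R"
    and inj: "\<And>d. (\<And>r. r \<in> R \<Longrightarrow> (\<Sum>i\<in>I. d i * A r i) = 0) \<Longrightarrow> \<forall>i\<in>I. d i = 0"
  shows "\<exists>c>0. \<forall>d. c * (\<Sum>i\<in>I. \<bar>d i\<bar>)\<^sup>2 \<le> (\<Sum>r\<in>R. (\<Sum>i\<in>I. d i * A r i)\<^sup>2)"
proof (rule quadratic_form_coercive[OF I])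
  show "continuous_on UNIV (\<lambda>d. \<Sum>r\<in>R. (\<Sum>i\<in>I. d i * A r i)\<^sup>2)"
    by (intro continuous_intros continuous_on_product_coordinates)
  show "(\<Sum>r\<in>R. (\<Sum>i\<in>I. s * d i * A r i)\<^sup>2) = s\<^sup>2 * (\<Sum>r\<in>R. (\<Sum>i\<in>I. d i * A r i)\<^sup>2)" for s d
    by (simp add: mult.assoc sum_distrib_left[symmetric] power_mult_distrib)
  show "(\<Sum>r\<in>R. (\<Sum>i\<in>I. d i * A r i)\<^sup>2) = (\<Sum>r\<in>R. (\<Sum>i\<in>I. d' i * A r i)\<^sup>2)"
    if "\<And>i. i \<in> I \<Longrightarrow> d i = d' i" for d d'
    using that by (intro sum.cong arg_cong[where f = "\<lambda>x. x\<^sup>2"]) auto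
  show "0 < (\<Sum>r\<in>R. (\<Sum>i\<in>I. d i * A r i)\<^sup>2)" if "i \<in> I" "d i \<noteq> 0" for d i
  proof (rule ccontr)
    assume "\<not> 0 < (\<Sum>r\<in>R. (\<Sum>i\<in>I. d i * A r i)\<^sup>2)"
    then have "(\<Sum>r\<in>R. (\<Sum>i\<in>I. d i * A r i)\<^sup>2) = 0"
      by (meson antisym not_less sum_nonneg zero_le_power2)
    then have "\<forall>r\<in>R. (\<Sum>i\<in>I. d i * A r i) = 0"
      using R by (simp add: sum_nonneg_eq_0_iff)
    then show False using inj[of d] that by blast
  qed
qed

lemma weighted_integral_coercive:
  fixes f :: "'i \<Rightarrow> 'a::euclidean_space \<Rightarrow> real"
  assumes I: "finite I" and \<omega>: "continuous_on (cbox a b) \<omega>" "\<And>x. x \<in> cbox a b \<Longrightarrow> \<omega> x \<ge> 0"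
    and f: "\<And>i. i \<in> I \<Longrightarrow> continuous_on (cbox a b) (f i)" and ne: "box a b \<noteq> {}"
    and inj: "\<And>d. (\<And>x. x \<in> cbox a b \<Longrightarrow> \<omega> x * (\<Sum>i\<in>I. d i * f i x)\<^sup>2 = 0) \<Longrightarrow> \<forall>i\<in>I. d i = 0"
  shows "\<exists>c>0. \<forall>d. c * (\<Sum>i\<in>I. \<bar>d i\<bar>)\<^sup>2 \<le> integral (cbox a b) (\<lambda>x. \<omega> x * (\<Sum>i\<in>I. d i * f i x)\<^sup>2)"
proof (rule quadratic_form_coercive[OF I])
  have c: "continuous_on (cbox a b) (\<lambda>x. \<omega> x * (\<Sum>i\<in>I. d i * f i x)\<^sup>2)" for d
    by (intro continuous_intros \<omega> f)
  have "integral (cbox a b) (\<lambda>x. \<omega> x * (\<Sum>i\<in>I. d i * f i x)\<^sup>2) =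
      (\<Sum>i\<in>I. \<Sum>j\<in>I. d i * d j * integral (cbox a b) (\<lambda>x. \<omega> x * (f i x * f j x)))" for d
  proof -
    have "integral (cbox a b) (\<lambda>x. \<omega> x * (\<Sum>i\<in>I. d i * f i x)\<^sup>2) =
        integral (cbox a b) (\<lambda>x. \<Sum>i\<in>I. \<Sum>j\<in>I. d i * d j * (\<omega> x * (f i x * f j x)))"
      by (simp add: sum_square_expand sum_distrib_left mult.left_commute)
    also have "\<dots> = (\<Sum>i\<in>I. \<Sum>j\<in>I. d i * d j * integral (cbox a b) (\<lambda>x. \<omega> x * (f i x * f j x)))"
      using I f \<omega> by (subst integral_sum | auto intro!: sum.cong integrable_continuous continuous_intros)+
    finally show ?thesis .
  qed
  then show "continuous_on UNIV (\<lambda>d. integral (cbox a b) (\<lambda>x. \<omega> x * (\<Sum>i\<in>I. d i * f i x)\<^sup>2))"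
    by (simp only:) (intro continuous_intros continuous_on_product_coordinates)
  show "integral (cbox a b) (\<lambda>x. \<omega> x * (\<Sum>i\<in>I. r * d i * f i x)\<^sup>2) =
      r\<^sup>2 * integral (cbox a b) (\<lambda>x. \<omega> x * (\<Sum>i\<in>I. d i * f i x)\<^sup>2)" for r d
    by (simp add: mult.assoc sum_distrib_left[symmetric] power_mult_distrib mult.left_commute[of _ "r\<^sup>2"])
  show "integral (cbox a b) (\<lambda>x. \<omega> x * (\<Sum>i\<in>I. d i * f i x)\<^sup>2) = integral (cbox a b) (\<lambda>x. \<omega> x * (\<Sum>i\<in>I. d' i * f i x)\<^sup>2)"
    if "\<And>i. i \<in> I \<Longrightarrow> d i = d' i" for d d'
  proof -
    have "(\<Sum>i\<in>I. d i * f i x) = (\<Sum>i\<in>I. d' i * f i x)" for x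
      using that by (intro sum.cong) auto
    then show ?thesis by simp
  qed
  show "0 < integral (cbox a b) (\<lambda>x. \<omega> x * (\<Sum>i\<in>I. d i * f i x)\<^sup>2)" if "i \<in> I" "d i \<noteq> 0" for d i
  proof (rule ccontr)
    assume "\<not> 0 < integral (cbox a b) (\<lambda>x. \<omega> x * (\<Sum>i\<in>I. d i * f i x)\<^sup>2)"
    moreover have "0 \<le> integral (cbox a b) (\<lambda>x. \<omega> x * (\<Sum>i\<in>I. d i * f i x)\<^sup>2)"
      using \<omega>(2) by (intro integral_nonneg integrable_continuous c) auto
    ultimately have "integral (cbox a b) (\<lambda>x. \<omega> x * (\<Sum>i\<in>I. d i * f i x)\<^sup>2) = 0" by simp
    then have "\<forall>x\<in>cbox a b. \<omega> x * (\<Sum>i\<in>I. d i * f i x)\<^sup>2 = 0"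
      using integral_cbox_eq_0_iff[OF c ne] \<omega>(2) by simp
    then show False using inj[of d] that by blast
  qed
qed

subsection \<open>Polynomials on an edge\<close>

lemma poly_as_sum_le:
  fixes q :: "real poly"
  assumes "degree q \<le> n"
  shows "poly q s = (\<Sum>i\<le>n. coeff q i * s ^ i)"
  unfolding poly_altdef using assms
  by (intro sum.mono_neutral_left) (auto simp: coeff_eq_0)

lemma power_sum_zero_coeffs:
  assumes "\<And>t. 0 < t \<Longrightarrow> t < r \<Longrightarrow> (\<Sum>i\<le>n. c i * t ^ i) = (0::real)" "r > 0" "i \<le> n"
  shows "c i = 0"
proof -
  define q where "q = (\<Sum>i\<le>n. monom (c i) i)"
  have q: "poly q t = (\<Sum>i\<le>n. c i * t ^ i)" for t
    by (simp add: q_def poly_sum poly_monom)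
  have "q = 0"
  proof (rule ccontr)
    assume "q \<noteq> 0"
    then have "finite {t. poly q t = 0}" by (rule poly_roots_finite)
    moreover have "{0<..<r} \<subseteq> {t. poly q t = 0}" using assms(1) by (auto simp: q)
    ultimately have "finite {0<..<r}" using finite_subset by blast
    then show False using assms(2) infinite_Ioo by blast
  qed
  then have "coeff q i = 0" by simp
  then show ?thesis using assms(3) by (simp add: q_def coeff_sum)
qed

lemma edge_weight_coercive:
  "\<exists>c>0. \<forall>q::real poly. degree q \<le> n \<longrightarrow>
    c * (\<Sum>i\<le>n. \<bar>coeff q i\<bar>)\<^sup>2 \<le> integral {0..1} (\<lambda>s. (s * (1 - s))\<^sup>2 * (poly q s)\<^sup>2)"
proof -
  have "\<exists>c>0. \<forall>d. c * (\<Sum>i\<in>{..n}. \<bar>d i\<bar>)\<^sup>2 \<le>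
      integral (cbox 0 1) (\<lambda>s::real. (s * (1 - s))\<^sup>2 * (\<Sum>i\<in>{..n}. d i * s ^ i)\<^sup>2)"
  proof (rule weighted_integral_coercive)
    fix d assume z: "\<And>x::real. x \<in> cbox 0 1 \<Longrightarrow> (x * (1 - x))\<^sup>2 * (\<Sum>i\<in>{..n}. d i * x ^ i)\<^sup>2 = 0"
    have "(\<Sum>i\<le>n. d i * t ^ i) = 0" if "0 < t" "t < 1" for t
      using z[of t] that by simp
    then show "\<forall>i\<in>{..n}. d i = 0"
      using power_sum_zero_coeffs[where r = 1 and n = n and c = d] by simp
  qed (auto intro!: continuous_intros simp: box_real)
  then obtain c where c: "c > 0" "\<And>d. c * (\<Sum>i\<le>n. \<bar>d i\<bar>)\<^sup>2 \<le>
      integral {0..1} (\<lambda>s::real. (s * (1 - s))\<^sup>2 * (\<Sum>i\<le>n. d i * s ^ i)\<^sup>2)"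
    by auto
  have "c * (\<Sum>i\<le>n. \<bar>coeff q i\<bar>)\<^sup>2 \<le> integral {0..1} (\<lambda>s. (s * (1 - s))\<^sup>2 * (poly q s)\<^sup>2)" if "degree q \<le> n" for q
    using c(2)[of "coeff q"] by (simp add: poly_as_sum_le[OF that])
  then show ?thesis using c(1) by blast
qed

text \<open>Unisolvence: a polynomial of degree \<open>n\<close> that vanishes at both ends is \<open>s (1 - s)\<close> times one of degree
  \<open>n - 2\<close>, and moments up to that degree test it against itself.\<close>

lemma edge_dofs_coercive:
  assumes n: "n \<ge> 1"
  shows "\<exists>c>0. \<forall>q::real poly. degree q \<le> n \<longrightarrow>
    c * (\<Sum>i\<le>n. \<bar>coeff q i\<bar>)\<^sup>2 \<le>
      (poly q 0)\<^sup>2 + (poly q 1)\<^sup>2 + (\<Sum>j<n - 1. (integral {0..1} (\<lambda>s. (s - 1/2) ^ j * poly q s))\<^sup>2)"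
proof -
  define A where "A r i = (if r = 0 then (0::real) ^ i else if r = 1 then 1 else integral {0..1} (\<lambda>s. (s - 1/2) ^ (r - 2) * s ^ i))" for r i :: nat
  have Aq: "(\<Sum>i\<le>n. coeff q i * A 0 i) = poly q 0" "(\<Sum>i\<le>n. coeff q i * A 1 i) = poly q 1"
    "(\<Sum>i\<le>n. coeff q i * A (j + 2) i) = integral {0..1} (\<lambda>s. (s - 1/2) ^ j * poly q s)"
    if "degree q \<le> n" for q j
  proof -
    show "(\<Sum>i\<le>n. coeff q i * A 0 i) = poly q 0" "(\<Sum>i\<le>n. coeff q i * A 1 i) = poly q 1"
      by (simp_all add: A_def poly_as_sum_le[OF that])
    have "integral {0..1} (\<lambda>s. (s - 1/2) ^ j * poly q s) = integral {0..1} (\<lambda>s. \<Sum>i\<le>n. coeff q i * ((s - 1/2) ^ j * s ^ i))"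
      by (simp add: poly_as_sum_le[OF that] sum_distrib_left mult.left_commute)
    also have "\<dots> = (\<Sum>i\<le>n. coeff q i * integral {0..1} (\<lambda>s. (s - 1/2) ^ j * s ^ i))"
      by (subst integral_sum) (auto intro!: integrable_continuous_real continuous_intros)
    finally show "(\<Sum>i\<le>n. coeff q i * A (j + 2) i) = integral {0..1} (\<lambda>s. (s - 1/2) ^ j * poly q s)"
      by (simp add: A_def)
  qed
  have "\<exists>c>0. \<forall>d. c * (\<Sum>i\<in>{..n}. \<bar>d i\<bar>)\<^sup>2 \<le> (\<Sum>r\<in>{..n}. (\<Sum>i\<in>{..n}. d i * A r i)\<^sup>2)"
  proof (rule functionals_coercive)
    fix d assume z: "\<And>r. r \<in> {..n} \<Longrightarrow> (\<Sum>i\<in>{..n}. d i * A r i) = 0"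
    define q where "q = (\<Sum>i\<le>n. monom (d i) i)"
    have cq: "coeff q i = (if i \<le> n then d i else 0)" for i
      by (simp add: q_def coeff_sum)
    have dq: "degree q \<le> n" by (rule degree_le) (simp add: cq)
    have sq: "(\<Sum>i\<le>n. coeff q i * A r i) = (\<Sum>i\<le>n. d i * A r i)" for r
      by (rule sum.cong) (auto simp: cq)
    have q0: "poly q 0 = 0" "poly q 1 = 0"
      using Aq(1,2)[OF dq] sq z[of 0] z[of 1] n by simp_all
    have mom: "integral {0..1} (\<lambda>s. (s - 1/2) ^ j * poly q s) = 0" if "j < n - 1" for j
      using Aq(3)[OF dq, of j] sq z[of "j + 2"] that by simp
    have "[:0, 1:] dvd q" using q0(1) poly_eq_0_iff_dvd[of q 0] by simp
    then obtain q1 where q1: "q = [:0, 1:] * q1" by (elim dvdE)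
    have "poly q1 1 = 0" using q0(2) by (simp add: q1)
    then have "[:-1, 1:] dvd q1" by (simp add: poly_eq_0_iff_dvd)
    then obtain q2 where q2: "q1 = [:-1, 1:] * q2" by (elim dvdE)
    have qr: "poly q s = - (s * (1 - s)) * poly q2 s" for s
      by (simp add: q1 q2 algebra_simps)
    have "q2 = 0"
    proof (rule ccontr)
      assume ne: "q2 \<noteq> 0"
      have "degree q = degree q2 + 2"
        unfolding q1 q2 using ne by (simp add: degree_mult_eq del: mult_pCons_left)
      then have deg: "degree q2 < n - 1" using dq by simp
      obtain e where e: "\<And>s. poly q2 s = (\<Sum>j\<le>degree q2. e j * (s - 1/2) ^ j)"
      proof -
        define p where "p = pcompose q2 [:1/2, 1:]"
        have "poly q2 s = poly p (s - 1/2)" for s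
          by (simp add: p_def poly_pcompose)
        moreover have "degree p \<le> degree q2" by (simp add: p_def degree_pcompose)
        ultimately show ?thesis using that poly_as_sum_le by metis
      qed
      have "integral {0..1} (\<lambda>s. poly q s * poly q2 s) = integral {0..1} (\<lambda>s. \<Sum>j\<le>degree q2. e j * ((s - 1/2) ^ j * poly q s))"
        by (simp add: e sum_distrib_left mult_ac)
      also have "\<dots> = (\<Sum>j\<le>degree q2. e j * integral {0..1} (\<lambda>s. (s - 1/2) ^ j * poly q s))"
        by (subst integral_sum) (auto intro!: integrable_continuous_real continuous_intros)
      also have "\<dots> = 0" using mom deg by (intro sum.neutral) auto
      finally have "integral (cbox 0 1) (\<lambda>s. (s * (1 - s)) * (poly q2 s)\<^sup>2) = 0"
        by (simp add: qr power2_eq_square mult.assoc)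
      then have z2: "\<forall>s\<in>cbox 0 1. (s * (1 - s)) * (poly q2 s)\<^sup>2 = 0"
        by (subst (asm) integral_cbox_eq_0_iff) (auto intro!: continuous_intros simp: box_real)
      have "poly q2 s = 0" if "0 < s" "s < 1" for s
        using bspec[OF z2, of s] that by (auto simp: box_real)
      then have "coeff q2 i = 0" if "i \<le> degree q2" for i
        using power_sum_zero_coeffs[where r = 1 and n = "degree q2" and c = "coeff q2"] that
        by (simp add: poly_altdef[symmetric])
      then show False using ne leading_coeff_0_iff by blast
    qed
    then have "q = 0" by (simp add: q1 q2)
    then show "\<forall>i\<in>{..n}. d i = 0" using cq by (metis atMost_iff coeff_0)
  qed auto
  then obtain c where c: "c > 0" "\<And>d. c * (\<Sum>i\<le>n. \<bar>d i\<bar>)\<^sup>2 \<le> (\<Sum>r\<le>n. (\<Sum>i\<le>n. d i * A r i)\<^sup>2)"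
    by auto
  have split: "(\<Sum>r\<le>n. g r) = g 0 + g 1 + (\<Sum>j<n - 1. g (j + 2))" for g :: "nat \<Rightarrow> real"
  proof -
    obtain m where m: "n = Suc m" using n by (cases n) auto
    have "(\<Sum>r\<le>n. g r) = g 0 + (\<Sum>r\<le>m. g (Suc r))"
      unfolding m by (rule sum.atMost_Suc_shift)
    also have "(\<Sum>r\<le>m. g (Suc r)) = g 1 + (\<Sum>r<m. g (Suc (Suc r)))"
      by (subst lessThan_Suc_atMost[symmetric], subst sum.lessThan_Suc_shift) simp
    finally show ?thesis by (simp add: m)
  qed
  have "c * (\<Sum>i\<le>n. \<bar>coeff q i\<bar>)\<^sup>2 \<le>
      (poly q 0)\<^sup>2 + (poly q 1)\<^sup>2 + (\<Sum>j<n - 1. (integral {0..1} (\<lambda>s. (s - 1/2) ^ j * poly q s))\<^sup>2)" if "degree q \<le> n" for q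
    using c(2)[of "coeff q"] split[of "\<lambda>r. (\<Sum>i\<le>n. coeff q i * A r i)\<^sup>2"] by (simp only: Aq[OF that])
  then show ?thesis using c(1) by blast
qed

subsection \<open>Polynomials in the plane\<close>

definition shifted_monomial :: "real^2 \<Rightarrow> real \<Rightarrow> nat \<times> nat \<Rightarrow> real^2 \<Rightarrow> real"
  where "shifted_monomial z h s x = ((x - z) $ 1 / h) ^ fst s * ((x - z) $ 2 / h) ^ snd s"

abbreviation monomial :: "nat \<times> nat \<Rightarrow> real^2 \<Rightarrow> real"
  where "monomial \<equiv> shifted_monomial 0 1"

lemma scaled_monomial_shifted: "scaled_monomial K ps = shifted_monomial (vertex_average ps) (diameter K)"
  by (intro ext) (simp add: scaled_monomial_def shifted_monomial_def)

lemma shifted_monomial_scale: "shifted_monomial z h s x = monomial s ((1 / h) *\<^sub>R (x - z))"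
  by (simp add: shifted_monomial_def)

lemma smooth_shifted_monomial: "smooth (shifted_monomial z h s)"
proof -
  have "smooth (\<lambda>x. (x - z) $ i / h)" for i
    using smooth_cmult[OF smooth_diff[OF smooth_component[of i] smooth_const[of "z $ i"]], of "1 / h"] by simp
  then show ?thesis
    unfolding shifted_monomial_def[abs_def] by (intro smooth_mult smooth_power)
qed

lemma shifted_monomial_bound:
  assumes "s \<in> multi_indices l" "R \<ge> 1" "\<bar>(x - z) $ 1 / h\<bar> \<le> R" "\<bar>(x - z) $ 2 / h\<bar> \<le> R"
  shows "\<bar>shifted_monomial z h s x\<bar> \<le> R ^ nat l"
proof -
  have "\<bar>shifted_monomial z h s x\<bar> \<le> R ^ fst s * R ^ snd s"
    unfolding shifted_monomial_def abs_mult power_abs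
    using assms by (intro mult_mono power_mono) auto
  also have "\<dots> = R ^ (fst s + snd s)" by (simp add: power_add)
  also have "\<dots> \<le> R ^ nat l"
    using assms(1,2) by (intro power_increasing) (auto simp: multi_indices_def)
  finally show ?thesis .
qed

text \<open>The binomial theorem moves the centre of a polynomial without raising its degree.\<close>

lemma polynomial_recenter:
  assumes h: "h \<noteq> 0"
  shows "\<exists>d. \<forall>x. (\<Sum>(a, b)\<in>multi_indices l. coef a b * (x $ 1) ^ a * (x $ 2) ^ b) =
    (\<Sum>s\<in>multi_indices l. d s * shifted_monomial z h s x)"
proof -
  define I where "I = multi_indices l"
  have I: "finite I" by (simp add: I_def finite_multi_indices)
  define V where "V = {f. \<exists>d. \<forall>x. f x = (\<Sum>s\<in>I. d s * shifted_monomial z h s x)}"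
  have zero: "(\<lambda>x. 0) \<in> V" unfolding V_def by (intro CollectI exI[of _ "\<lambda>_. 0"]) simp
  have add: "(\<lambda>x. f x + g x) \<in> V" if "f \<in> V" "g \<in> V" for f g
  proof -
    obtain d e where "\<forall>x. f x = (\<Sum>s\<in>I. d s * shifted_monomial z h s x)" "\<forall>x. g x = (\<Sum>s\<in>I. e s * shifted_monomial z h s x)"
      using \<open>f \<in> V\<close> \<open>g \<in> V\<close> unfolding V_def by blast
    then show ?thesis
      unfolding V_def by (intro CollectI exI[of _ "\<lambda>s. d s + e s"]) (simp add: sum.distrib distrib_right)
  qed
  have sum: "(\<lambda>x. \<Sum>j\<in>J. f j x) \<in> V" if "\<And>j. j \<in> J \<Longrightarrow> f j \<in> V" for f :: "'j \<Rightarrow> real^2 \<Rightarrow> real" and J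
    using that by (induction J rule: infinite_finite_induct) (auto intro: zero add)
  have mono: "(\<lambda>x. c * shifted_monomial z h s x) \<in> V" if "s \<in> I" for c s
  proof -
    have "(\<Sum>t\<in>I. (if t = s then c else 0) * shifted_monomial z h t x) = c * shifted_monomial z h s x" for x
      using I that by (simp add: if_distrib[of "\<lambda>y. y * _"] cong: if_cong)
    then show ?thesis unfolding V_def by (intro CollectI exI[of _ "\<lambda>t. if t = s then c else 0"]) simp
  qed
  have "(\<lambda>x. coef a b * (x $ 1) ^ a * (x $ 2) ^ b) \<in> V" if ab: "(a, b) \<in> I" for a b
  proof -
    have ex: "(x $ k) ^ n = (\<Sum>i\<le>n. real (n choose i) * h ^ i * (z $ k) ^ (n - i) * ((x - z) $ k / h) ^ i)" for x :: "real^2" and k n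
    proof -
      have "(x $ k) ^ n = (h * ((x - z) $ k / h) + z $ k) ^ n" using h by simp
      also have "\<dots> = (\<Sum>i\<le>n. real (n choose i) * (h * ((x - z) $ k / h)) ^ i * (z $ k) ^ (n - i))"
        by (rule binomial_ring)
      also have "\<dots> = (\<Sum>i\<le>n. real (n choose i) * h ^ i * (z $ k) ^ (n - i) * ((x - z) $ k / h) ^ i)"
        by (intro sum.cong refl) (simp only: power_mult_distrib mult_ac)
      finally show ?thesis .
    qed
    have "(\<lambda>x. coef a b * (x $ 1) ^ a * (x $ 2) ^ b) =
        (\<lambda>x. \<Sum>i\<le>a. \<Sum>j\<le>b. (coef a b * (real (a choose i) * h ^ i * (z $ 1) ^ (a - i)) * (real (b choose j) * h ^ j * (z $ 2) ^ (b - j)))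
          * shifted_monomial z h (i, j) x)"
    proof
      fix x :: "real^2"
      define A where "A i = real (a choose i) * h ^ i * (z $ 1) ^ (a - i)" for i
      define B where "B j = real (b choose j) * h ^ j * (z $ 2) ^ (b - j)" for j
      define X where "X i = ((x - z) $ 1 / h) ^ i" for i
      define Y where "Y i = ((x - z) $ 2 / h) ^ i" for i
      have "coef a b * (x $ 1) ^ a * (x $ 2) ^ b = coef a b * ((\<Sum>i\<le>a. A i * X i) * (\<Sum>j\<le>b. B j * Y j))"
        unfolding ex[of x 1 a] ex[of x 2 b] A_def B_def X_def Y_def by (rule mult.assoc)
      also have "\<dots> = coef a b * (\<Sum>i\<le>a. \<Sum>j\<le>b. (A i * X i) * (B j * Y j))"
        by (simp only: sum_product)
      also have "\<dots> = (\<Sum>i\<le>a. \<Sum>j\<le>b. (coef a b * A i * B j) * (X i * Y j))"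
        by (simp only: sum_distrib_left) (intro sum.cong refl, simp only: mult_ac)
      finally show "coef a b * (x $ 1) ^ a * (x $ 2) ^ b = (\<Sum>i\<le>a. \<Sum>j\<le>b.
          (coef a b * (real (a choose i) * h ^ i * (z $ 1) ^ (a - i)) * (real (b choose j) * h ^ j * (z $ 2) ^ (b - j)))
          * shifted_monomial z h (i, j) x)"
        unfolding A_def B_def X_def Y_def shifted_monomial_def fst_conv snd_conv .
    qed
    moreover have "(i, j) \<in> I" if "i \<le> a" "j \<le> b" for i j
      using ab that by (auto simp: I_def multi_indices_def)
    ultimately show ?thesis by (simp only:) (intro sum mono; simp)
  qed
  then have "(\<lambda>x. \<Sum>s\<in>I. coef (fst s) (snd s) * (x $ 1) ^ fst s * (x $ 2) ^ snd s) \<in> V"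
    by (intro sum) auto
  then show ?thesis
    unfolding V_def I_def by (simp add: case_prod_beta)
qed

lemma monomial_sum_zero_coeffs:
  assumes z: "\<And>y. 0 < y $ 1 \<Longrightarrow> y $ 1 < r \<Longrightarrow> 0 < y $ 2 \<Longrightarrow> y $ 2 < r \<Longrightarrow> (\<Sum>s\<in>multi_indices l. d s * monomial s y) = 0"
    and r: "r > 0" and s: "s \<in> multi_indices l"
  shows "d s = 0"
proof -
  define n where "n = nat l"
  define e where "e i j = (if (i, j) \<in> multi_indices l then d (i, j) else 0)" for i j
  have sub: "multi_indices l \<subseteq> {..n} \<times> {..n}" by (auto simp: multi_indices_def n_def)
  have eq: "(\<Sum>s\<in>multi_indices l. d s * monomial s y) = (\<Sum>i\<le>n. (\<Sum>j\<le>n. e i j * (y $ 2) ^ j) * (y $ 1) ^ i)" for y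
  proof -
    have "(\<Sum>s\<in>multi_indices l. d s * monomial s y) = (\<Sum>s\<in>{..n} \<times> {..n}. e (fst s) (snd s) * monomial s y)"
      by (rule sum.mono_neutral_cong_left[OF _ sub]) (auto simp: e_def)
    also have "\<dots> = (\<Sum>i\<le>n. \<Sum>j\<le>n. e i j * monomial (i, j) y)"
      by (simp add: sum.cartesian_product case_prod_beta)
    also have "\<dots> = (\<Sum>i\<le>n. (\<Sum>j\<le>n. e i j * (y $ 2) ^ j) * (y $ 1) ^ i)"
      by (simp add: shifted_monomial_def sum_distrib_left sum_distrib_right mult_ac)
    finally show ?thesis .
  qed
  have "e i j = 0" if "i \<le> n" "j \<le> n" for i j
  proof -
    have "(\<Sum>j\<le>n. e i j * t ^ j) = 0" if t: "0 < t" "t < r" for t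
    proof -
      have "(\<Sum>i\<le>n. (\<Sum>j\<le>n. e i j * t ^ j) * u ^ i) = 0" if "0 < u" "u < r" for u
        using z[of "vector [u, t]"] that t unfolding eq by simp
      then show ?thesis
        using power_sum_zero_coeffs[where r = r and n = n and c = "\<lambda>i. \<Sum>j\<le>n. e i j * t ^ j"] r \<open>i \<le> n\<close> by blast
    qed
    then show ?thesis
      using power_sum_zero_coeffs[where r = r and n = n and c = "e i"] r \<open>j \<le> n\<close> by blast
  qed
  moreover obtain i j where "s = (i, j)" "i \<le> n" "j \<le> n" using s sub by blast
  ultimately have "e i j = 0" by blast
  then show ?thesis using s \<open>s = (i, j)\<close> by (simp add: e_def)
qed

lemma monomials_coercive:
  assumes "continuous_on UNIV \<omega>" "\<And>y. \<omega> y \<ge> 0" and r: "r > 0" "r \<le> 1"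
    and pos: "\<And>y. 0 < y $ 1 \<Longrightarrow> y $ 1 < r \<Longrightarrow> 0 < y $ 2 \<Longrightarrow> y $ 2 < r \<Longrightarrow> \<omega> y > 0"
  shows "\<exists>c>0. \<forall>d. c * (\<Sum>s\<in>multi_indices l. \<bar>d s\<bar>)\<^sup>2 \<le>
    integral (cbox (-1) 1) (\<lambda>y::real^2. \<omega> y * (\<Sum>s\<in>multi_indices l. d s * monomial s y)\<^sup>2)"
proof (rule weighted_integral_coercive[OF finite_multi_indices])
  show "continuous_on (cbox (- 1) 1) \<omega>" using assms(1) by (rule continuous_on_subset) simp
  show "continuous_on (cbox (- 1) 1) (monomial s)" for s by (intro smooth_continuous_on smooth_shifted_monomial)
  have "0 \<in> box (- 1) (1::real^2)" by (simp add: mem_box_cart)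
  then show "box (- 1) (1::real^2) \<noteq> {}" by blast
  fix d assume z: "\<And>x. x \<in> cbox (- 1) (1::real^2) \<Longrightarrow> \<omega> x * (\<Sum>i\<in>multi_indices l. d i * monomial i x)\<^sup>2 = 0"
  show "\<forall>s\<in>multi_indices l. d s = 0"
  proof
    fix s assume s: "s \<in> multi_indices l"
    show "d s = 0"
    proof (rule monomial_sum_zero_coeffs[OF _ r(1) s])
      fix y :: "real^2" assume y: "0 < y $ 1" "y $ 1 < r" "0 < y $ 2" "y $ 2 < r"
      then have "y \<in> cbox (-1) 1" using r(2) by (simp add: mem_box_cart forall_2)
      then show "(\<Sum>s\<in>multi_indices l. d s * monomial s y) = 0"
        using z[of y] pos[OF y] by simp
    qed
  qed
qed (rule assms)

section \<open>The source is controlled by the solution\<close>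

text \<open>Supported in the disc of radius \<open>\<theta> / 2\<close>, whose closure lies inside the disc of radius \<open>\<theta>\<close>.\<close>

definition bump :: "real \<Rightarrow> real^2 \<Rightarrow> real"
  where "bump \<theta> y = exp_flat (\<theta>\<^sup>2 - 4 * ((y $ 1)\<^sup>2 + (y $ 2)\<^sup>2))"

lemma smooth_bump: "smooth (bump \<theta>)"
  unfolding bump_def[abs_def]
  by (intro smooth_compose[OF smooth_real_flat_poly] smooth_diff smooth_const smooth_cmult smooth_add smooth_power smooth_component)

lemma norm_2: "(norm y)\<^sup>2 = (y $ 1)\<^sup>2 + ((y::real^2) $ 2)\<^sup>2"
  unfolding power2_norm_eq_inner inner_2 by (simp add: power2_eq_square)

lemma bump_zero: "\<theta> \<le> 2 * norm y \<Longrightarrow> \<theta> \<ge> 0 \<Longrightarrow> bump \<theta> y = 0"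
  using power_mono[of \<theta> "2 * norm y" 2] by (simp add: bump_def flat_poly_def power_mult_distrib norm_2)

lemma bump_nonneg: "bump \<theta> y \<ge> 0"
  by (simp add: bump_def exp_flat_bounds)

lemma partial_scale:
  assumes "smooth f"
  shows "partial i (\<lambda>x. f (c *\<^sub>R (x - z))) x = c * partial i f (c *\<^sub>R (x - z))"
proof -
  have "((\<lambda>x. c *\<^sub>R (x - z)) has_derivative (\<lambda>v. c *\<^sub>R v)) (at x)"
    by (auto intro!: derivative_eq_intros)
  from has_derivative_compose[OF this has_derivative_partial[OF smooth_differentiable[OF assms]]]
  have "((\<lambda>x. f (c *\<^sub>R (x - z))) has_derivative (\<lambda>v. \<Sum>j\<in>UNIV. (c *\<^sub>R v) $ j * partial j f (c *\<^sub>R (x - z)))) (at x)" .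
  from partial_eq[OF this, of i] show ?thesis
    by (simp add: axis_def if_distrib[of "\<lambda>y. y * _"] if_distrib[of "\<lambda>y. c * y"] cong: if_cong)
qed

lemma smooth_scale:
  assumes "smooth f"
  shows "smooth (\<lambda>x. f (c *\<^sub>R (x - z)))"
proof (rule smooth_coinduct[of _ "{\<lambda>x. b * f (c *\<^sub>R (x - z)) | b f. smooth f}"])
  show "(\<lambda>x. f (c *\<^sub>R (x - z))) \<in> {\<lambda>x. b * f (c *\<^sub>R (x - z)) | b f. smooth f}"
    using assms by (intro CollectI exI[of _ 1] exI[of _ f]) simp
next
  fix g x assume "g \<in> {\<lambda>x. b * f (c *\<^sub>R (x - z)) | b f. smooth f}"
  then obtain b f where g: "g = (\<lambda>x. b * f (c *\<^sub>R (x - z)))" and f: "smooth f" by blast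
  have d: "(\<lambda>x. f (c *\<^sub>R (x - z))) differentiable (at x)" for x
    using differentiable_chain_at[of "\<lambda>x. c *\<^sub>R (x - z)" x f] smooth_differentiable[OF f] by (simp add: o_def)
  show "g differentiable (at x)" unfolding g by (intro differentiable_mult d differentiable_const)
  show "partial i g \<in> {\<lambda>x. b * f (c *\<^sub>R (x - z)) | b f. smooth f}" for i
  proof -
    have "partial i g x = b * c * partial i f (c *\<^sub>R (x - z))" for x
      unfolding g using d by (simp add: partial_mult partial_const partial_scale[OF f])
    then have "partial i g = (\<lambda>x. (b * c) * partial i f (c *\<^sub>R (x - z)))" by blast
    then show ?thesis using smooth_partial[OF f] by blast
  qed
qed

lemma lborel_integral_scale:
  fixes f :: "real^2 \<Rightarrow> real"
  assumes h: "h > 0" and f [measurable]: "f \<in> borel_measurable borel"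
  shows "(\<integral>x. f ((1 / h) *\<^sub>R (x - z)) \<partial>lborel) = h\<^sup>2 * (\<integral>y. f y \<partial>lborel)"
proof -
  have "(\<integral>x. f ((1 / h) *\<^sub>R (x - z)) \<partial>lborel) =
      (\<integral>x. f ((1 / h) *\<^sub>R (x - z)) \<partial>(density (distr lborel borel (\<lambda>x. z + h *\<^sub>R x)) (\<lambda>_. ennreal (\<bar>h\<bar> ^ DIM(real^2)))))"
    using lborel_affine[of h z] h by simp
  also have "\<dots> = (\<integral>y. \<bar>h\<bar> ^ DIM(real^2) * f ((1 / h) *\<^sub>R (z + h *\<^sub>R y - z)) \<partial>lborel)"
    by (subst integral_density) (auto simp: integral_distr)
  also have "\<dots> = h\<^sup>2 * (\<integral>y. f y \<partial>lborel)"
    using h by simp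
  finally show ?thesis .
qed

lemma measure_le_diameter:
  fixes K :: "(real^2) set"
  assumes "K \<in> lmeasurable" "bounded K" "x0 \<in> K" "diameter K = h"
  shows "measure lebesgue K \<le> pi * h\<^sup>2"
proof -
  have "K \<subseteq> cball x0 h"
    using diameter_bounded_bound[OF assms(2,3)] assms(4) by auto
  then have "measure lebesgue K \<le> measure lebesgue (cball x0 h)"
    using assms(1) by (intro measure_mono_fmeasurable) (auto simp: fmeasurableD)
  also have "\<dots> = pi * h\<^sup>2"
    using diameter_ge_0[OF assms(2)] assms(4) by (simp add: content_cball unit_ball_vol_2)
  finally show ?thesis .
qed

text \<open>Testing the equation with a bump times the source itself bounds the source by the solution, with two
  derivatives moved to the test function. All bumps and all monomials are scaled copies of finitely many
  fixed ones, so the constant is uniform.\<close>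

lemma source_bound:
  fixes l :: int and \<theta> :: real
  assumes \<theta>: "0 < \<theta>" "\<theta> \<le> 1"
  obtains C where "C > 0"
    "\<And>K h v p x0 xc. \<lbrakk>open K; bounded K; diameter K = h; h > 0; ball x0 (\<theta> * h) \<subseteq> K; norm (x0 - xc) \<le> h;
        v \<in> L2 K; p \<in> polys l K; weak_laplacian K v p\<rbrakk> \<Longrightarrow>
      \<exists>c. (\<forall>x\<in>K. p x = (\<Sum>s\<in>multi_indices l. c s * shifted_monomial xc h s x)) \<and>
        h ^ 3 * (\<Sum>s\<in>multi_indices l. \<bar>c s\<bar>) \<le> C * L2_norm K v"
proof -
  define I where "I = multi_indices l"
  have I: "finite I" by (simp add: I_def finite_multi_indices)
  obtain c3 where c3: "c3 > 0" "\<And>d. c3 * (\<Sum>s\<in>I. \<bar>d s\<bar>)\<^sup>2 \<le>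
      integral (cbox (-1) 1) (\<lambda>y. bump \<theta> y * (\<Sum>s\<in>I. d s * monomial s y)\<^sup>2)"
  proof -
    have "bump \<theta> y > 0" if y: "0 < y $ 1" "y $ 1 < \<theta> / 4" "0 < y $ 2" "y $ 2 < \<theta> / 4" for y
    proof -
      have "(4 * y $ 1)\<^sup>2 \<le> \<theta>\<^sup>2" "(4 * y $ 2)\<^sup>2 \<le> \<theta>\<^sup>2"
        by (rule power_mono; use y in simp)+
      then have "16 * (y $ 1)\<^sup>2 \<le> \<theta>\<^sup>2" "16 * (y $ 2)\<^sup>2 \<le> \<theta>\<^sup>2"
        by (simp_all add: power_mult_distrib)
      moreover have "\<theta>\<^sup>2 > 0" using \<theta>(1) by simp
      ultimately have "\<theta>\<^sup>2 - 4 * ((y $ 1)\<^sup>2 + (y $ 2)\<^sup>2) > 0" by argo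
      then show ?thesis by (simp add: bump_def flat_poly_def)
    qed
    then show ?thesis
      using monomials_coercive[of "bump \<theta>" "\<theta> / 4" l] \<theta> that bump_nonneg smooth_continuous_on[OF smooth_bump]
      unfolding I_def by auto
  qed
  obtain c4 where c4: "c4 > 0" "\<And>d. c4 * (\<Sum>s\<in>I. \<bar>d s\<bar>)\<^sup>2 \<le>
      integral (cbox (-1) 1) (\<lambda>y. (\<Sum>s\<in>I. d s * monomial s y)\<^sup>2)"
    using monomials_coercive[of "\<lambda>y. 1" 1 l] unfolding I_def by auto
  define B where "B s y = bump \<theta> y * monomial s y" for s y
  have B: "smooth (B s)" for s
    unfolding B_def[abs_def] by (intro smooth_mult smooth_bump smooth_shifted_monomial)
  have lapB: "smooth (laplacian (B s))" for s
    by (intro smooth_sum smooth_partial B)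
  obtain M where M: "M > 0" "\<And>s y. s \<in> I \<Longrightarrow> norm y \<le> 1 \<Longrightarrow> \<bar>laplacian (B s) y\<bar> \<le> M"
  proof -
    have "continuous_on (cball 0 1) (\<lambda>y. \<Sum>s\<in>I. \<bar>laplacian (B s) y\<bar>)"
      by (intro continuous_on_sum continuous_on_rabs smooth_continuous_on lapB[THEN smooth_continuous_on])
    then have "bounded ((\<lambda>y. \<Sum>s\<in>I. \<bar>laplacian (B s) y\<bar>) ` cball 0 1)"
      by (intro compact_imp_bounded compact_continuous_image) auto
    then obtain M where M: "M > 0" "\<forall>z\<in>(\<lambda>y. \<Sum>s\<in>I. \<bar>laplacian (B s) y\<bar>) ` cball 0 1. norm z \<le> M"
      unfolding bounded_pos by blast
    have "\<bar>laplacian (B s) y\<bar> \<le> M" if "s \<in> I" "norm y \<le> 1" for s y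
    proof -
      have "\<bar>laplacian (B s) y\<bar> \<le> (\<Sum>s\<in>I. \<bar>laplacian (B s) y\<bar>)"
        by (rule member_le_sum[OF that(1) _ I]) simp
      also have "\<dots> \<le> \<bar>\<Sum>s\<in>I. \<bar>laplacian (B s) y\<bar>\<bar>" by (rule abs_ge_self)
      also have "\<dots> \<le> M" using bspec[OF M(2), OF imageI, of y] that(2) by simp
      finally show ?thesis .
    qed
    then show ?thesis using M(1) that by blast
  qed
  define V where "V = measure lborel (cbox (-1) (1::real^2))"
  have V: "V \<ge> 0" by (simp add: V_def)
  (* The summand 1 only makes C positive. *)
  define C where "C = 2 ^ nat l * sqrt (V / c4) * (sqrt pi * M / c3) + 1"
  have C: "C > 0"
    unfolding C_def using V c4(1) c3(1) M(1) by (intro add_nonneg_pos mult_nonneg_nonneg) auto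
  show ?thesis
  proof (rule that[OF C])
    fix K h v p x0 xc
    assume K: "open K" "bounded K" and h: "diameter K = h" "h > 0" and ball: "ball x0 (\<theta> * h) \<subseteq> K"
      and xc: "norm (x0 - xc) \<le> h" and v: "v \<in> L2 K" and p: "p \<in> polys l K" and lap: "weak_laplacian K v p"
    have Km: "K \<in> lmeasurable" using K by (rule lmeasurable_open[OF _, rotated])
    have x0: "x0 \<in> K" using ball \<theta>(1) h(2) by auto
    obtain coef where coef: "\<And>x. x \<in> K \<Longrightarrow> p x = (\<Sum>(a, b)\<in>multi_indices l. coef a b * (x $ 1) ^ a * (x $ 2) ^ b)"
      using p unfolding polys_def by blast
    obtain d where d: "\<And>x. (\<Sum>(a, b)\<in>multi_indices l. coef a b * (x $ 1) ^ a * (x $ 2) ^ b) = (\<Sum>s\<in>I. d s * shifted_monomial x0 h s x)"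
      using polynomial_recenter[where h = h and l = l and coef = coef and z = x0] h(2) unfolding I_def by auto
    obtain c where c: "\<And>x. (\<Sum>(a, b)\<in>multi_indices l. coef a b * (x $ 1) ^ a * (x $ 2) ^ b) = (\<Sum>s\<in>I. c s * shifted_monomial xc h s x)"
      using polynomial_recenter[where h = h and l = l and coef = coef and z = xc] h(2) unfolding I_def by auto
    (* Coefficients around the centre of the disc, where the bump is, and around the prescribed centre. *)
    define Nd where "Nd = (\<Sum>s\<in>I. \<bar>d s\<bar>)"
    define Nc where "Nc = (\<Sum>s\<in>I. \<bar>c s\<bar>)"
    have N: "Nd \<ge> 0" "Nc \<ge> 0" by (auto simp: Nd_def Nc_def intro: sum_nonneg)
    define Y where "Y x = (1 / h) *\<^sub>R (x - x0)" for x :: "real^2"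
    define F where "F x = (\<Sum>s\<in>I. d s * B s (Y x))" for x
    have BY: "smooth (\<lambda>x. f (Y x))" if "smooth f" for f
      unfolding Y_def by (rule smooth_scale[OF that])
    have F: "smooth F" unfolding F_def[abs_def] by (intro smooth_sum smooth_cmult BY B)
    have F_eq: "F x = bump \<theta> (Y x) * (\<Sum>s\<in>I. d s * monomial s (Y x))" for x
      by (simp add: F_def B_def sum_distrib_left mult.left_commute)
    have normY: "norm (Y x) = dist x0 x / h" for x
      using h(2) by (simp add: Y_def dist_norm norm_minus_commute)
    have F0: "F x = 0" if "x \<notin> ball x0 (\<theta> * h / 2)" for x
    proof -
      have "\<theta> \<le> 2 * norm (Y x)" using that h(2) by (simp add: normY field_simps)
      then show ?thesis using bump_zero[of \<theta> "Y x"] \<theta> by (simp add: F_eq)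
    qed
    have small: "cball x0 (\<theta> * h / 2) \<subseteq> K"
    proof -
      have "\<theta> * h > 0" using \<theta>(1) h(2) by simp
      then show ?thesis using ball by (force simp: subset_iff)
    qed
    have F_test: "F \<in> test_functions K"
    proof -
      have "(\<lambda>x. if x \<in> K then F x else 0) \<in> test_functions K"
      proof (rule smooth_restrict_test_function(1)[OF K F])
        show "open (- cball x0 (\<theta> * h / 2))" by (intro open_Compl closed_cball)
        show "frontier K \<subseteq> - cball x0 (\<theta> * h / 2)"
          using small K(1) by (auto simp: frontier_def interior_open)
        show "F x = 0" if "x \<in> - cball x0 (\<theta> * h / 2)" for x
          using that by (intro F0) auto
      qed
      moreover have "(\<lambda>x. if x \<in> K then F x else 0) = F"
      proof
        fix x
        have "F x = 0" if "x \<notin> K" using that small ball_subset_cball by (intro F0) blast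
        then show "(if x \<in> K then F x else 0) = F x" by simp
      qed
      ultimately show ?thesis by simp
    qed
    have lapF: "laplacian F x = (\<Sum>s\<in>I. d s * ((1 / h)\<^sup>2 * laplacian (B s) (Y x)))" for x
    proof -
      have p1: "partial i (\<lambda>x. f (Y x)) x = 1 / h * partial i f (Y x)" if "smooth f" for f i x
        unfolding Y_def by (rule partial_scale[OF that])
      have "partial i F x = (\<Sum>s\<in>I. d s * (1 / h * partial i (B s) (Y x)))" for i x
        unfolding F_def[abs_def]
        by (simp only: partial_sum[OF smooth_cmult[OF BY[OF B]]] partial_cmult[OF BY[OF B]] p1[OF B])
      then have "partial i F = (\<lambda>x. \<Sum>s\<in>I. (d s * (1 / h)) * partial i (B s) (Y x))" for i
        by (simp only: mult.assoc fun_eq_iff)  simp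
      then have "partial i (partial i F) x = (\<Sum>s\<in>I. (d s * (1 / h)) * (1 / h * partial i (partial i (B s)) (Y x)))" for i
        by (simp only: partial_sum[OF smooth_cmult[OF BY[OF smooth_partial[OF B]]]]
            partial_cmult[OF BY[OF smooth_partial[OF B]]] p1[OF smooth_partial[OF B]])
      then show ?thesis
        by (simp only: sum_2 sum.distrib[symmetric]) (intro sum.cong refl, simp add: power2_eq_square algebra_simps)
    qed
    have bound: "\<bar>laplacian F x\<bar> \<le> (1 / h)\<^sup>2 * M * Nd" if "x \<in> K" for x
    proof -
      have nY: "norm (Y x) \<le> 1"
        unfolding normY using diameter_bounded_bound[OF K(2) x0 that] h by simp
      have "\<bar>d s * ((1 / h)\<^sup>2 * laplacian (B s) (Y x))\<bar> \<le> \<bar>d s\<bar> * ((1 / h)\<^sup>2 * M)" if "s \<in> I" for s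
        using mult_left_mono[OF mult_left_mono[OF M(2)[OF that nY], of "(1 / h)\<^sup>2"], of "\<bar>d s\<bar>"]
        by (simp only: abs_mult abs_power2 zero_le_power2 abs_ge_zero)
      then have "\<bar>laplacian F x\<bar> \<le> (\<Sum>s\<in>I. \<bar>d s\<bar> * ((1 / h)\<^sup>2 * M))"
        unfolding lapF by (intro order_trans[OF sum_abs] sum_mono)
      then show ?thesis
        unfolding Nd_def sum_distrib_right[symmetric] by (simp only: mult.commute)
    qed
    have lapFs: "smooth (laplacian F)" by (intro smooth_sum smooth_partial F)
    have lapFm: "laplacian F \<in> borel_measurable (lebesgue_on K)"
      using L2_continuous[OF Km K(2) smooth_continuous_on[OF lapFs]] by (simp add: L2_def)
    have nlap: "laplacian F \<in> L2 K" "L2_norm K (laplacian F) \<le> (1 / h)\<^sup>2 * M * Nd * sqrt (measure lebesgue K)"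
      using L2_bounded_function[OF Km lapFm bound] M(1) N by auto
    have "c3 * Nd\<^sup>2 * h\<^sup>2 \<le> (\<integral>x. p x * F x \<partial>lebesgue_on K)"
    proof -
      define f where "f y = bump \<theta> y * (\<Sum>s\<in>I. d s * monomial s y)\<^sup>2" for y
      have fs: "smooth f"
        unfolding f_def[abs_def] by (intro smooth_mult smooth_bump smooth_power smooth_sum smooth_cmult smooth_shifted_monomial)
      have fm [measurable]: "f \<in> borel_measurable borel"
        by (intro borel_measurable_continuous_onI smooth_continuous_on fs)
      have f0: "f y = 0" if "norm y \<ge> \<theta> / 2" for y
        using bump_zero[of \<theta> y] that \<theta> by (simp add: f_def)
      have "(\<integral>x. p x * F x \<partial>lebesgue_on K) = (\<integral>x. f (Y x) \<partial>lebesgue_on K)"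
        by (rule Bochner_Integration.integral_cong)
          (auto simp: coef d F_eq f_def shifted_monomial_scale[of x0] Y_def power2_eq_square)
      also have "\<dots> = (\<integral>x. indicator K x * f (Y x) \<partial>lborel)"
        using K(1) by (intro lebesgue_on_borel borel_measurable_continuous_onI smooth_continuous_on BY fs) auto
      also have "\<dots> = (\<integral>x. f (Y x) \<partial>lborel)"
      proof (rule Bochner_Integration.integral_cong[OF refl])
        fix x
        show "indicator K x * f (Y x) = f (Y x)"
        proof (cases "x \<in> K")
          case False
          then have "x \<notin> cball x0 (\<theta> * h / 2)" using small by blast
          then have "norm (Y x) \<ge> \<theta> / 2" using h(2) by (simp add: normY field_simps)
          then show ?thesis using f0 by simp
        qed simp
      qed
      also have "\<dots> = h\<^sup>2 * (\<integral>y. f y \<partial>lborel)"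
        unfolding Y_def by (rule lborel_integral_scale[OF h(2) fm])
      also have "(\<integral>y. f y \<partial>lborel) = (\<integral>y. indicator (cbox (-1) 1) y * f y \<partial>lborel)"
      proof (rule Bochner_Integration.integral_cong[OF refl])
        fix y :: "real^2"
        show "f y = indicator (cbox (-1) 1) y * f y"
        proof (cases "y \<in> cbox (-1) 1")
          case False
          have "norm y \<ge> \<theta> / 2"
          proof (rule ccontr)
            assume "\<not> norm y \<ge> \<theta> / 2"
            then have "norm y < 1" using \<theta> by simp
            then have "\<bar>y $ 1\<bar> < 1" "\<bar>y $ 2\<bar> < 1" using component_le_norm_cart[of y] by (meson le_less_trans)+
            then show False using False by (simp add: mem_box_cart forall_2 abs_less_iff less_imp_le)
          qed
          then show ?thesis using f0 by simp
        qed simp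
      qed
      also have "\<dots> = (\<integral>y. f y \<partial>lebesgue_on (cbox (-1) 1))"
        by (rule lebesgue_on_borel(1)[symmetric]) auto
      also have "\<dots> = integral (cbox (-1) 1) f"
        by (rule lebesgue_integral_eq_integral)
          (auto intro!: integrable_smooth fs)
      finally have "(\<integral>x. p x * F x \<partial>lebesgue_on K) = h\<^sup>2 * integral (cbox (-1) 1) f" .
      moreover have "c3 * Nd\<^sup>2 \<le> integral (cbox (-1) 1) f"
        using c3(2)[of d] unfolding f_def[abs_def] Nd_def .
      ultimately show ?thesis
        using mult_left_mono[of "c3 * Nd\<^sup>2" "integral (cbox (-1) 1) f" "h\<^sup>2"] by (simp add: mult_ac)
    qed
    also have "(\<integral>x. p x * F x \<partial>lebesgue_on K) = (\<integral>x. v x * laplacian F x \<partial>lebesgue_on K)"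
      using lap F_test by (simp add: weak_laplacian_def)
    also have "\<dots> \<le> L2_norm K v * L2_norm K (laplacian F)"
      using L2_Cauchy_Schwarz[OF v nlap(1)] by linarith
    also have "\<dots> \<le> L2_norm K v * ((1 / h)\<^sup>2 * M * Nd * (sqrt pi * h))"
    proof -
      have "sqrt (measure lebesgue K) \<le> sqrt (pi * h\<^sup>2)"
        by (rule real_sqrt_le_mono[OF measure_le_diameter[OF Km K(2) x0 h(1)]])
      also have "\<dots> = sqrt pi * h" using h(2) by (simp add: real_sqrt_mult)
      finally have "(1 / h)\<^sup>2 * M * Nd * sqrt (measure lebesgue K) \<le> (1 / h)\<^sup>2 * M * Nd * (sqrt pi * h)"
        using M(1) N by (intro mult_left_mono) auto
      then show ?thesis
        using nlap(2) by (intro mult_left_mono L2_norm_nonneg) linarith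
    qed
    finally have "c3 * Nd\<^sup>2 * h\<^sup>2 \<le> L2_norm K v * ((1 / h)\<^sup>2 * M * Nd * (sqrt pi * h))" .
    then have "(c3 * Nd\<^sup>2 * h\<^sup>2) * h \<le> (L2_norm K v * ((1 / h)\<^sup>2 * M * Nd * (sqrt pi * h))) * h"
      using h(2) by (intro mult_right_mono) auto
    also have "\<dots> = (sqrt pi * M * L2_norm K v) * Nd"
      using h(2) by (simp add: power2_eq_square field_simps)
    finally have "(c3 * h ^ 3 * Nd) * Nd \<le> (sqrt pi * M * L2_norm K v) * Nd"
      by (simp add: power2_eq_square power3_eq_cube mult_ac)
    then have Nd: "c3 * h ^ 3 * Nd \<le> sqrt pi * M * L2_norm K v"
      using N M(1) L2_norm_nonneg[of K v] by (cases "Nd = 0") auto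
    (* On a square of size h around xc both expansions are the same polynomial, and x0 is at distance at most h. *)
    have Nc: "Nc \<le> 2 ^ nat l * sqrt (V / c4) * Nd"
    proof -
      have "c4 * Nc\<^sup>2 \<le> integral (cbox (-1) 1) (\<lambda>y. (\<Sum>s\<in>I. c s * monomial s y)\<^sup>2)"
        using c4(2)[of c] unfolding Nc_def .
      also have "\<dots> \<le> integral (cbox (-1) (1::real^2)) (\<lambda>y. (2 ^ nat l * Nd)\<^sup>2)"
      proof (rule Henstock_Kurzweil_Integration.integral_le)
        show "(\<lambda>y. (\<Sum>s\<in>I. c s * monomial s y)\<^sup>2) integrable_on cbox (-1) 1"
          by (intro integrable_continuous smooth_continuous_on smooth_power smooth_sum smooth_cmult smooth_shifted_monomial)
        fix y :: "real^2" assume y: "y \<in> cbox (-1) 1"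
        have "(\<Sum>s\<in>I. c s * monomial s y) = (\<Sum>s\<in>I. c s * shifted_monomial xc h s (xc + h *\<^sub>R y))"
          using h(2) by (simp add: shifted_monomial_def)
        also have "\<dots> = (\<Sum>s\<in>I. d s * shifted_monomial x0 h s (xc + h *\<^sub>R y))"
          using c d by simp
        finally have "\<bar>\<Sum>s\<in>I. c s * monomial s y\<bar> \<le> (\<Sum>s\<in>I. \<bar>d s * shifted_monomial x0 h s (xc + h *\<^sub>R y)\<bar>)"
          by (simp only: sum_abs)
        also have "\<dots> \<le> (\<Sum>s\<in>I. \<bar>d s\<bar> * 2 ^ nat l)"
        proof (rule sum_mono)
          fix s assume s: "s \<in> I"
          have "\<bar>(xc + h *\<^sub>R y - x0) $ k / h\<bar> \<le> 2" for k
          proof -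
            have "\<bar>(xc - x0) $ k\<bar> \<le> h"
              using component_le_norm_cart[of "xc - x0" k] xc by (simp add: norm_minus_commute)
            then have "\<bar>(xc - x0) $ k / h\<bar> \<le> 1" using h(2) by simp
            moreover have "\<bar>y $ k\<bar> \<le> 1" using y by (simp add: mem_box_cart abs_le_iff minus_le_iff)
            moreover have "(xc + h *\<^sub>R y - x0) $ k / h = (xc - x0) $ k / h + y $ k"
              using h(2) by (simp add: field_simps)
            ultimately show ?thesis by linarith
          qed
          then have "\<bar>shifted_monomial x0 h s (xc + h *\<^sub>R y)\<bar> \<le> 2 ^ nat l"
            using s by (intro shifted_monomial_bound) (auto simp: I_def)
          then show "\<bar>d s * shifted_monomial x0 h s (xc + h *\<^sub>R y)\<bar> \<le> \<bar>d s\<bar> * 2 ^ nat l"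
            unfolding abs_mult by (intro mult_left_mono) auto
        qed
        also have "\<dots> = 2 ^ nat l * Nd" unfolding Nd_def sum_distrib_right[symmetric] by (rule mult.commute)
        finally show "(\<Sum>s\<in>I. c s * monomial s y)\<^sup>2 \<le> (2 ^ nat l * Nd)\<^sup>2"
          using N by (simp add: abs_le_square_iff[symmetric])
      qed auto
      also have "\<dots> = (2 ^ nat l * Nd)\<^sup>2 * V" by (simp add: V_def)
      finally have "Nc\<^sup>2 \<le> (2 ^ nat l * Nd)\<^sup>2 * (V / c4)"
        using c4(1) by (simp add: field_simps)
      then have "sqrt (Nc\<^sup>2) \<le> sqrt ((2 ^ nat l * Nd)\<^sup>2 * (V / c4))" by (rule real_sqrt_le_mono)
      then have "\<bar>Nc\<bar> \<le> \<bar>2 ^ nat l * Nd\<bar> * sqrt (V / c4)"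
        by (simp only: real_sqrt_mult real_sqrt_abs)
      then show ?thesis using N by (simp add: abs_mult mult_ac)
    qed
    have "h ^ 3 * Nc \<le> C * L2_norm K v"
    proof -
      let ?A = "2 ^ nat l * sqrt (V / c4)"
      have A: "?A \<ge> 0" using V c4(1) by simp
      have "h ^ 3 * Nc \<le> h ^ 3 * (?A * Nd)" using Nc h(2) by (intro mult_left_mono) auto
      also have "\<dots> = ?A * (h ^ 3 * Nd)" by (simp add: mult_ac)
      also have "h ^ 3 * Nd \<le> sqrt pi * M / c3 * L2_norm K v"
        using Nd c3(1) by (simp add: field_simps)
      finally have "h ^ 3 * Nc \<le> ?A * (sqrt pi * M / c3 * L2_norm K v)" using A by (simp add: mult_left_mono)
      also have "\<dots> \<le> C * L2_norm K v"
      proof -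
        have "?A * (sqrt pi * M / c3 * L2_norm K v) = (C - 1) * L2_norm K v"
          by (simp only: C_def mult.assoc add_diff_cancel_right')
        then show ?thesis using L2_norm_nonneg[of K v] by (simp only: left_diff_distrib)
      qed
      finally show ?thesis .
    qed
    moreover have "\<forall>x\<in>K. p x = (\<Sum>s\<in>I. c s * shifted_monomial xc h s x)" using coef c by simp
    ultimately show "\<exists>c. (\<forall>x\<in>K. p x = (\<Sum>s\<in>multi_indices l. c s * shifted_monomial xc h s x)) \<and>
        h ^ 3 * (\<Sum>s\<in>multi_indices l. \<bar>c s\<bar>) \<le> C * L2_norm K v"
      unfolding Nc_def I_def by blast
  qed
qed

section \<open>Triangulated polygons\<close>

lemma triangle_convex_hull: "triangle a u w = convex hull {a, a + u, a + w}"
proof -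
  have "convex hull {a, a + u, a + w} = {r *\<^sub>R a + s *\<^sub>R (a + u) + t *\<^sub>R (a + w) | r s t. 0 \<le> r \<and> 0 \<le> s \<and> 0 \<le> t \<and> r + s + t = 1}"
    by (rule convex_hull_3)
  also have "\<dots> = chart a u w ` {(s, t). 0 \<le> s \<and> 0 \<le> t \<and> s + t \<le> 1}"
  proof (intro equalityI subsetI)
    fix x assume "x \<in> {r *\<^sub>R a + s *\<^sub>R (a + u) + t *\<^sub>R (a + w) | r s t. 0 \<le> r \<and> 0 \<le> s \<and> 0 \<le> t \<and> r + s + t = 1}"
    then obtain r s t where x: "x = r *\<^sub>R a + s *\<^sub>R (a + u) + t *\<^sub>R (a + w)" and p: "0 \<le> r" "0 \<le> s" "0 \<le> t" "r + s + t = 1" by blast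
    have "x = (r + s + t) *\<^sub>R a + s *\<^sub>R u + t *\<^sub>R w"
      unfolding x by (simp add: scaleR_add_left scaleR_add_right)
    then have "x = chart a u w (s, t)" using p(4) by (simp add: chart_def)
    then show "x \<in> chart a u w ` {(s, t). 0 \<le> s \<and> 0 \<le> t \<and> s + t \<le> 1}"
      using p by (intro image_eqI[of _ _ "(s, t)"]) auto
  next
    fix x assume "x \<in> chart a u w ` {(s, t). 0 \<le> s \<and> 0 \<le> t \<and> s + t \<le> 1}"
    then obtain s t where x: "x = chart a u w (s, t)" and p: "0 \<le> s" "0 \<le> t" "s + t \<le> 1" by auto
    have "x = (1 - s - t) *\<^sub>R a + s *\<^sub>R (a + u) + t *\<^sub>R (a + w)"
      unfolding x chart_def by (simp add: scaleR_diff_left scaleR_add_right)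
    then show "x \<in> {r *\<^sub>R a + s *\<^sub>R (a + u) + t *\<^sub>R (a + w) | r s t. 0 \<le> r \<and> 0 \<le> s \<and> 0 \<le> t \<and> r + s + t = 1}"
      using p by (intro CollectI exI[of _ "1 - s - t"] exI[of _ s] exI[of _ t]) auto
  qed
  finally show ?thesis by (simp add: triangle_eq)
qed

lemma det2_nonzero:
  assumes "interior (triangle a u w) \<noteq> {}"
  shows "det2 u w \<noteq> 0"
proof
  assume det: "det2 u w = 0"
  have "\<exists>n. n \<noteq> 0 \<and> n \<bullet> u = 0 \<and> n \<bullet> w = 0"
  proof (cases "u = 0")
    case False
    then have "vector [- u $ 2, u $ 1] \<noteq> (0::real^2)" by (auto simp: vec_eq_iff forall_2)
    then show ?thesis
      using det by (intro exI[of _ "vector [- u $ 2, u $ 1]"]) (auto simp: inner_2 det2_def algebra_simps)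
  next
    case True
    show ?thesis
    proof (cases "w = 0")
      case False
      then have "vector [- w $ 2, w $ 1] \<noteq> (0::real^2)" by (auto simp: vec_eq_iff forall_2)
      then show ?thesis
        using True by (intro exI[of _ "vector [- w $ 2, w $ 1]"]) (auto simp: inner_2 algebra_simps)
    next
      assume "w = 0"
      then show ?thesis using True by (intro exI[of _ "axis 1 1"]) (simp add: axis_eq_0_iff)
    qed
  qed
  then obtain n where n: "n \<noteq> 0" "n \<bullet> u = 0" "n \<bullet> w = 0" by blast
  have "triangle a u w \<subseteq> {x. n \<bullet> x = n \<bullet> a}"
    unfolding triangle_eq using n by (auto simp: chart_def inner_add_right)
  then have "interior (triangle a u w) \<subseteq> interior {x. n \<bullet> x = n \<bullet> a}" by (rule interior_mono)
  then show False using assms interior_hyperplane[OF n(1)] by simp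
qed

locale triangulated_polygon =
  fixes K ps \<T> and \<kappa> \<sigma> c\<^sub>0 :: real
  assumes polygon: "simple_polygon K ps"
    and virtual: "virtual_triangulation \<kappa> \<sigma> c\<^sub>0 K ps \<T>"
begin

lemma open_K: "open K" and bounded_K: "bounded K" and length_ps: "length ps \<ge> 3" and distinct_ps: "distinct ps"
  and frontier_K: "frontier K = (\<Union>i<length ps. polygon_edge ps i)"
  using polygon unfolding simple_polygon_def by blast+

lemma lmeasurable_K: "K \<in> lmeasurable"
  using open_K bounded_K by (rule lmeasurable_open[OF _, rotated])

lemma finite_T: "finite \<T>" and simplex_T: "\<tau> \<in> \<T> \<Longrightarrow> 2 simplex \<tau>" and Union_T: "\<Union>\<T> = closure K"
  and face_T: "\<tau> \<in> \<T> \<Longrightarrow> \<tau>' \<in> \<T> \<Longrightarrow> \<tau> \<inter> \<tau>' face_of \<tau>"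
  and edge_T: "i < length ps \<Longrightarrow> \<exists>\<tau>\<in>\<T>. polygon_edge ps i edge_of \<tau>"
  and inscribed_T: "\<tau> \<in> \<T> \<Longrightarrow> \<exists>x r. inscribed_circle \<tau> x r \<and> diameter \<tau> / r \<le> \<kappa>"
  and diameter_T: "\<tau> \<in> \<T> \<Longrightarrow> diameter K \<le> c\<^sub>0 * diameter \<tau>"
  using virtual unfolding virtual_triangulation_def triangulation_def by blast+

lemma vtx_mod: "i < length ps \<Longrightarrow> vtx ps i = ps ! i"
  by (simp add: vtx_def)

lemma vtx_distinct:
  assumes "i < length ps"
  shows "vtx ps i \<noteq> vtx ps (Suc i)"
proof
  assume "vtx ps i = vtx ps (Suc i)"
  then have "i mod length ps = Suc i mod length ps"
  proof -
    have "Suc i mod length ps < length ps" using length_ps by (intro mod_less_divisor) linarith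
    then have "i = Suc i mod length ps"
      using nth_eq_iff_index_eq[OF distinct_ps assms] \<open>vtx ps i = vtx ps (Suc i)\<close> assms by (simp add: vtx_def)
    then show ?thesis using assms by simp
  qed
  then show False
    using assms length_ps by (cases "Suc i = length ps") auto
qed

lemma diameter_pos: "diameter K > 0"
proof -
  have "vtx ps 0 \<in> frontier K"
    using length_ps by (auto simp: frontier_K polygon_edge_def intro!: bexI[of _ 0])
  then have "K \<noteq> {}" by auto
  then obtain x e where e: "e > 0" "ball x e \<subseteq> K"
    using open_K open_contains_ball by blast
  have "x + (e / 2) *\<^sub>R axis 1 1 \<in> ball x e" "x \<in> ball x e" using e(1) by (auto simp: dist_norm)
  then have "dist x (x + (e / 2) *\<^sub>R axis 1 1) \<le> diameter K"
    using e(2) by (intro diameter_bounded_bound[OF bounded_K]) auto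
  then show ?thesis using e(1) by (simp add: dist_norm)
qed

lemma T_subset: "\<tau> \<in> \<T> \<Longrightarrow> \<tau> \<subseteq> closure K"
  using Union_T by blast



lemma aff_dim_T: "\<tau> \<in> \<T> \<Longrightarrow> aff_dim \<tau> = 2"
  using simplex_T aff_dim_simplex by blast

lemma convex_T: "\<tau> \<in> \<T> \<Longrightarrow> convex \<tau>"
  using simplex_T convex_simplex by blast

text \<open>The three sides of a triangle have no common point, hence an inscribed circle is not a single point.\<close>

lemma inball:
  assumes \<tau>: "\<tau> \<in> \<T>"
  shows "c\<^sub>0 * \<kappa> > 0" and "\<exists>x. cball x (diameter K / (c\<^sub>0 * \<kappa>)) \<subseteq> \<tau>"
proof -
  obtain C where C: "\<not> affine_dependent C" "card C = 3" "\<tau> = convex hull C"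
    using simplex_T[OF \<tau>] unfolding simplex_def by auto
  obtain a b c where abc: "C = {a, b, c}" "a \<noteq> b" "a \<noteq> c" "b \<noteq> c"
    using C(2) by (auto simp: card_3_iff)
  obtain x r where r: "inscribed_circle \<tau> x r" "diameter \<tau> / r \<le> \<kappa>"
    using inscribed_T[OF \<tau>] by blast
  have edge: "convex hull {p, q} edge_of \<tau>" if "{p, q} \<subseteq> C" "p \<noteq> q" for p q
    unfolding edge_of_def
  proof
    show "convex hull {p, q} face_of \<tau>"
      using face_of_convex_hull_affine_independent[OF C(1)] that C(3) by blast
    show "aff_dim (convex hull {p, q}) = 1"
      using that(2) by (simp add: aff_dim_convex_hull aff_dim_2)
  qed
  have meet: "cball x r \<inter> convex hull {p, q} \<noteq> {}" if "{p, q} \<subseteq> C" "p \<noteq> q" for p q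
    using r(1) edge[OF that] by (auto simp: inscribed_circle_def)
  have "r > 0"
  proof (rule ccontr)
    assume "\<not> r > 0"
    then have "cball x r \<subseteq> {x}" by (auto simp: subset_iff dest: order_trans[of _ r 0])
    then have m: "x \<in> convex hull {a, b}" "x \<in> convex hull {b, c}" "x \<in> convex hull {a, c}"
      using meet[of a b] meet[of b c] meet[of a c] abc by auto
    have "convex hull {a, b} \<inter> convex hull {b, c} = convex hull ({a, b} \<inter> {b, c})"
      using C(1) abc(1) by (intro convex_hull_Int[symmetric]) (simp add: insert_commute)
    also have "{a, b} \<inter> {b, c} = {b}" using abc by auto
    finally have "x = b" using m by auto
    have "convex hull {b} \<inter> convex hull {a, c} = convex hull ({b} \<inter> {a, c})"
      using C(1) abc(1) by (intro convex_hull_Int[symmetric]) (simp add: insert_commute)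
    also have "{b} \<inter> {a, c} = {}" using abc by auto
    finally show False using m(3) \<open>x = b\<close> by auto
  qed
  have h: "diameter K > 0" by (rule diameter_pos)
  have hc: "diameter K \<le> c\<^sub>0 * diameter \<tau>" by (rule diameter_T[OF \<tau>])
  have "bounded \<tau>" using T_subset[OF \<tau>] bounded_K bounded_closure bounded_subset by blast
  then have d0: "diameter \<tau> \<ge> 0" by (rule diameter_ge_0)
  then have d: "c\<^sub>0 > 0" "diameter \<tau> > 0"
    using h hc by (metis mult_nonpos_nonneg not_less order_trans, metis mult_zero_right not_less order_antisym_conv order_trans)
  have dr: "diameter \<tau> \<le> \<kappa> * r" using r(2) \<open>r > 0\<close> by (simp add: pos_divide_le_eq)
  have "\<kappa> > 0" using dr d(2) \<open>r > 0\<close> by (metis mult_nonpos_nonneg less_le_trans linorder_not_less order_less_imp_le)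
  then show ck: "c\<^sub>0 * \<kappa> > 0" using d by simp
  have "diameter K \<le> (c\<^sub>0 * \<kappa>) * r"
    using order_trans[OF hc mult_left_mono[OF dr, of c\<^sub>0]] d by (simp add: mult.assoc)
  then have "diameter K / (c\<^sub>0 * \<kappa>) \<le> r" using ck by (simp add: pos_divide_le_eq mult.commute)
  then have "cball x (diameter K / (c\<^sub>0 * \<kappa>)) \<subseteq> cball x r" by (rule subset_cball)
  also have "\<dots> \<subseteq> \<tau>" using r(1) by (simp add: inscribed_circle_def)
  finally show "\<exists>x. cball x (diameter K / (c\<^sub>0 * \<kappa>)) \<subseteq> \<tau>" by blast
qed

text \<open>Two triangles meet in a common face, and a proper face has smaller dimension and misses the interior.\<close>

lemma T_interior_unique:
  assumes "\<tau> \<in> \<T>" "\<tau>' \<in> \<T>" "x \<in> interior \<tau>" "x \<in> \<tau>'"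
  shows "\<tau>' = \<tau>"
proof -
  have "\<tau> \<inter> \<tau>' = \<tau>"
    using face_of_disjoint_interior[OF face_T[OF assms(1,2)]] assms(3,4) interior_subset by blast
  then have "\<tau> face_of \<tau>'" using face_T[OF assms(2,1)] by (simp add: Int_commute)
  then show ?thesis
    using face_of_aff_dim_lt[OF convex_T[OF assms(2)]] aff_dim_T assms by fastforce
qed

text \<open>A point of the frontier of \<open>K\<close> lies on an edge of \<open>K\<close>, hence on a side of some triangle, and therefore in the interior of no
  triangle.\<close>

lemma interior_T_subset:
  assumes "\<tau> \<in> \<T>"
  shows "interior \<tau> \<subseteq> K"
proof
  fix x assume x: "x \<in> interior \<tau>"
  show "x \<in> K"
  proof (rule ccontr)
    assume "x \<notin> K"
    moreover have "x \<in> closure K" using x T_subset[OF assms] interior_subset by blast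
    ultimately have "x \<in> frontier K" by (simp add: frontier_def interior_open[OF open_K])
    then obtain i where i: "i < length ps" "x \<in> polygon_edge ps i" by (auto simp: frontier_K)
    obtain \<tau>' where \<tau>': "\<tau>' \<in> \<T>" "polygon_edge ps i edge_of \<tau>'" using edge_T[OF i(1)] by blast
    then have "x \<in> \<tau>'" using i(2) edge_of_imp_subset by blast
    then have "\<tau>' = \<tau>" using T_interior_unique[OF assms \<tau>'(1) x] by simp
    then have e: "polygon_edge ps i face_of \<tau>" "aff_dim (polygon_edge ps i) = 1" using \<tau>'(2) by (auto simp: edge_of_def)
    then have "polygon_edge ps i \<noteq> \<tau>" using aff_dim_T[OF assms] by auto
    then show False using face_of_disjoint_interior[OF e(1)] x i(2) by blast
  qed
qed

lemma triangle_with_vertex: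
  assumes \<tau>: "\<tau> \<in> \<T>" and a: "a extreme_point_of \<tau>"
  obtains u w where "\<tau> = triangle a u w" "det2 u w \<noteq> 0"
proof -
  obtain C where C: "\<not> affine_dependent C" "card C = 3" "\<tau> = convex hull C"
    using simplex_T[OF \<tau>] unfolding simplex_def by auto
  have aC: "a \<in> C" using a extreme_point_of_convex_hull C(3) by blast
  obtain b c where abc: "C = {a, b, c}"
  proof -
    have "card (C - {a}) = 2" using C(2) aC by simp
    then obtain b c where "C - {a} = {b, c}" by (auto simp: card_2_iff)
    then show ?thesis using that[of b c] aC by blast
  qed
  have eq: "\<tau> = triangle a (b - a) (c - a)"
    unfolding triangle_convex_hull using C(3) abc by simp
  have "interior \<tau> \<noteq> {}"
  proof -
    obtain x where "cball x (diameter K / (c\<^sub>0 * \<kappa>)) \<subseteq> \<tau>" using inball(2)[OF \<tau>] by blast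
    then have "interior (cball x (diameter K / (c\<^sub>0 * \<kappa>))) \<subseteq> interior \<tau>" by (rule interior_mono)
    moreover have "x \<in> ball x (diameter K / (c\<^sub>0 * \<kappa>))" using diameter_pos inball(1)[OF \<tau>] by simp
    ultimately show ?thesis by (auto simp: interior_cball)
  qed
  then have "det2 (b - a) (c - a) \<noteq> 0" using det2_nonzero eq by simp
  with eq show ?thesis by (rule that)
qed

lemma triangle_with_edge:
  assumes \<tau>: "\<tau> \<in> \<T>" and e: "closed_segment a b face_of \<tau>" "a \<noteq> b"
  obtains w where "\<tau> = triangle a (b - a) w" "det2 (b - a) w \<noteq> 0"
proof -
  obtain C where C: "\<not> affine_dependent C" "card C = 3" "\<tau> = convex hull C"
    using simplex_T[OF \<tau>] unfolding simplex_def by auto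
  have ab: "a \<in> C" "b \<in> C" using segment_face_of[OF e(1)] extreme_point_of_convex_hull C(3) by blast+
  obtain c where abc: "C = {a, b, c}"
  proof -
    have "card (C - {a, b}) = 1" using C(2) ab e(2) by (simp add: card_Diff_subset)
    then obtain c where "C - {a, b} = {c}" by (auto simp: card_1_singleton_iff)
    then show ?thesis using that[of c] ab by blast
  qed
  have eq: "\<tau> = triangle a (b - a) (c - a)"
    unfolding triangle_convex_hull using C(3) abc by simp
  have "interior \<tau> \<noteq> {}"
  proof -
    obtain x where "cball x (diameter K / (c\<^sub>0 * \<kappa>)) \<subseteq> \<tau>" using inball(2)[OF \<tau>] by blast
    then have "interior (cball x (diameter K / (c\<^sub>0 * \<kappa>))) \<subseteq> interior \<tau>" by (rule interior_mono)
    moreover have "x \<in> ball x (diameter K / (c\<^sub>0 * \<kappa>))" using diameter_pos inball(1)[OF \<tau>] by simp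
    ultimately show ?thesis by (auto simp: interior_cball)
  qed
  then have "det2 (b - a) (c - a) \<noteq> 0" using det2_nonzero eq by simp
  with eq show ?thesis by (rule that)
qed

lemma open_triangle_subset_K:
  assumes "\<tau> \<in> \<T>" "\<tau> = triangle a u w" "det2 u w \<noteq> 0"
  shows "open_triangle a u w \<subseteq> K"
  using interior_maximal[OF open_triangle_subset[OF assms(3)] open_open_triangle] interior_T_subset[OF assms(1)] assms(2)
  by blast

text \<open>An edge of the polygon is itself a side of a triangle, and two triangles meet in a common face.\<close>

lemma edge_inter_T:
  assumes \<tau>: "\<tau> \<in> \<T>" and i: "i < length ps"
  shows "\<tau> \<inter> polygon_edge ps i = {} \<or> polygon_edge ps i face_of \<tau> \<or>
    (\<exists>v\<in>{vtx ps i, vtx ps (Suc i)}. v extreme_point_of \<tau> \<and> \<tau> \<inter> polygon_edge ps i = {v})"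
proof -
  let ?e = "polygon_edge ps i"
  obtain \<tau>' where \<tau>': "\<tau>' \<in> \<T>" "?e face_of \<tau>'" using edge_T[OF i] by (auto simp: edge_of_def)
  have sub: "?e \<subseteq> \<tau>'" using \<tau>'(2) by (rule face_of_imp_subset)
  have "(\<tau>' \<inter> \<tau>) \<inter> ?e face_of \<tau>'" using face_of_Int[OF face_T[OF \<tau>'(1) \<tau>] \<tau>'(2)] .
  moreover have "(\<tau>' \<inter> \<tau>) \<inter> ?e = \<tau> \<inter> ?e" using sub by blast
  ultimately have F: "\<tau> \<inter> ?e face_of \<tau>'" by simp
  have "\<tau> \<inter> ?e face_of \<tau>' \<inter> \<tau>"
    by (rule face_of_subset[OF F]) (use sub in auto)
  then have F\<tau>: "\<tau> \<inter> ?e face_of \<tau>"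
    using face_of_trans[OF _ face_T[OF \<tau> \<tau>'(1)]] by (simp add: Int_commute)
  have "\<tau> \<inter> ?e face_of ?e" by (rule face_of_subset[OF F]) (use sub in auto)
  moreover have "?e = convex hull {vtx ps i, vtx ps (Suc i)}" by (simp add: polygon_edge_def segment_convex_hull)
  ultimately obtain S where S: "S \<subseteq> {vtx ps i, vtx ps (Suc i)}" "\<tau> \<inter> ?e = convex hull S"
    using face_of_convex_hull_subset[of "{vtx ps i, vtx ps (Suc i)}" "\<tau> \<inter> ?e"] by (metis finite.emptyI finite.insertI finite_imp_compact)
  consider "S = {}" | v where "S = {v}" "v \<in> {vtx ps i, vtx ps (Suc i)}" | "S = {vtx ps i, vtx ps (Suc i)}"
    using S(1) by blast
  then show ?thesis
  proof cases
    case 1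
    then show ?thesis using S(2) by simp
  next
    case (2 v)
    then have "\<tau> \<inter> ?e = {v}" using S(2) by simp
    moreover from this have "v extreme_point_of \<tau>" using F\<tau> by (simp add: face_of_singleton)
    ultimately show ?thesis using 2 by blast
  next
    case 3
    then have "\<tau> \<inter> ?e = ?e" using S(2) by (simp add: polygon_edge_def segment_convex_hull)
    then show ?thesis using F\<tau> by simp
  qed
qed

lemma edge_triangle:
  assumes i: "i < length ps"
  obtains w where "triangle (vtx ps i) (vtx ps (Suc i) - vtx ps i) w \<in> \<T>" "det2 (vtx ps (Suc i) - vtx ps i) w \<noteq> 0"
proof -
  obtain \<tau> where \<tau>: "\<tau> \<in> \<T>" "closed_segment (vtx ps i) (vtx ps (Suc i)) face_of \<tau>"
    using edge_T[OF i] by (auto simp: edge_of_def polygon_edge_def)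
  then show ?thesis using triangle_with_edge[OF \<tau> vtx_distinct[OF i]] that by metis
qed

text \<open>The number of triangles is bounded because each of them contains a disc of radius comparable to that of \<open>K\<close>.\<close>

lemma length_ps_bound:
  assumes \<theta>: "0 < \<theta>" "\<theta> \<le> 1 / (c\<^sub>0 * \<kappa>)"
  shows "real (length ps) \<le> 3 / \<theta>\<^sup>2"
proof -
  let ?h = "diameter K"
  have "\<exists>x. ball x (\<theta> * ?h) \<subseteq> \<tau>" if t: "\<tau> \<in> \<T>" for \<tau>
  proof -
    obtain x where x: "cball x (?h / (c\<^sub>0 * \<kappa>)) \<subseteq> \<tau>" using inball(2)[OF t] by blast
    have "\<theta> * ?h \<le> ?h / (c\<^sub>0 * \<kappa>)" using mult_right_mono[OF \<theta>(2), of ?h] diameter_pos by simp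
    then have "ball x (\<theta> * ?h) \<subseteq> cball x (?h / (c\<^sub>0 * \<kappa>))" by (auto simp: subset_iff)
    then show ?thesis using x by blast
  qed
  then obtain X where X: "\<And>\<tau>. \<tau> \<in> \<T> \<Longrightarrow> ball (X \<tau>) (\<theta> * ?h) \<subseteq> \<tau>" by metis
  have int: "ball (X \<tau>) (\<theta> * ?h) \<subseteq> interior \<tau>" if "\<tau> \<in> \<T>" for \<tau>
    by (rule interior_maximal[OF X[OF that] open_ball])
  have "disjoint_family_on (\<lambda>\<tau>. ball (X \<tau>) (\<theta> * ?h)) \<T>"
    unfolding disjoint_family_on_def
  proof (intro ballI impI)
    fix \<tau> \<tau>' assume t: "\<tau> \<in> \<T>" "\<tau>' \<in> \<T>" "\<tau> \<noteq> \<tau>'"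
    show "ball (X \<tau>) (\<theta> * ?h) \<inter> ball (X \<tau>') (\<theta> * ?h) = {}"
      using T_interior_unique[OF t(1,2)] int[OF t(1)] X[OF t(2)] t(3) by blast
  qed
  then have "measure lebesgue (\<Union>\<tau>\<in>\<T>. ball (X \<tau>) (\<theta> * ?h)) = (\<Sum>\<tau>\<in>\<T>. measure lebesgue (ball (X \<tau>) (\<theta> * ?h)))"
    using less_imp_neq[OF emeasure_bounded_finite[OF bounded_ball]]
    by (intro measure_finite_Union finite_T) auto
  also have "\<dots> = real (card \<T>) * (pi * (\<theta> * ?h)\<^sup>2)"
    using \<theta>(1) diameter_pos by (simp add: content_ball unit_ball_vol_2)
  finally have "real (card \<T>) * (pi * (\<theta> * ?h)\<^sup>2) = measure lebesgue (\<Union>\<tau>\<in>\<T>. ball (X \<tau>) (\<theta> * ?h))" by simp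
  also have "\<dots> \<le> measure lebesgue K"
    using int interior_T_subset lmeasurable_K
    by (intro measure_mono_fmeasurable) (auto intro!: sets.finite_UN finite_T)
  also have "\<dots> \<le> pi * ?h\<^sup>2"
  proof -
    obtain x where "x \<in> K" using diameter_pos by (metis all_not_in_conv diameter_empty less_irrefl)
    then show ?thesis by (rule measure_le_diameter[OF lmeasurable_K bounded_K _ refl])
  qed
  finally have "real (card \<T>) * \<theta>\<^sup>2 \<le> 1"
    using diameter_pos by (simp add: power_mult_distrib)
  then have cT: "real (card \<T>) \<le> 1 / \<theta>\<^sup>2" using \<theta>(1) by (simp add: field_simps)
  have "\<exists>C. card C = 3 \<and> \<tau> = convex hull C" if "\<tau> \<in> \<T>" for \<tau>
    using simplex_T[OF that] unfolding simplex_def by auto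
  then obtain C where C: "\<And>\<tau>. \<tau> \<in> \<T> \<Longrightarrow> card (C \<tau>) = 3" "\<And>\<tau>. \<tau> \<in> \<T> \<Longrightarrow> \<tau> = convex hull (C \<tau>)" by metis
  have "set ps \<subseteq> (\<Union>\<tau>\<in>\<T>. C \<tau>)"
  proof
    fix p assume "p \<in> set ps"
    then obtain i where i: "i < length ps" "p = vtx ps i" by (auto simp: in_set_conv_nth vtx_def)
    obtain \<tau> where \<tau>: "\<tau> \<in> \<T>" "closed_segment (vtx ps i) (vtx ps (Suc i)) face_of \<tau>"
      using edge_T[OF i(1)] by (auto simp: edge_of_def polygon_edge_def)
    have "p extreme_point_of convex hull (C \<tau>)" using segment_face_of(1)[OF \<tau>(2)] i(2) C(2)[OF \<tau>(1)] by simp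
    then show "p \<in> (\<Union>\<tau>\<in>\<T>. C \<tau>)" using extreme_point_of_convex_hull \<tau>(1) by blast
  qed
  then have "card (set ps) \<le> card (\<Union>\<tau>\<in>\<T>. C \<tau>)"
    using C(1) by (intro card_mono finite_UN_I finite_T) (auto intro: card_ge_0_finite)
  also have "\<dots> \<le> (\<Sum>\<tau>\<in>\<T>. card (C \<tau>))" by (rule card_UN_le[OF finite_T])
  also have "\<dots> = 3 * card \<T>" using C(1) by simp
  finally have "real (length ps) \<le> 3 * real (card \<T>)"
    using distinct_card[OF distinct_ps] by simp
  also have "\<dots> \<le> 3 * (1 / \<theta>\<^sup>2)" using cT by simp
  finally show ?thesis by simp
qed

end

section \<open>Cutoff functions near the boundary\<close>

lemma partial_prod_bound:
  assumes "finite J" "\<And>j. j \<in> J \<Longrightarrow> smooth (g j)" "\<And>j. j \<in> J \<Longrightarrow> \<bar>g j x\<bar> \<le> 1"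
  shows "\<bar>partial i (\<lambda>x. \<Prod>j\<in>J. g j x) x\<bar> \<le> (\<Sum>j\<in>J. \<bar>partial i (g j) x\<bar>)"
  using assms
proof (induction J rule: finite_induct)
  case empty
  then show ?case by (simp add: partial_const)
next
  case (insert j J)
  let ?P = "\<lambda>x. \<Prod>j\<in>J. g j x"
  have P: "smooth ?P" using insert by (intro smooth_prod) auto
  have P1: "\<bar>?P x\<bar> \<le> 1"
    unfolding abs_prod using insert by (intro prod_le_1) auto
  have eq: "partial i (\<lambda>x. \<Prod>j\<in>insert j J. g j x) x = g j x * partial i ?P x + partial i (g j) x * ?P x"
    using insert P by (simp add: partial_mult smooth_differentiable)
  have A: "\<bar>g j x * partial i ?P x\<bar> \<le> 1 * \<bar>partial i ?P x\<bar>"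
    unfolding abs_mult by (rule mult_right_mono) (use insert in auto)
  have B: "\<bar>partial i (g j) x * ?P x\<bar> \<le> \<bar>partial i (g j) x\<bar> * 1"
    unfolding abs_mult by (rule mult_left_mono) (use P1 in auto)
  have "\<bar>partial i (\<lambda>x. \<Prod>j\<in>insert j J. g j x) x\<bar> \<le> 1 * \<bar>partial i ?P x\<bar> + \<bar>partial i (g j) x\<bar> * 1"
    unfolding eq by (rule order_trans[OF abs_triangle_ineq add_mono[OF A B]])
  also have "\<dots> \<le> (\<Sum>j\<in>insert j J. \<bar>partial i (g j) x\<bar>)"
    using insert by simp
  finally show ?case .
qed

text \<open>The coordinates measure, in units of \<open>\<epsilon>\<close>, how far a point lies above, below, before and behind the side of the
  parallelogram of \<open>u\<close> and \<open>w\<close> that runs along \<open>u\<close>. The cutoff vanishes where all four are at most 1 and equals one where one of them is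
  at least 2.\<close>

definition collar_coord :: "real^2 \<Rightarrow> real^2 \<Rightarrow> real^2 \<Rightarrow> real \<Rightarrow> nat \<Rightarrow> real^2 \<Rightarrow> real"
  where "collar_coord a u w \<epsilon> k x = 1 / \<epsilon> * (((if k = 2 then - 1 else if k = 3 then 1 else 0) * bary1 a u w x
    + (if k = 0 then 1 else if k = 1 then - 1 else 0) * bary2 a u w x) + (if k = 3 then - 1 else 0))"

definition collar_cutoff :: "real^2 \<Rightarrow> real^2 \<Rightarrow> real^2 \<Rightarrow> real \<Rightarrow> real^2 \<Rightarrow> real"
  where "collar_cutoff a u w \<epsilon> x = 1 - (\<Prod>k<4::nat. 1 - smooth_step (collar_coord a u w \<epsilon> k x))"

definition collar :: "real^2 \<Rightarrow> real^2 \<Rightarrow> real^2 \<Rightarrow> real \<Rightarrow> (real^2) set"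
  where "collar a u w \<epsilon> = {x. \<bar>bary2 a u w x\<bar> \<le> 2 * \<epsilon> \<and> - 2 * \<epsilon> \<le> bary1 a u w x \<and> bary1 a u w x \<le> 1 + 2 * \<epsilon>}"

lemma smooth_collar_coord: "smooth (collar_coord a u w \<epsilon> k)"
  unfolding collar_coord_def[abs_def]
  by (intro smooth_cmult smooth_add smooth_bary smooth_const)

lemma smooth_collar_cutoff: "smooth (collar_cutoff a u w \<epsilon>)"
  unfolding collar_cutoff_def[abs_def]
  by (intro smooth_diff smooth_const smooth_prod smooth_smooth_step smooth_collar_coord)

lemma collar_cutoff_bounds: "0 \<le> collar_cutoff a u w \<epsilon> x" "collar_cutoff a u w \<epsilon> x \<le> 1"
  unfolding collar_cutoff_def using smooth_step_bounds
  by (auto intro!: prod_nonneg prod_le_1)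

lemma notin_collar:
  assumes "x \<notin> collar a u w \<epsilon>" "\<epsilon> > 0"
  shows "\<exists>k<4. collar_coord a u w \<epsilon> k x > 2"
proof -
  consider "bary2 a u w x > 2 * \<epsilon>" | "- bary2 a u w x > 2 * \<epsilon>" | "- bary1 a u w x > 2 * \<epsilon>" | "bary1 a u w x - 1 > 2 * \<epsilon>"
    using assms(1) unfolding collar_def by (auto simp: abs_le_iff not_le)
  then show ?thesis
  proof cases
    case 1
    then show ?thesis using assms(2) by (intro exI[of _ 0]) (simp add: collar_coord_def field_simps)
  next
    case 2
    then show ?thesis using assms(2) by (intro exI[of _ 1]) (simp add: collar_coord_def field_simps)
  next
    case 3
    then show ?thesis using assms(2) by (intro exI[of _ 2]) (simp add: collar_coord_def field_simps)
  next
    case 4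
    then show ?thesis using assms(2) by (intro exI[of _ 3]) (simp add: collar_coord_def field_simps)
  qed
qed

lemma collar_cutoff_outside:
  assumes "x \<notin> collar a u w \<epsilon>" "\<epsilon> > 0"
  shows "collar_cutoff a u w \<epsilon> x = 1" and "partial i (collar_cutoff a u w \<epsilon>) x = 0"
proof -
  obtain k where k: "k < 4" "collar_coord a u w \<epsilon> k x > 2" using notin_collar[OF assms] by blast
  have one: "collar_cutoff a u w \<epsilon> y = 1" if "y \<in> {y. collar_coord a u w \<epsilon> k y > 2}" for y
  proof -
    have "(\<Prod>k<4::nat. 1 - smooth_step (collar_coord a u w \<epsilon> k y)) = 0"
      using k(1) that by (intro prod_zero) (auto simp: smooth_step_1 intro!: bexI[of _ k])
    then show ?thesis by (simp add: collar_cutoff_def)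
  qed
  then show "collar_cutoff a u w \<epsilon> x = 1" using k(2) by simp
  have "open {y. collar_coord a u w \<epsilon> k y > 2}"
    by (intro open_Collect_less continuous_on_const smooth_continuous_on smooth_collar_coord)
  then have "partial i (collar_cutoff a u w \<epsilon>) x = partial i (\<lambda>_. 1) x"
    using k(2) one by (intro partial_cong_open(2)[of "{y. collar_coord a u w \<epsilon> k y > 2}"]) auto
  then show "partial i (collar_cutoff a u w \<epsilon>) x = 0" by (simp add: partial_const)
qed

lemma partial_collar_cutoff_bound:
  fixes a u w :: "real^2"
  assumes "\<epsilon> > 0"
  shows "\<bar>partial i (collar_cutoff a u w \<epsilon>) x\<bar> \<le> 4 * step_slope * (norm (coord_grad1 u w) + norm (coord_grad2 u w)) / \<epsilon>"
proof -
  let ?G = "norm (coord_grad1 u w) + norm (coord_grad2 u w)"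
  define g where "g k x = 1 - smooth_step (collar_coord a u w \<epsilon> k x)" for k x
  have g: "smooth (g k)" for k
    unfolding g_def[abs_def] by (intro smooth_diff smooth_const smooth_smooth_step smooth_collar_coord)
  have gb: "\<bar>g k x\<bar> \<le> 1" for k using smooth_step_bounds by (simp add: g_def)
  have neg: "partial i (\<lambda>x. 1 - f x) x = - partial i f x" if "smooth f" for f
    using partial_add[of "\<lambda>_. 1" x "\<lambda>x. (-1) * f x" i] partial_cmult[OF that, of i "-1" x] that
    by (simp add: smooth_differentiable smooth_cmult[OF that, of "-1", simplified] partial_const)
  have cc: "\<bar>partial i (collar_coord a u w \<epsilon> k) x\<bar> \<le> ?G / \<epsilon>" for k
  proof -
    define \<alpha> \<beta> :: real where "\<alpha> = (if k = 2 then - 1 else if k = 3 then 1 else 0)" and "\<beta> = (if k = 0 then 1 else if k = 1 then - 1 else 0)"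
    have "partial i (collar_coord a u w \<epsilon> k) x = 1 / \<epsilon> * (\<alpha> * coord_grad1 u w $ i + \<beta> * coord_grad2 u w $ i)"
      unfolding collar_coord_def[abs_def] \<alpha>_def[symmetric] \<beta>_def[symmetric]
      by (simp only: partial_cmult[OF smooth_add[OF smooth_add[OF smooth_cmult[OF smooth_bary(1)] smooth_cmult[OF smooth_bary(2)]] smooth_const]]
          partial_add[OF smooth_differentiable smooth_differentiable, OF smooth_add[OF smooth_cmult[OF smooth_bary(1)] smooth_cmult[OF smooth_bary(2)]] smooth_const]
          partial_add[OF smooth_differentiable smooth_differentiable, OF smooth_cmult[OF smooth_bary(1)] smooth_cmult[OF smooth_bary(2)]]
          partial_cmult[OF smooth_bary(1)] partial_cmult[OF smooth_bary(2)] partial_bary partial_const add_0_right)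
    moreover have "\<bar>\<alpha> * coord_grad1 u w $ i + \<beta> * coord_grad2 u w $ i\<bar> \<le> ?G"
      using component_le_norm_cart[of "coord_grad1 u w" i] component_le_norm_cart[of "coord_grad2 u w" i]
      by (auto simp: \<alpha>_def \<beta>_def intro: order_trans)
    ultimately show ?thesis using assms by (simp add: abs_mult divide_right_mono)
  qed
  have "\<bar>partial i (collar_cutoff a u w \<epsilon>) x\<bar> = \<bar>partial i (\<lambda>x. \<Prod>k<4::nat. g k x) x\<bar>"
    unfolding collar_cutoff_def[abs_def] g_def[symmetric] by (simp only: neg[OF smooth_prod[OF g]] abs_minus_cancel)
  also have "\<dots> \<le> (\<Sum>k<4::nat. \<bar>partial i (g k) x\<bar>)"
    by (rule partial_prod_bound) (auto intro: g gb)
  also have "\<dots> \<le> (\<Sum>k<4::nat. step_slope * (?G / \<epsilon>))"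
  proof (rule sum_mono)
    fix k
    have "\<bar>partial i (g k) x\<bar> = \<bar>smooth_step_deriv (collar_coord a u w \<epsilon> k x)\<bar> * \<bar>partial i (collar_coord a u w \<epsilon> k) x\<bar>"
      unfolding g_def[abs_def] by (simp add: neg smooth_smooth_step smooth_collar_coord partial_smooth_step abs_mult)
    also have "\<dots> \<le> step_slope * (?G / \<epsilon>)"
      using smooth_step_deriv_bound cc step_slope_pos by (intro mult_mono) auto
    finally show "\<bar>partial i (g k) x\<bar> \<le> step_slope * (?G / \<epsilon>)" .
  qed
  also have "\<dots> = 4 * step_slope * ?G / \<epsilon>" by simp
  finally show ?thesis .
qed

lemma collar_cutoff_zero:
  assumes "\<epsilon> > 0" "\<bar>bary2 a u w x\<bar> < \<epsilon>" "- \<epsilon> < bary1 a u w x" "bary1 a u w x < 1 + \<epsilon>"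
  shows "collar_cutoff a u w \<epsilon> x = 0"
proof -
  have "collar_coord a u w \<epsilon> k x \<le> 1" for k
    using assms by (auto simp: collar_coord_def field_simps abs_less_iff)
  then show ?thesis by (simp add: collar_cutoff_def smooth_step_0)
qed

lemma collar_near_segment:
  assumes det: "det2 u w \<noteq> 0" and \<epsilon>: "\<epsilon> > 0" and x: "x \<in> collar a u w \<epsilon>"
  shows "\<exists>y\<in>closed_segment a (a + u). norm (x - y) \<le> 2 * \<epsilon> * (norm u + norm w)"
proof -
  define s where "s = bary1 a u w x"
  define t where "t = bary2 a u w x"
  have xs: "x = a + s *\<^sub>R u + t *\<^sub>R w"
    using chart_coords(3)[OF det, of a x] by (simp add: chart_def s_def t_def bary1_def bary2_def)
  have st: "\<bar>t\<bar> \<le> 2 * \<epsilon>" "- 2 * \<epsilon> \<le> s" "s \<le> 1 + 2 * \<epsilon>" using x by (auto simp: collar_def s_def t_def)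
  define r where "r = max 0 (min s 1)"
  have r: "0 \<le> r" "r \<le> 1" "\<bar>s - r\<bar> \<le> 2 * \<epsilon>" using st \<epsilon> by (auto simp: r_def)
  have "a + r *\<^sub>R u \<in> closed_segment a (a + u)"
    using r by (auto simp: in_segment intro!: exI[of _ r]) (simp add: algebra_simps)
  moreover have "norm (x - (a + r *\<^sub>R u)) \<le> 2 * \<epsilon> * (norm u + norm w)"
  proof -
    have "x - (a + r *\<^sub>R u) = (s - r) *\<^sub>R u + t *\<^sub>R w" unfolding xs by (simp add: algebra_simps)
    then have "norm (x - (a + r *\<^sub>R u)) \<le> \<bar>s - r\<bar> * norm u + \<bar>t\<bar> * norm w"
      using norm_triangle_ineq[of "(s - r) *\<^sub>R u" "t *\<^sub>R w"] by simp
    also have "\<dots> \<le> 2 * \<epsilon> * norm u + 2 * \<epsilon> * norm w"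
      using r(3) st(1) by (intro add_mono mult_right_mono) auto
    finally show ?thesis by (simp add: algebra_simps)
  qed
  ultimately show ?thesis by blast
qed

text \<open>A triangle and a segment with exactly a common vertex separate at least linearly. The triangle is a union of
  segments from that vertex to the opposite side, and no point of the opposite side lies on the ray of the segment.\<close>

lemma triangle_segment_transversal:
  assumes det: "det2 p q \<noteq> 0" and meet: "triangle v p q \<inter> closed_segment v (v + e) = {v}" and e: "e \<noteq> 0"
  shows "\<exists>m>0. \<forall>x\<in>triangle v p q. \<forall>y\<in>closed_segment v (v + e). m * norm (x - v) \<le> norm (x - y)"
proof -
  define S where "S = closed_segment p q"
  define R where "R = {r *\<^sub>R e | r. r \<ge> 0}"
  have disj: "S \<inter> R = {}"
  proof (rule ccontr)
    assume "S \<inter> R \<noteq> {}"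
    then obtain r where r: "r \<ge> 0" "r *\<^sub>R e \<in> S" by (auto simp: R_def)
    then obtain s where s: "0 \<le> s" "s \<le> 1" "r *\<^sub>R e = (1 - s) *\<^sub>R p + s *\<^sub>R q" by (auto simp: S_def in_segment)
    have "r \<noteq> 0"
    proof
      assume "r = 0"
      then have "coord_grad1 p q \<bullet> ((1 - s) *\<^sub>R p + s *\<^sub>R q) = 0" "coord_grad2 p q \<bullet> ((1 - s) *\<^sub>R p + s *\<^sub>R q) = 0"
        using s(3) by (metis inner_zero_right scaleR_zero_left)+
      then show False by (simp add: inner_add_right coord_grad_dual[OF det])
    qed
    then have "r > 0" using r(1) by simp
    define k where "k = min 1 (1 / r)"
    have k: "0 < k" "k \<le> 1" "k * r \<le> 1" "0 < k * r" using \<open>r > 0\<close> by (auto simp: k_def min_def field_simps)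
    have "v + (k * r) *\<^sub>R e \<in> closed_segment v (v + e)"
      using k by (auto simp: in_segment intro!: exI[of _ "k * r"]) (simp add: algebra_simps)
    moreover have "v + (k * r) *\<^sub>R e \<in> triangle v p q"
    proof -
      have "v + (k * r) *\<^sub>R e = v + k *\<^sub>R (r *\<^sub>R e)" by simp
      also have "\<dots> = chart v p q (k * (1 - s), k * s)" unfolding s(3) by (simp add: chart_def algebra_simps)
      finally show ?thesis
        unfolding triangle_eq using k s by (intro image_eqI[of _ _ "(k * (1 - s), k * s)"]) (auto simp: algebra_simps)
    qed
    ultimately have "v + (k * r) *\<^sub>R e = v" using meet by blast
    then show False using k(1) \<open>r > 0\<close> e by simp
  qed
  have "closed R"
  proof -
    have "R = (\<lambda>r. r *\<^sub>R e) ` {0..}" by (auto simp: R_def)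
    moreover have "closed ((\<lambda>r. r *\<^sub>R e) ` {0..})"
      by (intro closed_injective_linear_image[of "{0..}" "\<lambda>r. r *\<^sub>R e"])
        (auto simp: linear_iff algebra_simps inj_on_def e)
    ultimately show ?thesis by simp
  qed
  moreover have "compact S" by (simp add: S_def)
  ultimately obtain d where d: "d > 0" "\<And>y z. y \<in> S \<Longrightarrow> z \<in> R \<Longrightarrow> d \<le> dist y z"
    using separate_compact_closed[of S R] disj by blast
  define m where "m = d / (norm p + norm q)"
  have "p \<noteq> 0" using det by (auto simp: det2_def)
  then have pq: "norm p + norm q > 0" by (simp add: add_pos_nonneg)
  have "m * norm (x - v) \<le> norm (x - y)" if x: "x \<in> triangle v p q" and y: "y \<in> closed_segment v (v + e)" for x y
  proof -
    obtain s t where st: "x = v + s *\<^sub>R p + t *\<^sub>R q" "0 \<le> s" "0 \<le> t" "s + t \<le> 1"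
      using x unfolding triangle_eq by (auto simp: chart_def)
    obtain b where b: "y = v + b *\<^sub>R e" "0 \<le> b"
      using y by (auto simp: in_segment algebra_simps)
    define r where "r = s + t"
    show ?thesis
    proof (cases "r = 0")
      case True
      then have "s = 0" "t = 0" using st by (auto simp: r_def)
      then show ?thesis using st(1) by simp
    next
      case False
      then have r: "r > 0" using st by (simp add: r_def)
      define g where "g = (s / r) *\<^sub>R p + (t / r) *\<^sub>R q"
      have gS: "g \<in> S"
      proof -
        have "s / r = 1 - t / r" using r by (simp add: r_def field_simps)
        then show ?thesis
          unfolding S_def g_def in_segment using st r by (intro exI[of _ "t / r"]) (auto simp: r_def field_simps)
      qed
      have xr: "x - v = r *\<^sub>R g" unfolding st(1) g_def using r by (simp add: scaleR_add_right)
      have "norm (x - y) = norm (r *\<^sub>R (g - (b / r) *\<^sub>R e))"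
      proof -
        have "x - y = (x - v) - b *\<^sub>R e" by (simp add: b(1))
        then show ?thesis using xr r by (simp add: scaleR_diff_right)
      qed
      also have "\<dots> = r * dist g ((b / r) *\<^sub>R e)" using r by (simp add: dist_norm)
      finally have nxy: "norm (x - y) = r * dist g ((b / r) *\<^sub>R e)" .
      have "(b / r) *\<^sub>R e \<in> R" using b(2) r by (auto simp: R_def)
      then have "r * d \<le> norm (x - y)"
        unfolding nxy using d(2)[OF gS] r by (intro mult_left_mono) auto
      moreover have "m * norm (x - v) \<le> r * d"
      proof -
        have "norm g \<le> norm p + norm q"
        proof -
          have "norm g \<le> \<bar>s / r\<bar> * norm p + \<bar>t / r\<bar> * norm q"
            unfolding g_def using norm_triangle_ineq[of "(s / r) *\<^sub>R p" "(t / r) *\<^sub>R q"] by simp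
          also have "\<dots> \<le> 1 * norm p + 1 * norm q"
            using st r by (intro add_mono mult_right_mono) (auto simp: r_def)
          finally show ?thesis by simp
        qed
        then have "m * norm g \<le> d"
          using mult_left_mono[of "norm g" "norm p + norm q" d] pq d(1) by (simp add: m_def field_simps)
        then show ?thesis using r by (simp add: xr mult.left_commute)
      qed
      ultimately show ?thesis by linarith
    qed
  qed
  moreover have "m > 0" using d(1) pq by (simp add: m_def)
  ultimately show ?thesis by blast
qed

definition edge_energy :: "(real^2) list \<Rightarrow> nat \<Rightarrow> (real^2 \<Rightarrow> real) \<Rightarrow> real"
  where "edge_energy ps i z = (\<integral>t. (z (linepath (vtx ps i) (vtx ps (Suc i)) t))\<^sup>2 \<partial>lebesgue_on {0..1})"

definition grad_energy :: "(real^2) set \<Rightarrow> (real^2 \<Rightarrow> real) \<Rightarrow> real"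
  where "grad_energy K z = (\<Sum>j\<in>UNIV. \<integral>x. (partial j z x)\<^sup>2 \<partial>lebesgue_on K)"

lemma energy_nonneg: "edge_energy ps i z \<ge> 0" "grad_energy K z \<ge> 0"
  by (auto simp: edge_energy_def grad_energy_def intro: sum_nonneg)

lemma integrable_indicator_borel:
  fixes f :: "real^2 \<Rightarrow> real"
  assumes "S \<in> sets borel" "bounded S" "continuous_on UNIV f"
  shows "integrable lborel (\<lambda>x. indicator S x * f x)"
proof -
  have "S \<in> lmeasurable" using assms(1,2) by (intro bounded_set_imp_lmeasurable) auto
  then have "integrable (lebesgue_on S) f"
    using assms by (intro L2_integrable L2_continuous)
  then show ?thesis
    using lebesgue_on_borel(2)[OF assms(1) borel_measurable_continuous_onI[OF assms(3)]] by simp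
qed

lemma collar_borel: "collar a u w \<epsilon> \<in> sets borel"
proof -
  have "closed (collar a u w \<epsilon>)"
    unfolding collar_def
    by (intro closed_Collect_conj closed_Collect_le continuous_intros continuous_bary)
  then show ?thesis by (rule borel_closed)
qed

context triangulated_polygon
begin

definition side :: "nat \<Rightarrow> real^2"
  where "side i = vtx ps (Suc i) - vtx ps i"

text \<open>Any direction serves that is not parallel to the side; the constants of the collar estimates may depend on the polygon, because
  the collar shrinks in the end.\<close>

definition transversal :: "nat \<Rightarrow> real^2"
  where "transversal i = (SOME w. det2 (side i) w \<noteq> 0)"

lemma det2_transversal: "i < length ps \<Longrightarrow> det2 (side i) (transversal i) \<noteq> 0"
  unfolding transversal_def using edge_triangle[of i] by (metis (mono_tags, lifting) side_def someI)

lemma polygon_edge_side: "polygon_edge ps i = closed_segment (vtx ps i) (vtx ps i + side i)"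
  by (simp add: polygon_edge_def side_def)

abbreviation edge_collar :: "nat \<Rightarrow> real \<Rightarrow> (real^2) set"
  where "edge_collar i \<epsilon> \<equiv> collar (vtx ps i) (side i) (transversal i) \<epsilon>"

definition collar_width :: "nat \<Rightarrow> real"
  where "collar_width i = 2 * (norm (side i) + norm (transversal i))"

lemma collar_width_pos:
  assumes "i < length ps"
  shows "collar_width i > 0"
proof -
  have "norm (side i) > 0" using vtx_distinct[OF assms] by (simp add: side_def)
  then show ?thesis unfolding collar_width_def by (intro mult_pos_pos add_pos_nonneg) auto
qed

lemma edge_collar_near:
  assumes "i < length ps" "\<epsilon> > 0" "x \<in> edge_collar i \<epsilon>"
  obtains y where "y \<in> polygon_edge ps i" "norm (x - y) \<le> \<epsilon> * collar_width i"
  using collar_near_segment[OF det2_transversal[OF assms(1)] assms(2,3)] that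
  by (auto simp: polygon_edge_side collar_width_def mult_ac)

text \<open>Three cases, by conformity. A triangle away from the edge does not meet a thin collar; a triangle that touches
  it in a vertex meets it in a set of diameter of order \<open>\<epsilon>\<close>, where the bound on \<open>z\<close> suffices; on a triangle
  along the edge the function is integrated from the edge inwards.\<close>

lemma collar_estimate_triangle:
  assumes \<tau>: "\<tau> \<in> \<T>" and i: "i < length ps"
  shows "\<exists>C \<epsilon>0. C \<ge> 0 \<and> \<epsilon>0 > 0 \<and> (\<forall>\<epsilon> z N. 0 < \<epsilon> \<and> \<epsilon> < \<epsilon>0 \<and> smooth z \<and> (\<forall>x. \<bar>z x\<bar> \<le> N) \<longrightarrow>
    (\<integral>x. indicator (\<tau> \<inter> edge_collar i \<epsilon>) x * (z x)\<^sup>2 \<partial>lborel) \<le> C * (\<epsilon>\<^sup>2 * N\<^sup>2 + \<epsilon> * edge_energy ps i z + \<epsilon>\<^sup>2 * grad_energy K z))"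
proof -
  let ?e = "polygon_edge ps i" and ?k = "collar_width i"
  have k: "?k > 0" by (rule collar_width_pos[OF i])
  have ctau: "compact \<tau>" using simplex_T[OF \<tau>] compact_simplex by blast
  have rhs: "0 \<le> \<epsilon>\<^sup>2 * N\<^sup>2 + \<epsilon> * edge_energy ps i z + \<epsilon>\<^sup>2 * grad_energy K z" if "\<epsilon> > 0" for \<epsilon> N z
    using that energy_nonneg by (intro add_nonneg_nonneg mult_nonneg_nonneg) auto
  have bor: "\<tau> \<inter> edge_collar i \<epsilon> \<in> sets borel" for \<epsilon>
    using ctau collar_borel by (intro sets.Int) (auto intro: borel_compact)
  have int: "integrable lborel (\<lambda>x. indicator S x * (z x)\<^sup>2)" if "S \<in> sets borel" "bounded S" "smooth z" for S z
    using that by (intro integrable_indicator_borel smooth_continuous_on smooth_power)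
  have bdd: "bounded (\<tau> \<inter> edge_collar i \<epsilon>)" for \<epsilon>
    using compact_imp_bounded[OF ctau] by (rule bounded_subset) auto
  consider "\<tau> \<inter> ?e = {}" | v where "v \<in> {vtx ps i, vtx ps (Suc i)}" "v extreme_point_of \<tau>" "\<tau> \<inter> ?e = {v}" | "?e face_of \<tau>"
    using edge_inter_T[OF \<tau> i] by blast
  then show ?thesis
  proof cases
    case 1
    obtain d where d: "d > 0" "\<And>x y. x \<in> \<tau> \<Longrightarrow> y \<in> ?e \<Longrightarrow> d \<le> dist x y"
      using separate_compact_closed[of \<tau> ?e] ctau 1 by (auto simp: polygon_edge_def)
    have "\<tau> \<inter> edge_collar i \<epsilon> = {}" if \<epsilon>: "0 < \<epsilon>" "\<epsilon> < d / ?k" for \<epsilon>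
    proof (rule ccontr)
      assume "\<tau> \<inter> edge_collar i \<epsilon> \<noteq> {}"
      then obtain x where x: "x \<in> \<tau>" "x \<in> edge_collar i \<epsilon>" by blast
      obtain y where y: "y \<in> ?e" "norm (x - y) \<le> \<epsilon> * ?k" using edge_collar_near[OF i \<epsilon>(1) x(2)] .
      have "\<epsilon> * ?k < d" using \<epsilon>(2) k by (simp add: pos_less_divide_eq)
      then show False using d(2)[OF x(1) y(1)] y(2) by (simp add: dist_norm)
    qed
    then show ?thesis using d(1) k by (intro exI[of _ 0] exI[of _ "d / ?k"]) auto
  next
    case (2 v)
    obtain p q where pq: "\<tau> = triangle v p q" "det2 p q \<noteq> 0" using triangle_with_vertex[OF \<tau> 2(2)] .
    obtain e where e: "e \<noteq> 0" "?e = closed_segment v (v + e)"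
    proof -
      have "?e = closed_segment (vtx ps i) (vtx ps i + (vtx ps (Suc i) - vtx ps i))" by (simp add: polygon_edge_def)
      moreover have "?e = closed_segment (vtx ps (Suc i)) (vtx ps (Suc i) + (vtx ps i - vtx ps (Suc i)))"
        by (simp add: polygon_edge_def closed_segment_commute)
      ultimately show ?thesis using 2(1) vtx_distinct[OF i] that
        by (metis eq_iff_diff_eq_0 insertE singletonD)
    qed
    obtain m where m: "m > 0" "\<And>x y. x \<in> \<tau> \<Longrightarrow> y \<in> ?e \<Longrightarrow> m * norm (x - v) \<le> norm (x - y)"
      using triangle_segment_transversal[OF pq(2), of v e] 2(3) e pq(1) by auto
    let ?C = "pi * (?k / m)\<^sup>2"
    have "(\<integral>x. indicator (\<tau> \<inter> edge_collar i \<epsilon>) x * (z x)\<^sup>2 \<partial>lborel) \<le> ?C * (\<epsilon>\<^sup>2 * N\<^sup>2 + \<epsilon> * edge_energy ps i z + \<epsilon>\<^sup>2 * grad_energy K z)"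
      if \<epsilon>: "0 < \<epsilon>" and z: "smooth z" and N: "\<And>x. \<bar>z x\<bar> \<le> N" for \<epsilon> z N
    proof -
      let ?B = "cball v (\<epsilon> * ?k / m)"
      have sub: "\<tau> \<inter> edge_collar i \<epsilon> \<subseteq> ?B"
      proof
        fix x assume x: "x \<in> \<tau> \<inter> edge_collar i \<epsilon>"
        then obtain y where y: "y \<in> ?e" "norm (x - y) \<le> \<epsilon> * ?k" using edge_collar_near[OF i \<epsilon>] by blast
        then have "m * norm (x - v) \<le> \<epsilon> * ?k" using m(2)[of x y] x by auto
        then show "x \<in> ?B" using m(1) by (simp add: dist_norm norm_minus_commute pos_le_divide_eq mult.commute)
      qed
      have "(\<integral>x. indicator (\<tau> \<inter> edge_collar i \<epsilon>) x * (z x)\<^sup>2 \<partial>lborel) \<le> (\<integral>x. indicator ?B x * N\<^sup>2 \<partial>lborel)"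
      proof (rule integral_mono)
        show "integrable lborel (\<lambda>x. indicator (\<tau> \<inter> edge_collar i \<epsilon>) x * (z x)\<^sup>2)" by (rule int[OF bor bdd z])
        show "integrable lborel (\<lambda>x. indicator ?B x * N\<^sup>2)"
          by (rule integrable_indicator_borel) auto
        have "(z x)\<^sup>2 \<le> N\<^sup>2" for x using power_mono[OF N[of x], of 2] by simp
        then show "indicator (\<tau> \<inter> edge_collar i \<epsilon>) x * (z x)\<^sup>2 \<le> indicator ?B x * N\<^sup>2" for x
          using sub by (auto simp: indicator_def)
      qed
      also have "\<dots> = pi * (\<epsilon> * ?k / m)\<^sup>2 * N\<^sup>2"
        using \<epsilon> k m(1) content_cball[of "\<epsilon> * ?k / m" v] by (simp add: unit_ball_vol_2)
      also have "\<dots> = ?C * (\<epsilon>\<^sup>2 * N\<^sup>2)" by (simp add: power_mult_distrib power_divide)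
      also have "\<dots> \<le> ?C * (\<epsilon>\<^sup>2 * N\<^sup>2 + \<epsilon> * edge_energy ps i z + \<epsilon>\<^sup>2 * grad_energy K z)"
        using energy_nonneg \<epsilon> by (intro mult_left_mono) auto
      finally show ?thesis .
    qed
    then show ?thesis by (intro exI[of _ ?C] exI[of _ 1]) auto
  next
    case 3
    obtain w where w: "\<tau> = triangle (vtx ps i) (side i) w" "det2 (side i) w \<noteq> 0"
      using triangle_with_edge[OF \<tau> _ vtx_distinct[OF i]] 3 unfolding polygon_edge_def side_def by blast
    let ?a = "vtx ps i" and ?u = "side i"
    define L where "L = norm (coord_grad2 ?u w) * ?k"
    have L: "L > 0"
    proof -
      have "coord_grad2 ?u w \<noteq> 0" using coord_grad_dual(4)[OF w(2)] by auto
      then show ?thesis using k by (simp add: L_def)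
    qed
    let ?C = "4 * L * \<bar>det2 ?u w\<bar> + 32 * L\<^sup>2 * (norm w)\<^sup>2"
    have "(\<integral>x. indicator (\<tau> \<inter> edge_collar i \<epsilon>) x * (z x)\<^sup>2 \<partial>lborel) \<le> ?C * (\<epsilon>\<^sup>2 * N\<^sup>2 + \<epsilon> * edge_energy ps i z + \<epsilon>\<^sup>2 * grad_energy K z)"
      if \<epsilon>: "0 < \<epsilon>" and z: "smooth z" for \<epsilon> z N
    proof -
      define h where "h s = min (1 - s) (\<epsilon> * L)" for s
      let ?R = "chart_region ?a ?u w h"
      have hc: "continuous_on {0..1} h" unfolding h_def[abs_def] by (intro continuous_intros)
      have sub: "\<tau> \<inter> edge_collar i \<epsilon> \<subseteq> ?R"
      proof
        fix x assume x: "x \<in> \<tau> \<inter> edge_collar i \<epsilon>"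
        then obtain y where y: "y \<in> ?e" "norm (x - y) \<le> \<epsilon> * ?k" using edge_collar_near[OF i \<epsilon>] by blast
        obtain b where b: "y = ?a + b *\<^sub>R ?u" using y(1) by (auto simp: polygon_edge_side in_segment algebra_simps)
        have "x - ?a = (x - y) + b *\<^sub>R ?u" using b by simp
        then have "coord_grad2 ?u w \<bullet> (x - ?a) = coord_grad2 ?u w \<bullet> (x - y) + b * (coord_grad2 ?u w \<bullet> ?u)"
          by (simp only: inner_add_right inner_scaleR_right)
        also have "\<dots> = coord_grad2 ?u w \<bullet> (x - y)" by (simp add: coord_grad_dual[OF w(2)])
        also have "\<dots> \<le> norm (coord_grad2 ?u w) * norm (x - y)" by (rule norm_cauchy_schwarz)
        also have "\<dots> \<le> norm (coord_grad2 ?u w) * (\<epsilon> * ?k)" using y(2) by (intro mult_left_mono) auto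
        finally have "coord_grad2 ?u w \<bullet> (x - ?a) \<le> \<epsilon> * L" by (simp add: L_def mult_ac)
        moreover have "x \<in> triangle ?a ?u w" using x w(1) by simp
        ultimately show "x \<in> ?R"
          unfolding triangle_def mem_chart_region[OF w(2)] by (auto simp: Let_def h_def)
      qed
      have Rb: "?R \<in> sets borel" "bounded ?R"
        using compact_chart_region[OF hc] by (auto intro: borel_compact compact_imp_bounded)
      have "(\<integral>x. indicator (\<tau> \<inter> edge_collar i \<epsilon>) x * (z x)\<^sup>2 \<partial>lborel) \<le> (\<integral>x. indicator ?R x * (z x)\<^sup>2 \<partial>lborel)"
        using sub by (intro integral_mono int bor bdd z Rb) (auto simp: indicator_def)
      also have "\<dots> = (\<integral>x. (z x)\<^sup>2 \<partial>lebesgue_on ?R)"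
        using Rb z by (intro lebesgue_on_borel(1)[symmetric] borel_measurable_continuous_onI smooth_continuous_on smooth_power)
      also have "\<dots> \<le> 4 * (\<epsilon> * L) * \<bar>det2 ?u w\<bar> * (\<integral>s. indicator {0..1} s * (z (chart ?a ?u w (s, 0)))\<^sup>2 \<partial>lborel)
          + 16 * (\<epsilon> * L)\<^sup>2 * (\<integral>x. (dir_deriv w z x)\<^sup>2 \<partial>lebesgue_on (chart_region ?a ?u w (\<lambda>s. 1 - s)))"
        by (rule chart_region_layer_estimate[OF w(2) hc])
          (use \<epsilon> L z in \<open>auto simp: h_def intro: continuous_intros\<close>)
      also have "(\<integral>s. indicator {0..1} s * (z (chart ?a ?u w (s, 0)))\<^sup>2 \<partial>lborel) = edge_energy ps i z"
      proof -
        have l: "linepath ?a (vtx ps (Suc i)) s = chart ?a ?u w (s, 0)" for s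
          by (simp add: linepath_chart[of _ _ _ w] side_def)
        have "continuous_on UNIV (\<lambda>s. (z (linepath ?a (vtx ps (Suc i)) s))\<^sup>2)"
          by (intro continuous_intros smooth_linepath_continuous z)
        then show ?thesis
          unfolding edge_energy_def l[symmetric]
          by (intro lebesgue_on_borel(1)[symmetric] borel_measurable_continuous_onI) auto
      qed
      also have "(\<integral>x. (dir_deriv w z x)\<^sup>2 \<partial>lebesgue_on (chart_region ?a ?u w (\<lambda>s. 1 - s))) \<le> 2 * (norm w)\<^sup>2 * grad_energy K z"
      proof -
        let ?O = "open_triangle ?a ?u w"
        have OK: "?O \<subseteq> K" by (rule open_triangle_subset_K[OF \<tau> w])
        have O: "?O \<in> lmeasurable" "bounded ?O"
          using open_open_triangle OK bounded_K bounded_subset lmeasurable_open by blast+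
        have ik: "integrable (lebesgue_on K) (\<lambda>x. (partial j z x)\<^sup>2)" for j
          by (intro integrable_smooth lmeasurable_K bounded_K smooth_power smooth_partial z)
        have io: "integrable (lebesgue_on ?O) (\<lambda>x. (partial j z x)\<^sup>2)" for j
          by (intro integrable_smooth O smooth_power smooth_partial z)
        have "(\<integral>x. (dir_deriv w z x)\<^sup>2 \<partial>lebesgue_on (chart_region ?a ?u w (\<lambda>s. 1 - s))) = (\<integral>x. (dir_deriv w z x)\<^sup>2 \<partial>lebesgue_on ?O)"
          unfolding triangle_def[symmetric]
          by (intro integral_open_triangle[OF w(2), symmetric] borel_measurable_continuous_onI smooth_continuous_on smooth_power smooth_dir_deriv z)
        also have "\<dots> \<le> (\<integral>x. 2 * (norm w)\<^sup>2 * ((partial 1 z x)\<^sup>2 + (partial 2 z x)\<^sup>2) \<partial>lebesgue_on ?O)"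
        proof (rule integral_mono)
          show "integrable (lebesgue_on ?O) (\<lambda>x. (dir_deriv w z x)\<^sup>2)"
            by (intro integrable_smooth O smooth_power smooth_dir_deriv z)
          show "integrable (lebesgue_on ?O) (\<lambda>x. 2 * (norm w)\<^sup>2 * ((partial 1 z x)\<^sup>2 + (partial 2 z x)\<^sup>2))" using io by auto
          fix x
          have "(dir_deriv w z x)\<^sup>2 \<le> 2 * ((w $ 1 * partial 1 z x)\<^sup>2 + (w $ 2 * partial 2 z x)\<^sup>2)"
            using sum_squares_bound[of "w $ 1 * partial 1 z x" "w $ 2 * partial 2 z x"] by (simp add: dir_deriv_def power2_sum)
          also have "\<dots> \<le> 2 * ((norm w)\<^sup>2 * (partial 1 z x)\<^sup>2 + (norm w)\<^sup>2 * (partial 2 z x)\<^sup>2)"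
            unfolding power_mult_distrib norm_2 by (intro mult_left_mono add_mono mult_right_mono) auto
          finally show "(dir_deriv w z x)\<^sup>2 \<le> 2 * (norm w)\<^sup>2 * ((partial 1 z x)\<^sup>2 + (partial 2 z x)\<^sup>2)" by (simp add: algebra_simps)
        qed
        also have "\<dots> = 2 * (norm w)\<^sup>2 * ((\<integral>x. (partial 1 z x)\<^sup>2 \<partial>lebesgue_on ?O) + (\<integral>x. (partial 2 z x)\<^sup>2 \<partial>lebesgue_on ?O))"
          using io by simp
        also have "\<dots> \<le> 2 * (norm w)\<^sup>2 * grad_energy K z"
        proof -
          have "(\<integral>x. (partial j z x)\<^sup>2 \<partial>lebesgue_on ?O) \<le> (\<integral>x. (partial j z x)\<^sup>2 \<partial>lebesgue_on K)" for j
            using lebesgue_on_integral_subset[OF fmeasurableD[OF O(1)] fmeasurableD[OF lmeasurable_K] OK, of "\<lambda>x. (partial j z x)\<^sup>2"] io[of j] ik[of j]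
            by (auto intro!: integral_mono simp: indicator_def)
          then show ?thesis
            unfolding grad_energy_def sum_2 by (intro mult_left_mono add_mono) auto
        qed
        finally show ?thesis .
      qed
      finally have "(\<integral>x. indicator (\<tau> \<inter> edge_collar i \<epsilon>) x * (z x)\<^sup>2 \<partial>lborel) \<le>
          4 * (\<epsilon> * L) * \<bar>det2 ?u w\<bar> * edge_energy ps i z + 16 * (\<epsilon> * L)\<^sup>2 * (2 * (norm w)\<^sup>2 * grad_energy K z)"
        by (simp add: mult_left_mono)
      also have "\<dots> = (4 * L * \<bar>det2 ?u w\<bar>) * (\<epsilon> * edge_energy ps i z) + (32 * L\<^sup>2 * (norm w)\<^sup>2) * (\<epsilon>\<^sup>2 * grad_energy K z)"
        by (simp add: power_mult_distrib)
      also have "\<dots> \<le> (4 * L * \<bar>det2 ?u w\<bar>) * (\<epsilon>\<^sup>2 * N\<^sup>2 + \<epsilon> * edge_energy ps i z + \<epsilon>\<^sup>2 * grad_energy K z)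
          + (32 * L\<^sup>2 * (norm w)\<^sup>2) * (\<epsilon>\<^sup>2 * N\<^sup>2 + \<epsilon> * edge_energy ps i z + \<epsilon>\<^sup>2 * grad_energy K z)"
        using energy_nonneg \<epsilon> L by (intro add_mono mult_left_mono) auto
      finally show ?thesis by (simp only: distrib_right)
    qed
    then show ?thesis using L by (intro exI[of _ ?C] exI[of _ 1]) auto
  qed
qed

end

section \<open>Functions with vanishing trace as test functions\<close>

context triangulated_polygon
begin

definition boundary_cutoff :: "real \<Rightarrow> real^2 \<Rightarrow> real"
  where "boundary_cutoff \<epsilon> x = (\<Prod>i<length ps. collar_cutoff (vtx ps i) (side i) (transversal i) \<epsilon> x)"

definition boundary_collar :: "real \<Rightarrow> (real^2) set"
  where "boundary_collar \<epsilon> = (\<Union>i<length ps. edge_collar i \<epsilon>)"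

definition boundary_energy :: "(real^2 \<Rightarrow> real) \<Rightarrow> real"
  where "boundary_energy z = (\<Sum>i<length ps. edge_energy ps i z)"

lemma boundary_energy_nonneg: "boundary_energy z \<ge> 0"
  by (auto simp: boundary_energy_def intro: sum_nonneg energy_nonneg)

lemma smooth_boundary_cutoff: "smooth (boundary_cutoff \<epsilon>)"
  unfolding boundary_cutoff_def[abs_def] by (intro smooth_prod smooth_collar_cutoff)

lemma boundary_cutoff_bounds: "0 \<le> boundary_cutoff \<epsilon> x" "boundary_cutoff \<epsilon> x \<le> 1"
  unfolding boundary_cutoff_def by (auto intro!: prod_nonneg prod_le_1 collar_cutoff_bounds)

lemma boundary_cutoff_vanishes:
  assumes "\<epsilon> > 0"
  obtains U where "open U" "frontier K \<subseteq> U" "\<And>x. x \<in> U \<Longrightarrow> boundary_cutoff \<epsilon> x = 0"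
proof
  let ?U = "\<Union>i<length ps. {x. \<bar>bary2 (vtx ps i) (side i) (transversal i) x\<bar> < \<epsilon> \<and>
    - \<epsilon> < bary1 (vtx ps i) (side i) (transversal i) x \<and> bary1 (vtx ps i) (side i) (transversal i) x < 1 + \<epsilon>}"
  show "open ?U"
    by (intro open_UN ballI open_Collect_conj open_Collect_less continuous_intros continuous_bary)
  show "frontier K \<subseteq> ?U"
  proof
    fix x assume "x \<in> frontier K"
    then obtain i where i: "i < length ps" "x \<in> polygon_edge ps i" by (auto simp: frontier_K)
    then obtain b where b: "0 \<le> b" "b \<le> 1" "x = vtx ps i + b *\<^sub>R side i"
      by (auto simp: polygon_edge_side in_segment algebra_simps)
    then have "x = chart (vtx ps i) (side i) (transversal i) (b, 0)" by (simp add: chart_def)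
    then have "bary2 (vtx ps i) (side i) (transversal i) x = 0" "bary1 (vtx ps i) (side i) (transversal i) x = b"
      by (simp_all add: bary_chart[OF det2_transversal[OF i(1)]])
    then show "x \<in> ?U" using i(1) b assms by (intro UN_I[of i]) auto
  qed
  show "boundary_cutoff \<epsilon> x = 0" if xU: "x \<in> ?U" for x
  proof -
    obtain i where "i < length ps" "collar_cutoff (vtx ps i) (side i) (transversal i) \<epsilon> x = 0"
      using xU collar_cutoff_zero[OF assms] by blast
    then show ?thesis unfolding boundary_cutoff_def by (intro prod_zero bexI[of _ i]) auto
  qed
qed

lemma boundary_cutoff_outside:
  assumes "\<epsilon> > 0" "x \<notin> boundary_collar \<epsilon>"
  shows "boundary_cutoff \<epsilon> x = 1" "partial j (boundary_cutoff \<epsilon>) x = 0"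
proof -
  have out: "x \<notin> edge_collar i \<epsilon>" if "i < length ps" for i using assms(2) that by (auto simp: boundary_collar_def)
  show "boundary_cutoff \<epsilon> x = 1"
    unfolding boundary_cutoff_def using out by (intro prod.neutral) (simp add: collar_cutoff_outside(1)[OF _ assms(1)])
  have "\<bar>partial j (boundary_cutoff \<epsilon>) x\<bar> \<le> (\<Sum>i<length ps. \<bar>partial j (collar_cutoff (vtx ps i) (side i) (transversal i) \<epsilon>) x\<bar>)"
    unfolding boundary_cutoff_def[abs_def]
    by (rule partial_prod_bound) (simp_all add: smooth_collar_cutoff collar_cutoff_bounds)
  also have "\<dots> = 0"
    using out by (intro sum.neutral) (simp add: collar_cutoff_outside(2)[OF _ assms(1)])
  finally show "partial j (boundary_cutoff \<epsilon>) x = 0" by simp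
qed

lemma eventually_not_in_boundary_collar:
  assumes \<epsilon>: "\<epsilon> \<longlonglongrightarrow> 0" and x: "x \<in> K"
  shows "\<forall>\<^sub>F n in sequentially. x \<notin> boundary_collar (\<epsilon> n)"
proof -
  have "\<forall>\<^sub>F n in sequentially. x \<notin> edge_collar i (\<epsilon> n)" if i: "i < length ps" for i
  proof -
    let ?s = "bary1 (vtx ps i) (side i) (transversal i) x" and ?t = "bary2 (vtx ps i) (side i) (transversal i) x"
    have "x \<notin> polygon_edge ps i"
      using x i frontier_K open_K by (auto simp: frontier_def interior_open)
    moreover have "x = vtx ps i + ?s *\<^sub>R side i + ?t *\<^sub>R transversal i"
      using chart_coords(3)[OF det2_transversal[OF i], of "vtx ps i" x] by (simp add: chart_def bary1_def bary2_def)
    ultimately have "\<not> (?t = 0 \<and> 0 \<le> ?s \<and> ?s \<le> 1)"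
      by (auto simp: polygon_edge_side in_segment algebra_simps)
    then have "max \<bar>?t\<bar> (max (- ?s) (?s - 1)) / 2 > 0" by auto
    then have "\<forall>\<^sub>F n in sequentially. \<epsilon> n < max \<bar>?t\<bar> (max (- ?s) (?s - 1)) / 2"
      using \<epsilon> by (intro order_tendstoD) auto
    then show ?thesis
      by eventually_elim (auto simp: collar_def)
  qed
  then have "\<forall>\<^sub>F n in sequentially. \<forall>i\<in>{..<length ps}. x \<notin> edge_collar i (\<epsilon> n)"
    by (intro eventually_ball_finite) auto
  then show ?thesis by eventually_elim (auto simp: boundary_collar_def)
qed

text \<open>The derivative of the cutoff is of size \<open>1 / \<epsilon>\<close>. Over the collar, the square of a function with small boundary values has an
  integral of order \<open>\<epsilon>\<^sup>2\<close>, which compensates for it.\<close>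

lemma boundary_cutoff_energy:
  "\<exists>C \<epsilon>0. C \<ge> 0 \<and> \<epsilon>0 > 0 \<and> (\<forall>\<epsilon> z N j. 0 < \<epsilon> \<and> \<epsilon> < \<epsilon>0 \<and> smooth z \<and> (\<forall>x. \<bar>z x\<bar> \<le> N) \<longrightarrow>
    (\<integral>x. (partial j (boundary_cutoff \<epsilon>) x * z x)\<^sup>2 \<partial>lebesgue_on K) \<le> C * (N\<^sup>2 + boundary_energy z / \<epsilon> + grad_energy K z))"
proof -
  let ?n = "length ps"
  define P where "P \<tau> i C E \<longleftrightarrow> C \<ge> 0 \<and> E > 0 \<and> (\<forall>\<epsilon> z N. 0 < \<epsilon> \<and> \<epsilon> < E \<and> smooth z \<and> (\<forall>x. \<bar>z x\<bar> \<le> N) \<longrightarrow>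
    (\<integral>x. indicator (\<tau> \<inter> edge_collar i \<epsilon>) x * (z x)\<^sup>2 \<partial>lborel) \<le> C * (\<epsilon>\<^sup>2 * N\<^sup>2 + \<epsilon> * edge_energy ps i z + \<epsilon>\<^sup>2 * grad_energy K z))" for \<tau> i C E
  have "\<exists>C E. P \<tau> i C E" if "\<tau> \<in> \<T>" "i < ?n" for \<tau> i
    unfolding P_def by (rule collar_estimate_triangle[OF that])
  then obtain C E where PCE: "\<And>\<tau> i. \<tau> \<in> \<T> \<Longrightarrow> i < ?n \<Longrightarrow> P \<tau> i (C \<tau> i) (E \<tau> i)"
    by metis
  note CE = PCE[unfolded P_def]
  define \<epsilon>0 where "\<epsilon>0 = Min (insert 1 ((\<lambda>(\<tau>, i). E \<tau> i) ` (\<T> \<times> {..<?n})))"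
  have fin: "finite (insert 1 ((\<lambda>(\<tau>, i). E \<tau> i) ` (\<T> \<times> {..<?n})))" using finite_T by simp
  have \<epsilon>0: "\<epsilon>0 > 0" "\<And>\<tau> i. \<tau> \<in> \<T> \<Longrightarrow> i < ?n \<Longrightarrow> \<epsilon>0 \<le> E \<tau> i"
    unfolding \<epsilon>0_def using fin CE by (auto intro!: Min_le)
  define D where "D = (\<Sum>i<?n. 4 * step_slope * (norm (coord_grad1 (side i) (transversal i)) + norm (coord_grad2 (side i) (transversal i))))"
  define S where "S = (\<Sum>i<?n. \<Sum>\<tau>\<in>\<T>. C \<tau> i)"
  have D: "D \<ge> 0" unfolding D_def using step_slope_pos by (intro sum_nonneg mult_nonneg_nonneg add_nonneg_nonneg) auto
  have S: "S \<ge> 0" unfolding S_def using CE by (intro sum_nonneg) auto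
  have main: "(\<integral>x. (partial j (boundary_cutoff \<epsilon>) x * z x)\<^sup>2 \<partial>lebesgue_on K) \<le> (D\<^sup>2 * S) * (N\<^sup>2 + boundary_energy z / \<epsilon> + grad_energy K z)"
    if \<epsilon>: "0 < \<epsilon>" "\<epsilon> < \<epsilon>0" and z: "smooth z" and N: "\<forall>x. \<bar>z x\<bar> \<le> N" for \<epsilon> z N j
  proof -
    let ?d = "partial j (boundary_cutoff \<epsilon>)"
    have bor: "\<tau> \<inter> edge_collar i \<epsilon> \<in> sets borel" "bounded (\<tau> \<inter> edge_collar i \<epsilon>)" if "\<tau> \<in> \<T>" for \<tau> i
    proof -
      have "compact \<tau>" using simplex_T[OF that] compact_simplex by blast
      then show "\<tau> \<inter> edge_collar i \<epsilon> \<in> sets borel" "bounded (\<tau> \<inter> edge_collar i \<epsilon>)"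
        using collar_borel bounded_subset[OF compact_imp_bounded, of \<tau>] by (auto intro: borel_compact)
    qed
    have int: "integrable lborel (\<lambda>x. indicator (\<tau> \<inter> edge_collar i \<epsilon>) x * (z x)\<^sup>2)" if "\<tau> \<in> \<T>" for \<tau> i
      using bor[OF that] z by (intro integrable_indicator_borel smooth_continuous_on smooth_power)
    have dbound: "\<bar>?d x\<bar> \<le> D / \<epsilon>" for x
    proof -
      have "\<bar>?d x\<bar> \<le> (\<Sum>i<?n. \<bar>partial j (collar_cutoff (vtx ps i) (side i) (transversal i) \<epsilon>) x\<bar>)"
        unfolding boundary_cutoff_def[abs_def]
        by (rule partial_prod_bound) (simp_all add: smooth_collar_cutoff collar_cutoff_bounds)
      also have "\<dots> \<le> (\<Sum>i<?n. 4 * step_slope * (norm (coord_grad1 (side i) (transversal i)) + norm (coord_grad2 (side i) (transversal i))) / \<epsilon>)"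
        by (intro sum_mono partial_collar_cutoff_bound \<epsilon>)
      finally show ?thesis by (simp add: D_def sum_divide_distrib)
    qed
    have pt: "indicator K x * (?d x * z x)\<^sup>2 \<le> (\<Sum>i<?n. \<Sum>\<tau>\<in>\<T>. (D / \<epsilon>)\<^sup>2 * (indicator (\<tau> \<inter> edge_collar i \<epsilon>) x * (z x)\<^sup>2))" (is "_ \<le> ?rhs") for x
    proof (cases "x \<in> K \<and> x \<in> boundary_collar \<epsilon>")
      case True
      then obtain i where i: "i < ?n" "x \<in> edge_collar i \<epsilon>" by (auto simp: boundary_collar_def)
      obtain \<tau> where \<tau>: "\<tau> \<in> \<T>" "x \<in> \<tau>" using True Union_T closure_subset by blast
      have "(?d x)\<^sup>2 \<le> (D / \<epsilon>)\<^sup>2" using power_mono[OF dbound, of x 2] by simp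
      then have "indicator K x * (?d x * z x)\<^sup>2 \<le> (D / \<epsilon>)\<^sup>2 * (indicator (\<tau> \<inter> edge_collar i \<epsilon>) x * (z x)\<^sup>2)"
        using True i \<tau> by (simp add: power_mult_distrib mult_right_mono)
      also have "\<dots> \<le> (\<Sum>\<tau>\<in>\<T>. (D / \<epsilon>)\<^sup>2 * (indicator (\<tau> \<inter> edge_collar i \<epsilon>) x * (z x)\<^sup>2))"
        by (rule member_le_sum[OF \<tau>(1) _ finite_T]) simp
      also have "\<dots> \<le> ?rhs"
        by (rule member_le_sum[of i "{..<?n}" "\<lambda>i. \<Sum>\<tau>\<in>\<T>. (D / \<epsilon>)\<^sup>2 * (indicator (\<tau> \<inter> edge_collar i \<epsilon>) x * (z x)\<^sup>2)"])
          (use i in \<open>auto intro!: sum_nonneg\<close>)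
      finally show ?thesis .
    next
      case False
      then have "indicator K x * (?d x * z x)\<^sup>2 = 0"
        using boundary_cutoff_outside(2)[OF \<epsilon>(1)] by (auto simp: indicator_def)
      moreover have "?rhs \<ge> 0" by (intro sum_nonneg mult_nonneg_nonneg) auto
      ultimately show ?thesis by (simp only:)
    qed
    have sm: "smooth (\<lambda>x. (?d x * z x)\<^sup>2)"
      by (intro smooth_power smooth_mult smooth_partial smooth_boundary_cutoff z)
    have KB: "K \<in> sets borel" using open_K by simp
    have "(\<integral>x. (?d x * z x)\<^sup>2 \<partial>lebesgue_on K) = (\<integral>x. indicator K x * (?d x * z x)\<^sup>2 \<partial>lborel)"
      by (intro lebesgue_on_borel(1)[OF KB] borel_measurable_continuous_onI smooth_continuous_on sm)
    also have "\<dots> \<le> (\<integral>x. (\<Sum>i<?n. \<Sum>\<tau>\<in>\<T>. (D / \<epsilon>)\<^sup>2 * (indicator (\<tau> \<inter> edge_collar i \<epsilon>) x * (z x)\<^sup>2)) \<partial>lborel)"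
      using pt int by (intro integral_mono integrable_indicator_borel[OF KB bounded_K smooth_continuous_on[OF sm]]) auto
    also have "\<dots> = (\<Sum>i<?n. \<Sum>\<tau>\<in>\<T>. (D / \<epsilon>)\<^sup>2 * (\<integral>x. indicator (\<tau> \<inter> edge_collar i \<epsilon>) x * (z x)\<^sup>2 \<partial>lborel))"
      using int by simp
    also have "\<dots> \<le> (\<Sum>i<?n. \<Sum>\<tau>\<in>\<T>. (D / \<epsilon>)\<^sup>2 * (C \<tau> i * (\<epsilon>\<^sup>2 * N\<^sup>2 + \<epsilon> * boundary_energy z + \<epsilon>\<^sup>2 * grad_energy K z)))"
    proof (intro sum_mono mult_left_mono)
      fix i \<tau> assume i: "i \<in> {..<?n}" and \<tau>: "\<tau> \<in> \<T>"
      have "(\<integral>x. indicator (\<tau> \<inter> edge_collar i \<epsilon>) x * (z x)\<^sup>2 \<partial>lborel) \<le> C \<tau> i * (\<epsilon>\<^sup>2 * N\<^sup>2 + \<epsilon> * edge_energy ps i z + \<epsilon>\<^sup>2 * grad_energy K z)"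
        using CE[OF \<tau>, of i] \<epsilon>0(2)[OF \<tau>, of i] \<epsilon> z N i by fastforce
      also have "edge_energy ps i z \<le> boundary_energy z"
        unfolding boundary_energy_def using i by (intro member_le_sum energy_nonneg) auto
      finally show "(\<integral>x. indicator (\<tau> \<inter> edge_collar i \<epsilon>) x * (z x)\<^sup>2 \<partial>lborel) \<le> C \<tau> i * (\<epsilon>\<^sup>2 * N\<^sup>2 + \<epsilon> * boundary_energy z + \<epsilon>\<^sup>2 * grad_energy K z)"
        using CE[OF \<tau>, of i] i \<epsilon>(1) by (simp add: mult_left_mono)
    qed auto
    also have "\<dots> = ((D / \<epsilon>)\<^sup>2 * (\<epsilon>\<^sup>2 * N\<^sup>2 + \<epsilon> * boundary_energy z + \<epsilon>\<^sup>2 * grad_energy K z)) * S"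
      unfolding S_def sum_distrib_left by (intro sum.cong refl) (simp only: mult_ac)
    also have "\<dots> = (D\<^sup>2 * S) * (N\<^sup>2 + boundary_energy z / \<epsilon> + grad_energy K z)"
      using \<epsilon>(1) by (simp add: power2_eq_square field_simps)
    finally show ?thesis .
  qed
  show ?thesis
    using main \<epsilon>0(1) D S by (intro exI[of _ "D\<^sup>2 * S"] exI[of _ \<epsilon>0]) auto
qed

lemma smooth_bounded_on_K:
  assumes "smooth f"
  shows "\<exists>B. \<forall>x\<in>K. \<bar>f x\<bar> \<le> B"
  using uniformly_bounded_fixed[OF bounded_K smooth_continuous_on[OF assms]] by (simp add: uniformly_bounded_def)

lemma L2_smooth: "smooth f \<Longrightarrow> f \<in> L2 K"
  by (intro L2_continuous lmeasurable_K bounded_K smooth_continuous_on)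

lemma measurable_smooth: "smooth f \<Longrightarrow> f \<in> borel_measurable (lebesgue_on K)"
  using L2_smooth by (simp add: L2_def)

text \<open>The equation may be tested with a limit of bounded smooth functions whose boundary values tend to zero.
  Multiplied by the cutoff they are test functions. With the cutoff fixed the approximation is removed first; what is left of
  the derivative of the cutoff is bounded in the square mean, uniformly in \<open>\<epsilon>\<close>, and is paired with the flux on a
  collar that shrinks to nothing.\<close>

lemma vanishing_trace_test:
  assumes div: "has_weak_divergence K w p"
    and zs: "\<And>m. smooth (z m)" and N: "\<And>m x. \<bar>z m x\<bar> \<le> N" and bd: "(\<lambda>m. boundary_energy (z m)) \<longlonglongrightarrow> 0"
    and lim: "L2_tendsto K z f" "\<And>j. L2_tendsto K (\<lambda>m. partial j (z m)) (y j)"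
  shows "(\<Sum>j\<in>UNIV. \<integral>x. w j x * y j x \<partial>lebesgue_on K) = - (\<integral>x. p x * f x \<partial>lebesgue_on K)"
proof -
  have w: "w j \<in> L2 K" and p: "p \<in> L2 K" for j using div by (auto simp: has_weak_divergence_def)
  have fL: "f \<in> L2 K" and yL: "y j \<in> L2 K" for j using lim by (auto simp: L2_tendsto_def)
  obtain C \<epsilon>0 where C: "C \<ge> 0" "\<epsilon>0 > 0" and est: "\<And>\<epsilon> z N j. 0 < \<epsilon> \<Longrightarrow> \<epsilon> < \<epsilon>0 \<Longrightarrow> smooth z \<Longrightarrow> (\<And>x. \<bar>z x\<bar> \<le> N) \<Longrightarrow>
    (\<integral>x. (partial j (boundary_cutoff \<epsilon>) x * z x)\<^sup>2 \<partial>lebesgue_on K) \<le> C * (N\<^sup>2 + boundary_energy z / \<epsilon> + grad_energy K z)"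
    using boundary_cutoff_energy by blast
  define \<epsilon> where "\<epsilon> n = \<epsilon>0 / real (Suc (Suc n))" for n
  have \<epsilon>: "\<epsilon> n > 0" "\<epsilon> n < \<epsilon>0" for n
  proof -
    show "\<epsilon> n > 0" using C(2) by (simp add: \<epsilon>_def)
    have "\<epsilon>0 * 1 < \<epsilon>0 * real (Suc (Suc n))" using C(2) by (intro mult_strict_left_mono) auto
    then show "\<epsilon> n < \<epsilon>0" by (simp add: \<epsilon>_def pos_divide_less_eq)
  qed
  have \<epsilon>_lim: "\<epsilon> \<longlonglongrightarrow> 0"
    unfolding \<epsilon>_def[abs_def] using tendsto_mult[OF tendsto_const LIMSEQ_Suc[OF LIMSEQ_Suc[OF lim_1_over_n]], of \<epsilon>0] by simp
  define \<eta> where "\<eta> n = boundary_cutoff (\<epsilon> n)" for n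
  have \<eta>s: "smooth (\<eta> n)" for n by (simp add: \<eta>_def smooth_boundary_cutoff)
  have \<eta>b: "\<bar>\<eta> n x\<bar> \<le> 1" for n x using boundary_cutoff_bounds[of "\<epsilon> n" x] by (simp add: \<eta>_def)
  have step1: "(\<Sum>j\<in>UNIV. (\<integral>x. w j x * (partial j (\<eta> n) x * f x) \<partial>lebesgue_on K) + (\<integral>x. w j x * (\<eta> n x * y j x) \<partial>lebesgue_on K))
      = - (\<integral>x. p x * (\<eta> n x * f x) \<partial>lebesgue_on K)" for n
  proof -
    have dL: "L2_tendsto K (\<lambda>m x. partial j (\<eta> n) x * z m x) (\<lambda>x. partial j (\<eta> n) x * f x)" for j
    proof -
      obtain B where "\<forall>x\<in>K. \<bar>partial j (\<eta> n) x\<bar> \<le> B" using smooth_bounded_on_K[OF smooth_partial[OF \<eta>s]] by blast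
      then show ?thesis by (intro L2_tendsto_mult_fixed[OF lim(1)] measurable_smooth smooth_partial \<eta>s) auto
    qed
    have cL: "L2_tendsto K (\<lambda>m x. \<eta> n x * partial j (z m) x) (\<lambda>x. \<eta> n x * y j x)"
      "L2_tendsto K (\<lambda>m x. \<eta> n x * z m x) (\<lambda>x. \<eta> n x * f x)" for j
      using \<eta>b by (intro L2_tendsto_mult_fixed[where B = 1] lim measurable_smooth \<eta>s; simp)+
    have eq: "(\<Sum>j\<in>UNIV. (\<integral>x. w j x * (partial j (\<eta> n) x * z m x) \<partial>lebesgue_on K) + (\<integral>x. w j x * (\<eta> n x * partial j (z m) x) \<partial>lebesgue_on K))
      = - (\<integral>x. p x * (\<eta> n x * z m x) \<partial>lebesgue_on K)" for m
    proof -
      define F where "F x = \<eta> n x * z m x" for x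
      have F: "smooth F" unfolding F_def[abs_def] by (intro smooth_mult \<eta>s zs)
      obtain U where U: "open U" "frontier K \<subseteq> U" "\<And>x. x \<in> U \<Longrightarrow> \<eta> n x = 0"
        using boundary_cutoff_vanishes[OF \<epsilon>(1)[of n]] unfolding \<eta>_def by blast
      have F0: "\<And>x. x \<in> U \<Longrightarrow> F x = 0" using U(3) by (simp add: F_def)
      let ?\<zeta> = "\<lambda>x. if x \<in> K then F x else 0"
      have "(\<Sum>j\<in>UNIV. \<integral>x. w j x * partial j ?\<zeta> x \<partial>lebesgue_on K) = - (\<integral>x. p x * ?\<zeta> x \<partial>lebesgue_on K)"
        using div smooth_restrict_test_function(1)[OF open_K bounded_K F U(1,2) F0] unfolding has_weak_divergence_def by blast
      moreover have "(\<integral>x. w j x * partial j ?\<zeta> x \<partial>lebesgue_on K) =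
          (\<integral>x. w j x * (partial j (\<eta> n) x * z m x) \<partial>lebesgue_on K) + (\<integral>x. w j x * (\<eta> n x * partial j (z m) x) \<partial>lebesgue_on K)" for j
      proof -
        have "(\<integral>x. w j x * partial j ?\<zeta> x \<partial>lebesgue_on K) = (\<integral>x. w j x * (partial j (\<eta> n) x * z m x) + w j x * (\<eta> n x * partial j (z m) x) \<partial>lebesgue_on K)"
        proof (rule Bochner_Integration.integral_cong[OF refl])
          fix x assume "x \<in> space (lebesgue_on K)"
          then have "partial j ?\<zeta> x = partial j F x"
            using smooth_restrict_test_function(2)[OF open_K bounded_K F U(1,2) F0] by simp
          also have "\<dots> = \<eta> n x * partial j (z m) x + partial j (\<eta> n) x * z m x"
            unfolding F_def[abs_def] by (intro partial_mult smooth_differentiable \<eta>s zs)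
          finally show "w j x * partial j ?\<zeta> x = w j x * (partial j (\<eta> n) x * z m x) + w j x * (\<eta> n x * partial j (z m) x)"
            by (simp add: algebra_simps)
        qed
        also have "\<dots> = (\<integral>x. w j x * (partial j (\<eta> n) x * z m x) \<partial>lebesgue_on K) + (\<integral>x. w j x * (\<eta> n x * partial j (z m) x) \<partial>lebesgue_on K)"
          by (intro Bochner_Integration.integral_add L2_mult_integrable w L2_smooth smooth_mult smooth_partial \<eta>s zs)
        finally show ?thesis .
      qed
      moreover have "(\<integral>x. p x * ?\<zeta> x \<partial>lebesgue_on K) = (\<integral>x. p x * (\<eta> n x * z m x) \<partial>lebesgue_on K)"
        by (rule Bochner_Integration.integral_cong) (simp_all add: F_def)
      ultimately show ?thesis by simp
    qed
    have "(\<lambda>m. \<Sum>j\<in>UNIV. (\<integral>x. w j x * (partial j (\<eta> n) x * z m x) \<partial>lebesgue_on K) + (\<integral>x. w j x * (\<eta> n x * partial j (z m) x) \<partial>lebesgue_on K))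
        \<longlonglongrightarrow> (\<Sum>j\<in>UNIV. (\<integral>x. w j x * (partial j (\<eta> n) x * f x) \<partial>lebesgue_on K) + (\<integral>x. w j x * (\<eta> n x * y j x) \<partial>lebesgue_on K))"
      by (intro tendsto_sum tendsto_add L2_tendsto_integral_mult L2_tendsto_const w dL cL)
    moreover have "(\<lambda>m. - (\<integral>x. p x * (\<eta> n x * z m x) \<partial>lebesgue_on K)) \<longlonglongrightarrow> - (\<integral>x. p x * (\<eta> n x * f x) \<partial>lebesgue_on K)"
      by (intro tendsto_minus L2_tendsto_integral_mult L2_tendsto_const p cL)
    ultimately show ?thesis unfolding eq by (rule LIMSEQ_unique)
  qed
  define G where "G = (\<Sum>j\<in>UNIV. \<integral>x. (y j x)\<^sup>2 \<partial>lebesgue_on K)"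
  have dfL: "(\<lambda>x. partial j (\<eta> n) x * f x) \<in> L2 K" for j n
  proof -
    obtain B where "\<forall>x\<in>K. \<bar>partial j (\<eta> n) x\<bar> \<le> B" using smooth_bounded_on_K[OF smooth_partial[OF \<eta>s]] by blast
    then show ?thesis by (intro L2_mult_bounded[OF fL] measurable_smooth smooth_partial \<eta>s) auto
  qed
  have step2: "(L2_norm K (\<lambda>x. partial j (\<eta> n) x * f x))\<^sup>2 \<le> C * (N\<^sup>2 + G)" for j n
  proof -
    have dL: "L2_tendsto K (\<lambda>m x. partial j (\<eta> n) x * z m x) (\<lambda>x. partial j (\<eta> n) x * f x)"
    proof -
      obtain B where "\<forall>x\<in>K. \<bar>partial j (\<eta> n) x\<bar> \<le> B" using smooth_bounded_on_K[OF smooth_partial[OF \<eta>s]] by blast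
      then show ?thesis by (intro L2_tendsto_mult_fixed[OF lim(1)] measurable_smooth smooth_partial \<eta>s) auto
    qed
    have 1: "(\<lambda>m. \<integral>x. (partial j (\<eta> n) x * z m x)\<^sup>2 \<partial>lebesgue_on K) \<longlonglongrightarrow> (L2_norm K (\<lambda>x. partial j (\<eta> n) x * f x))\<^sup>2"
      using L2_tendsto_integral_mult[OF dL dL] unfolding L2_norm_power2 by (simp only: power2_eq_square)
    have "(\<lambda>m. grad_energy K (z m)) \<longlonglongrightarrow> G"
      unfolding grad_energy_def G_def using L2_tendsto_integral_mult[OF lim(2) lim(2)] by (intro tendsto_sum) (simp add: power2_eq_square)
    then have "(\<lambda>m. C * (N\<^sup>2 + boundary_energy (z m) / \<epsilon> n + grad_energy K (z m))) \<longlonglongrightarrow> C * (N\<^sup>2 + 0 / \<epsilon> n + G)"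
      using \<epsilon>(1)[of n] by (intro tendsto_intros bd) auto
    then show ?thesis
      using LIMSEQ_le[OF 1] est[OF \<epsilon>[of n] zs N] unfolding \<eta>_def by fastforce
  qed
  have bor: "boundary_collar (\<epsilon> n) \<in> sets borel" for n
    unfolding boundary_collar_def by (intro sets.finite_UN collar_borel) auto
  have indm: "indicator (boundary_collar (\<epsilon> n)) \<in> borel_measurable (lebesgue_on K)" for n :: nat
    using borel_measurable_indicator[OF bor[of n]] by (intro measurable_restrict_space1 measurable_completion) simp
  have step3: "(\<lambda>n. \<integral>x. w j x * (partial j (\<eta> n) x * f x) \<partial>lebesgue_on K) \<longlonglongrightarrow> 0" for j
  proof (rule Lim_null_comparison)
    let ?wi = "\<lambda>n x. indicator (boundary_collar (\<epsilon> n)) x * w j x"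
    have wi: "L2_tendsto K ?wi (\<lambda>x. 0 * w j x)"
    proof (rule L2_tendsto_mult_pointwise[OF w indm, where B = 1])
      show "AE x in lebesgue_on K. (\<lambda>n. indicat_real (boundary_collar (\<epsilon> n)) x) \<longlonglongrightarrow> 0"
      proof (rule AE_I2)
        fix x assume "x \<in> space (lebesgue_on K)"
        then have "\<forall>\<^sub>F n in sequentially. x \<notin> boundary_collar (\<epsilon> n)"
          by (intro eventually_not_in_boundary_collar \<epsilon>_lim) simp
        then show "(\<lambda>n. indicat_real (boundary_collar (\<epsilon> n)) x) \<longlonglongrightarrow> 0"
          by (intro tendsto_eventually) (auto elim: eventually_mono)
      qed
    qed (auto simp: indicator_def)
    have wiL: "?wi n \<in> L2 K" for n using wi by (simp add: L2_tendsto_def)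
    have "(\<lambda>n. L2_norm K (?wi n)) \<longlonglongrightarrow> 0" using wi by (simp add: L2_tendsto_def)
    then show "(\<lambda>n. L2_norm K (?wi n) * sqrt (C * (N\<^sup>2 + G))) \<longlonglongrightarrow> 0" by (rule tendsto_mult_left_zero)
    have "\<bar>\<integral>x. w j x * (partial j (\<eta> n) x * f x) \<partial>lebesgue_on K\<bar> \<le> L2_norm K (?wi n) * sqrt (C * (N\<^sup>2 + G))" for n
    proof -
      have "w j x * (partial j (\<eta> n) x * f x) = ?wi n x * (partial j (\<eta> n) x * f x)" for x
        using boundary_cutoff_outside(2)[OF \<epsilon>(1)[of n], of x j] by (auto simp: indicator_def \<eta>_def)
      then have "\<bar>\<integral>x. w j x * (partial j (\<eta> n) x * f x) \<partial>lebesgue_on K\<bar> = \<bar>\<integral>x. ?wi n x * (partial j (\<eta> n) x * f x) \<partial>lebesgue_on K\<bar>"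
        by (simp only:)
      also have "\<dots> \<le> L2_norm K (?wi n) * L2_norm K (\<lambda>x. partial j (\<eta> n) x * f x)"
        by (rule L2_Cauchy_Schwarz[OF wiL dfL])
      also have "\<dots> \<le> L2_norm K (?wi n) * sqrt (C * (N\<^sup>2 + G))"
        using step2 by (intro mult_left_mono real_le_rsqrt L2_norm_nonneg)
      finally show ?thesis .
    qed
    then show "\<forall>\<^sub>F n in sequentially. norm (\<integral>x. w j x * (partial j (\<eta> n) x * f x) \<partial>lebesgue_on K) \<le> L2_norm K (?wi n) * sqrt (C * (N\<^sup>2 + G))"
      by simp
  qed
  have \<eta>lim: "L2_tendsto K (\<lambda>n x. \<eta> n x * g x) (\<lambda>x. 1 * g x)" if "g \<in> L2 K" for g
  proof (rule L2_tendsto_mult_pointwise[OF that, where B = 1])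
    show "AE x in lebesgue_on K. (\<lambda>n. \<eta> n x) \<longlonglongrightarrow> 1"
    proof (rule AE_I2)
      fix x assume "x \<in> space (lebesgue_on K)"
      then have "\<forall>\<^sub>F n in sequentially. x \<notin> boundary_collar (\<epsilon> n)"
        by (intro eventually_not_in_boundary_collar \<epsilon>_lim) simp
      then show "(\<lambda>n. \<eta> n x) \<longlonglongrightarrow> 1"
        by (intro tendsto_eventually) (auto elim!: eventually_mono simp: \<eta>_def boundary_cutoff_outside(1)[OF \<epsilon>(1)])
    qed
  qed (use \<eta>b measurable_smooth[OF \<eta>s] in auto)
  have "(\<lambda>n. \<Sum>j\<in>UNIV. (\<integral>x. w j x * (partial j (\<eta> n) x * f x) \<partial>lebesgue_on K) + (\<integral>x. w j x * (\<eta> n x * y j x) \<partial>lebesgue_on K))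
      \<longlonglongrightarrow> (\<Sum>j\<in>UNIV. 0 + (\<integral>x. w j x * (1 * y j x) \<partial>lebesgue_on K))"
    by (intro tendsto_sum tendsto_add step3 L2_tendsto_integral_mult L2_tendsto_const w \<eta>lim yL)
  moreover have "(\<lambda>n. - (\<integral>x. p x * (\<eta> n x * f x) \<partial>lebesgue_on K)) \<longlonglongrightarrow> - (\<integral>x. p x * (1 * f x) \<partial>lebesgue_on K)"
    by (intro tendsto_minus L2_tendsto_integral_mult L2_tendsto_const p \<eta>lim fL)
  ultimately have "(\<Sum>j\<in>UNIV. 0 + (\<integral>x. w j x * (1 * y j x) \<partial>lebesgue_on K)) = - (\<integral>x. p x * (1 * f x) \<partial>lebesgue_on K)"
    unfolding step1 by (rule LIMSEQ_unique)
  then show ?thesis by simp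
qed

end

section \<open>Soft thresholding\<close>

lemma Lipschitz_of_derivative:
  fixes f f' :: "real \<Rightarrow> real"
  assumes "\<And>x. (f has_real_derivative f' x) (at x)" "\<And>x. \<bar>f' x\<bar> \<le> 1"
  shows "\<bar>f a - f b\<bar> \<le> \<bar>a - b\<bar>"
proof -
  have less: "\<bar>f a - f b\<bar> \<le> \<bar>a - b\<bar>" if "a < b" for a b
  proof -
    obtain z where "f b - f a = (b - a) * f' z" using MVT2[OF \<open>a < b\<close>, of f f'] assms(1) by blast
    then have "f a - f b = (a - b) * f' z" by (simp add: algebra_simps)
    then have "\<bar>f a - f b\<bar> = \<bar>a - b\<bar> * \<bar>f' z\<bar>" by (simp add: abs_mult)
    then show ?thesis using mult_left_mono[OF assms(2)[of z], of "\<bar>a - b\<bar>"] by simp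
  qed
  consider "a < b" | "b < a" | "a = b" by linarith
  then show ?thesis
    by cases (use less[of a b] less[of b a] in \<open>auto simp: abs_minus_commute\<close>)
qed

text \<open>For positive \<open>s\<close> this is \<open>s exp (- G / s)\<close>, a smooth substitute for the positive part: its slope is \<open>(1 + x) exp (- x)\<close> with
  \<open>x = G / s\<close>, which lies between 0 and 1, and it differs from \<open>s\<close> by at most \<open>G\<close>.\<close>

definition ramp :: "real \<Rightarrow> real \<Rightarrow> real"
  where "ramp G s = s * exp_flat (s / G)"

definition ramp_deriv :: "real \<Rightarrow> real \<Rightarrow> real"
  where "ramp_deriv G s = exp_flat (s / G) + s / G * exp_flat_deriv (s / G)"

lemma has_real_derivative_ramp: "(ramp G has_real_derivative ramp_deriv G s) (at s)"
proof -
  have "((\<lambda>s. exp_flat (s / G)) has_real_derivative exp_flat_deriv (s / G) * (1 / G)) (at s)"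
    by (rule DERIV_chain2[OF has_real_derivative_exp_flat DERIV_cdivide[OF DERIV_ident]])
  then show ?thesis
    unfolding ramp_def[abs_def] ramp_deriv_def by (auto intro!: derivative_eq_intros)
qed

lemma ramp_nonpos: "G > 0 \<Longrightarrow> s \<le> 0 \<Longrightarrow> ramp G s = 0" "G > 0 \<Longrightarrow> s \<le> 0 \<Longrightarrow> ramp_deriv G s = 0"
  by (auto simp: ramp_def ramp_deriv_def flat_poly_def exp_flat_deriv_def divide_le_0_iff)

lemma ramp_bounds:
  assumes "G > 0" "s \<ge> 0"
  shows "0 \<le> ramp G s" "ramp G s \<le> s" "s - G \<le> ramp G s" "0 \<le> ramp_deriv G s" "ramp_deriv G s \<le> 1"
proof -
  show "0 \<le> ramp G s" "ramp G s \<le> s"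
    using assms exp_flat_bounds[of "s / G"] by (auto simp: ramp_def mult_left_le)
  show "0 \<le> ramp_deriv G s"
    using assms exp_flat_bounds exp_flat_deriv_bounds unfolding ramp_deriv_def by (intro add_nonneg_nonneg mult_nonneg_nonneg) auto
  show "s - G \<le> ramp G s" and "ramp_deriv G s \<le> 1"
  proof -
    have "s - G \<le> ramp G s \<and> ramp_deriv G s \<le> 1"
    proof (cases "s = 0")
      case True
      then show ?thesis using assms by (simp add: ramp_nonpos)
    next
      case False
      define x where "x = G / s"
      have x: "x > 0" using assms False by (simp add: x_def)
      have e: "exp_flat (s / G) = exp (- x)" "s / G * exp_flat_deriv (s / G) = x * exp (- x)"
        using assms False by (simp_all add: flat_poly_def exp_flat_deriv_def x_def power2_eq_square field_simps)
      have "1 - x \<le> exp (- x)" using exp_ge_add_one_self[of "- x"] by simp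
      then have "s * (1 - x) \<le> s * exp (- x)" using assms by (intro mult_left_mono) auto
      moreover have "s * (1 - x) = s - G" using False by (simp add: x_def field_simps)
      moreover have "(1 + x) * exp (- x) \<le> exp x * exp (- x)"
        using exp_ge_add_one_self[of x] by (intro mult_right_mono) auto
      ultimately show ?thesis
        unfolding ramp_def ramp_deriv_def e by (simp add: distrib_right exp_minus_inverse)
    qed
    then show "s - G \<le> ramp G s" and "ramp_deriv G s \<le> 1" by auto
  qed
qed

lemma continuous_ramp_deriv: "continuous_on UNIV (ramp_deriv G)"
proof (cases "G = 0")
  case True
  then show ?thesis by (simp add: ramp_deriv_def[abs_def])
next
  case False
  then show ?thesis
    unfolding ramp_deriv_def[abs_def]
    by (intro continuous_intros continuous_on_compose2[OF continuous_on_exp_flat(1)[of UNIV]]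
        continuous_on_compose2[OF continuous_on_exp_flat(2)[of UNIV]]) auto
qed

definition soft :: "real \<Rightarrow> real \<Rightarrow> real"
  where "soft G s = ramp G (s - G) - ramp G (- s - G)"

definition soft_deriv :: "real \<Rightarrow> real \<Rightarrow> real"
  where "soft_deriv G s = ramp_deriv G (s - G) + ramp_deriv G (- s - G)"

lemma has_real_derivative_soft: "(soft G has_real_derivative soft_deriv G s) (at s)"
proof -
  have "((\<lambda>s. ramp G (s - G)) has_real_derivative ramp_deriv G (s - G) * 1) (at s)"
    "((\<lambda>s. ramp G (- s - G)) has_real_derivative ramp_deriv G (- s - G) * (- 1)) (at s)"
    by (rule DERIV_chain2[OF has_real_derivative_ramp]; auto intro!: derivative_eq_intros)+
  from DERIV_diff[OF this] show ?thesis
    unfolding soft_def[abs_def] soft_deriv_def by simp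
qed

lemma soft_deriv_bounds:
  assumes "G > 0"
  shows "0 \<le> soft_deriv G s" "soft_deriv G s \<le> 1"
proof -
  have "s - G \<le> 0 \<or> - s - G \<le> 0" using assms by linarith
  moreover have "0 \<le> ramp_deriv G t \<and> ramp_deriv G t \<le> 1" for t
    using ramp_bounds(4,5)[OF assms, of t] ramp_nonpos(2)[OF assms, of t] by (cases "t \<ge> 0") auto
  ultimately have "0 \<le> soft_deriv G s \<and> soft_deriv G s \<le> 1"
    unfolding soft_deriv_def using ramp_nonpos(2)[OF assms] by auto
  then show "0 \<le> soft_deriv G s" "soft_deriv G s \<le> 1" by auto
qed

lemma soft_small: "G > 0 \<Longrightarrow> \<bar>s\<bar> \<le> G \<Longrightarrow> soft G s = 0"
  by (simp add: soft_def ramp_nonpos abs_le_iff)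

lemma soft_close:
  assumes "G > 0"
  shows "\<bar>s - soft G s\<bar> \<le> 2 * G"
proof -
  consider "\<bar>s\<bar> \<le> G" | "s > G" | "s < - G" using assms by linarith
  then show ?thesis
  proof cases
    case 1
    then show ?thesis using soft_small[OF assms 1] assms by simp
  next
    case 2
    then show ?thesis using ramp_bounds(2,3)[OF assms, of "s - G"] ramp_nonpos(1)[OF assms, of "- s - G"] assms
      by (simp add: soft_def abs_le_iff)
  next
    case 3
    then show ?thesis using ramp_bounds(2,3)[OF assms, of "- s - G"] ramp_nonpos(1)[OF assms, of "s - G"] assms
      by (simp add: soft_def abs_le_iff)
  qed
qed

text \<open>Subtracting a level \<open>G\<close> from the modulus and saturating at the level \<open>N\<close>, smoothly and without ever increasing distances.\<close>

definition threshold :: "real \<Rightarrow> real \<Rightarrow> real \<Rightarrow> real"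
  where "threshold G N s = N * tanh (1 / N * soft G s)"

definition threshold_deriv :: "real \<Rightarrow> real \<Rightarrow> real \<Rightarrow> real"
  where "threshold_deriv G N s = (1 - (tanh (1 / N * soft G s))\<^sup>2) * soft_deriv G s"

lemma has_real_derivative_threshold:
  assumes "N > 0"
  shows "(threshold G N has_real_derivative threshold_deriv G N s) (at s)"
proof -
  have t: "(tanh has_real_derivative 1 - (tanh x)\<^sup>2) (at x)" for x :: real
    by (auto intro!: derivative_eq_intros)
  have "((\<lambda>s. tanh (1 / N * soft G s)) has_real_derivative (1 - (tanh (1 / N * soft G s))\<^sup>2) * (1 / N * soft_deriv G s)) (at s)"
    by (rule DERIV_chain2[OF t DERIV_cmult[OF has_real_derivative_soft]])
  from DERIV_cmult[OF this, of N] show ?thesis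
    unfolding threshold_def[abs_def] threshold_deriv_def using assms by simp
qed

lemma threshold_deriv_bounds:
  assumes "G > 0"
  shows "0 \<le> threshold_deriv G N s" "threshold_deriv G N s \<le> 1"
proof -
  have t: "0 \<le> 1 - (tanh x)\<^sup>2" "1 - (tanh x)\<^sup>2 \<le> 1" for x :: real
    using abs_square_le_1[of "tanh x"] tanh_real_lt_1[of x] tanh_real_gt_neg1[of x] by (auto simp: abs_le_iff)
  show "0 \<le> threshold_deriv G N s"
    unfolding threshold_deriv_def using t soft_deriv_bounds[OF assms] by (intro mult_nonneg_nonneg) auto
  have "(1 - (tanh (1 / N * soft G s))\<^sup>2) * soft_deriv G s \<le> 1 * 1"
    using t soft_deriv_bounds[OF assms] by (intro mult_mono) auto
  then show "threshold_deriv G N s \<le> 1" by (simp add: threshold_deriv_def)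
qed

lemma continuous_threshold_deriv: "continuous_on UNIV (threshold_deriv G N)"
proof -
  have s: "continuous_on UNIV (soft G)"
    by (rule DERIV_continuous_on[OF has_field_derivative_at_within[OF has_real_derivative_soft]])
  have "continuous_on UNIV (soft_deriv G)"
    unfolding soft_deriv_def[abs_def]
    by (intro continuous_intros continuous_on_compose2[OF continuous_ramp_deriv]) auto
  moreover have "continuous_on UNIV (\<lambda>s. tanh (1 / N * soft G s))"
    by (intro continuous_on_tanh continuous_on_mult continuous_on_const s) (simp add: cosh_real_nonzero)
  ultimately show ?thesis
    unfolding threshold_deriv_def[abs_def]
    by (intro continuous_on_mult continuous_on_diff continuous_on_const continuous_on_power)
qed

lemma threshold_bound: "N > 0 \<Longrightarrow> \<bar>threshold G N s\<bar> \<le> N"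
  using tanh_real_lt_1[of "1 / N * soft G s"] tanh_real_gt_neg1[of "1 / N * soft G s"]
  by (simp add: threshold_def abs_mult mult_left_le abs_le_iff)

lemma threshold_Lipschitz:
  assumes "G > 0" "N > 0"
  shows "\<bar>threshold G N a - threshold G N b\<bar> \<le> \<bar>a - b\<bar>"
  by (rule Lipschitz_of_derivative[OF has_real_derivative_threshold[OF assms(2)]])
    (use threshold_deriv_bounds[OF assms(1)] in auto)

lemma threshold_small: "G > 0 \<Longrightarrow> \<bar>s\<bar> \<le> G \<Longrightarrow> threshold G N s = 0"
  by (simp add: threshold_def soft_small)

lemma threshold_le: "G > 0 \<Longrightarrow> N > 0 \<Longrightarrow> \<bar>threshold G N s\<bar> \<le> \<bar>s\<bar>"
  using threshold_Lipschitz[of G N s 0] threshold_small[of G 0 N] by simp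

lemma continuous_threshold:
  assumes "N > 0"
  shows "continuous_on UNIV (threshold G N)"
  by (rule DERIV_continuous_on[OF has_field_derivative_at_within[OF has_real_derivative_threshold[OF assms]]])

lemma threshold_tendsto: "(\<lambda>n. threshold G (real (Suc n)) s) \<longlonglongrightarrow> soft G s"
proof (cases "soft G s = 0")
  case False
  let ?x = "soft G s"
  have "((\<lambda>h. tanh h / h) \<longlongrightarrow> 1) (at (0::real))"
  proof -
    have "(tanh has_real_derivative 1 - (tanh 0)\<^sup>2) (at (0::real))" by (auto intro!: derivative_eq_intros)
    then show ?thesis by (simp add: DERIV_def)
  qed
  moreover have "filterlim (\<lambda>n. 1 / real (Suc n) * ?x) (at 0) sequentially"
    unfolding filterlim_at using False tendsto_mult[OF LIMSEQ_Suc[OF lim_1_over_n] tendsto_const, of ?x] by auto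
  ultimately have "(\<lambda>n. tanh (1 / real (Suc n) * ?x) / (1 / real (Suc n) * ?x)) \<longlonglongrightarrow> 1"
    by (rule filterlim_compose)
  from tendsto_mult[OF tendsto_const[of ?x] this]
  have "(\<lambda>n. ?x * (tanh (1 / real (Suc n) * ?x) / (1 / real (Suc n) * ?x))) \<longlonglongrightarrow> ?x" by simp
  moreover have "?x * (tanh (1 / real (Suc n) * ?x) / (1 / real (Suc n) * ?x)) = threshold G (real (Suc n)) s" for n
    using False by (simp add: threshold_def del: of_nat_Suc)
  ultimately show ?thesis by simp
qed (simp add: threshold_def)

lemma smooth_threshold:
  assumes "smooth f"
  shows "smooth (\<lambda>x. threshold G N (f x))"
proof -
  have r: "smooth (\<lambda>x. ramp G (g x))" if "smooth g" for g
    using smooth_mult[OF that smooth_compose[OF smooth_real_flat_poly smooth_cmult[OF that, of "1 / G"], of 1]] by (simp add: ramp_def)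
  have n: "smooth (\<lambda>x. - f x - G)"
    using smooth_diff[OF smooth_cmult[OF assms, of "-1"] smooth_const[of G]] by simp
  have "smooth (\<lambda>x. soft G (f x))"
    unfolding soft_def by (intro smooth_diff r n assms smooth_const)
  then show ?thesis
    unfolding threshold_def by (intro smooth_cmult smooth_compose[OF smooth_real_tanh])
qed

context triangulated_polygon
begin

lemma position_divergence: "has_weak_divergence K (\<lambda>j x. if j = 1 then x $ 1 - c else 0) (\<lambda>_. 1)"
  unfolding has_weak_divergence_def
proof (intro conjI allI ballI)
  have sm: "smooth (\<lambda>x. x $ 1 - c)" by (intro smooth_diff smooth_component smooth_const)
  show "(\<lambda>x. if j = 1 then x $ 1 - c else 0) \<in> L2 K" for j :: 2
    using L2_smooth[OF sm] L2_zero by (cases "j = 1") auto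
  show "(\<lambda>_. 1) \<in> L2 K" by (intro L2_smooth smooth_const)
  fix \<zeta> assume \<zeta>: "\<zeta> \<in> test_functions K"
  let ?F = "\<lambda>x. (x $ 1 - c) * \<zeta> x"
  have \<zeta>s: "smooth \<zeta>" by (rule test_function_smooth[OF \<zeta>])
  have F: "?F \<in> test_functions K"
  proof -
    have sub: "closure {x. ?F x \<noteq> 0} \<subseteq> closure {x. \<zeta> x \<noteq> 0}" by (rule closure_mono) auto
    moreover have "compact (closure {x. ?F x \<noteq> 0})"
      using sub \<zeta> by (metis (no_types, lifting) bounded_subset closed_closure compact_eq_bounded_closed mem_Collect_eq test_functions_def)
    moreover have "closure {x. \<zeta> x \<noteq> 0} \<subseteq> K" using \<zeta> by (simp add: test_functions_def)
    ultimately show ?thesis using smooth_mult[OF sm \<zeta>s] by (simp add: test_functions_def)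
  qed
  have "partial 1 ?F x = (x $ 1 - c) * partial 1 \<zeta> x + \<zeta> x" for x
  proof -
    have "partial 1 (\<lambda>x. x $ 1 - c) x = 1"
    proof -
      have "partial 1 (\<lambda>x. axis 1 1 \<bullet> x + - c) x = 1"
        by (subst partial_affine) (simp add: axis_def)
      then show ?thesis by (simp add: inner_axis')
    qed
    then show ?thesis using partial_mult[OF smooth_differentiable[OF sm] smooth_differentiable[OF \<zeta>s]] by simp
  qed
  then have "0 = (\<integral>x. (x $ 1 - c) * partial 1 \<zeta> x + \<zeta> x \<partial>lebesgue_on K)"
    using integral_partial_test_function[OF bounded_K F, of 1] lmeasurable_K by (simp add: fmeasurableD)
  also have "\<dots> = (\<integral>x. (x $ 1 - c) * partial 1 \<zeta> x \<partial>lebesgue_on K) + (\<integral>x. \<zeta> x \<partial>lebesgue_on K)"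
    by (intro Bochner_Integration.integral_add integrable_smooth lmeasurable_K bounded_K smooth_mult sm \<zeta>s smooth_partial)
  finally show "(\<Sum>j\<in>UNIV. \<integral>x. (if j = 1 then x $ 1 - c else 0) * partial j \<zeta> x \<partial>lebesgue_on K) = - (\<integral>x. 1 * \<zeta> x \<partial>lebesgue_on K)"
    by (simp add: sum_2)
qed

text \<open>The Poincare inequality: the field \<open>(x\<^sub>1 - c, 0)\<close> has divergence one and is bounded by the diameter; it is tested with the square
  of the function.\<close>

lemma vanishing_trace_Poincare:
  assumes zs: "\<And>m. smooth (z m)" and N: "\<And>m x. \<bar>z m x\<bar> \<le> N" "\<And>x. \<bar>f x\<bar> \<le> N" and bd: "(\<lambda>m. boundary_energy (z m)) \<longlonglongrightarrow> 0"
    and lim: "L2_tendsto K z f" "\<And>j. L2_tendsto K (\<lambda>m. partial j (z m)) (y j)"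
    and AE: "AE x in lebesgue_on K. (\<lambda>m. z m x) \<longlonglongrightarrow> f x"
  shows "L2_norm K f \<le> 2 * diameter K * L2_norm K (y 1)"
proof -
  have fL: "f \<in> L2 K" and yL: "y j \<in> L2 K" for j using lim by (auto simp: L2_tendsto_def)
  have fm: "f \<in> borel_measurable (lebesgue_on K)" using fL by (simp add: L2_def)
  obtain x0 where x0: "x0 \<in> K" using diameter_pos by (metis all_not_in_conv diameter_empty less_irrefl)
  let ?c = "x0 $ 1"
  have N0: "N \<ge> 0" using N(2)[of x0] by linarith
  have "(\<Sum>j\<in>UNIV. \<integral>x. (if j = 1 then x $ 1 - ?c else 0) * (2 * (f x * y j x)) \<partial>lebesgue_on K) = - (\<integral>x. 1 * (f x * f x) \<partial>lebesgue_on K)"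
  proof (rule vanishing_trace_test[OF position_divergence, where N = "N * N"])
    show "smooth (\<lambda>x. z m x * z m x)" for m by (intro smooth_mult zs)
    show "\<bar>z m x * z m x\<bar> \<le> N * N" for m x unfolding abs_mult using N(1)[of m x] N0 by (intro mult_mono) auto
    show "(\<lambda>m. boundary_energy (\<lambda>x. z m x * z m x)) \<longlonglongrightarrow> 0"
    proof (rule tendsto_sandwich[OF _ _ tendsto_const])
      show "\<forall>\<^sub>F m in sequentially. 0 \<le> boundary_energy (\<lambda>x. z m x * z m x)" by (simp add: boundary_energy_nonneg)
      show "(\<lambda>m. N\<^sup>2 * boundary_energy (z m)) \<longlonglongrightarrow> 0" using tendsto_mult_right_zero[OF bd] by simp
      have "edge_energy ps i (\<lambda>x. z m x * z m x) \<le> N\<^sup>2 * edge_energy ps i (z m)" for m i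
      proof -
        let ?l = "linepath (vtx ps i) (vtx ps (Suc i))"
        have c: "continuous_on UNIV (\<lambda>t. z m (?l t))" by (rule smooth_linepath_continuous[OF zs])
        have L: "(\<lambda>t. z m (?l t) * z m (?l t)) \<in> L2 {0..1}" "(\<lambda>t. z m (?l t)) \<in> L2 {0..1}"
          by (intro L2_continuous_unit continuous_on_mult c)+
        have "(\<integral>t. (z m (?l t) * z m (?l t))\<^sup>2 \<partial>lebesgue_on {0..1}) \<le> (\<integral>t. N\<^sup>2 * (z m (?l t))\<^sup>2 \<partial>lebesgue_on {0..1})"
        proof (rule integral_mono)
          show "integrable (lebesgue_on {0..1}) (\<lambda>t. (z m (?l t) * z m (?l t))\<^sup>2)" using L(1) by (simp add: L2_def)
          show "integrable (lebesgue_on {0..1}) (\<lambda>t. N\<^sup>2 * (z m (?l t))\<^sup>2)" using L(2) by (simp add: L2_def)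
          have "(z m (?l t))\<^sup>2 \<le> N\<^sup>2" for t using power_mono[OF N(1)[of m "?l t"], of 2] by simp
          then show "(z m (?l t) * z m (?l t))\<^sup>2 \<le> N\<^sup>2 * (z m (?l t))\<^sup>2" for t
            unfolding power_mult_distrib by (intro mult_right_mono) auto
        qed
        then show ?thesis by (simp add: edge_energy_def)
      qed
      then show "\<forall>\<^sub>F m in sequentially. boundary_energy (\<lambda>x. z m x * z m x) \<le> N\<^sup>2 * boundary_energy (z m)"
        unfolding boundary_energy_def sum_distrib_left by (intro always_eventually allI sum_mono)
    qed
    show "L2_tendsto K (\<lambda>m x. z m x * z m x) (\<lambda>x. f x * f x)"
      using N AE by (intro L2_tendsto_mult[OF lim(1)] measurable_smooth zs fm) auto
    show "L2_tendsto K (\<lambda>m. partial j (\<lambda>x. z m x * z m x)) (\<lambda>x. 2 * (f x * y j x))" for j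
    proof -
      have "L2_tendsto K (\<lambda>m x. z m x * partial j (z m) x) (\<lambda>x. f x * y j x)"
        using N AE by (intro L2_tendsto_mult[OF lim(2)] measurable_smooth zs fm) auto
      note twice = L2_tendsto_add[OF this this]
      have "partial j (\<lambda>x. z m x * z m x) = (\<lambda>x. z m x * partial j (z m) x + z m x * partial j (z m) x)" for m
        by (intro ext) (simp add: partial_mult[OF smooth_differentiable[OF zs] smooth_differentiable[OF zs]] mult.commute)
      then show ?thesis using twice by (simp only: mult_2)
    qed
  qed
  then have eq: "(L2_norm K f)\<^sup>2 = - (\<integral>x. (x $ 1 - ?c) * (2 * (f x * y 1 x)) \<partial>lebesgue_on K)"
    unfolding L2_norm_power2 by (simp add: sum_2 power2_eq_square)
  let ?g = "\<lambda>x. (x $ 1 - ?c) * f x"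
  have xb: "\<bar>x $ 1 - ?c\<bar> \<le> diameter K" if "x \<in> K" for x
    using component_le_norm_cart[of "x - x0" 1] diameter_bounded_bound[OF bounded_K that x0] by (simp add: dist_norm)
  have gL: "?g \<in> L2 K"
    by (rule L2_mult_bounded[OF fL measurable_smooth xb]) (intro smooth_diff smooth_component smooth_const)
  have "L2_norm K ?g \<le> L2_norm K (\<lambda>x. diameter K * f x)"
  proof (rule L2_norm_mono[OF gL L2_cmult[OF fL]])
    show "\<bar>?g x\<bar> \<le> \<bar>diameter K * f x\<bar>" if "x \<in> K" for x
      unfolding abs_mult using xb[OF that] by (intro mult_right_mono) auto
  qed
  then have gn: "L2_norm K ?g \<le> diameter K * L2_norm K f" using diameter_pos by (simp add: L2_norm_cmult)
  have "(L2_norm K f)\<^sup>2 = - (2 * (\<integral>x. ?g x * y 1 x \<partial>lebesgue_on K))"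
    unfolding eq by (simp add: mult_ac flip: Bochner_Integration.integral_mult_right_zero)
  also have "\<dots> \<le> 2 * (L2_norm K ?g * L2_norm K (y 1))"
    using L2_Cauchy_Schwarz[OF gL yL[of 1]] by linarith
  also have "\<dots> \<le> 2 * ((diameter K * L2_norm K f) * L2_norm K (y 1))"
    using gn by (intro mult_left_mono mult_right_mono L2_norm_nonneg) auto
  finally have "L2_norm K f * L2_norm K f \<le> (2 * diameter K * L2_norm K (y 1)) * L2_norm K f"
    by (simp add: power2_eq_square mult_ac)
  then show ?thesis
    using L2_norm_nonneg[of K f] L2_norm_nonneg[of K "y 1"] diameter_pos by (cases "L2_norm K f = 0") auto
qed

text \<open>Thresholding at the level of the boundary values produces a function with zero trace, which is tested against the
  equation: the maximum principle in energy form.\<close>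

lemma threshold_energy:
  assumes tr: "has_trace K ps v g" and lap: "weak_laplacian K v p" and p: "p \<in> L2 K"
    and G: "G > 0" "\<And>i t. i < length ps \<Longrightarrow> t \<in> {0..1} \<Longrightarrow> \<bar>g (linepath (vtx ps i) (vtx ps (Suc i)) t)\<bar> \<le> G" and N: "N > 0"
  shows "\<exists>E\<ge>0. E\<^sup>2 \<le> - (\<integral>x. p x * threshold G N (v x) \<partial>lebesgue_on K) \<and>
    L2_norm K (\<lambda>x. threshold G N (v x)) \<le> 2 * diameter K * E"
proof -
  let ?T = "threshold G N" and ?T' = "threshold_deriv G N"
  obtain w \<phi> where v: "v \<in> L2 K" and gL: "\<And>i. i < length ps \<Longrightarrow> (\<lambda>t. g (linepath (vtx ps i) (vtx ps (Suc i)) t)) \<in> L2 {0..1}"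
    and w: "\<And>i. w i \<in> L2 K" and grad: "weak_gradient K v w" and sm: "\<And>n. smooth (\<phi> n)"
    and lim0: "(\<lambda>n. L2_norm K (\<lambda>x. \<phi> n x - v x)) \<longlonglongrightarrow> 0"
      "\<And>i. (\<lambda>n. L2_norm K (\<lambda>x. partial i (\<phi> n) x - w i x)) \<longlonglongrightarrow> 0"
      "(\<lambda>n. boundary_integral ps (\<lambda>x. (\<phi> n x - g x)\<^sup>2)) \<longlonglongrightarrow> 0"
    using tr unfolding has_trace_def by blast
  have lim1: "L2_tendsto K \<phi> v" "L2_tendsto K (\<lambda>n. partial j (\<phi> n)) (w j)" for j
    by (simp_all add: L2_tendsto_def v w L2_smooth smooth_partial sm lim0)
  obtain r where r: "strict_mono r" "AE x in lebesgue_on K. (\<lambda>n. \<phi> (r n) x) \<longlonglongrightarrow> v x"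
    using L2_tendsto_AE_subsequence[OF lim1(1)] by blast
  have lim: "L2_tendsto K (\<lambda>n. \<phi> (r n)) v" "L2_tendsto K (\<lambda>n. partial j (\<phi> (r n))) (w j)" for j
    using L2_tendsto_subsequence[OF lim1(1) r(1)] L2_tendsto_subsequence[OF lim1(2) r(1)] by auto
  have vm: "v \<in> borel_measurable (lebesgue_on K)" using v by (simp add: L2_def)
  have Tm: "?T \<in> borel_measurable borel" "?T' \<in> borel_measurable borel"
    using continuous_threshold[OF N] continuous_threshold_deriv by (auto intro: borel_measurable_continuous_onI)
  have Tvm: "(\<lambda>x. ?T (v x)) \<in> borel_measurable (lebesgue_on K)" "(\<lambda>x. ?T' (v x)) \<in> borel_measurable (lebesgue_on K)"
    using measurable_compose[OF vm Tm(1)] measurable_compose[OF vm Tm(2)] by auto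
  have T'b: "\<bar>?T' s\<bar> \<le> 1" for s using threshold_deriv_bounds[OF G(1), of N s] by simp
  define z where "z m = (\<lambda>x. ?T (\<phi> (r m) x))" for m
  define y where "y j = (\<lambda>x. ?T' (v x) * w j x)" for j
  have zs: "smooth (z m)" for m unfolding z_def by (rule smooth_threshold[OF sm])
  have pz: "partial j (z m) = (\<lambda>x. ?T' (\<phi> (r m) x) * partial j (\<phi> (r m)) x)" for j m
    unfolding z_def by (intro ext partial_compose has_real_derivative_threshold[OF N] smooth_differentiable sm)
  have zN: "\<bar>z m x\<bar> \<le> N" for m x unfolding z_def by (rule threshold_bound[OF N])
  have TvL: "(\<lambda>x. ?T (v x)) \<in> L2 K"
    by (rule L2_bound[OF v Tvm(1), where B = 1]) (simp add: threshold_le[OF G(1) N])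
  have zlim: "L2_tendsto K z (\<lambda>x. ?T (v x))"
    by (rule L2_tendsto_bound[OF lim(1) TvL L2_smooth[OF zs], where B = 1]) (simp add: z_def threshold_Lipschitz[OF G(1) N])
  have zAE: "AE x in lebesgue_on K. (\<lambda>m. z m x) \<longlonglongrightarrow> ?T (v x)"
    using r(2) by eventually_elim (auto simp: z_def intro: continuous_on_tendsto_compose[OF continuous_threshold[OF N]])
  have T'AE: "AE x in lebesgue_on K. (\<lambda>m. ?T' (\<phi> (r m) x)) \<longlonglongrightarrow> ?T' (v x)"
    using r(2) by eventually_elim (auto intro: continuous_on_tendsto_compose[OF continuous_threshold_deriv])
  have T'm: "(\<lambda>x. ?T' (\<phi> (r m) x)) \<in> borel_measurable (lebesgue_on K)" for m
    using measurable_compose[OF measurable_smooth[OF sm] Tm(2)] .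
  have ylim: "L2_tendsto K (\<lambda>m. partial j (z m)) (y j)" for j
    unfolding pz y_def by (rule L2_tendsto_mult[OF lim(2) T'm Tvm(2) T'b T'b T'AE])
  have yL: "y j \<in> L2 K" for j using ylim[of j] by (simp add: L2_tendsto_def)
  have bd: "(\<lambda>m. boundary_energy (z m)) \<longlonglongrightarrow> 0"
  proof -
    have "(\<lambda>m. edge_energy ps i (z m)) \<longlonglongrightarrow> 0" if i: "i < length ps" for i
    proof (rule tendsto_sandwich[OF _ _ tendsto_const])
      let ?l = "linepath (vtx ps i) (vtx ps (Suc i))"
      have e: "L2_tendsto {0..1} (\<lambda>n t. \<phi> n (?l t)) (\<lambda>t. g (?l t))"
        by (rule boundary_L2_tendsto_edge[OF lim0(3) sm i vtx_distinct[OF i] gL[OF i]])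
      have e': "L2_tendsto {0..1} (\<lambda>n t. \<phi> (r n) (?l t)) (\<lambda>t. g (?l t))"
        by (rule L2_tendsto_subsequence[OF e r(1)])
      show "\<forall>\<^sub>F m in sequentially. 0 \<le> edge_energy ps i (z m)" by (simp add: energy_nonneg)
      show "(\<lambda>m. (L2_norm {0..1} (\<lambda>t. \<phi> (r m) (?l t) - g (?l t)))\<^sup>2) \<longlonglongrightarrow> 0"
        using tendsto_power[of _ 0 sequentially 2] e' by (fastforce simp: L2_tendsto_def)
      have "edge_energy ps i (z m) \<le> (L2_norm {0..1} (\<lambda>t. \<phi> (r m) (?l t) - g (?l t)))\<^sup>2" for m
      proof -
        have dL: "(\<lambda>t. \<phi> (r m) (?l t) - g (?l t)) \<in> L2 {0..1}"
          using e' by (auto simp: L2_tendsto_def intro: L2_diff)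
        have "L2_norm {0..1} (\<lambda>t. z m (?l t)) \<le> L2_norm {0..1} (\<lambda>t. \<phi> (r m) (?l t) - g (?l t))"
        proof (rule L2_norm_mono[OF _ dL])
          show "(\<lambda>t. z m (?l t)) \<in> L2 {0..1}" by (intro L2_continuous_unit smooth_linepath_continuous zs)
          show "\<bar>z m (?l t)\<bar> \<le> \<bar>\<phi> (r m) (?l t) - g (?l t)\<bar>" if "t \<in> {0..1}" for t
            using threshold_Lipschitz[OF G(1) N, of "\<phi> (r m) (?l t)" "g (?l t)"] threshold_small[OF G(1) G(2)[OF i that]]
            by (simp add: z_def)
        qed
        then have "(L2_norm {0..1} (\<lambda>t. z m (?l t)))\<^sup>2 \<le> (L2_norm {0..1} (\<lambda>t. \<phi> (r m) (?l t) - g (?l t)))\<^sup>2"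
          by (intro power_mono L2_norm_nonneg)
        then show ?thesis by (simp add: edge_energy_def L2_norm_power2)
      qed
      then show "\<forall>\<^sub>F m in sequentially. edge_energy ps i (z m) \<le> (L2_norm {0..1} (\<lambda>t. \<phi> (r m) (?l t) - g (?l t)))\<^sup>2" by simp
    qed
    then have "(\<lambda>m. \<Sum>i<length ps. edge_energy ps i (z m)) \<longlonglongrightarrow> (\<Sum>i<length ps. 0)"
      by (intro tendsto_sum) auto
    then show ?thesis by (simp add: boundary_energy_def)
  qed
  have div: "has_weak_divergence K w p"
    by (rule weak_laplacian_has_weak_divergence[OF lmeasurable_K bounded_K v w p grad lap])
  have en: "(\<Sum>j\<in>UNIV. \<integral>x. w j x * y j x \<partial>lebesgue_on K) = - (\<integral>x. p x * ?T (v x) \<partial>lebesgue_on K)"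
    by (rule vanishing_trace_test[OF div zs zN bd zlim ylim])
  define E where "E = sqrt (\<Sum>j\<in>UNIV. (L2_norm K (y j))\<^sup>2)"
  have E2: "E\<^sup>2 = (\<Sum>j\<in>UNIV. (L2_norm K (y j))\<^sup>2)" by (simp add: E_def sum_nonneg)
  have "(L2_norm K (y j))\<^sup>2 \<le> (\<integral>x. w j x * y j x \<partial>lebesgue_on K)" for j
    unfolding L2_norm_power2
  proof (rule integral_mono)
    show "integrable (lebesgue_on K) (\<lambda>x. (y j x)\<^sup>2)" using yL[of j] by (simp add: L2_def)
    show "integrable (lebesgue_on K) (\<lambda>x. w j x * y j x)" by (rule L2_mult_integrable[OF w yL])
    fix x
    have "?T' (v x) * ?T' (v x) \<le> 1 * ?T' (v x)" using threshold_deriv_bounds[OF G(1)] by (intro mult_right_mono) auto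
    then have "(?T' (v x) * ?T' (v x)) * (w j x)\<^sup>2 \<le> ?T' (v x) * (w j x)\<^sup>2" by (intro mult_right_mono) auto
    then show "(y j x)\<^sup>2 \<le> w j x * y j x" by (simp add: y_def power2_eq_square mult_ac)
  qed
  then have "E\<^sup>2 \<le> - (\<integral>x. p x * ?T (v x) \<partial>lebesgue_on K)"
    unfolding E2 en[symmetric] by (intro sum_mono)
  moreover have "L2_norm K (\<lambda>x. ?T (v x)) \<le> 2 * diameter K * E"
  proof -
    have "L2_norm K (\<lambda>x. ?T (v x)) \<le> 2 * diameter K * L2_norm K (y 1)"
      by (rule vanishing_trace_Poincare[OF zs zN threshold_bound[OF N] bd zlim ylim zAE])
    also have "L2_norm K (y 1) \<le> E"
      unfolding E_def by (intro real_le_rsqrt) (simp add: sum_2)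
    finally show ?thesis using diameter_pos by (simp add: mult_left_mono)
  qed
  moreover have "E \<ge> 0" by (simp add: E_def sum_nonneg)
  ultimately show ?thesis by blast
qed

end

section \<open>The boundary values are controlled by the solution\<close>

text \<open>The barycentric coordinates as a point of the plane, so that an edge bubble is a fixed function composed with an affine map.\<close>

definition reference_point :: "real^2 \<Rightarrow> real^2 \<Rightarrow> real^2 \<Rightarrow> real^2 \<Rightarrow> real^2"
  where "reference_point a u w x = chart 0 (axis 1 1) (axis 2 1) (bary1 a u w x, bary2 a u w x)"

lemma has_derivative_reference_compose:
  assumes "smooth f"
  shows "((\<lambda>x. f (reference_point a u w x)) has_derivative
    (\<lambda>v. (coord_grad1 u w \<bullet> v) * partial 1 f (reference_point a u w x) + (coord_grad2 u w \<bullet> v) * partial 2 f (reference_point a u w x))) (at x)"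
proof -
  have "(reference_point a u w has_derivative (\<lambda>v. (coord_grad1 u w \<bullet> v) *\<^sub>R axis 1 1 + (coord_grad2 u w \<bullet> v) *\<^sub>R axis 2 1)) (at x)"
    unfolding reference_point_def[abs_def] chart_def bary_affine by (auto intro!: derivative_eq_intros)
  from has_derivative_compose[OF this has_derivative_partial[OF smooth_differentiable[OF assms]]]
  show ?thesis by (simp add: sum_2 axis_def)
qed

lemma partial_reference_compose:
  assumes "smooth f"
  shows "partial i (\<lambda>x. f (reference_point a u w x)) x =
    coord_grad1 u w $ i * partial 1 f (reference_point a u w x) + coord_grad2 u w $ i * partial 2 f (reference_point a u w x)"
  using partial_eq[OF has_derivative_reference_compose[OF assms], of i a u w x] by (simp add: inner_axis)

lemma laplacian_reference_compose:
  assumes "smooth f"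
  shows "laplacian (\<lambda>x. f (reference_point a u w x)) x =
    (\<Sum>i\<in>UNIV. coord_grad1 u w $ i * (coord_grad1 u w $ i * partial 1 (partial 1 f) (reference_point a u w x)
        + coord_grad2 u w $ i * partial 2 (partial 1 f) (reference_point a u w x))
      + coord_grad2 u w $ i * (coord_grad1 u w $ i * partial 1 (partial 2 f) (reference_point a u w x)
        + coord_grad2 u w $ i * partial 2 (partial 2 f) (reference_point a u w x)))"
proof (rule sum.cong[OF refl])
  fix i :: 2
  have eq: "partial i (\<lambda>x. f (reference_point a u w x)) =
      (\<lambda>x. coord_grad1 u w $ i * partial 1 f (reference_point a u w x) + coord_grad2 u w $ i * partial 2 f (reference_point a u w x))"
    by (intro ext partial_reference_compose assms)
  have d: "(\<lambda>x. partial j f (reference_point a u w x)) differentiable (at x)" for j x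
    using has_derivative_reference_compose[OF smooth_partial[OF assms]] unfolding differentiable_def by blast
  have c: "partial i (\<lambda>x. r * partial j f (reference_point a u w x)) x = r * partial i (\<lambda>x. partial j f (reference_point a u w x)) x" for r j
    using partial_mult[of "\<lambda>_. r" x "\<lambda>x. partial j f (reference_point a u w x)" i] d by (simp add: partial_const)
  have dm: "(\<lambda>x. r * partial j f (reference_point a u w x)) differentiable (at x)" for r j
    by (intro differentiable_mult differentiable_const d)
  show "partial i (partial i (\<lambda>x. f (reference_point a u w x))) x =
      coord_grad1 u w $ i * (coord_grad1 u w $ i * partial 1 (partial 1 f) (reference_point a u w x)
        + coord_grad2 u w $ i * partial 2 (partial 1 f) (reference_point a u w x))
      + coord_grad2 u w $ i * (coord_grad1 u w $ i * partial 1 (partial 2 f) (reference_point a u w x)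
        + coord_grad2 u w $ i * partial 2 (partial 2 f) (reference_point a u w x))"
    unfolding eq partial_add[OF dm dm] c partial_reference_compose[OF smooth_partial[OF assms]] ..
qed

definition reference_bubble :: "nat \<Rightarrow> real^2 \<Rightarrow> real"
  where "reference_bubble j y = (1 - y $ 1 - y $ 2) * (y $ 1 * (y $ 1) ^ j) * ((1 - y $ 1 - y $ 2) * y $ 1 * y $ 2)"

lemma smooth_reference_bubble: "smooth (reference_bubble j)"
  unfolding reference_bubble_def[abs_def]
  by (intro smooth_mult smooth_diff smooth_const smooth_component smooth_power)

lemma edge_bubble_reference:
  assumes "degree q \<le> n"
  shows "edge_bubble a u w q = (\<lambda>x. (\<lambda>y. \<Sum>j\<le>n. coeff q j * reference_bubble j y) (reference_point a u w x))"
proof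
  fix x
  have "reference_point a u w x $ 1 = bary1 a u w x" "reference_point a u w x $ 2 = bary2 a u w x"
    by (simp_all add: reference_point_def chart_axes)
  then show "edge_bubble a u w q x = (\<Sum>j\<le>n. coeff q j * reference_bubble j (reference_point a u w x))"
    unfolding edge_bubble_def edge_factor_def reference_bubble_def bary0_def poly_as_sum_le[OF assms]
    by (simp add: sum_distrib_left sum_distrib_right mult_ac)
qed

text \<open>Finitely many fixed bubbles span all edge bubbles in reference coordinates, where their second derivatives are bounded; the
  affine map contributes the gradients of its coordinates twice.\<close>

lemma edge_bubble_laplacian_bound:
  obtains M where "M > 0"
    "\<And>a u w q x \<Lambda>. \<lbrakk>degree q \<le> n; norm (coord_grad1 u w) \<le> \<Lambda>; norm (coord_grad2 u w) \<le> \<Lambda>; x \<in> open_triangle a u w\<rbrakk> \<Longrightarrow>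
      \<bar>laplacian (edge_bubble a u w q) x\<bar> \<le> M * \<Lambda>\<^sup>2 * (\<Sum>j\<le>n. \<bar>coeff q j\<bar>)"
proof -
  let ?S = "\<lambda>y. \<Sum>j\<le>n. \<Sum>k\<in>UNIV. \<Sum>i\<in>UNIV. \<bar>partial k (partial i (reference_bubble j)) y\<bar>"
  have "continuous_on (cbox 0 1) ?S"
    by (intro continuous_on_sum continuous_on_rabs smooth_continuous_on smooth_partial smooth_reference_bubble)
  then have "bounded (?S ` cbox 0 1)"
    by (intro compact_imp_bounded compact_continuous_image compact_cbox)
  then obtain M where M: "M > 0" "\<forall>z\<in>?S ` cbox 0 1. norm z \<le> M"
    unfolding bounded_pos by blast
  have D: "\<bar>partial k (partial i (reference_bubble j)) y\<bar> \<le> M" if "y \<in> cbox 0 1" "j \<le> n" for y j k i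
  proof -
    have "\<bar>partial k (partial i (reference_bubble j)) y\<bar> \<le> (\<Sum>i\<in>UNIV. \<bar>partial k (partial i (reference_bubble j)) y\<bar>)"
      by (rule member_le_sum) auto
    also have "\<dots> \<le> (\<Sum>k\<in>UNIV. \<Sum>i\<in>UNIV. \<bar>partial k (partial i (reference_bubble j)) y\<bar>)"
      by (rule member_le_sum[of k UNIV "\<lambda>k. \<Sum>i\<in>UNIV. \<bar>partial k (partial i (reference_bubble j)) y\<bar>"]) (auto intro: sum_nonneg)
    also have "\<dots> \<le> ?S y"
      by (rule member_le_sum[of j "{..n}" "\<lambda>j. \<Sum>k\<in>UNIV. \<Sum>i\<in>UNIV. \<bar>partial k (partial i (reference_bubble j)) y\<bar>"])
        (use that in \<open>auto intro: sum_nonneg\<close>)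
    also have "\<dots> \<le> M" using bspec[OF M(2) imageI[OF that(1)]] by simp
    finally show ?thesis .
  qed
  show ?thesis
  proof (rule that[of "8 * M"])
    show "8 * M > 0" using M(1) by simp
    fix a u w :: "real^2" and q :: "real poly" and x \<Lambda>
    assume q: "degree q \<le> n" and \<Lambda>: "norm (coord_grad1 u w) \<le> \<Lambda>" "norm (coord_grad2 u w) \<le> \<Lambda>" and x: "x \<in> open_triangle a u w"
    let ?y = "reference_point a u w x" and ?Q = "\<Sum>j\<le>n. \<bar>coeff q j\<bar>"
    define f where "f y = (\<Sum>j\<le>n. coeff q j * reference_bubble j y)" for y
    have f: "smooth f" unfolding f_def[abs_def] by (intro smooth_sum smooth_cmult smooth_reference_bubble)
    have Q: "?Q \<ge> 0" by (auto intro: sum_nonneg)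
    have \<Lambda>0: "\<Lambda> \<ge> 0" using \<Lambda>(1) norm_ge_zero order_trans by blast
    have y: "?y \<in> cbox 0 1"
      using x by (auto simp: mem_box_cart forall_2 reference_point_def chart_axes open_triangle_def bary0_def)
    have pf: "\<bar>partial k (partial i f) ?y\<bar> \<le> M * ?Q" for k i
    proof -
      have "partial i f = (\<lambda>y. \<Sum>j\<le>n. coeff q j * partial i (reference_bubble j) y)"
        unfolding f_def[abs_def]
        by (intro ext) (simp only: partial_sum[OF smooth_cmult[OF smooth_reference_bubble]] partial_cmult[OF smooth_reference_bubble])
      then have "partial k (partial i f) ?y = (\<Sum>j\<le>n. coeff q j * partial k (partial i (reference_bubble j)) ?y)"
        by (simp only: partial_sum[OF smooth_cmult[OF smooth_partial[OF smooth_reference_bubble]]]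
            partial_cmult[OF smooth_partial[OF smooth_reference_bubble]])
      also have "\<bar>\<dots>\<bar> \<le> (\<Sum>j\<le>n. \<bar>coeff q j\<bar> * M)"
        by (rule order_trans[OF sum_abs], rule sum_mono) (use D[OF y] in \<open>simp add: abs_mult mult_left_mono\<close>)
      also have "\<dots> = M * ?Q" unfolding sum_distrib_right[symmetric] by (rule mult.commute)
      finally show ?thesis .
    qed
    have \<nu>: "\<bar>coord_grad1 u w $ i\<bar> \<le> \<Lambda>" "\<bar>coord_grad2 u w $ i\<bar> \<le> \<Lambda>" for i
      using component_le_norm_cart[of "coord_grad1 u w" i] component_le_norm_cart[of "coord_grad2 u w" i] \<Lambda> by linarith+
    have prod3: "\<bar>r * (s * d)\<bar> \<le> \<Lambda> * (\<Lambda> * (M * ?Q))" if "\<bar>r\<bar> \<le> \<Lambda>" "\<bar>s\<bar> \<le> \<Lambda>" "\<bar>d\<bar> \<le> M * ?Q" for r s d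
      unfolding abs_mult using that \<Lambda>0 by (intro mult_mono mult_nonneg_nonneg) auto
    have four: "\<bar>r1 + r2 + (r3 + r4)\<bar> \<le> 4 * B" if "\<bar>r1\<bar> \<le> B" "\<bar>r2\<bar> \<le> B" "\<bar>r3\<bar> \<le> B" "\<bar>r4\<bar> \<le> B" for r1 r2 r3 r4 B :: real
      using that by linarith
    have "\<bar>laplacian (edge_bubble a u w q) x\<bar> = \<bar>laplacian (\<lambda>x. f (reference_point a u w x)) x\<bar>"
      unfolding edge_bubble_reference[OF q] f_def ..
    also have "\<dots> \<le> (\<Sum>i\<in>(UNIV::2 set). 4 * (\<Lambda> * (\<Lambda> * (M * ?Q))))"
      unfolding laplacian_reference_compose[OF f] distrib_left
      by (rule order_trans[OF sum_abs], rule sum_mono, rule four) (intro prod3 \<nu> pf)+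
    also have "\<dots> = 8 * M * \<Lambda>\<^sup>2 * ?Q" by (simp add: power2_eq_square)
    finally show "\<bar>laplacian (edge_bubble a u w q) x\<bar> \<le> 8 * M * \<Lambda>\<^sup>2 * ?Q" .
  qed
qed

text \<open>Between the centre and the boundary of the disc an affine function varies by its gradient times the radius.\<close>

lemma barycentric_gradient_bound:
  assumes "\<rho> > 0" and b: "\<And>x. x \<in> cball x0 \<rho> \<Longrightarrow> 0 \<le> \<nu> \<bullet> (x - a) \<and> \<nu> \<bullet> (x - a) \<le> (1::real)"
  shows "norm \<nu> \<le> 1 / \<rho>"
proof (cases "\<nu> = 0")
  case False
  let ?e = "(\<rho> / norm \<nu>) *\<^sub>R \<nu>"
  have "x0 + ?e \<in> cball x0 \<rho>" "x0 \<in> cball x0 \<rho>" using assms(1) False by (auto simp: dist_norm)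
  then have "\<nu> \<bullet> (x0 + ?e - a) - \<nu> \<bullet> (x0 - a) \<le> 1" using b[of "x0 + ?e"] b[of x0] by linarith
  moreover have "\<nu> \<bullet> (x0 + ?e - a) - \<nu> \<bullet> (x0 - a) = \<rho> * norm \<nu>"
    using False by (simp add: inner_add_right inner_diff_right dot_square_norm power2_eq_square)
  ultimately show ?thesis using assms(1) by (simp add: field_simps)
qed (use assms in simp)

text \<open>The factor of the boundary term in Green's identity is the square of the length of \<open>u\<close> divided by twice the area of the triangle,
  hence at least the ratio of the lengths of \<open>u\<close> and \<open>w\<close>.\<close>

lemma edge_weight_lower:
  assumes det: "det2 u w \<noteq> 0" and \<theta>: "\<theta> > 0" and h: "h > 0"
    and w: "norm w \<le> h" and \<nu>: "norm (coord_grad1 u w) \<le> 1 / (\<theta> * h)"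
  shows "\<theta> \<le> \<bar>det2 u w\<bar> * (coord_grad2 u w \<bullet> coord_grad2 u w)"
proof -
  have u0: "u \<noteq> 0" using det by (auto simp: det2_def)
  have "1 \<le> norm (coord_grad1 u w) * norm u"
    using norm_cauchy_schwarz[of "coord_grad1 u w" u] by (simp add: coord_grad_dual[OF det])
  also have "\<dots> \<le> 1 / (\<theta> * h) * norm u" using \<nu> by (intro mult_right_mono) auto
  finally have u: "\<theta> * h \<le> norm u" using \<theta> h by (simp add: field_simps)
  have eq: "det2 u w * det2 u w * (coord_grad2 u w \<bullet> coord_grad2 u w) = (norm u)\<^sup>2"
  proof -
    have "det2 u w * det2 u w * (coord_grad2 u w \<bullet> coord_grad2 u w) = vector [- u $ 2, u $ 1] \<bullet> (vector [- u $ 2, u $ 1] :: real^2)"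
      using det by (simp add: coord_grad2_def)
    also have "\<dots> = (norm u)\<^sup>2" unfolding inner_2 norm_2 by (simp add: power2_eq_square)
    finally show ?thesis .
  qed
  have "\<bar>det2 u w\<bar> \<le> norm u * norm w"
  proof -
    have "det2 u w = vector [- u $ 2, u $ 1] \<bullet> w" by (simp add: det2_def inner_2)
    moreover have "norm (vector [- u $ 2, u $ 1] :: real^2) = norm u"
      by (rule power2_eq_imp_eq) (simp_all add: norm_2)
    ultimately show ?thesis using Cauchy_Schwarz_ineq2[of "vector [- u $ 2, u $ 1]" w] by simp
  qed
  also have "\<dots> \<le> norm u * h" using w by (intro mult_left_mono) auto
  finally have J: "\<bar>det2 u w\<bar> \<le> norm u * h" .
  have "\<theta> * \<bar>det2 u w\<bar> \<le> \<theta> * (norm u * h)" using J \<theta> by (intro mult_left_mono) auto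
  also have "\<dots> = (\<theta> * h) * norm u" by simp
  also have "\<dots> \<le> norm u * norm u" using u by (intro mult_right_mono) auto
  also have "\<dots> = \<bar>det2 u w\<bar> * (\<bar>det2 u w\<bar> * (coord_grad2 u w \<bullet> coord_grad2 u w))"
    using eq by (simp add: power2_eq_square abs_mult[symmetric] mult.assoc[symmetric])
  finally show ?thesis using det by (simp add: mult.commute)
qed

text \<open>Green's identity with the bubble built from the trace itself. The boundary term dominates the square of the trace, the
  volume terms are bounded by the solution and, through the source, again by the solution.\<close>

lemma edge_bound:
  assumes \<theta>: "\<theta> > 0" and Cs: "Cs \<ge> 0"
  obtains C where "C > 0"
    "\<And>K ps \<T> \<kappa> \<sigma> c\<^sub>0 i v p g q P. \<lbrakk>triangulated_polygon K ps \<T> \<kappa> \<sigma> c\<^sub>0; \<theta> \<le> 1 / (c\<^sub>0 * \<kappa>); i < length ps; v \<in> L2 K; p \<in> L2 K;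
        has_trace K ps v g; weak_laplacian K v p; \<And>x. x \<in> K \<Longrightarrow> \<bar>p x\<bar> \<le> P; P \<ge> 0; diameter K ^ 3 * P \<le> Cs * L2_norm K v;
        degree q \<le> n; \<And>s. s \<in> {0..1} \<Longrightarrow> g (linepath (vtx ps i) (vtx ps (Suc i)) s) = poly q s\<rbrakk> \<Longrightarrow>
      diameter K * (\<Sum>j\<le>n. \<bar>coeff q j\<bar>) \<le> C * L2_norm K v"
proof -
  obtain M where M: "M > 0" and lapb: "\<And>a u w q x \<Lambda>. \<lbrakk>degree q \<le> n; norm (coord_grad1 u w) \<le> \<Lambda>; norm (coord_grad2 u w) \<le> \<Lambda>; x \<in> open_triangle a u w\<rbrakk> \<Longrightarrow>
      \<bar>laplacian (edge_bubble a u w q) x\<bar> \<le> M * \<Lambda>\<^sup>2 * (\<Sum>j\<le>n. \<bar>coeff q j\<bar>)"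
    using edge_bubble_laplacian_bound[of n] by blast
  obtain c1 where c1: "c1 > 0" and coer: "\<And>q::real poly. degree q \<le> n \<Longrightarrow>
      c1 * (\<Sum>i\<le>n. \<bar>coeff q i\<bar>)\<^sup>2 \<le> integral {0..1} (\<lambda>s. (s * (1 - s))\<^sup>2 * (poly q s)\<^sup>2)"
    using edge_weight_coercive[of n] by blast
  define C where "C = (pi * Cs + M * sqrt pi / \<theta>\<^sup>2) / (\<theta> * c1)"
  have C: "C > 0" unfolding C_def using M \<theta> c1 Cs by (intro divide_pos_pos add_nonneg_pos mult_pos_pos) auto
  show ?thesis
  proof (rule that[OF C])
    fix K ps \<T> \<kappa> \<sigma> c\<^sub>0 i v p g q P
    assume tp: "triangulated_polygon K ps \<T> \<kappa> \<sigma> c\<^sub>0" and \<theta>le: "\<theta> \<le> 1 / (c\<^sub>0 * \<kappa>)" and i: "i < length ps"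
      and v: "v \<in> L2 K" and p: "p \<in> L2 K" and tr: "has_trace K ps v g" and lap: "weak_laplacian K v p"
      and P: "\<And>x. x \<in> K \<Longrightarrow> \<bar>p x\<bar> \<le> P" "P \<ge> 0" "diameter K ^ 3 * P \<le> Cs * L2_norm K v"
      and q: "degree q \<le> n" and gq: "\<And>s. s \<in> {0..1} \<Longrightarrow> g (linepath (vtx ps i) (vtx ps (Suc i)) s) = poly q s"
    interpret triangulated_polygon K ps \<T> \<kappa> \<sigma> c\<^sub>0 by (rule tp)
    let ?h = "diameter K" and ?a = "vtx ps i" and ?u = "vtx ps (Suc i) - vtx ps i" and ?Q = "\<Sum>j\<le>n. \<bar>coeff q j\<bar>"
    have h: "?h > 0" by (rule diameter_pos)
    have Q: "?Q \<ge> 0" by (auto intro: sum_nonneg)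
    obtain w where w: "triangle ?a ?u w \<in> \<T>" "det2 ?u w \<noteq> 0" using edge_triangle[OF i] .
    let ?O = "open_triangle ?a ?u w" and ?\<psi> = "edge_bubble ?a ?u w q"
    have sub: "?O \<subseteq> K" by (rule open_triangle_subset_K[OF w(1) refl w(2)])
    have O: "?O \<in> lmeasurable" "bounded ?O"
      using open_open_triangle sub bounded_K bounded_subset lmeasurable_open by blast+
    obtain x0 where x0: "cball x0 (?h / (c\<^sub>0 * \<kappa>)) \<subseteq> triangle ?a ?u w" using inball(2)[OF w(1)] by blast
    have ck: "c\<^sub>0 * \<kappa> > 0" by (rule inball(1)[OF w(1)])
    have "\<theta> * ?h \<le> 1 / (c\<^sub>0 * \<kappa>) * ?h" using \<theta>le h by (intro mult_right_mono) auto
    then have "cball x0 (\<theta> * ?h) \<subseteq> triangle ?a ?u w" using x0 subset_cball[of "\<theta> * ?h" "?h / (c\<^sub>0 * \<kappa>)" x0] by auto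
    then have bary: "0 \<le> bary0 ?a ?u w x \<and> 0 \<le> bary1 ?a ?u w x \<and> 0 \<le> bary2 ?a ?u w x" if "x \<in> cball x0 (\<theta> * ?h)" for x
      using that mem_triangle[OF w(2)] by blast
    have \<Lambda>: "norm (coord_grad1 ?u w) \<le> 1 / (\<theta> * ?h)" "norm (coord_grad2 ?u w) \<le> 1 / (\<theta> * ?h)"
      by (rule barycentric_gradient_bound[of "\<theta> * ?h" x0 _ ?a];
          use \<theta> h bary in \<open>force simp: bary0_def bary1_def bary2_def\<close>)+
    have nw: "norm w \<le> ?h"
    proof -
      have "?a \<in> triangle ?a ?u w"
        unfolding triangle_eq by (rule image_eqI[of _ _ "(0, 0)"]) (auto simp: chart_def)
      moreover have "?a + w \<in> triangle ?a ?u w"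
        unfolding triangle_eq by (rule image_eqI[of _ _ "(0, 1)"]) (auto simp: chart_def)
      ultimately have "dist ?a (?a + w) \<le> diameter (closure K)"
        using T_subset[OF w(1)] bounded_K by (intro diameter_bounded_bound) auto
      then show ?thesis by (simp add: diameter_closure[OF bounded_K] dist_norm)
    qed
    have weight: "\<theta> \<le> \<bar>det2 ?u w\<bar> * (coord_grad2 ?u w \<bullet> coord_grad2 ?u w)"
      by (rule edge_weight_lower[OF w(2) \<theta> h nw \<Lambda>(1)])
    have green: "\<bar>det2 ?u w\<bar> * (coord_grad2 ?u w \<bullet> coord_grad2 ?u w) *
        (\<integral>s. g (linepath ?a (vtx ps (Suc i)) s) * ((s * (1 - s))\<^sup>2 * poly q s) \<partial>lebesgue_on {0..1})
      = (\<integral>x. p x * ?\<psi> x \<partial>lebesgue_on ?O) - (\<integral>x. v x * laplacian ?\<psi> x \<partial>lebesgue_on ?O)"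
      by (rule trace_Green_identity[OF open_K bounded_K v p tr lap i vtx_distinct[OF i] refl refl w(2) sub])
    have "(\<integral>s. g (linepath ?a (vtx ps (Suc i)) s) * ((s * (1 - s))\<^sup>2 * poly q s) \<partial>lebesgue_on {0..1})
        = (\<integral>s. (s * (1 - s))\<^sup>2 * (poly q s)\<^sup>2 \<partial>lebesgue_on {0..1})"
      by (rule Bochner_Integration.integral_cong) (simp_all add: gq power2_eq_square)
    also have "\<dots> = integral {0..1} (\<lambda>s. (s * (1 - s))\<^sup>2 * (poly q s)\<^sup>2)"
      by (intro lebesgue_integral_eq_integral L2_integrable L2_continuous_unit continuous_intros) auto
    finally have "(\<integral>s. g (linepath ?a (vtx ps (Suc i)) s) * ((s * (1 - s))\<^sup>2 * poly q s) \<partial>lebesgue_on {0..1}) \<ge> c1 * ?Q\<^sup>2"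
      using coer[OF q] by simp
    then have "\<theta> * (c1 * ?Q\<^sup>2) \<le> (\<integral>x. p x * ?\<psi> x \<partial>lebesgue_on ?O) - (\<integral>x. v x * laplacian ?\<psi> x \<partial>lebesgue_on ?O)"
      unfolding green[symmetric] using weight \<theta> c1 by (intro mult_mono) auto
    also have "\<dots> \<le> pi * ?h\<^sup>2 * P * ?Q + L2_norm K v * (M * (1 / (\<theta> * ?h))\<^sup>2 * ?Q * (sqrt pi * ?h))"
    proof -
      obtain x1 where x1: "x1 \<in> K" using h by (metis all_not_in_conv diameter_empty less_irrefl)
      have mK: "measure lebesgue ?O \<le> pi * ?h\<^sup>2"
        using measure_mono_fmeasurable[OF sub fmeasurableD[OF O(1)] lmeasurable_K]
          measure_le_diameter[OF lmeasurable_K bounded_K x1 refl] by linarith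
      then have smK: "sqrt (measure lebesgue ?O) \<le> sqrt pi * ?h"
        using real_sqrt_le_mono[OF mK] h by (simp add: real_sqrt_mult)
      have pO: "p \<in> L2 ?O" and vO: "v \<in> L2 ?O" "L2_norm ?O v \<le> L2_norm K v"
        using L2_subset[OF fmeasurableD[OF O(1)] fmeasurableD[OF lmeasurable_K] sub] p v by auto
      have smL: "smooth (laplacian ?\<psi>)" by (intro smooth_sum smooth_partial smooth_edge_bubble)
      have L2O: "f \<in> L2 ?O" if "smooth f" for f by (intro L2_continuous O smooth_continuous_on that)
      have \<psi>b: "\<bar>?\<psi> x\<bar> \<le> ?Q" if x: "x \<in> ?O" for x
      proof -
        have b: "0 \<le> bary0 ?a ?u w x" "0 \<le> bary1 ?a ?u w x" "0 \<le> bary2 ?a ?u w x"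
          "bary0 ?a ?u w x \<le> 1" "bary1 ?a ?u w x \<le> 1" "bary2 ?a ?u w x \<le> 1"
          using x by (auto simp: open_triangle_def bary0_def)
        have "\<bar>poly q (bary1 ?a ?u w x)\<bar> \<le> (\<Sum>j\<le>n. \<bar>coeff q j\<bar> * 1)"
          unfolding poly_as_sum_le[OF q]
          by (rule order_trans[OF sum_abs], rule sum_mono) (use b in \<open>auto simp: abs_mult intro!: mult_left_le power_le_one\<close>)
        then have "\<bar>poly q (bary1 ?a ?u w x)\<bar> \<le> ?Q" by simp
        then have "bary0 ?a ?u w x * bary1 ?a ?u w x * \<bar>poly q (bary1 ?a ?u w x)\<bar> * (bary0 ?a ?u w x * bary1 ?a ?u w x * bary2 ?a ?u w x) \<le> 1 * 1 * ?Q * (1 * 1 * 1)"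
          using b Q by (intro mult_mono mult_nonneg_nonneg) auto
        then show ?thesis using b by (simp add: edge_bubble_def edge_factor_def abs_mult)
      qed
      have "(\<integral>x. p x * ?\<psi> x \<partial>lebesgue_on ?O) \<le> (\<integral>x. P * ?Q \<partial>lebesgue_on ?O)"
      proof (rule integral_mono)
        show "integrable (lebesgue_on ?O) (\<lambda>x. p x * ?\<psi> x)" by (intro L2_mult_integrable pO L2O smooth_edge_bubble)
        show "integrable (lebesgue_on ?O) (\<lambda>x. P * ?Q)" by (intro integrable_smooth O smooth_const)
        fix x assume "x \<in> space (lebesgue_on ?O)"
        then have x: "x \<in> ?O" by simp
        have "\<bar>p x * ?\<psi> x\<bar> \<le> P * ?Q" unfolding abs_mult using P \<psi>b[OF x] x sub by (intro mult_mono) auto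
        then show "p x * ?\<psi> x \<le> P * ?Q" by linarith
      qed
      also have "\<dots> = measure lebesgue ?O * (P * ?Q)"
        using O(1) by (simp add: measure_restrict_space fmeasurableD)
      also have "\<dots> \<le> pi * ?h\<^sup>2 * (P * ?Q)" using mK P(2) Q by (intro mult_right_mono mult_nonneg_nonneg) auto
      finally have 1: "(\<integral>x. p x * ?\<psi> x \<partial>lebesgue_on ?O) \<le> pi * ?h\<^sup>2 * P * ?Q" by (simp add: mult.assoc)
      have "\<bar>\<integral>x. v x * laplacian ?\<psi> x \<partial>lebesgue_on ?O\<bar> \<le> L2_norm ?O v * L2_norm ?O (laplacian ?\<psi>)"
        by (intro L2_Cauchy_Schwarz vO L2O smL)
      also have "\<dots> \<le> L2_norm K v * (M * (1 / (\<theta> * ?h))\<^sup>2 * ?Q * (sqrt pi * ?h))"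
      proof (rule mult_mono[OF vO(2)])
        have "L2_norm ?O (laplacian ?\<psi>) \<le> (M * (1 / (\<theta> * ?h))\<^sup>2 * ?Q) * sqrt (measure lebesgue ?O)"
          using L2O[OF smL] M Q
          by (intro L2_bounded_function(2)[OF O(1)] lapb[OF q \<Lambda>]) (auto simp: L2_def)
        also have "\<dots> \<le> (M * (1 / (\<theta> * ?h))\<^sup>2 * ?Q) * (sqrt pi * ?h)"
          using smK M Q by (intro mult_left_mono) auto
        finally show "L2_norm ?O (laplacian ?\<psi>) \<le> M * (1 / (\<theta> * ?h))\<^sup>2 * ?Q * (sqrt pi * ?h)" .
      qed (auto simp: L2_norm_nonneg)
      finally show ?thesis using 1 by linarith
    qed
    finally have "\<theta> * (c1 * ?Q\<^sup>2) * ?h \<le> (pi * ?h\<^sup>2 * P * ?Q + L2_norm K v * (M * (1 / (\<theta> * ?h))\<^sup>2 * ?Q * (sqrt pi * ?h))) * ?h"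
      using h by (intro mult_right_mono) auto
    also have "\<dots> = (pi * (?h ^ 3 * P) + L2_norm K v * (M * sqrt pi / \<theta>\<^sup>2)) * ?Q"
      using h by (simp add: power2_eq_square power3_eq_cube field_simps)
    also have "\<dots> \<le> (pi * (Cs * L2_norm K v) + L2_norm K v * (M * sqrt pi / \<theta>\<^sup>2)) * ?Q"
      using P(3) Q by (intro mult_right_mono add_right_mono mult_left_mono) auto
    finally have "(\<theta> * c1 * (?h * ?Q)) * ?Q \<le> ((pi * Cs + M * sqrt pi / \<theta>\<^sup>2) * L2_norm K v) * ?Q"
      by (simp add: power2_eq_square algebra_simps)
    then have "\<theta> * c1 * (?h * ?Q) \<le> (pi * Cs + M * sqrt pi / \<theta>\<^sup>2) * L2_norm K v"
    proof (cases "?Q = 0")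
      case True
      have "0 \<le> (pi * Cs + M * sqrt pi / \<theta>\<^sup>2) * L2_norm K v"
        using Cs M by (intro mult_nonneg_nonneg add_nonneg_nonneg L2_norm_nonneg) auto
      then show ?thesis unfolding True by simp
    next
      case False
      then have "?Q > 0" using Q by linarith
      then show ?thesis
        using \<open>(\<theta> * c1 * (?h * ?Q)) * ?Q \<le> ((pi * Cs + M * sqrt pi / \<theta>\<^sup>2) * L2_norm K v) * ?Q\<close> mult_right_le_imp_le by blast
    qed
    then show "?h * ?Q \<le> C * L2_norm K v"
      using \<theta> c1 by (simp add: C_def pos_le_divide_eq mult.commute)
  qed
qed

section \<open>Degrees of freedom on polynomial boundary data\<close>

lemma polys_edge_polynomial:
  assumes "f \<in> polys k (polygon_edge ps i)"
  obtains q :: "real poly" where "degree q \<le> nat k"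
    "\<And>s. s \<in> {0..1} \<Longrightarrow> f (linepath (vtx ps i) (vtx ps (Suc i)) s) = poly q s"
proof -
  let ?a = "vtx ps i" and ?b = "vtx ps (Suc i)"
  obtain coef where coef: "\<And>x. x \<in> polygon_edge ps i \<Longrightarrow> f x = (\<Sum>(a, b)\<in>multi_indices k. coef a b * (x $ 1) ^ a * (x $ 2) ^ b)"
    using assms unfolding polys_def by blast
  define q where "q = (\<Sum>(a, b)\<in>multi_indices k. smult (coef a b) ([:?a $ 1, ?b $ 1 - ?a $ 1:] ^ a * [:?a $ 2, ?b $ 2 - ?a $ 2:] ^ b))"
  have lin: "degree ([:r, s:] ^ m) \<le> m" for r s :: real and m
    using order_trans[OF degree_power_le[of "[:r, s:]" m] mult_right_mono[OF degree_pCons_le[of r "[:s:]"], of m]] by simp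
  have "degree q \<le> nat k"
    unfolding q_def
  proof (rule degree_sum_le[OF finite_multi_indices])
    fix x assume "x \<in> multi_indices k"
    then obtain a b where x: "x = (a, b)" and ab: "int a + int b \<le> k" by (auto simp: multi_indices_def)
    have "degree ([:?a $ 1, ?b $ 1 - ?a $ 1:] ^ a * [:?a $ 2, ?b $ 2 - ?a $ 2:] ^ b) \<le> a + b"
      by (rule order_trans[OF degree_mult_le add_mono[OF lin lin]])
    then show "degree (case x of (a, b) \<Rightarrow> smult (coef a b) ([:?a $ 1, ?b $ 1 - ?a $ 1:] ^ a * [:?a $ 2, ?b $ 2 - ?a $ 2:] ^ b)) \<le> nat k"
      unfolding x using order_trans[OF degree_smult_le] ab by fastforce
  qed
  moreover have "f (linepath ?a ?b s) = poly q s" if "s \<in> {0..1}" for s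
  proof -
    have c: "linepath ?a ?b s $ j = poly [:?a $ j, ?b $ j - ?a $ j:] s" for j
      by (simp add: linepath_def algebra_simps)
    have "f (linepath ?a ?b s) = (\<Sum>(a, b)\<in>multi_indices k. coef a b * (linepath ?a ?b s $ 1) ^ a * (linepath ?a ?b s $ 2) ^ b)"
      using that by (intro coef) (simp add: polygon_edge_def linepath_in_path)
    also have "\<dots> = poly q s"
      unfolding q_def c poly_sum by (intro sum.cong) (simp_all add: case_prod_unfold mult.assoc)
    finally show ?thesis .
  qed
  ultimately show ?thesis using that by blast
qed

lemma scaled_edge_monomial_linepath:
  assumes "a \<noteq> b"
  shows "scaled_edge_monomial a b j (linepath a b t) = (t - 1 / 2) ^ j"
proof -
  have seg: "\<exists>s\<in>{0..1}. x = linepath a b s" if "x \<in> closed_segment a b" for x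
    using that unfolding closed_segment_image_interval linepath_def by auto
  have "diameter (closed_segment a b) = norm (b - a)"
  proof (rule antisym)
    show "diameter (closed_segment a b) \<le> norm (b - a)"
    proof (rule diameter_le)
      fix x y assume "x \<in> closed_segment a b" "y \<in> closed_segment a b"
      then obtain r s where r: "r \<in> {0..1}" "x = linepath a b r" and s: "s \<in> {0..1}" "y = linepath a b s" using seg by blast
      have "x - y = (r - s) *\<^sub>R (b - a)" unfolding r s linepath_def by (simp add: algebra_simps)
      then have "norm (x - y) = \<bar>r - s\<bar> * norm (b - a)" by simp
      also have "\<dots> \<le> 1 * norm (b - a)" using r s by (intro mult_right_mono) (auto simp: abs_le_iff)
      finally show "norm (x - y) \<le> norm (b - a)" by simp
    qed simp
    show "norm (b - a) \<le> diameter (closed_segment a b)"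
      using diameter_bounded_bound[OF bounded_closed_segment[of a b], of b a] by (simp add: dist_norm)
  qed
  moreover have "linepath a b t - midpoint a b = (t - 1 / 2) *\<^sub>R (b - a)"
    unfolding vec_eq_iff linepath_def midpoint_def by (simp add: field_simps)
  moreover have "(b - a) \<bullet> sgn (b - a) = norm (b - a)"
    using assms by (simp add: sgn_div_norm dot_square_norm power2_eq_square)
  ultimately show ?thesis
    using assms by (simp add: scaled_edge_monomial_def)
qed

context triangulated_polygon
begin

lemma vertex_average_near:
  assumes x: "x \<in> closure K"
  shows "norm (x - vertex_average ps) \<le> diameter K"
proof -
  let ?m = "real (length ps)"
  have m: "?m > 0" using length_ps by linarith
  have v: "norm (x - ps ! i) \<le> diameter K" if i: "i < length ps" for i
  proof -
    have "ps ! i \<in> polygon_edge ps i" using i by (simp add: polygon_edge_def vtx_mod)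
    then have "ps ! i \<in> frontier K" using i frontier_K by blast
    then have "ps ! i \<in> closure K" by (simp add: frontier_def)
    then show ?thesis
      using diameter_bounded_bound[of "closure K" x "ps ! i"] x bounded_closure[OF bounded_K] by (simp add: diameter_closure[OF bounded_K] dist_norm)
  qed
  have "x - vertex_average ps = (1 / ?m) *\<^sub>R (\<Sum>i<length ps. x - ps ! i)"
    using m by (simp add: vertex_average_def sum_list_sum_nth atLeast0LessThan sum_subtractf scaleR_diff_right sum_constant_scaleR del: sum_constant)
  also have "norm \<dots> \<le> 1 / ?m * (\<Sum>i<length ps. diameter K)"
    unfolding norm_scaleR using m by (intro mult_mono sum_norm_le v) auto
  also have "\<dots> = diameter K" using m by simp
  finally show ?thesis .
qed

lemma boundary_trace_eq:
  assumes tr: "has_trace K ps v g" and cont: "continuous_on (frontier K) g"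
    and lap: "weak_laplacian K v p" and p: "p \<in> L2 K" and i: "i < length ps" and x: "x \<in> polygon_edge ps i"
  shows "boundary_trace K ps v x = g x"
proof -
  let ?g = "boundary_trace K ps v"
  have g: "continuous_on (frontier K) ?g \<and> has_trace K ps v ?g"
    unfolding boundary_trace_def by (rule someI[of _ g]) (use tr cont in simp)
  obtain w where w: "triangle (vtx ps i) (vtx ps (Suc i) - vtx ps i) w \<in> \<T>" "det2 (vtx ps (Suc i) - vtx ps i) w \<noteq> 0"
    using edge_triangle[OF i] .
  have sub: "polygon_edge ps i \<subseteq> frontier K" using frontier_K i by blast
  have v: "v \<in> L2 K" using tr unfolding has_trace_def by blast
  show ?thesis
    by (rule continuous_trace_unique[OF open_K bounded_K v p conjunct2[OF g] tr lap i vtx_distinct[OF i]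
          continuous_on_subset[OF conjunct1[OF g] sub] continuous_on_subset[OF cont sub] w(2) open_triangle_subset_K[OF w(1) refl w(2)] x])
qed

lemma dof_edge_polynomial:
  assumes i: "i < length ps" and t: "\<And>s. s \<in> {0..1} \<Longrightarrow> boundary_trace K ps v (linepath (vtx ps i) (vtx ps (Suc i)) s) = poly q s"
  shows "dof K ps v (Vertex i) = poly q 0" "dof K ps v (Vertex (Suc i mod length ps)) = poly q 1"
    "dof K ps v (Edge_Moment i j) = integral {0..1} (\<lambda>s. (s - 1 / 2) ^ j * poly q s)"
proof -
  let ?a = "vtx ps i" and ?b = "vtx ps (Suc i)"
  show "dof K ps v (Vertex i) = poly q 0" using t[of 0] by (simp add: linepath_def)
  show "dof K ps v (Vertex (Suc i mod length ps)) = poly q 1" using t[of 1] by (simp add: linepath_def vtx_def)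
  have d: "dist ?a ?b \<noteq> 0" using vtx_distinct[OF i] by simp
  have "dof K ps v (Edge_Moment i j) = (\<integral>s. scaled_edge_monomial ?a ?b j (linepath ?a ?b s) * boundary_trace K ps v (linepath ?a ?b s) \<partial>lebesgue_on {0..1})"
    using d by (simp add: Let_def edge_integral_def)
  also have "\<dots> = (\<integral>s. (s - 1 / 2) ^ j * poly q s \<partial>lebesgue_on {0..1})"
    by (rule Bochner_Integration.integral_cong) (simp_all add: t scaled_edge_monomial_linepath[OF vtx_distinct[OF i]])
  also have "\<dots> = integral {0..1} (\<lambda>s. (s - 1 / 2) ^ j * poly q s)"
    by (intro lebesgue_integral_eq_integral L2_integrable L2_continuous_unit continuous_intros) auto
  finally show "dof K ps v (Edge_Moment i j) = integral {0..1} (\<lambda>s. (s - 1 / 2) ^ j * poly q s)" .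
qed

lemma scaled_monomial_le_1:
  assumes "s \<in> multi_indices l" "x \<in> K"
  shows "\<bar>scaled_monomial K ps s x\<bar> \<le> 1"
proof -
  have c: "\<bar>(x - vertex_average ps) $ i / diameter K\<bar> \<le> 1" for i
  proof -
    have "\<bar>(x - vertex_average ps) $ i\<bar> \<le> diameter K"
      by (rule order_trans[OF component_le_norm_cart vertex_average_near]) (use assms(2) closure_subset in blast)
    then show ?thesis using diameter_pos by (simp add: abs_divide)
  qed
  then show ?thesis
    unfolding scaled_monomial_shifted using shifted_monomial_bound[OF assms(1), of 1 x "vertex_average ps" "diameter K"] by simp
qed

text \<open>The comparison argument. Thresholding above the boundary values leaves a function with vanishing trace, whose energy is
  controlled by the source; what thresholding removes is of the size of the boundary values.\<close>

lemma solution_bound: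
  assumes tr: "has_trace K ps v g" and lap: "weak_laplacian K v p" and p: "p \<in> L2 K"
    and P: "\<And>x. x \<in> K \<Longrightarrow> \<bar>p x\<bar> \<le> P" "P \<ge> 0" "diameter K ^ 3 * P \<le> Cs * L2_norm K v" and Cs: "Cs \<ge> 0"
    and D: "\<bar>\<integral>x. p x * v x \<partial>lebesgue_on K\<bar> \<le> P * D * measure lebesgue K" "D \<ge> 0"
    and G: "G > 0" "\<And>i t. i < length ps \<Longrightarrow> t \<in> {0..1} \<Longrightarrow> \<bar>g (linepath (vtx ps i) (vtx ps (Suc i)) t)\<bar> \<le> G"
  shows "L2_norm K v \<le> 2 * diameter K * (2 * pi * Cs + 2) * (D + 3 * G)"
proof -
  let ?h = "diameter K" and ?m = "measure lebesgue K" and ?T = "\<lambda>n x. threshold G (real (Suc n)) (v x)" and ?S = "\<lambda>x. soft G (v x)"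
  have h: "?h > 0" by (rule diameter_pos)
  have v: "v \<in> L2 K" using tr unfolding has_trace_def by blast
  then have vm: "v \<in> borel_measurable (lebesgue_on K)" by (simp add: L2_def)
  have x1: "\<exists>x. x \<in> K" using h by (metis all_not_in_conv diameter_empty less_irrefl)
  have m: "?m \<le> pi * ?h\<^sup>2" using x1 measure_le_diameter[OF lmeasurable_K bounded_K _ refl] by blast
  have m0: "?m > 0"
    using open_K x1 lmeasurable_K open_not_negligible[of K] measure_nonneg[of lebesgue K]
    by (auto simp: negligible_iff_measure order.strict_iff_order)
  have Tm: "?T n \<in> borel_measurable (lebesgue_on K)" for n
    by (rule measurable_compose[OF vm borel_measurable_continuous_onI[OF continuous_threshold]]) simp
  have TL: "?T n \<in> L2 K" for n
    by (rule L2_bound[OF v Tm, where B = 1]) (use threshold_le[OF G(1)] in simp)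
  have "\<exists>n. L2_norm K (\<lambda>x. v x - ?T n x) \<le> 3 * G * sqrt ?m"
  proof -
    let ?b = "\<lambda>n x. if v x = 0 then 0 else ?T n x / v x" and ?b' = "\<lambda>x. if v x = 0 then 0 else ?S x / v x"
    have bm: "?b n \<in> borel_measurable (lebesgue_on K)" for n
      using vm Tm[of n] by measurable
    have lim: "(\<lambda>n. ?b n x) \<longlonglongrightarrow> ?b' x" for x
      by (cases "v x = 0") (simp_all del: of_nat_Suc add: tendsto_divide[OF threshold_tendsto tendsto_const])
    have b1: "\<bar>?b n x\<bar> \<le> 1" for n x
      using threshold_le[OF G(1), of "real (Suc n)" "v x"] by (simp add: abs_divide)
    have b1': "\<bar>?b' x\<bar> \<le> 1" for x
      by (rule LIMSEQ_le_const2[OF tendsto_rabs[OF lim]]) (use b1 in blast)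
    have "L2_tendsto K (\<lambda>n x. ?b n x * v x) (\<lambda>x. ?b' x * v x)"
      by (rule L2_tendsto_mult_pointwise[OF v bm borel_measurable_LIMSEQ_real[OF lim bm] b1 b1']) (use lim in simp)
    moreover have "(\<lambda>n x. ?b n x * v x) = ?T" using threshold_small[OF G(1), of 0] G(1) by (auto simp: fun_eq_iff)
    moreover have "(\<lambda>x. ?b' x * v x) = ?S" using soft_small[OF G(1), of 0] G(1) by (auto simp: fun_eq_iff)
    ultimately have TS: "L2_tendsto K ?T ?S" by simp
    then have S: "?S \<in> L2 K" and l0: "(\<lambda>n. L2_norm K (\<lambda>x. ?T n x - ?S x)) \<longlonglongrightarrow> 0" by (simp_all add: L2_tendsto_def)
    have "G * sqrt ?m > 0" using G(1) m0 by simp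
    then obtain n where n: "L2_norm K (\<lambda>x. ?T n x - ?S x) < G * sqrt ?m"
      using eventually_happens'[OF sequentially_bot order_tendstoD(2)[OF l0]] by blast
    have "L2_norm K (\<lambda>x. v x - ?T n x) = L2_norm K (\<lambda>x. (v x - ?S x) + (-1) * (?T n x - ?S x))" by simp
    also have "\<dots> \<le> L2_norm K (\<lambda>x. v x - ?S x) + L2_norm K (\<lambda>x. (-1) * (?T n x - ?S x))"
      by (intro L2_norm_triangle L2_cmult L2_diff v S TL)
    also have "L2_norm K (\<lambda>x. (-1) * (?T n x - ?S x)) = L2_norm K (\<lambda>x. ?T n x - ?S x)" unfolding L2_norm_cmult by simp
    also have "L2_norm K (\<lambda>x. v x - ?S x) \<le> 2 * G * sqrt ?m"
      using L2_diff[OF v S] G(1) by (intro L2_bounded_function(2)[OF lmeasurable_K] soft_close) (auto simp: L2_def)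
    finally show ?thesis using n by (intro exI[of _ n]) linarith
  qed
  then obtain n where n: "L2_norm K (\<lambda>x. v x - ?T n x) \<le> 3 * G * sqrt ?m" ..
  obtain E where E: "E \<ge> 0" "E\<^sup>2 \<le> - (\<integral>x. p x * ?T n x \<partial>lebesgue_on K)" "L2_norm K (?T n) \<le> 2 * ?h * E"
    using threshold_energy[OF tr lap p G, of "real (Suc n)"] by auto
  let ?X = "D + 3 * G" and ?A = "2 * pi * Cs"
  have X: "?X \<ge> 0" "?X \<ge> 3 * G" using D(2) G(1) by auto
  have A: "?A \<ge> 0" using Cs by simp
  have "(\<integral>x. p x * (v x - ?T n x) \<partial>lebesgue_on K) \<le> L2_norm K p * L2_norm K (\<lambda>x. v x - ?T n x)"
    using L2_Cauchy_Schwarz[OF p L2_diff[OF v TL[of n]]] by linarith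
  also have "\<dots> \<le> (P * sqrt ?m) * (3 * G * sqrt ?m)"
  proof (rule mult_mono[OF _ n])
    show "L2_norm K p \<le> P * sqrt ?m"
      using p P by (intro L2_bounded_function(2)[OF lmeasurable_K]) (auto simp: L2_def)
  qed (use P(2) m0 in \<open>auto simp: L2_norm_nonneg\<close>)
  also have "\<dots> = P * (3 * G) * ?m" using m0 by simp
  finally have "- (\<integral>x. p x * ?T n x \<partial>lebesgue_on K) \<le> P * D * ?m + P * (3 * G) * ?m"
    using D(1) L2_mult_integrable[OF p v] L2_mult_integrable[OF p TL[of n]] by (simp add: right_diff_distrib)
  then have E2: "E\<^sup>2 \<le> P * ?X * ?m" using E(2) by (simp add: algebra_simps)
  have "L2_norm K v = L2_norm K (\<lambda>x. ?T n x + (v x - ?T n x))" by simp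
  also have "\<dots> \<le> L2_norm K (?T n) + L2_norm K (\<lambda>x. v x - ?T n x)" by (intro L2_norm_triangle L2_diff v TL)
  also have "\<dots> \<le> 2 * ?h * E + 3 * G * (2 * ?h)"
  proof -
    have "sqrt ?m \<le> 2 * ?h"
    proof (rule real_le_lsqrt)
      have "pi * ?h\<^sup>2 \<le> 4 * ?h\<^sup>2" using pi_less_4 by (intro mult_right_mono) auto
      then show "?m \<le> (2 * ?h)\<^sup>2" using m by (simp add: power2_eq_square)
    qed (use h in simp)
    then have "3 * G * sqrt ?m \<le> 3 * G * (2 * ?h)" using G(1) h by (intro mult_left_mono) auto
    then show ?thesis using E(3) n by linarith
  qed
  also have "\<dots> \<le> 2 * ?h * (E + ?X)" using X(2) h by (simp add: distrib_left)
  finally have vE: "L2_norm K v \<le> 2 * ?h * (E + ?X)" .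
  have "?h * E\<^sup>2 \<le> ?h * (P * ?X * (pi * ?h\<^sup>2))"
    using E2 m P(2) X(1) h by (intro mult_left_mono order_trans[OF E2] mult_nonneg_nonneg) auto
  also have "\<dots> = ?h ^ 3 * P * (pi * ?X)" by (simp add: power2_eq_square power3_eq_cube)
  also have "\<dots> \<le> Cs * (2 * ?h * (E + ?X)) * (pi * ?X)"
    using P(3) vE Cs X(1) by (intro mult_right_mono order_trans[OF P(3)] mult_left_mono) auto
  also have "\<dots> = ?h * (?A * (E + ?X) * ?X)" by simp
  finally have E3: "E\<^sup>2 \<le> ?A * (E + ?X) * ?X" using h by simp
  have "E \<le> (?A + 1) * ?X"
  proof (rule ccontr)
    assume "\<not> E \<le> (?A + 1) * ?X"
    then have less: "(?A + 1) * ?X < E" by simp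
    have "?X \<le> (?A + 1) * ?X" using A X(1) mult_right_mono[of 1 "?A + 1" ?X] by simp
    then have "?X \<le> E" and E0: "E > 0" using less X(1) by linarith+
    have "?A * (E + ?X) * ?X = ?A * ?X * E + ?A * ?X * ?X" by (simp add: algebra_simps)
    also have "\<dots> \<le> ?A * ?X * E + (?A + 1) * ?X * ?X"
      using X(1) by (intro add_left_mono mult_right_mono) auto
    also have "\<dots> \<le> ?A * ?X * E + E * ?X" using less X(1) by (intro add_left_mono mult_right_mono) auto
    also have "\<dots> = ((?A + 1) * ?X) * E" by (simp add: algebra_simps)
    also have "\<dots> < E * E" using less E0 by (intro mult_strict_right_mono)
    finally show False using E3 by (simp add: power2_eq_square)
  qed
  then have "2 * ?h * (E + ?X) \<le> 2 * ?h * ((?A + 1) * ?X + ?X)" using h by (intro mult_left_mono) auto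
  also have "\<dots> = 2 * ?h * (2 * pi * Cs + 2) * ?X" by (simp add: algebra_simps)
  finally show ?thesis using vE by linarith
qed

end

section \<open>Norm equivalence\<close>

lemma poly_abs_le_coeff_sum:
  fixes q :: "real poly"
  assumes "degree q \<le> n" "s \<in> {0..1}"
  shows "\<bar>poly q s\<bar> \<le> (\<Sum>j\<le>n. \<bar>coeff q j\<bar>)"
  unfolding poly_as_sum_le[OF assms(1)]
  by (rule order_trans[OF sum_abs], rule sum_mono) (use assms(2) in \<open>auto simp: abs_mult power_abs intro!: mult_left_le power_le_one\<close>)

lemma (in triangulated_polygon) scaled_monomial_sum_le:
  assumes x: "x \<in> K"
  shows "\<bar>\<Sum>s\<in>multi_indices l. c s * scaled_monomial K ps s x\<bar> \<le> (\<Sum>s\<in>multi_indices l. \<bar>c s\<bar>)"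
  by (rule order_trans[OF sum_abs], rule sum_mono) (use scaled_monomial_le_1[OF _ x] in \<open>auto simp: abs_mult intro!: mult_left_le\<close>)

lemma (in triangulated_polygon) inner_ball:
  assumes \<theta>: "\<theta> \<le> 1 / (c\<^sub>0 * \<kappa>)"
  obtains x0 where "ball x0 (\<theta> * diameter K) \<subseteq> K"
proof -
  let ?h = "diameter K"
  have "0 < length ps" using length_ps by linarith
  then obtain w where w: "triangle (vtx ps 0) (vtx ps (Suc 0) - vtx ps 0) w \<in> \<T>" using edge_triangle by blast
  obtain x0 where x0: "cball x0 (?h / (c\<^sub>0 * \<kappa>)) \<subseteq> triangle (vtx ps 0) (vtx ps (Suc 0) - vtx ps 0) w"
    using inball(2)[OF w] by blast
  have "\<theta> * ?h \<le> 1 / (c\<^sub>0 * \<kappa>) * ?h" using \<theta> diameter_pos by (intro mult_right_mono) auto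
  then have "ball x0 (\<theta> * ?h) \<subseteq> triangle (vtx ps 0) (vtx ps (Suc 0) - vtx ps 0) w"
    using x0 ball_subset_cball[of x0 "\<theta> * ?h"] subset_cball[of "\<theta> * ?h" "?h / (c\<^sub>0 * \<kappa>)" x0] by auto
  then have "ball x0 (\<theta> * ?h) \<subseteq> K"
    using interior_maximal[OF _ open_ball] interior_T_subset[OF w] by blast
  then show ?thesis by (rule that)
qed

text \<open>All that the two inequalities use about a function of the space. The quantities \<open>c\<close> and \<open>q\<close> are the coefficients of its Laplacian
  and of its trace; both are bounded by the function itself, up to the powers of the diameter that scaling dictates.\<close>

lemma vem_function_data:
  fixes k l :: int and \<theta> :: real
  assumes \<theta>: "0 < \<theta>" "\<theta> \<le> 1"
  obtains Cs Ce where "Cs > 0" "Ce > 0"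
    "\<And>K ps \<T> \<kappa> \<sigma> c\<^sub>0 v. \<lbrakk>triangulated_polygon K ps \<T> \<kappa> \<sigma> c\<^sub>0; \<theta> \<le> 1 / (c\<^sub>0 * \<kappa>); v \<in> vem_space k l K ps\<rbrakk> \<Longrightarrow>
      \<exists>g p c q. has_trace K ps v g \<and> weak_laplacian K v p \<and> p \<in> L2 K \<and>
        (\<forall>x\<in>K. p x = (\<Sum>s\<in>multi_indices l. c s * scaled_monomial K ps s x)) \<and>
        diameter K ^ 3 * (\<Sum>s\<in>multi_indices l. \<bar>c s\<bar>) \<le> Cs * L2_norm K v \<and>
        (\<forall>i<length ps. degree (q i) \<le> nat k \<and> diameter K * (\<Sum>j\<le>nat k. \<bar>coeff (q i) j\<bar>) \<le> Ce * L2_norm K v \<and>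
          (\<forall>s\<in>{0..1}. g (linepath (vtx ps i) (vtx ps (Suc i)) s) = poly (q i) s \<and>
            boundary_trace K ps v (linepath (vtx ps i) (vtx ps (Suc i)) s) = poly (q i) s))"
proof -
  obtain Cs where Cs: "Cs > 0" and source: "\<And>K h v p x0 xc. \<lbrakk>open K; bounded K; diameter K = h; h > 0; ball x0 (\<theta> * h) \<subseteq> K; norm (x0 - xc) \<le> h;
        v \<in> L2 K; p \<in> polys l K; weak_laplacian K v p\<rbrakk> \<Longrightarrow>
      \<exists>c. (\<forall>x\<in>K. p x = (\<Sum>s\<in>multi_indices l. c s * shifted_monomial xc h s x)) \<and>
        h ^ 3 * (\<Sum>s\<in>multi_indices l. \<bar>c s\<bar>) \<le> Cs * L2_norm K v"
    using source_bound[OF \<theta>, of l] by blast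
  obtain Ce where Ce: "Ce > 0" and edge: "\<And>K ps \<T> \<kappa> \<sigma> c\<^sub>0 i v p g q P. \<lbrakk>triangulated_polygon K ps \<T> \<kappa> \<sigma> c\<^sub>0; \<theta> \<le> 1 / (c\<^sub>0 * \<kappa>); i < length ps; v \<in> L2 K; p \<in> L2 K;
        has_trace K ps v g; weak_laplacian K v p; \<And>x. x \<in> K \<Longrightarrow> \<bar>p x\<bar> \<le> P; P \<ge> 0; diameter K ^ 3 * P \<le> Cs * L2_norm K v;
        degree q \<le> nat k; \<And>s. s \<in> {0..1} \<Longrightarrow> g (linepath (vtx ps i) (vtx ps (Suc i)) s) = poly q s\<rbrakk> \<Longrightarrow>
      diameter K * (\<Sum>j\<le>nat k. \<bar>coeff q j\<bar>) \<le> Ce * L2_norm K v"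
    using edge_bound[OF \<theta>(1) less_imp_le[OF Cs], of "nat k"] by blast
  show ?thesis
  proof (rule that[OF Cs Ce])
    fix K ps \<T> \<kappa> \<sigma> c\<^sub>0 v
    assume tp: "triangulated_polygon K ps \<T> \<kappa> \<sigma> c\<^sub>0" and \<theta>le: "\<theta> \<le> 1 / (c\<^sub>0 * \<kappa>)" and vem: "v \<in> vem_space k l K ps"
    interpret triangulated_polygon K ps \<T> \<kappa> \<sigma> c\<^sub>0 by (rule tp)
    let ?h = "diameter K"
    obtain g p where g: "g \<in> boundary_space k K ps" and tr: "has_trace K ps v g" and pp: "p \<in> polys l K" and lap: "weak_laplacian K v p"
      using vem unfolding vem_space_def by blast
    have v: "v \<in> L2 K" using tr unfolding has_trace_def by blast
    obtain x0 where ball: "ball x0 (\<theta> * ?h) \<subseteq> K" using inner_ball[OF \<theta>le] .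
    moreover have "x0 \<in> ball x0 (\<theta> * ?h)" using \<theta>(1) diameter_pos by simp
    ultimately have "x0 \<in> closure K" using closure_subset by blast
    then obtain c where c: "\<And>x. x \<in> K \<Longrightarrow> p x = (\<Sum>s\<in>multi_indices l. c s * scaled_monomial K ps s x)"
        "?h ^ 3 * (\<Sum>s\<in>multi_indices l. \<bar>c s\<bar>) \<le> Cs * L2_norm K v"
      using source[OF open_K bounded_K refl diameter_pos ball vertex_average_near v pp lap] unfolding scaled_monomial_shifted by blast
    have pL: "p \<in> L2 K"
    proof -
      let ?f = "\<lambda>x. \<Sum>s\<in>multi_indices l. c s * scaled_monomial K ps s x"
      have "smooth ?f" unfolding scaled_monomial_shifted by (intro smooth_sum smooth_cmult smooth_shifted_monomial)
      then have f: "?f \<in> L2 K" by (intro L2_continuous lmeasurable_K bounded_K smooth_continuous_on)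
      have "p \<in> borel_measurable (lebesgue_on K) \<longleftrightarrow> ?f \<in> borel_measurable (lebesgue_on K)"
        by (rule measurable_cong) (simp add: c(1))
      then have "p \<in> borel_measurable (lebesgue_on K)" using f by (simp add: L2_def)
      then show ?thesis by (rule L2_bound[OF f, where B = 1]) (simp add: c(1))
    qed
    have pb: "\<bar>p x\<bar> \<le> (\<Sum>s\<in>multi_indices l. \<bar>c s\<bar>)" if x: "x \<in> K" for x
      unfolding c(1)[OF x] by (rule scaled_monomial_sum_le[OF x])
    have "\<forall>i. \<exists>q. i < length ps \<longrightarrow> degree q \<le> nat k \<and> (\<forall>s\<in>{0..1}. g (linepath (vtx ps i) (vtx ps (Suc i)) s) = poly q s)"
    proof
      fix i
      show "\<exists>q. i < length ps \<longrightarrow> degree q \<le> nat k \<and> (\<forall>s\<in>{0..1}. g (linepath (vtx ps i) (vtx ps (Suc i)) s) = poly q s)"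
      proof (cases "i < length ps")
        case True
        then have "g \<in> polys k (polygon_edge ps i)" using g by (simp add: boundary_space_def)
        then obtain q where "degree q \<le> nat k" "\<And>s. s \<in> {0..1} \<Longrightarrow> g (linepath (vtx ps i) (vtx ps (Suc i)) s) = poly q s"
          using polys_edge_polynomial by blast
        then show ?thesis by (intro exI[of _ q]) simp
      qed simp
    qed
    from choice[OF this] obtain q where qq: "\<forall>i. i < length ps \<longrightarrow> degree (q i) \<le> nat k \<and>
        (\<forall>s\<in>{0..1}. g (linepath (vtx ps i) (vtx ps (Suc i)) s) = poly (q i) s)" ..
    then have q: "\<And>i. i < length ps \<Longrightarrow> degree (q i) \<le> nat k"
        "\<And>i s. i < length ps \<Longrightarrow> s \<in> {0..1} \<Longrightarrow> g (linepath (vtx ps i) (vtx ps (Suc i)) s) = poly (q i) s"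
      by simp_all
    have bt: "boundary_trace K ps v (linepath (vtx ps i) (vtx ps (Suc i)) s) = poly (q i) s" if i: "i < length ps" and s: "s \<in> {0..1}" for i s
    proof -
      have "boundary_trace K ps v (linepath (vtx ps i) (vtx ps (Suc i)) s) = g (linepath (vtx ps i) (vtx ps (Suc i)) s)"
        using g s by (intro boundary_trace_eq[OF tr _ lap pL i]) (auto simp: boundary_space_def polygon_edge_def linepath_in_path)
      then show ?thesis using q(2)[OF i s] by simp
    qed
    have eb: "?h * (\<Sum>j\<le>nat k. \<bar>coeff (q i) j\<bar>) \<le> Ce * L2_norm K v" if i: "i < length ps" for i
      by (rule edge[OF tp \<theta>le i v pL tr lap pb _ c(2) q(1)[OF i] q(2)[OF i]]) (auto intro: sum_nonneg)
    show "\<exists>g p c q. has_trace K ps v g \<and> weak_laplacian K v p \<and> p \<in> L2 K \<and>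
        (\<forall>x\<in>K. p x = (\<Sum>s\<in>multi_indices l. c s * scaled_monomial K ps s x)) \<and>
        ?h ^ 3 * (\<Sum>s\<in>multi_indices l. \<bar>c s\<bar>) \<le> Cs * L2_norm K v \<and>
        (\<forall>i<length ps. degree (q i) \<le> nat k \<and> ?h * (\<Sum>j\<le>nat k. \<bar>coeff (q i) j\<bar>) \<le> Ce * L2_norm K v \<and>
          (\<forall>s\<in>{0..1}. g (linepath (vtx ps i) (vtx ps (Suc i)) s) = poly (q i) s \<and>
            boundary_trace K ps v (linepath (vtx ps i) (vtx ps (Suc i)) s) = poly (q i) s))"
      using tr lap pL c q bt eb by (intro exI[of _ g] exI[of _ p] exI[of _ c] exI[of _ q]) simp
  qed
qed

lemma card_dof_indices:
  "card (dof_indices k l ps) \<le> length ps * (1 + nat k) + card (multi_indices l)"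
proof -
  have sub: "{Edge_Moment i j |i j. i < length ps \<and> int j \<le> k - 2} \<subseteq> case_prod Edge_Moment ` ({..<length ps} \<times> {..<nat k})"
    by auto
  have "card (dof_indices k l ps) \<le> card (Vertex ` {..<length ps}) + card {Edge_Moment i j |i j. i < length ps \<and> int j \<le> k - 2}
      + card (Interior_Moment ` multi_indices l)"
    unfolding dof_indices_def by (rule order_trans[OF card_Un_le add_right_mono[OF card_Un_le]])
  also have "\<dots> \<le> length ps + length ps * nat k + card (multi_indices l)"
  proof (intro add_mono)
    show "card (Vertex ` {..<length ps}) \<le> length ps" using card_image_le[of "{..<length ps}" Vertex] by simp
    have "card {Edge_Moment i j |i j. i < length ps \<and> int j \<le> k - 2} \<le> card (case_prod Edge_Moment ` ({..<length ps} \<times> {..<nat k}))"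
      by (intro card_mono sub) simp
    also have "\<dots> \<le> card ({..<length ps} \<times> {..<nat k})" by (rule card_image_le) simp
    finally show "card {Edge_Moment i j |i j. i < length ps \<and> int j \<le> k - 2} \<le> length ps * nat k" by simp
    show "card (Interior_Moment ` multi_indices l) \<le> card (multi_indices l)" by (rule card_image_le[OF finite_multi_indices])
  qed
  finally show ?thesis by simp
qed

context triangulated_polygon
begin

text \<open>Vertex values and edge moments are bounded by the coefficients of the trace; for interior moments the Cauchy-Schwarz inequality
  loses a factor \<open>1 / h\<close>, because the area of \<open>K\<close> is comparable to \<open>h\<^sup>2\<close>.\<close>

lemma dof_le_L2_norm:
  assumes \<theta>: "0 < \<theta>" "\<theta> \<le> 1 / (c\<^sub>0 * \<kappa>)" and v: "v \<in> L2 K" and Ce: "Ce \<ge> 0"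
    and q: "\<And>i. i < length ps \<Longrightarrow> degree (q i) \<le> nat k"
      "\<And>i. i < length ps \<Longrightarrow> diameter K * (\<Sum>j\<le>nat k. \<bar>coeff (q i) j\<bar>) \<le> Ce * L2_norm K v"
      "\<And>i s. i < length ps \<Longrightarrow> s \<in> {0..1} \<Longrightarrow> boundary_trace K ps v (linepath (vtx ps i) (vtx ps (Suc i)) s) = poly (q i) s"
    and d: "d \<in> dof_indices k l ps"
  shows "diameter K * \<bar>dof K ps v d\<bar> \<le> (Ce + 1 / \<theta>) * L2_norm K v"
proof -
  let ?h = "diameter K" and ?m = "measure lebesgue K" and ?v = "L2_norm K v"
  have h: "?h > 0" by (rule diameter_pos)
  have v0: "?v \<ge> 0" by (rule L2_norm_nonneg)
  have edge: "?h * r \<le> (Ce + 1 / \<theta>) * ?v" if i: "i < length ps" and r: "r \<le> (\<Sum>j\<le>nat k. \<bar>coeff (q i) j\<bar>)" for i r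
  proof -
    have "?h * r \<le> Ce * ?v" using order_trans[OF mult_left_mono[OF r] q(2)[OF i]] h by simp
    also have "\<dots> \<le> (Ce + 1 / \<theta>) * ?v" using \<theta>(1) v0 by (intro mult_right_mono) auto
    finally show ?thesis .
  qed
  consider i where "d = Vertex i" "i < length ps" | i j where "d = Edge_Moment i j" "i < length ps"
    | s where "d = Interior_Moment s" "s \<in> multi_indices l"
    using d unfolding dof_indices_def by blast
  then show ?thesis
  proof cases
    case (1 i)
    have dof: "dof K ps v (Vertex i) = poly (q i) 0"
      by (rule dof_edge_polynomial(1)[OF 1(2)], rule q(3)[OF 1(2)])
    show ?thesis
      unfolding 1(1) dof
      by (rule edge[OF 1(2) poly_abs_le_coeff_sum[OF q(1)[OF 1(2)]]]) simp
  next
    case (2 i j)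
    let ?Q = "\<Sum>j\<le>nat k. \<bar>coeff (q i) j\<bar>"
    have "norm (integral {0..1} (\<lambda>s. (s - 1 / 2) ^ j * poly (q i) s)) \<le> ?Q * (1 - 0)"
    proof (rule integral_bound)
      fix s :: real assume s: "s \<in> {0..1}"
      have "\<bar>s - 1 / 2\<bar> \<le> 1" using s by (simp add: abs_le_iff)
      then have "\<bar>(s - 1 / 2) ^ j\<bar> * \<bar>poly (q i) s\<bar> \<le> 1 * ?Q"
        using poly_abs_le_coeff_sum[OF q(1)[OF 2(2)] s] by (intro mult_mono) (auto simp: power_abs power_le_one)
      then show "norm ((s - 1 / 2) ^ j * poly (q i) s) \<le> ?Q" by (simp add: abs_mult)
    qed (auto intro!: continuous_intros)
    moreover have "dof K ps v (Edge_Moment i j) = integral {0..1} (\<lambda>s. (s - 1 / 2) ^ j * poly (q i) s)"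
      by (rule dof_edge_polynomial(3)[OF 2(2)], rule q(3)[OF 2(2)])
    ultimately show ?thesis
      unfolding 2(1) by (intro edge[OF 2(2)]) simp
  next
    case (3 s)
    let ?M = "scaled_monomial K ps s"
    have sm: "smooth ?M" unfolding scaled_monomial_shifted by (rule smooth_shifted_monomial)
    have M: "?M \<in> L2 K" by (intro L2_continuous lmeasurable_K bounded_K smooth_continuous_on sm)
    have "L2_norm K ?M \<le> 1 * sqrt ?m"
      using M by (intro L2_bounded_function(2)[OF lmeasurable_K] scaled_monomial_le_1[OF 3(2)]) (auto simp: L2_def)
    then have Mv: "\<bar>\<integral>x. ?M x * v x \<partial>lebesgue_on K\<bar> \<le> sqrt ?m * ?v"
      using order_trans[OF L2_Cauchy_Schwarz[OF M v] mult_right_mono[OF _ v0]] by simp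
    have m: "\<theta> * ?h \<le> sqrt ?m" and m0: "?m > 0"
    proof -
      obtain x0 where ball: "ball x0 (\<theta> * ?h) \<subseteq> K" using inner_ball[OF \<theta>(2)] .
      have \<theta>h: "\<theta> * ?h > 0" using \<theta>(1) h by simp
      have "1 * (\<theta> * ?h)\<^sup>2 \<le> pi * (\<theta> * ?h)\<^sup>2" using pi_ge_two by (intro mult_right_mono) auto
      also have "\<dots> = measure lebesgue (ball x0 (\<theta> * ?h))" using \<theta>h by (simp add: content_ball unit_ball_vol_2)
      also have "\<dots> \<le> ?m" using ball lmeasurable_K by (intro measure_mono_fmeasurable) auto
      finally have m: "(\<theta> * ?h)\<^sup>2 \<le> ?m" by simp
      then show "\<theta> * ?h \<le> sqrt ?m" by (rule real_le_rsqrt)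
      show "?m > 0" using less_le_trans[OF zero_less_power[OF \<theta>h] m] .
    qed
    have "\<bar>dof K ps v d\<bar> \<le> sqrt ?m * ?v / ?m" unfolding 3(1) using Mv m0 by (simp add: abs_divide divide_right_mono)
    also have "\<dots> = ?v / sqrt ?m" using m0 by (simp add: field_simps)
    also have "\<dots> \<le> ?v / (\<theta> * ?h)" using m v0 \<theta>(1) h by (intro frac_le) auto
    finally have "?h * \<bar>dof K ps v d\<bar> \<le> ?h * (?v / (\<theta> * ?h))" using h by (intro mult_left_mono) auto
    also have "\<dots> = 1 / \<theta> * ?v" using h by simp
    also have "\<dots> \<le> (Ce + 1 / \<theta>) * ?v" using Ce v0 by (intro mult_right_mono) auto
    finally show ?thesis .
  qed
qed

text \<open>The degrees of freedom that belong to one edge, including the value at the next vertex, determine the trace on it.\<close>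

lemma dof_bounds_trace:
  assumes k: "k \<ge> 1" and cu: "cu > 0" "\<And>q::real poly. degree q \<le> nat k \<Longrightarrow> cu * (\<Sum>i\<le>nat k. \<bar>coeff q i\<bar>)\<^sup>2 \<le>
      (poly q 0)\<^sup>2 + (poly q 1)\<^sup>2 + (\<Sum>j<nat k - 1. (integral {0..1} (\<lambda>s. (s - 1/2) ^ j * poly q s))\<^sup>2)"
    and i: "i < length ps" and q: "degree q \<le> nat k"
      "\<And>s. s \<in> {0..1} \<Longrightarrow> boundary_trace K ps v (linepath (vtx ps i) (vtx ps (Suc i)) s) = poly q s"
  shows "(\<Sum>j\<le>nat k. \<bar>coeff q j\<bar>) \<le> sqrt ((nat k + 1) / cu) * dof_norm k l K ps v"
proof -
  let ?D = "dof_norm k l K ps v"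
  have D: "(dof K ps v d)\<^sup>2 \<le> ?D\<^sup>2" if "d \<in> dof_indices k l ps" for d
  proof -
    have "(dof K ps v d)\<^sup>2 \<le> (\<Sum>d\<in>dof_indices k l ps. (dof K ps v d)\<^sup>2)"
      by (rule member_le_sum[OF that _ finite_dof_indices]) simp
    then show ?thesis by (simp add: dof_norm_def L2_set_def sum_nonneg)
  qed
  have dof: "dof K ps v (Vertex i) = poly q 0" "dof K ps v (Vertex (Suc i mod length ps)) = poly q 1"
    "dof K ps v (Edge_Moment i j) = integral {0..1} (\<lambda>s. (s - 1 / 2) ^ j * poly q s)" for j
    by (rule dof_edge_polynomial[OF i], rule q(2), assumption)+
  have "0 < length ps" using i by linarith
  then have "(poly q 0)\<^sup>2 \<le> ?D\<^sup>2" "(poly q 1)\<^sup>2 \<le> ?D\<^sup>2"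
    using D[of "Vertex i"] D[of "Vertex (Suc i mod length ps)"] i dof(1,2) by (auto simp: dof_indices_def)
  moreover have "(\<Sum>j<nat k - 1. (integral {0..1} (\<lambda>s. (s - 1/2) ^ j * poly q s))\<^sup>2) \<le> (\<Sum>j<nat k - 1. ?D\<^sup>2)"
  proof (rule sum_mono)
    fix j assume "j \<in> {..<nat k - 1}"
    then have "Edge_Moment i j \<in> dof_indices k l ps" using i by (auto simp: dof_indices_def)
    from D[OF this] show "(integral {0..1} (\<lambda>s. (s - 1/2) ^ j * poly q s))\<^sup>2 \<le> ?D\<^sup>2"
      unfolding dof(3) .
  qed
  ultimately have "cu * (\<Sum>i\<le>nat k. \<bar>coeff q i\<bar>)\<^sup>2 \<le> ?D\<^sup>2 + ?D\<^sup>2 + (nat k - 1) * ?D\<^sup>2"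
    using cu(2)[OF q(1)] by (simp add: sum_constant)
  also have "\<dots> = (nat k + 1) * ?D\<^sup>2"
  proof -
    have "real (nat k - 1) = real (nat k) - 1" using k by (simp add: of_nat_diff)
    then show ?thesis by (simp add: algebra_simps)
  qed
  finally have "(\<Sum>i\<le>nat k. \<bar>coeff q i\<bar>)\<^sup>2 \<le> (nat k + 1) / cu * ?D\<^sup>2" using cu(1) by (simp add: field_simps)
  then have "(\<Sum>i\<le>nat k. \<bar>coeff q i\<bar>) \<le> sqrt ((nat k + 1) / cu * ?D\<^sup>2)" by (rule real_le_rsqrt)
  also have "\<dots> = sqrt ((nat k + 1) / cu) * ?D"
    unfolding real_sqrt_mult by (simp add: dof_norm_def L2_set_nonneg)
  finally show ?thesis .
qed

text \<open>The Laplacian is a combination of the monomials that define the interior moments.\<close>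

lemma source_pairing_le:
  assumes v: "v \<in> L2 K" and c: "\<And>x. x \<in> K \<Longrightarrow> p x = (\<Sum>s\<in>multi_indices l. c s * scaled_monomial K ps s x)"
  shows "\<bar>\<integral>x. p x * v x \<partial>lebesgue_on K\<bar> \<le> (\<Sum>s\<in>multi_indices l. \<bar>c s\<bar>) * dof_norm k l K ps v * measure lebesgue K"
proof -
  let ?m = "measure lebesgue K" and ?D = "dof_norm k l K ps v" and ?I = "\<lambda>s. \<integral>x. scaled_monomial K ps s x * v x \<partial>lebesgue_on K"
  have int: "integrable (lebesgue_on K) (\<lambda>x. scaled_monomial K ps s x * v x)" for s
    unfolding scaled_monomial_shifted
    by (intro L2_mult_integrable v L2_continuous lmeasurable_K bounded_K smooth_continuous_on smooth_shifted_monomial)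
  have I: "\<bar>?I s\<bar> \<le> ?D * ?m" if s: "s \<in> multi_indices l" for s
  proof (cases "?m = 0")
    case True
    then have "AE x in lebesgue_on K. False"
      using lmeasurable_K by (simp add: AE_iff_measurable[where N = K] emeasure_restrict_space fmeasurableD emeasure_eq_measure2 measure_eq_0_null_sets)
    then have "?I s = 0" by (intro integral_eq_zero_AE) auto
    then show ?thesis using True by simp
  next
    case False
    then have m0: "?m > 0" using measure_nonneg[of lebesgue K] by linarith
    have "Interior_Moment s \<in> dof_indices k l ps" using s by (simp add: dof_indices_def)
    then have "\<bar>dof K ps v (Interior_Moment s)\<bar> \<le> ?D"
      unfolding dof_norm_def using member_le_L2_set[OF finite_dof_indices, of "Interior_Moment s" k l ps "\<lambda>d. \<bar>dof K ps v d\<bar>"]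
      by (simp add: L2_set_def)
    then show ?thesis using m0 by (simp add: abs_divide field_simps)
  qed
  have "(\<integral>x. p x * v x \<partial>lebesgue_on K) = (\<integral>x. (\<Sum>s\<in>multi_indices l. c s * (scaled_monomial K ps s x * v x)) \<partial>lebesgue_on K)"
    by (rule Bochner_Integration.integral_cong) (simp_all add: c sum_distrib_right mult.assoc)
  also have "\<dots> = (\<Sum>s\<in>multi_indices l. c s * ?I s)" using int by (simp add: Bochner_Integration.integral_sum)
  also have "\<bar>\<dots>\<bar> \<le> (\<Sum>s\<in>multi_indices l. \<bar>c s\<bar> * (?D * ?m))"
    by (rule order_trans[OF sum_abs], rule sum_mono) (use I in \<open>auto simp: abs_mult intro!: mult_left_mono\<close>)
  also have "\<dots> = (\<Sum>s\<in>multi_indices l. \<bar>c s\<bar>) * ?D * ?m" by (simp add: sum_distrib_right mult.assoc)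
  finally show ?thesis .
qed

end

theorem theorem4p5:
  fixes k l :: int and \<kappa> \<sigma> c\<^sub>0 :: real
  assumes "k \<ge> 1" and "l \<ge> -1"
  shows "\<exists>c C :: real. c > 0 \<and> C > 0 \<and>
    (\<forall>K ps \<T>. simple_polygon K ps \<and> virtual_triangulation \<kappa> \<sigma> c\<^sub>0 K ps \<T> \<longrightarrow>
      (\<forall>v\<in>vem_space k l K ps.
        c * diameter K * dof_norm k l K ps v \<le> L2_norm K v \<and>
        L2_norm K v \<le> C * diameter K * dof_norm k l K ps v))"
proof -
  (* For c\<^sub>0 * \<kappa> \<le> 0 there are no triangulations at all and any \<theta> will do. *)
  define \<theta> where "\<theta> = (if c\<^sub>0 * \<kappa> > 0 then min 1 (1 / (c\<^sub>0 * \<kappa>)) else 1)"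
  have \<theta>: "0 < \<theta>" "\<theta> \<le> 1" by (auto simp: \<theta>_def)
  obtain Cs Ce where Cs: "Cs > 0" and Ce: "Ce > 0" and data:
    "\<And>K ps \<T> \<kappa> \<sigma> c\<^sub>0 v. \<lbrakk>triangulated_polygon K ps \<T> \<kappa> \<sigma> c\<^sub>0; \<theta> \<le> 1 / (c\<^sub>0 * \<kappa>); v \<in> vem_space k l K ps\<rbrakk> \<Longrightarrow>
      \<exists>g p c q. has_trace K ps v g \<and> weak_laplacian K v p \<and> p \<in> L2 K \<and>
        (\<forall>x\<in>K. p x = (\<Sum>s\<in>multi_indices l. c s * scaled_monomial K ps s x)) \<and>
        diameter K ^ 3 * (\<Sum>s\<in>multi_indices l. \<bar>c s\<bar>) \<le> Cs * L2_norm K v \<and>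
        (\<forall>i<length ps. degree (q i) \<le> nat k \<and> diameter K * (\<Sum>j\<le>nat k. \<bar>coeff (q i) j\<bar>) \<le> Ce * L2_norm K v \<and>
          (\<forall>s\<in>{0..1}. g (linepath (vtx ps i) (vtx ps (Suc i)) s) = poly (q i) s \<and>
            boundary_trace K ps v (linepath (vtx ps i) (vtx ps (Suc i)) s) = poly (q i) s))"
    using vem_function_data[OF \<theta>, of k l] by blast
  have "nat k \<ge> 1" using assms(1) by simp
  then obtain cu where cu: "cu > 0" "\<And>q::real poly. degree q \<le> nat k \<Longrightarrow> cu * (\<Sum>i\<le>nat k. \<bar>coeff q i\<bar>)\<^sup>2 \<le>
      (poly q 0)\<^sup>2 + (poly q 1)\<^sup>2 + (\<Sum>j<nat k - 1. (integral {0..1} (\<lambda>s. (s - 1/2) ^ j * poly q s))\<^sup>2)"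
    using edge_dofs_coercive[of "nat k"] by blast
  define B where "B = (3 / \<theta>\<^sup>2 * (1 + nat k) + card (multi_indices l)) * (Ce + 1 / \<theta>)"
  define Cq where "Cq = sqrt ((nat k + 1) / cu)"
  define A where "A = 2 * (2 * pi * Cs + 2)"
  have B: "B > 0" unfolding B_def using \<theta>(1) Ce by (intro mult_pos_pos add_pos_nonneg divide_pos_pos) auto
  have Cq: "Cq \<ge> 0" unfolding Cq_def using cu(1) by simp
  have A: "A > 0" unfolding A_def using Cs by (intro mult_pos_pos add_pos_pos) auto
  show ?thesis
  proof (rule exI[of _ "1 / B"], rule exI[of _ "A * (1 + 3 * Cq)"], intro conjI allI impI ballI)
    show "1 / B > 0" "A * (1 + 3 * Cq) > 0" using A B Cq by (auto intro!: mult_pos_pos add_pos_nonneg)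
    fix K ps \<T> v
    assume "simple_polygon K ps \<and> virtual_triangulation \<kappa> \<sigma> c\<^sub>0 K ps \<T>" and vem: "v \<in> vem_space k l K ps"
    then interpret triangulated_polygon K ps \<T> \<kappa> \<sigma> c\<^sub>0 by unfold_locales auto
    let ?h = "diameter K" and ?D = "dof_norm k l K ps v" and ?v = "L2_norm K v"
    have h: "?h > 0" by (rule diameter_pos)
    have D: "?D \<ge> 0" by (simp add: dof_norm_def)
    have "0 < length ps" using length_ps by linarith
    then obtain w where "triangle (vtx ps 0) (vtx ps (Suc 0) - vtx ps 0) w \<in> \<T>" using edge_triangle by blast
    then have \<theta>le: "\<theta> \<le> 1 / (c\<^sub>0 * \<kappa>)" using inball(1) by (simp add: \<theta>_def)
    obtain g p c q where tr: "has_trace K ps v g" and lap: "weak_laplacian K v p" and p: "p \<in> L2 K"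
      and c: "\<And>x. x \<in> K \<Longrightarrow> p x = (\<Sum>s\<in>multi_indices l. c s * scaled_monomial K ps s x)"
        "?h ^ 3 * (\<Sum>s\<in>multi_indices l. \<bar>c s\<bar>) \<le> Cs * ?v"
      and q: "\<And>i. i < length ps \<Longrightarrow> degree (q i) \<le> nat k"
        "\<And>i. i < length ps \<Longrightarrow> ?h * (\<Sum>j\<le>nat k. \<bar>coeff (q i) j\<bar>) \<le> Ce * ?v"
        "\<And>i s. i < length ps \<Longrightarrow> s \<in> {0..1} \<Longrightarrow> g (linepath (vtx ps i) (vtx ps (Suc i)) s) = poly (q i) s"
        "\<And>i s. i < length ps \<Longrightarrow> s \<in> {0..1} \<Longrightarrow> boundary_trace K ps v (linepath (vtx ps i) (vtx ps (Suc i)) s) = poly (q i) s"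
      using data[OF triangulated_polygon_axioms \<theta>le vem] by blast
    have v: "v \<in> L2 K" using tr unfolding has_trace_def by blast
    have "?h * ?D \<le> ?h * (\<Sum>d\<in>dof_indices k l ps. \<bar>dof K ps v d\<bar>)"
      unfolding dof_norm_def using h by (intro mult_left_mono L2_set_le_sum_abs) auto
    also have "\<dots> = (\<Sum>d\<in>dof_indices k l ps. ?h * \<bar>dof K ps v d\<bar>)" by (rule sum_distrib_left)
    also have "\<dots> \<le> (\<Sum>d\<in>dof_indices k l ps. (Ce + 1 / \<theta>) * ?v)"
      by (intro sum_mono dof_le_L2_norm[OF \<theta>(1) \<theta>le v less_imp_le[OF Ce] q(1,2,4)]) assumption+
    also have "\<dots> = card (dof_indices k l ps) * ((Ce + 1 / \<theta>) * ?v)" by simp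
    also have "\<dots> \<le> (3 / \<theta>\<^sup>2 * (1 + nat k) + card (multi_indices l)) * ((Ce + 1 / \<theta>) * ?v)"
    proof (rule mult_right_mono)
      have "real (card (dof_indices k l ps)) \<le> real (length ps * (1 + nat k) + card (multi_indices l))"
        using card_dof_indices[of k l ps] by (simp only: of_nat_le_iff)
      also have "\<dots> = real (length ps) * (1 + nat k) + card (multi_indices l)" by (simp add: distrib_left)
      also have "\<dots> \<le> 3 / \<theta>\<^sup>2 * (1 + nat k) + card (multi_indices l)"
        using length_ps_bound[OF \<theta>(1) \<theta>le] by (intro add_right_mono mult_right_mono) auto
      finally show "real (card (dof_indices k l ps)) \<le> 3 / \<theta>\<^sup>2 * (1 + nat k) + card (multi_indices l)" .
      show "0 \<le> (Ce + 1 / \<theta>) * ?v" using Ce \<theta>(1) by (intro mult_nonneg_nonneg L2_norm_nonneg) auto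
    qed
    also have "\<dots> = B * ?v" by (simp add: B_def)
    finally show "1 / B * ?h * ?D \<le> ?v" using B by (simp add: field_simps)
    show "?v \<le> A * (1 + 3 * Cq) * ?h * ?D"
    proof (rule field_le_epsilon)
      fix \<epsilon> :: real assume \<epsilon>: "\<epsilon> > 0"
      (* The level must be positive even if all degrees of freedom vanish. *)
      define \<eta> where "\<eta> = \<epsilon> / (3 * A * ?h)"
      have \<eta>: "\<eta> > 0" unfolding \<eta>_def using \<epsilon> A h by simp
      have pb: "\<bar>p x\<bar> \<le> (\<Sum>s\<in>multi_indices l. \<bar>c s\<bar>)" if x: "x \<in> K" for x
        unfolding c(1)[OF x] by (rule scaled_monomial_sum_le[OF x])
      have gb: "\<bar>g (linepath (vtx ps i) (vtx ps (Suc i)) t)\<bar> \<le> Cq * ?D + \<eta>" if i: "i < length ps" and t: "t \<in> {0..1}" for i t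
      proof -
        have "\<bar>g (linepath (vtx ps i) (vtx ps (Suc i)) t)\<bar> \<le> (\<Sum>j\<le>nat k. \<bar>coeff (q i) j\<bar>)"
          unfolding q(3)[OF i t] by (rule poly_abs_le_coeff_sum[OF q(1)[OF i] t])
        also have "\<dots> \<le> Cq * ?D"
          unfolding Cq_def by (rule dof_bounds_trace[OF assms(1) cu i q(1)[OF i] q(4)[OF i]])
        finally show ?thesis using \<eta> by linarith
      qed
      have "Cq * ?D + \<eta> > 0" using Cq D \<eta> by (intro add_nonneg_pos mult_nonneg_nonneg) auto
      then have "?v \<le> 2 * ?h * (2 * pi * Cs + 2) * (?D + 3 * (Cq * ?D + \<eta>))"
        by (intro solution_bound[OF tr lap p pb _ c(2) less_imp_le[OF Cs] source_pairing_le[OF v c(1)] D _ gb])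
          (auto intro: sum_nonneg)
      also have "\<dots> = A * ?h * (?D + 3 * (Cq * ?D + \<eta>))" by (simp add: A_def)
      also have "\<dots> = A * (1 + 3 * Cq) * ?h * ?D + 3 * A * ?h * \<eta>" by (simp add: algebra_simps)
      also have "3 * A * ?h * \<eta> = \<epsilon>" unfolding \<eta>_def using A h by simp
      finally show "?v \<le> A * (1 + 3 * Cq) * ?h * ?D + \<epsilon>" .
    qed
  qed
qed

end
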